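(* Let $q\in L^1_{\mathrm{loc}}(\mathbb{R})$ be real-valued and let $d\nu$ be a real, locally finite signed Borel measure on $\mathbb{R}$, singular with respect to Lebesgue measure, with topological support $\Sigma$; put $dP=dx+d\nu$ and let $\mathrm{H}$ be the maximal operator in $L^2(\mathbb{R})$ associated with $\tau=-\frac{d}{dx}\frac{d}{dP(x)}+q(x)$. Let $\mathrm{H}^0$ be the restriction of $\mathrm{H}$ to $\mathrm{dom}(\mathrm{H}^0)=\mathrm{dom}(\mathrm{H})\cap L^2_{\mathrm{c}}(\mathbb{R})$, and let $\mathfrak{t}^0$ be the quadratic form $$\mathfrak{t}^0[f]=\int_{\mathbb{R}}|f^{[1]}|^2\,dP(x)+\int_{\mathbb{R}}q(x)|f(x)|^2\,dx,$$ $$\mathrm{dom}(\mathfrak{t}^0)=\{f\in L^2_{\mathrm{c}}(\mathbb{R}): f\in AC_{\mathrm{loc}}(\mathbb{R};dP),\ f^{[1]}\in L^2(\mathbb{R};|dP|)\}.$$ (i) If $f\in\mathrm{dom}(\mathrm{H}^0)$, then $f\in\mathrm{dom}(\mathfrak{t}^0)$ and $(\mathrm{H}^0f,f)=\mathfrak{t}^0[f]$. (ii) Assume additionally that $\Sigma$ satisfies at least one of the following conditions: $\Sigma$ is bounded; or $\Sigma$ has Lebesgue measure zero; or $\Sigma$ has infinitely many gaps near $+\infty$ and near $-\infty$ whose lengths do not tend to zero (that is, there are $\varepsilon>0$ and sequences $x_j^{\pm}\to\pm\infty$ with $(x_j^{\pm},x_j^{\pm}+\varepsilon)\cap\Sigma=\emptyset$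 for all $j\in\mathbb{N}$). If the form $\mathfrak{t}^0$ is lower semibounded, then it is closable and the operator associated with its closure $\mathfrak{t}=\overline{\mathfrak{t}^0}$ coincides with the operator $\mathrm{H}$, which is self-adjoint.
   Context: $L^2_{\mathrm{c}}(\mathbb{R})$ denotes the square integrable functions with compact support. $AC_{\mathrm{loc}}(\mathbb{R};dP)$ is the set of functions $f$ which are locally of bounded variation and whose Borel measure $df$ is absolutely continuous with respect to $dP$; then $df=f^{[1]}\,dP$ with $f^{[1]}\in L^1_{\mathrm{loc}}(\mathbb{R};dP)$ the quasi-derivative of $f$ (left-continuous representatives of $f$ are used). Put $\mathfrak{D}=\{f\in AC_{\mathrm{loc}}(\mathbb{R};dP): f^{[1]}\in AC_{\mathrm{loc}}(\mathbb{R})\}$ and $\tau f=-(f^{[1]})'+qf$ for $f\in\mathfrak{D}$. The maximal operator is $\mathrm{H}f=\tau f$ with $\mathrm{dom}(\mathrm{H})=\{f\in L^2(\mathbb{R}): f\in\mathfrak{D},\ \tau f\in L^2(\mathbb{R})\}$. *)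

theory Defs
  imports "HOL-Analysis.Analysis"
begin

section \<open>Locally finite signed and complex Borel measures on the real line\<close>

text \<open>A locally finite signed measure need not assign a value to unbounded sets (both parts of its
  Jordan decomposition may be infinite there), so it is a countably additive set function on the
  bounded Borel sets; its values on other sets are irrelevant.\<close>

definition bounded_borel :: "real set set" where
  "bounded_borel = {B \<in> sets borel. bounded B}"

definition loc_measure :: "(real set \<Rightarrow> 'a::real_normed_vector) \<Rightarrow> bool" where
  "loc_measure \<mu> \<longleftrightarrow>
     (\<forall>A :: nat \<Rightarrow> real set. range A \<subseteq> bounded_borel \<and> disjoint_family A \<and> bounded (\<Union>i. A i)
        \<longrightarrow> (\<lambda>i. \<mu> (A i)) sums \<mu> (\<Union>i. A i))"

text \<open>Jordan decomposition: \<open>\<mu>\<^sup>+(B)\<close> is the supremum of \<open>\<mu>(A)\<close> over \<open>A \<subseteq> B\<close>, and \<open>\<mu>\<^sup>- = (-\<mu>)\<^sup>+\<close>.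
  Since \<^const>\<open>measure_of\<close> is the zero measure if the given set function is not countably additive,
  \<open>emeasure_pos_part\<close> and \<open>emeasure_variation\<close> below confirm that this does not happen.\<close>

definition pos_part :: "(real set \<Rightarrow> real) \<Rightarrow> real measure" where
  "pos_part \<mu> = measure_of UNIV (sets borel)
     (\<lambda>B. SUP A \<in> {A \<in> bounded_borel. A \<subseteq> B}. ennreal (\<mu> A))"

definition neg_part :: "(real set \<Rightarrow> real) \<Rightarrow> real measure" where
  "neg_part \<mu> = pos_part (\<lambda>B. - \<mu> B)"

definition variation :: "(real set \<Rightarrow> real) \<Rightarrow> real measure" where
  "variation \<mu> = measure_of UNIV (sets borel)
     (\<lambda>B. emeasure (pos_part \<mu>) B + emeasure (neg_part \<mu>) B)"

definition signed_integral ::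
    "(real set \<Rightarrow> real) \<Rightarrow> (real \<Rightarrow> 'a::{banach, second_countable_topology}) \<Rightarrow> 'a" where
  "signed_integral \<mu> g = integral\<^sup>L (pos_part \<mu>) g - integral\<^sup>L (neg_part \<mu>) g"

definition lebesgue_singular :: "(real set \<Rightarrow> real) \<Rightarrow> bool" where
  "lebesgue_singular \<mu> \<longleftrightarrow> (\<exists>N \<in> null_sets lborel. emeasure (variation \<mu>) (- N) = 0)"

definition measure_support :: "(real set \<Rightarrow> real) \<Rightarrow> real set" where
  "measure_support \<mu> = {x. \<forall>U. open U \<and> x \<in> U \<longrightarrow> emeasure (variation \<mu>) U > 0}"

definition locally_integrable ::
    "real measure \<Rightarrow> (real \<Rightarrow> 'a::{banach, second_countable_topology}) \<Rightarrow> bool" where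
  "locally_integrable M g \<longleftrightarrow> (\<forall>a b. set_integrable M {a..b} g)"

lemma sets_pos_part [simp, measurable_cong]: "sets (pos_part \<mu>) = sets borel"
  using sets.sigma_sets_eq[of borel] by (simp add: pos_part_def)

lemma sets_neg_part [simp, measurable_cong]: "sets (neg_part \<mu>) = sets borel"
  by (simp add: neg_part_def)

lemma sets_variation [simp, measurable_cong]: "sets (variation \<mu>) = sets borel"
  using sets.sigma_sets_eq[of borel] by (simp add: variation_def)

lemma empty_bounded_borel [simp]: "{} \<in> bounded_borel"
  by (simp add: bounded_borel_def)

lemma loc_measure_empty:
  assumes "loc_measure \<mu>" shows "\<mu> {} = 0"
proof -
  have "(\<lambda>i::nat. \<mu> {}) sums \<mu> (\<Union>i::nat. {})"
    using assms[unfolded loc_measure_def, rule_format, of "\<lambda>_. {}"]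
    by (auto simp: disjoint_family_on_def)
  then show ?thesis
    by (metis sums_summable summable_const_iff)
qed

lemma loc_measure_Un:
  assumes "loc_measure \<mu>" "A \<in> bounded_borel" "B \<in> bounded_borel" "A \<inter> B = {}"
  shows "\<mu> (A \<union> B) = \<mu> A + \<mu> B"
proof -
  let ?A = "binaryset A B"
  have r: "range ?A \<subseteq> bounded_borel"
    using assms(2,3) by (auto simp: range_binaryset_eq)
  have "disjoint_family ?A"
    using assms(4) by (auto simp: disjoint_family_on_def binaryset_def)
  moreover have "bounded (\<Union>i. ?A i)"
    using assms(2,3) by (simp add: UN_binaryset_eq bounded_borel_def)
  ultimately have "(\<lambda>i. \<mu> (?A i)) sums \<mu> (\<Union>i. ?A i)"
    using assms(1)[unfolded loc_measure_def] r by blast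
  moreover have "(\<lambda>i. \<mu> (?A i)) sums (\<mu> A + \<mu> B)"
    by (rule binaryset_sums) (rule loc_measure_empty[OF assms(1)])
  ultimately show ?thesis
    by (simp add: UN_binaryset_eq sums_unique2)
qed

lemma emeasure_pos_part:
  assumes \<mu>: "loc_measure \<mu>" and B: "B \<in> sets borel"
  shows "emeasure (pos_part \<mu>) B = (SUP A \<in> {A \<in> bounded_borel. A \<subseteq> B}. ennreal (\<mu> A))"
proof -
  define m where "m = (\<lambda>B. SUP A \<in> {A \<in> bounded_borel. A \<subseteq> B}. ennreal (\<mu> A))"
  have m_empty: "m {} = 0"
  proof -
    have "{A \<in> bounded_borel. A \<subseteq> {}} = {{}}" by auto
    then show ?thesis by (simp add: m_def loc_measure_empty[OF \<mu>])
  qed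
  have super: "m A + m C \<le> m (A \<union> C)" if "A \<inter> C = {}" for A C
  proof -
    have le: "ennreal (\<mu> X) + ennreal (\<mu> Y) \<le> m (A \<union> C)"
      if X: "X \<in> {X \<in> bounded_borel. X \<subseteq> A}" and Y: "Y \<in> {Y \<in> bounded_borel. Y \<subseteq> C}" for X Y
    proof -
      have un: "\<mu> (X \<union> Y) = \<mu> X + \<mu> Y"
        using X Y \<open>A \<inter> C = {}\<close> by (intro loc_measure_Un[OF \<mu>]) auto
      have sub: "ennreal (\<mu> Z) \<le> m (A \<union> C)" if "Z \<in> {X, Y, X \<union> Y}" for Z
        unfolding m_def using X Y that by (intro SUP_upper) (auto simp: bounded_borel_def)
      show ?thesis
      proof (cases "\<mu> X \<ge> 0 \<and> \<mu> Y \<ge> 0")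
        case True
        then show ?thesis using sub[of "X \<union> Y"] un by simp
      next
        case False
        then show ?thesis using sub[of X] sub[of Y] by (auto simp: ennreal_neg)
      qed
    qed
    have ne: "{X \<in> bounded_borel. X \<subseteq> S} \<noteq> {}" for S :: "real set"
      using empty_bounded_borel by blast
    have "m A + m C = (SUP X\<in>{X \<in> bounded_borel. X \<subseteq> A}. SUP Y\<in>{Y \<in> bounded_borel. Y \<subseteq> C}.
        ennreal (\<mu> X) + ennreal (\<mu> Y))"
      unfolding m_def ennreal_SUP_add_left[OF ne, symmetric]
      by (intro SUP_cong refl ennreal_SUP_add_right[OF ne])
    also have "\<dots> \<le> m (A \<union> C)"
      by (intro SUP_least le)
    finally show ?thesis .
  qed
  have ca: "countably_additive (sets borel) m"
  proof (rule countably_additiveI)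
    fix A :: "nat \<Rightarrow> real set"
    assume A: "range A \<subseteq> sets borel" "disjoint_family A" "\<Union> (range A) \<in> sets borel"
    have mono: "m X \<le> m Y" if "X \<subseteq> Y" for X Y
      unfolding m_def using that by (intro SUP_subset_mono) auto
    have fin: "(\<Sum>i<n. m (A i)) \<le> m (\<Union>i<n. A i)" for n
    proof (induction n)
      case 0
      then show ?case by (simp add: m_empty)
    next
      case (Suc n)
      have "(\<Sum>i<Suc n. m (A i)) \<le> m (\<Union>i<n. A i) + m (A n)"
        using Suc by (simp add: add_mono)
      also have "\<dots> \<le> m ((\<Union>i<n. A i) \<union> A n)"
      proof (rule super)
        have "A i \<inter> A n = {}" if "i < n" for i
          using A(2) that by (simp add: disjoint_family_on_def)
        then show "(\<Union>i<n. A i) \<inter> A n = {}" by blast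
      qed
      also have "(\<Union>i<n. A i) \<union> A n = (\<Union>i<Suc n. A i)"
        by (auto simp: lessThan_Suc)
      finally show ?case .
    qed
    have "(\<Sum>i. m (A i)) \<le> m (\<Union> (range A))"
      by (rule suminf_le_const[OF summableI]) (rule order_trans[OF fin mono], blast)
    moreover have "m (\<Union> (range A)) \<le> (\<Sum>i. m (A i))"
      unfolding m_def
    proof (rule SUP_least)
      fix X assume X: "X \<in> {X \<in> bounded_borel. X \<subseteq> \<Union> (range A)}"
      let ?X = "\<lambda>i. X \<inter> A i"
      have eq: "(\<Union>i. ?X i) = X" using X by auto
      have XB: "?X i \<in> bounded_borel" for i
        using X A(1) by (auto simp: bounded_borel_def intro: bounded_subset)
      have "(\<lambda>i. \<mu> (?X i)) sums \<mu> (\<Union>i. ?X i)"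
        using X XB A(2) eq
        by (intro \<mu>[unfolded loc_measure_def, rule_format])
           (auto simp: disjoint_family_on_def bounded_borel_def)
      then have lim: "(\<lambda>n. ennreal (\<Sum>i<n. \<mu> (?X i))) \<longlonglongrightarrow> ennreal (\<mu> X)"
        unfolding eq sums_def by (rule tendsto_ennrealI)
      have "ennreal (\<Sum>i<n. \<mu> (?X i)) \<le> (\<Sum>i. m (A i))" for n
      proof -
        have "ennreal (\<Sum>i<n. \<mu> (?X i)) \<le> ennreal (\<Sum>i<n. max 0 (\<mu> (?X i)))"
          by (intro ennreal_leI sum_mono) auto
        also have "\<dots> = (\<Sum>i<n. ennreal (max 0 (\<mu> (?X i))))"
          by (rule sum_ennreal[symmetric]) auto
        also have "\<dots> \<le> (\<Sum>i<n. m (A i))"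
        proof (rule sum_mono)
          fix i
          have "ennreal (max 0 (\<mu> (?X i))) = ennreal (\<mu> (?X i))"
            by (cases "\<mu> (?X i) \<ge> 0") (auto simp: ennreal_neg)
          also have "\<dots> \<le> m (A i)"
            unfolding m_def using XB by (intro SUP_upper) auto
          finally show "ennreal (max 0 (\<mu> (?X i))) \<le> m (A i)" .
        qed
        also have "\<dots> \<le> (\<Sum>i. m (A i))"
          by (intro sum_le_suminf summableI) auto
        finally show ?thesis .
      qed
      then show "ennreal (\<mu> X) \<le> (\<Sum>i. SUP A\<in>{Aa \<in> bounded_borel. Aa \<subseteq> A i}. ennreal (\<mu> A))"
        using LIMSEQ_le_const2[OF lim] unfolding m_def by blast
    qed
    ultimately show "(\<Sum>i. m (A i)) = m (\<Union> (range A))" by (rule antisym)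
  qed
  have "emeasure (pos_part \<mu>) B = m B"
  proof (rule emeasure_measure_of[where \<Omega>=UNIV and A="sets borel"])
    show "pos_part \<mu> = measure_of UNIV (sets borel) m" by (simp add: pos_part_def m_def)
    show "positive (sets (pos_part \<mu>)) m" by (simp add: positive_def m_empty)
    show "countably_additive (sets (pos_part \<mu>)) m" using ca by simp
  qed (use B in auto)
  then show ?thesis by (simp add: m_def)
qed

lemma emeasure_variation:
  assumes "B \<in> sets borel"
  shows "emeasure (variation \<mu>) B = emeasure (pos_part \<mu>) B + emeasure (neg_part \<mu>) B"
proof (rule emeasure_measure_of[OF variation_def])
  show "countably_additive (sets (variation \<mu>))
      (\<lambda>B. emeasure (pos_part \<mu>) B + emeasure (neg_part \<mu>) B)"
    by (intro countably_additiveI) (auto simp: suminf_add[symmetric] suminf_emeasure)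
qed (use assms in \<open>auto simp: positive_def\<close>)


section \<open>Absolute continuity with respect to a signed measure and quasi-derivatives\<close>

definition locally_bv :: "(real \<Rightarrow> complex) \<Rightarrow> bool" where
  "locally_bv f \<longleftrightarrow>
     (\<forall>a b. \<exists>C. \<forall>(x :: nat \<Rightarrow> real) n. mono x \<and> range x \<subseteq> {a..b}
        \<longrightarrow> (\<Sum>i<n. cmod (f (x (Suc i)) - f (x i))) \<le> C)"

text \<open>The Borel measure \<open>df\<close> of a left-continuous function of locally bounded variation. It is
  uniquely determined on the bounded Borel sets.\<close>

definition stieltjes :: "(real \<Rightarrow> complex) \<Rightarrow> real set \<Rightarrow> complex" where
  "stieltjes f = (SOME \<mu>. loc_measure \<mu> \<and> (\<forall>a b. a \<le> b \<longrightarrow> \<mu> {a..<b} = f b - f a))"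

definition AC_loc :: "(real set \<Rightarrow> real) \<Rightarrow> (real \<Rightarrow> complex) set" where
  "AC_loc \<mu> = {f. (\<forall>x. continuous (at_left x) f) \<and> locally_bv f \<and>
     (\<forall>B \<in> bounded_borel. emeasure (variation \<mu>) B = 0 \<longrightarrow> stieltjes f B = 0)}"

text \<open>\<open>has_quasi_deriv \<mu> f g\<close> means \<open>df = g d\<mu>\<close>, so that \<open>g\<close> is determined \<open>|\<mu>|\<close>-almost everywhere.
  For \<open>\<mu> = measure lborel\<close>, this is the ordinary derivative of a locally absolutely continuous
  function.\<close>

definition has_quasi_deriv ::
    "(real set \<Rightarrow> real) \<Rightarrow> (real \<Rightarrow> complex) \<Rightarrow> (real \<Rightarrow> complex) \<Rightarrow> bool" where
  "has_quasi_deriv \<mu> f g \<longleftrightarrow> locally_integrable (variation \<mu>) g \<and>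
     (\<forall>B \<in> bounded_borel. stieltjes f B = signed_integral \<mu> (\<lambda>x. indicator B x *\<^sub>R g x))"

definition quasi_deriv :: "(real set \<Rightarrow> real) \<Rightarrow> (real \<Rightarrow> complex) \<Rightarrow> real \<Rightarrow> complex" where
  "quasi_deriv \<mu> f = (SOME g. has_quasi_deriv \<mu> f g)"


section \<open>The Hilbert space of square integrable functions\<close>

text \<open>Elements of \<open>L\<^sup>2\<close> are represented by Borel functions. Domains of forms and graphs of operators
  below are closed under almost everywhere equality, so that equality of such sets is
  equality in the Hilbert space.\<close>

definition square_integrable :: "real measure \<Rightarrow> (real \<Rightarrow> complex) set" where
  "square_integrable M = {f \<in> borel_measurable M. integrable M (\<lambda>x. (cmod (f x))\<^sup>2)}"

abbreviation L2 :: "(real \<Rightarrow> complex) set" where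
  "L2 \<equiv> square_integrable lborel"

definition L2c :: "(real \<Rightarrow> complex) set" where
  "L2c = {f \<in> L2. \<exists>R. AE x in lborel. \<bar>x\<bar> > R \<longrightarrow> f x = 0}"

definition L2_inner :: "(real \<Rightarrow> complex) \<Rightarrow> (real \<Rightarrow> complex) \<Rightarrow> complex" where
  "L2_inner f g = (LINT x|lborel. f x * cnj (g x))"

definition L2_norm :: "(real \<Rightarrow> complex) \<Rightarrow> real" where
  "L2_norm f = sqrt (LINT x|lborel. (cmod (f x))\<^sup>2)"

text \<open>An unbounded operator is given by its graph.\<close>

type_synonym L2_operator = "((real \<Rightarrow> complex) \<times> (real \<Rightarrow> complex)) set"

definition densely_defined :: "L2_operator \<Rightarrow> bool" where
  "densely_defined T \<longleftrightarrow> (\<forall>u \<in> L2. \<forall>e>0. \<exists>f \<in> Domain T. L2_norm (\<lambda>x. u x - f x) < e)"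

definition L2_adjoint :: "L2_operator \<Rightarrow> L2_operator" where
  "L2_adjoint T = {(u, v). u \<in> L2 \<and> v \<in> L2 \<and> (\<forall>(f, g) \<in> T. L2_inner g u = L2_inner f v)}"

definition self_adjoint :: "L2_operator \<Rightarrow> bool" where
  "self_adjoint T \<longleftrightarrow> densely_defined T \<and> L2_adjoint T = T"


section \<open>Quadratic forms\<close>

text \<open>A real quadratic form is a partial function whose domain is that of the form; thus
  \<open>s \<subseteq>\<^sub>m t\<close> means that \<open>t\<close> is an extension of \<open>s\<close>.\<close>

type_synonym L2_form = "(real \<Rightarrow> complex) \<rightharpoonup> real"

definition sesquilinear_on ::
    "(real \<Rightarrow> complex) set \<Rightarrow> ((real \<Rightarrow> complex) \<Rightarrow> (real \<Rightarrow> complex) \<Rightarrow> complex) \<Rightarrow> bool" where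
  "sesquilinear_on D s \<longleftrightarrow>
     (\<forall>f\<in>D. \<forall>g\<in>D. \<forall>h\<in>D. \<forall>c d.
        s (\<lambda>x. c * f x + d * g x) h = c * s f h + d * s g h \<and>
        s h (\<lambda>x. c * f x + d * g x) = cnj c * s h f + cnj d * s h g)"

definition quadratic_form :: "L2_form \<Rightarrow> bool" where
  "quadratic_form t \<longleftrightarrow>
     dom t \<subseteq> L2 \<and> (\<lambda>_. 0) \<in> dom t \<and>
     (\<forall>f\<in>dom t. \<forall>g\<in>dom t. \<forall>c d. (\<lambda>x. c * f x + d * g x) \<in> dom t) \<and>
     (\<forall>f\<in>dom t. \<forall>g\<in>L2. (AE x in lborel. f x = g x) \<longrightarrow> t g = t f) \<and>
     (\<exists>s. sesquilinear_on (dom t) s \<and> (\<forall>f\<in>dom t. s f f = of_real (the (t f))))"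

definition lower_semibounded :: "L2_form \<Rightarrow> bool" where
  "lower_semibounded t \<longleftrightarrow> (\<exists>\<gamma>. \<forall>f \<in> dom t. the (t f) \<ge> \<gamma> * (L2_norm f)\<^sup>2)"

definition closed_form :: "L2_form \<Rightarrow> bool" where
  "closed_form t \<longleftrightarrow> quadratic_form t \<and> lower_semibounded t \<and>
     (\<forall>F u. (\<forall>n::nat. F n \<in> dom t) \<and> u \<in> L2 \<and>
        (\<lambda>n. L2_norm (\<lambda>x. F n x - u x)) \<longlonglongrightarrow> 0 \<and>
        (\<forall>e>0. \<exists>N. \<forall>m\<ge>N. \<forall>n\<ge>N. \<bar>the (t (\<lambda>x. F m x - F n x))\<bar> < e)
        \<longrightarrow> u \<in> dom t \<and> (\<lambda>n. the (t (\<lambda>x. F n x - u x))) \<longlonglongrightarrow> 0)"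

definition closable :: "L2_form \<Rightarrow> bool" where
  "closable t \<longleftrightarrow> (\<exists>s. closed_form s \<and> t \<subseteq>\<^sub>m s)"

text \<open>The smallest closed extension, which exists for closable forms.\<close>

definition form_closure :: "L2_form \<Rightarrow> L2_form" where
  "form_closure t = (THE s. closed_form s \<and> t \<subseteq>\<^sub>m s \<and> (\<forall>r. closed_form r \<and> t \<subseteq>\<^sub>m r \<longrightarrow> s \<subseteq>\<^sub>m r))"

text \<open>The sesquilinear form (linear in the first argument) associated with a quadratic form by
  polarization.\<close>

definition polarization ::
    "L2_form \<Rightarrow> (real \<Rightarrow> complex) \<Rightarrow> (real \<Rightarrow> complex) \<Rightarrow> complex" where
  "polarization t u w =
     (of_real (the (t (\<lambda>x. u x + w x))) - of_real (the (t (\<lambda>x. u x - w x)))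
      + \<i> * of_real (the (t (\<lambda>x. u x + \<i> * w x)))
      - \<i> * of_real (the (t (\<lambda>x. u x - \<i> * w x)))) / 4"

text \<open>The operator of the first representation theorem.\<close>

definition form_operator :: "L2_form \<Rightarrow> L2_operator" where
  "form_operator t = {(u, v). u \<in> dom t \<and> v \<in> L2 \<and> (\<forall>w \<in> dom t. polarization t u w = L2_inner v w)}"


section \<open>The differential operator and its quadratic form\<close>

definition dP :: "(real set \<Rightarrow> real) \<Rightarrow> real set \<Rightarrow> real" where
  "dP \<nu> B = measure lborel B + \<nu> B"

text \<open>\<open>ac_quasi_deriv\<close> is the locally absolutely continuous representative of the quasi-derivative,
  which is an equivalence class modulo \<open>|dP|\<close>-null sets. It is unique on \<open>tau_dom\<close> for singular \<open>\<nu>\<close>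
  as Lebesgue measure is then bounded by \<open>|dP|\<close>.\<close>

definition tau_dom :: "(real set \<Rightarrow> real) \<Rightarrow> (real \<Rightarrow> complex) set" where
  "tau_dom \<nu> = {f \<in> AC_loc (dP \<nu>). \<exists>g \<in> AC_loc (measure lborel). has_quasi_deriv (dP \<nu>) f g}"

definition ac_quasi_deriv :: "(real set \<Rightarrow> real) \<Rightarrow> (real \<Rightarrow> complex) \<Rightarrow> real \<Rightarrow> complex" where
  "ac_quasi_deriv \<nu> f = (THE g. g \<in> AC_loc (measure lborel) \<and> has_quasi_deriv (dP \<nu>) f g)"

definition tau ::
    "(real set \<Rightarrow> real) \<Rightarrow> (real \<Rightarrow> real) \<Rightarrow> (real \<Rightarrow> complex) \<Rightarrow> real \<Rightarrow> complex" where
  "tau \<nu> q f x = - quasi_deriv (measure lborel) (ac_quasi_deriv \<nu> f) x + of_real (q x) * f x"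

definition max_operator :: "(real set \<Rightarrow> real) \<Rightarrow> (real \<Rightarrow> real) \<Rightarrow> L2_operator" where
  "max_operator \<nu> q = {(u, v). u \<in> L2 \<and> v \<in> L2 \<and>
     (\<exists>f \<in> tau_dom \<nu>. (AE x in lborel. u x = f x) \<and> (AE x in lborel. v x = tau \<nu> q f x))}"

definition max_operator0 :: "(real set \<Rightarrow> real) \<Rightarrow> (real \<Rightarrow> real) \<Rightarrow> L2_operator" where
  "max_operator0 \<nu> q = {(u, v) \<in> max_operator \<nu> q. u \<in> L2c}"

text \<open>The left-continuous representative of an \<open>L\<^sup>2\<close> function having one in \<open>AC_loc\<close>.\<close>

definition ac_rep :: "(real set \<Rightarrow> real) \<Rightarrow> (real \<Rightarrow> complex) \<Rightarrow> real \<Rightarrow> complex" where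
  "ac_rep \<mu> u = (THE f. f \<in> AC_loc \<mu> \<and> (AE x in lborel. u x = f x))"

definition form0 :: "(real set \<Rightarrow> real) \<Rightarrow> (real \<Rightarrow> real) \<Rightarrow> L2_form" where
  "form0 \<nu> q u =
    (if u \<in> L2c \<and> (\<exists>f \<in> AC_loc (dP \<nu>). AE x in lborel. u x = f x) \<and>
        quasi_deriv (dP \<nu>) (ac_rep (dP \<nu>) u) \<in> square_integrable (variation (dP \<nu>))
     then Some (signed_integral (dP \<nu>) (\<lambda>x. (cmod (quasi_deriv (dP \<nu>) (ac_rep (dP \<nu>) u) x))\<^sup>2)
                + (LINT x|lborel. q x * (cmod (u x))\<^sup>2))
     else None)"

end

theory Submission
  imports Defs
begin

text \<open>For \<open>f \<in> dom(H\<^sup>0)\<close> part (i) is integration by parts: \<open>d(f\<^sup>* f\<^sup>[\<^sup>1\<^sup>]) = |f\<^sup>[\<^sup>1\<^sup>]|\<^sup>2 dP + f\<^sup>* (q f - \<tau> f) dx\<close> integrates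
  to zero.

  For part (ii), variation of constants shows that a source \<open>r \<in> L\<^sup>2\<^sub>c\<close> has a compactly supported solution
  of \<open>\<tau> h = r\<close> iff it is orthogonal to the two-dimensional space of solutions of \<open>\<tau> u = 0\<close>. Hence every weak
  solution of \<open>\<tau> u = v\<close>, tested only against such \<open>h\<close>, is a solution; in particular \<open>(H\<^sup>0)\<^sup>* = H\<close>. The same fact
  shows that the quasi-derivatives of such \<open>h\<close> are dense in \<open>L\<^sup>2(|dP|)\<close> modulo the constraint \<open>\<integral> g dP = 0\<close>, so that
  \<open>dom(H\<^sup>0)\<close> is a core of \<open>t\<^sup>0\<close>, which is therefore closable. The operator \<open>A\<close> of the closure satisfies
  \<open>A \<subseteq> (H\<^sup>0)\<^sup>* = H\<close>. Conversely, \<open>A + c\<close> is onto for large \<open>c\<close>, so it remains to see that \<open>H + c\<close> is injective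
  (Povzner--Wienholtz): if \<open>\<tau> f = - c f\<close> then \<open>t\<^sup>0[\<phi> f] + c \<parallel>\<phi> f\<parallel>\<^sup>2 = \<integral> \<phi>'\<^sup>2 |f|\<^sup>2 dx\<close> for every cut-off \<open>\<phi>\<close>, and the
  right-hand side tends to zero as the slopes of \<open>\<phi>\<close> do.\<close>

section \<open>Positive sesquilinear forms\<close>

text \<open>Everything rests on the singularity of \<nu>: off a Lebesgue-null set N the signed
  measure dP is Lebesgue measure, so dx is |dP| restricted to -N, where the sign of dP is +1. A
  Lebesgue absolutely continuous cut-off \<phi> is therefore absolutely continuous for dP too, with
  density \<phi>' cut down to -N; this is why \<phi>'^2 |f|^2 ends up integrated against dx. The
  quasi-derivative of \<phi> f contains that cut-down term, which is not absolutely continuous in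
  general, so \<phi> f may leave dom(H0) and the form is evaluated on it instead of the operator.
  The obstacle is the sign of dP: semiboundedness gives no direct control of the quasi-derivative in
  L2(|dP|) by the form norm. Only the opposite estimate is proved, for supports in a fixed interval,
  and it suffices to carry density of quasi-derivatives over to the form norm. Functions stand for
  their classes, so inner products are only semidefinite, and Hilbert space arguments on incomplete
  spaces are phrased with Cauchy sequences.\<close>

locale semi_inner =
  fixes D :: "(real \<Rightarrow> complex) set"
    and B :: "(real \<Rightarrow> complex) \<Rightarrow> (real \<Rightarrow> complex) \<Rightarrow> complex"
  assumes zero_mem: "(\<lambda>_. 0) \<in> D"
    and lin_mem: "\<And>f g c d. f \<in> D \<Longrightarrow> g \<in> D \<Longrightarrow> (\<lambda>x. c * f x + d * g x) \<in> D"
    and sesq: "sesquilinear_on D B"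
    and pos: "\<And>f. f \<in> D \<Longrightarrow> Im (B f f) = 0 \<and> 0 \<le> Re (B f f)"
begin

definition nrm where "nrm f = sqrt (Re (B f f))"

lemma add_mem: "f \<in> D \<Longrightarrow> g \<in> D \<Longrightarrow> (\<lambda>x. f x + g x) \<in> D"
  using lin_mem[of f g 1 1] by simp

lemma diff_mem: "f \<in> D \<Longrightarrow> g \<in> D \<Longrightarrow> (\<lambda>x. f x - g x) \<in> D"
  using lin_mem[of f g 1 "-1"] by simp

lemma scale_mem: "f \<in> D \<Longrightarrow> (\<lambda>x. c * f x) \<in> D"
  using lin_mem[of f f c 0] by simp

lemma lin_left: "f \<in> D \<Longrightarrow> g \<in> D \<Longrightarrow> h \<in> D \<Longrightarrow> B (\<lambda>x. c * f x + d * g x) h = c * B f h + d * B g h"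
  and lin_right: "f \<in> D \<Longrightarrow> g \<in> D \<Longrightarrow> h \<in> D \<Longrightarrow>
    B h (\<lambda>x. c * f x + d * g x) = cnj c * B h f + cnj d * B h g"
  using sesq unfolding sesquilinear_on_def by blast+

lemma add_left: "f \<in> D \<Longrightarrow> g \<in> D \<Longrightarrow> h \<in> D \<Longrightarrow> B (\<lambda>x. f x + g x) h = B f h + B g h"
  and add_right: "f \<in> D \<Longrightarrow> g \<in> D \<Longrightarrow> h \<in> D \<Longrightarrow> B h (\<lambda>x. f x + g x) = B h f + B h g"
  and diff_left: "f \<in> D \<Longrightarrow> g \<in> D \<Longrightarrow> h \<in> D \<Longrightarrow> B (\<lambda>x. f x - g x) h = B f h - B g h"
  and diff_right: "f \<in> D \<Longrightarrow> g \<in> D \<Longrightarrow> h \<in> D \<Longrightarrow> B h (\<lambda>x. f x - g x) = B h f - B h g"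
  and scale_left: "f \<in> D \<Longrightarrow> h \<in> D \<Longrightarrow> B (\<lambda>x. c * f x) h = c * B f h"
  and scale_right: "f \<in> D \<Longrightarrow> h \<in> D \<Longrightarrow> B h (\<lambda>x. c * f x) = cnj c * B h f"
  using lin_left[of f g h 1 1] lin_right[of f g h 1 1] lin_left[of f g h 1 "-1"]
    lin_right[of f g h 1 "-1"] lin_left[of f f h c 0] lin_right[of f f h c 0]
  by simp_all

lemma nrm_ge0 [simp]: "f \<in> D \<Longrightarrow> 0 \<le> nrm f"
  using pos by (simp add: nrm_def)

lemma nrm_sq: "f \<in> D \<Longrightarrow> (nrm f)\<^sup>2 = Re (B f f)"
  using pos by (simp add: nrm_def)

lemma B_expand: "f \<in> D \<Longrightarrow> g \<in> D \<Longrightarrow> B (\<lambda>x. f x + c * g x) (\<lambda>x. f x + c * g x) =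
    B f f + cnj c * B f g + c * B g f + c * cnj c * B g g"
  by (simp add: add_left add_right scale_left scale_right scale_mem add_mem algebra_simps)

text \<open>Real diagonal values at f + c g force the imaginary parts of the mixed terms to cancel;
  c = 1 and c = \<i> give the two components.\<close>

lemma hermitian:
  assumes "f \<in> D" "g \<in> D" shows "B g f = cnj (B f g)"
proof -
  have 1: "Im (B f f + cnj c * B f g + c * B g f + c * cnj c * B g g) = 0" for c
    using B_expand[OF assms, of c] pos[OF add_mem[OF assms(1) scale_mem[OF assms(2)]], of c] by metis
  have 2: "Im (B f f) = 0" "Im (B g g) = 0" using pos assms by auto
  show ?thesis using 1[of 1] 1[of \<i>] 2 by (simp add: complex_eq_iff)
qed

lemma Re_expand:
  assumes "f \<in> D" "g \<in> D"
  shows "Re (B (\<lambda>x. f x + c * g x) (\<lambda>x. f x + c * g x)) =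
    Re (B f f) + 2 * Re (cnj c * B f g) + (cmod c)\<^sup>2 * Re (B g g)"
proof -
  have "Re (c * B g f) = Re (cnj c * B f g)"
    by (simp add: hermitian[OF assms])
  moreover have "Re (c * cnj c * B g g) = (cmod c)\<^sup>2 * Re (B g g)"
    unfolding complex_norm_square[symmetric] by (simp del: of_real_power)
  ultimately show ?thesis by (simp add: B_expand[OF assms])
qed

text \<open>Discriminant inequality with a free constant p: for Cauchy-Schwarz p is B f f, while in
  \<open>riesz_sequence\<close> p is the defect of an almost minimal element.\<close>

lemma quadratic_bound:
  fixes w :: complex
  assumes "\<And>c. 0 \<le> p + 2 * Re (cnj c * w) + (cmod c)\<^sup>2 * b" "0 \<le> b"
  shows "(cmod w)\<^sup>2 \<le> p * b"
proof -
  have ww: "Re (cnj (- of_real t * w) * w) = - t * (cmod w)\<^sup>2" for t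
    unfolding cmod_power2 by (simp add: power2_eq_square algebra_simps)
  have 1: "0 \<le> p - 2 * t * (cmod w)\<^sup>2 + t\<^sup>2 * (cmod w)\<^sup>2 * b" for t
    using assms(1)[of "- of_real t * w"] unfolding ww by (simp add: norm_mult power_mult_distrib)
  show ?thesis
  proof (cases "b = 0")
    case True
    have "(cmod w)\<^sup>2 = 0"
    proof (rule ccontr)
      assume "(cmod w)\<^sup>2 \<noteq> 0"
      \<comment> \<open>For b = 0 the expression is affine in t, and this t gives it the value
        -1.\<close>
      then show False using 1[of "(p + 1) / (2 * (cmod w)\<^sup>2)"] True by simp
    qed
    then show ?thesis using True by simp
  next
    case False
    then have "b > 0" using assms(2) by simp
    have "0 \<le> p - (cmod w)\<^sup>2 / b"
      using 1[of "1 / b"] False by (simp add: power2_eq_square field_simps)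
    then show ?thesis using \<open>b > 0\<close> by (simp add: field_simps)
  qed
qed

lemma Cauchy_Schwarz_sq:
  assumes "f \<in> D" "g \<in> D" shows "(cmod (B f g))\<^sup>2 \<le> Re (B f f) * Re (B g g)"
proof (rule quadratic_bound)
  show "0 \<le> Re (B f f) + 2 * Re (cnj c * B f g) + (cmod c)\<^sup>2 * Re (B g g)" for c
    using Re_expand[OF assms, of c] pos[OF add_mem[OF assms(1) scale_mem[OF assms(2)]], of c] by metis
qed (use pos assms in auto)

lemma Cauchy_Schwarz:
  assumes "f \<in> D" "g \<in> D" shows "cmod (B f g) \<le> nrm f * nrm g"
proof -
  have "(cmod (B f g))\<^sup>2 \<le> (nrm f * nrm g)\<^sup>2"
    using Cauchy_Schwarz_sq[OF assms] assms by (simp add: power_mult_distrib nrm_sq)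
  then show ?thesis by (rule power2_le_imp_le) (simp add: assms)
qed

lemma triangle:
  assumes "f \<in> D" "g \<in> D" shows "nrm (\<lambda>x. f x + g x) \<le> nrm f + nrm g"
proof -
  have "(nrm (\<lambda>x. f x + g x))\<^sup>2 = (nrm f)\<^sup>2 + 2 * Re (B f g) + (nrm g)\<^sup>2"
    using Re_expand[OF assms, of 1] assms by (simp add: nrm_sq add_mem)
  also have "\<dots> \<le> (nrm f + nrm g)\<^sup>2"
    using Cauchy_Schwarz[OF assms] complex_Re_le_cmod[of "B f g"] by (simp add: power2_sum)
  finally show ?thesis by (rule power2_le_imp_le) (simp add: assms)
qed

lemma nrm_scale: "f \<in> D \<Longrightarrow> nrm (\<lambda>x. c * f x) = cmod c * nrm f"
proof -
  assume f: "f \<in> D"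
  have cc: "c * cnj c = (of_real (cmod c))\<^sup>2"
    using complex_norm_square[of c] by simp
  have "B (\<lambda>x. c * f x) (\<lambda>x. c * f x) = of_real ((cmod c)\<^sup>2) * B f f"
    using f by (simp add: scale_left scale_right scale_mem cc)
  then show ?thesis by (simp add: nrm_def real_sqrt_mult)
qed

lemma nrm_minus: "f \<in> D \<Longrightarrow> nrm (\<lambda>x. - f x) = nrm f"
  using nrm_scale[of f "-1"] by simp

lemma triangle_diff:
  assumes "f \<in> D" "g \<in> D" "h \<in> D"
  shows "nrm (\<lambda>x. f x - h x) \<le> nrm (\<lambda>x. f x - g x) + nrm (\<lambda>x. g x - h x)"
  using triangle[of "\<lambda>x. f x - g x" "\<lambda>x. g x - h x"] assms by (simp add: diff_mem)

lemma nrm_sym: "f \<in> D \<Longrightarrow> g \<in> D \<Longrightarrow> nrm (\<lambda>x. f x - g x) = nrm (\<lambda>x. g x - f x)"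
  using nrm_minus[of "\<lambda>x. f x - g x"] by (simp add: diff_mem)

lemma nrm_rev_triangle:
  assumes "f \<in> D" "g \<in> D" shows "\<bar>nrm f - nrm g\<bar> \<le> nrm (\<lambda>x. f x - g x)"
  using triangle[of "\<lambda>x. f x - g x" g] triangle[of "\<lambda>x. g x - f x" f] nrm_sym[OF assms] assms
  by (simp add: diff_mem abs_le_iff)

definition cauchy where
  "cauchy F \<longleftrightarrow> (\<forall>n::nat. F n \<in> D) \<and> (\<forall>e>0. \<exists>N. \<forall>m\<ge>N. \<forall>n\<ge>N. nrm (\<lambda>x. F m x - F n x) < e)"

lemma cauchyD: "cauchy F \<Longrightarrow> F n \<in> D"
  by (simp add: cauchy_def)

lemma cauchy_lin:
  assumes "cauchy F" "cauchy G" shows "cauchy (\<lambda>n x. c * F n x + d * G n x)"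
  unfolding cauchy_def
proof (intro conjI allI impI)
  fix n show "(\<lambda>x. c * F n x + d * G n x) \<in> D" using assms cauchyD lin_mem by blast
next
  fix e :: real assume "e > 0"
  define k where "k = e / (2 * (cmod c + cmod d + 1))"
  have "cmod c + cmod d + 1 > 0" by (smt (verit) norm_ge_zero)
  then have k: "k > 0" "(cmod c + cmod d) * k < e"
    using \<open>e > 0\<close> by (auto simp: k_def field_simps intro!: add_nonneg_pos)
  obtain N1 N2 where N: "\<forall>m\<ge>N1. \<forall>n\<ge>N1. nrm (\<lambda>x. F m x - F n x) < k"
    "\<forall>m\<ge>N2. \<forall>n\<ge>N2. nrm (\<lambda>x. G m x - G n x) < k"
    using assms k(1) unfolding cauchy_def by metis
  show "\<exists>N. \<forall>m\<ge>N. \<forall>n\<ge>N. nrm (\<lambda>x. c * F m x + d * G m x - (c * F n x + d * G n x)) < e"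
  proof (intro exI[of _ "max N1 N2"] allI impI)
    fix m n assume mn: "max N1 N2 \<le> m" "max N1 N2 \<le> n"
    have D: "(\<lambda>x. F m x - F n x) \<in> D" "(\<lambda>x. G m x - G n x) \<in> D"
      using assms cauchyD diff_mem by blast+
    have "nrm (\<lambda>x. c * F m x + d * G m x - (c * F n x + d * G n x))
      = nrm (\<lambda>x. c * (F m x - F n x) + d * (G m x - G n x))"
      by (simp add: algebra_simps)
    also have "\<dots> \<le> cmod c * nrm (\<lambda>x. F m x - F n x) + cmod d * nrm (\<lambda>x. G m x - G n x)"
      using triangle[OF scale_mem[OF D(1), of c] scale_mem[OF D(2), of d]] nrm_scale[OF D(1), of c]
        nrm_scale[OF D(2), of d] by simp
    also have "\<dots> \<le> cmod c * k + cmod d * k"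
      using N mn by (intro add_mono mult_left_mono) (auto simp: less_imp_le)
    also have "\<dots> < e" using k(2) by (simp add: algebra_simps)
    finally show "nrm (\<lambda>x. c * F m x + d * G m x - (c * F n x + d * G n x)) < e" .
  qed
qed

lemma cauchy_const: "f \<in> D \<Longrightarrow> cauchy (\<lambda>_. f)"
  using nrm_scale[OF zero_mem, of 0] by (auto simp: cauchy_def)

lemma cauchy_bounded:
  assumes "cauchy F" shows "\<exists>K>0. \<forall>n. nrm (F n) \<le> K"
proof -
  obtain N where N: "\<forall>m\<ge>N. \<forall>n\<ge>N. nrm (\<lambda>x. F m x - F n x) < 1"
    using assms unfolding cauchy_def by (metis zero_less_one)
  define K where "K = Max ((\<lambda>n. nrm (F n)) ` {..N}) + 1"
  have le: "nrm (F n) \<le> K - 1" if "n \<le> N" for n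
    unfolding K_def using that by simp
  have "nrm (F n) \<le> K" for n
  proof (cases "n \<le> N")
    case False
    have "nrm (F n) \<le> nrm (F N) + 1"
      using nrm_rev_triangle[of "F n" "F N"] N[rule_format, of n N] assms False
      by (simp add: cauchyD)
    then show ?thesis using le[of N] by simp
  qed (use le in force)
  moreover have "K > 0" using le[of 0] nrm_ge0[OF cauchyD[OF assms, of 0]] by simp
  ultimately show ?thesis by blast
qed

text \<open>Gives B a value on pairs of Cauchy sequences although D need not contain their limits;
  the closure of a form is defined by it.\<close>

lemma cauchy_pairing_convergent:
  assumes F: "cauchy F" and G: "cauchy G" shows "convergent (\<lambda>n. B (F n) (G n))"
proof -
  obtain K where K: "K > 0" "\<And>n. nrm (F n) \<le> K" "\<And>n. nrm (G n) \<le> K"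
  proof -
    obtain K1 K2 where "K1 > 0" "\<forall>n. nrm (F n) \<le> K1" "K2 > 0" "\<forall>n. nrm (G n) \<le> K2"
      using cauchy_bounded F G by meson
    then show ?thesis by (intro that[of "max K1 K2"]) (auto simp: le_max_iff_disj)
  qed
  have "Cauchy (\<lambda>n. B (F n) (G n))"
  proof (rule CauchyI)
    fix e :: real assume "e > 0"
    then have "e / (2 * K) > 0" using K by simp
    obtain N1 N2 where N: "\<forall>m\<ge>N1. \<forall>n\<ge>N1. nrm (\<lambda>x. F m x - F n x) < e / (2 * K)"
      "\<forall>m\<ge>N2. \<forall>n\<ge>N2. nrm (\<lambda>x. G m x - G n x) < e / (2 * K)"
      using F G \<open>e / (2 * K) > 0\<close> unfolding cauchy_def by metis
    show "\<exists>M. \<forall>m\<ge>M. \<forall>n\<ge>M. norm (B (F m) (G m) - B (F n) (G n)) < e"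
    proof (intro exI[of _ "max N1 N2"] allI impI)
      fix m n assume mn: "max N1 N2 \<le> m" "max N1 N2 \<le> n"
      note FD = cauchyD[OF F] and GD = cauchyD[OF G]
      have eq: "B (F m) (G m) - B (F n) (G n) =
        B (\<lambda>x. F m x - F n x) (G m) + B (F n) (\<lambda>x. G m x - G n x)"
        using FD GD by (simp add: diff_left diff_right)
      have "cmod (B (F m) (G m) - B (F n) (G n)) \<le> nrm (\<lambda>x. F m x - F n x) * nrm (G m) + nrm (F n) * nrm (\<lambda>x. G m x - G n x)"
        unfolding eq using FD GD by (intro norm_triangle_le add_mono Cauchy_Schwarz diff_mem)
      also have "\<dots> \<le> nrm (\<lambda>x. F m x - F n x) * K + K * nrm (\<lambda>x. G m x - G n x)"
        using FD GD K by (intro add_mono mult_left_mono mult_right_mono) (auto intro!: diff_mem nrm_ge0)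
      also have "\<dots> < e / (2 * K) * K + K * (e / (2 * K))"
        using N mn K(1) by (intro add_strict_mono mult_strict_left_mono mult_strict_right_mono) auto
      also have "\<dots> = e" using K(1) by simp
      finally show "norm (B (F m) (G m) - B (F n) (G n)) < e" .
    qed
  qed
  then show ?thesis by (simp add: Cauchy_convergent_iff)
qed

text \<open>The minimising sequence of \<open>B h h - 2 Re (\<ell> h)\<close> is Cauchy and represents \<open>\<ell>\<close>
  in the limit, which replaces the Riesz theorem in the (not necessarily complete) space \<open>D\<close>.\<close>

lemma riesz_sequence:
  fixes l :: "(real \<Rightarrow> complex) \<Rightarrow> complex"
  assumes l: "\<And>f g c d. f \<in> D \<Longrightarrow> g \<in> D \<Longrightarrow> l (\<lambda>x. c * f x + d * g x) = cnj c * l f + cnj d * l g"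
    and bnd: "\<And>f. f \<in> D \<Longrightarrow> cmod (l f) \<le> C * nrm f"
  shows "\<exists>F. cauchy F \<and> (\<forall>k\<in>D. (\<lambda>n. B (F n) k) \<longlonglongrightarrow> l k)"
proof -
  define J where "J = (\<lambda>f. Re (B f f) - 2 * Re (l f))"
  define j where "j = Inf (J ` D)"
  have bdd: "bdd_below (J ` D)"
  proof (rule bdd_belowI2[of _ "- C\<^sup>2"])
    fix f assume f: "f \<in> D"
    have "- C\<^sup>2 \<le> (nrm f)\<^sup>2 - 2 * (C * nrm f)"
      using zero_le_power2[of "nrm f - C"] by (simp add: power2_diff algebra_simps)
    also have "\<dots> \<le> J f"
      using bnd[OF f] complex_Re_le_cmod[of "l f"] f by (simp add: J_def nrm_sq)
    finally show "- C\<^sup>2 \<le> J f" .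
  qed
  have ge: "j \<le> J f" if "f \<in> D" for f
    unfolding j_def using bdd that by (simp add: cInf_lower)
  have "\<exists>f\<in>D. J f < j + 1 / (Suc n)" for n :: nat
  proof -
    have "Inf (J ` D) < j + 1 / (Suc n)" by (simp add: j_def)
    then show ?thesis using cInf_lessD[of "J ` D"] zero_mem by blast
  qed
  then obtain F where F: "\<And>n::nat. F n \<in> D" "\<And>n. J (F n) < j + 1 / (Suc n)"
    by metis
  have lsc: "l (\<lambda>x. f x + c * g x) = l f + cnj c * l g" if "f \<in> D" "g \<in> D" for f g c
    using l[OF that, of 1 c] by simp
  have var: "J (\<lambda>x. f x + c * k x) = J f + 2 * Re (cnj c * (B f k - l k)) + (cmod c)\<^sup>2 * Re (B k k)"
    if "f \<in> D" "k \<in> D" for f k c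
    unfolding J_def by (simp add: Re_expand[OF that] lsc[OF that] algebra_simps)
  \<comment> \<open>No direction can lower J at F n by more than 1/(n+1), so the discriminant
    inequality bounds the first variation.\<close>
  have near: "(cmod (B (F n) k - l k))\<^sup>2 \<le> 1 / (Suc n) * Re (B k k)" if k: "k \<in> D" for k n
  proof (rule quadratic_bound)
    fix c
    have "j \<le> J (\<lambda>x. F n x + c * k x)" using F k by (intro ge add_mem scale_mem)
    then show "0 \<le> 1 / (Suc n) + 2 * Re (cnj c * (B (F n) k - l k)) + (cmod c)\<^sup>2 * Re (B k k)"
      unfolding var[OF F(1) k] using F(2)[of n] by linarith
  qed (use pos k in auto)
  have lim: "(\<lambda>n. B (F n) k) \<longlonglongrightarrow> l k" if k: "k \<in> D" for k
  proof -
    have "(\<lambda>n. 1 / real (Suc n) * Re (B k k)) \<longlonglongrightarrow> 0"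
      using tendsto_mult_right[OF LIMSEQ_inverse_real_of_nat, of "Re (B k k)"]
      by (simp add: inverse_eq_divide)
    then have "(\<lambda>n. (cmod (B (F n) k - l k))\<^sup>2) \<longlonglongrightarrow> 0"
      by (rule tendsto_sandwich[rotated -1]) (use near[OF k] in auto)
    then have "(\<lambda>n. cmod (B (F n) k - l k)) \<longlonglongrightarrow> 0"
      using tendsto_real_sqrt by fastforce
    then show ?thesis by (simp add: LIM_zero_iff tendsto_norm_zero_iff)
  qed
  \<comment> \<open>At the midpoint of F m and F n the functional J is still at least j, while both
    end points are close to j; the parallelogram law bounds their distance.\<close>
  have par: "Re (B (\<lambda>x. F m x - F n x) (\<lambda>x. F m x - F n x)) \<le> 2 / Suc m + 2 / Suc n" for m n
  proof -
    let ?d = "\<lambda>x. F n x - F m x"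
    have d: "?d \<in> D" using F diff_mem by blast
    have "(\<lambda>x. F m x + 1/2 * ?d x) \<in> D" using F d add_mem scale_mem by blast
    then have "j \<le> J (\<lambda>x. F m x + 1/2 * ?d x)" by (rule ge)
    also have "\<dots> = J (F m) + Re (B (F m) ?d - l ?d) + 1/4 * Re (B ?d ?d)"
      using var[OF F(1)[of m] d, of "1/2"] by (simp add: power2_eq_square)
    finally have 1: "j \<le> J (F m) + Re (B (F m) ?d - l ?d) + 1/4 * Re (B ?d ?d)" .
    have 2: "J (F n) = J (F m) + 2 * Re (B (F m) ?d - l ?d) + Re (B ?d ?d)"
      using var[OF F(1)[of m] d, of 1] by simp
    have "Re (B ?d ?d) \<le> 2 * (J (F m) - j) + 2 * (J (F n) - j)" using 1 2 by argo
    also have "\<dots> \<le> 2 / Suc m + 2 / Suc n" using F(2)[of m] F(2)[of n] by simp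
    finally have "Re (B ?d ?d) \<le> 2 / Suc m + 2 / Suc n" .
    then show ?thesis using nrm_sym[OF F(1) F(1), of m n]
      by (metis F(1) d diff_mem nrm_sq)
  qed
  have "cauchy F"
    unfolding cauchy_def
  proof (intro conjI allI impI F)
    fix e :: real assume "e > 0"
    then obtain N where N: "4 / real (Suc N) < e\<^sup>2"
    proof -
      obtain N where "inverse (real (Suc N)) < e\<^sup>2 / 4"
        using reals_Archimedean[of "e\<^sup>2/4"] \<open>e > 0\<close> by auto
      then show ?thesis by (intro that[of N]) (simp add: inverse_eq_divide)
    qed
    show "\<exists>N. \<forall>m\<ge>N. \<forall>n\<ge>N. nrm (\<lambda>x. F m x - F n x) < e"
    proof (intro exI[of _ N] allI impI)
      fix m n assume mn: "N \<le> m" "N \<le> n"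
      have "(nrm (\<lambda>x. F m x - F n x))\<^sup>2 \<le> 2 / Suc m + 2 / Suc n"
        using par[of m n] F by (simp add: nrm_sq diff_mem)
      also have "\<dots> \<le> 2 / Suc N + 2 / Suc N"
        using mn by (intro add_mono divide_left_mono) auto
      also have "\<dots> < e\<^sup>2" using N by simp
      finally show "nrm (\<lambda>x. F m x - F n x) < e"
        using \<open>e > 0\<close> power2_less_imp_less less_imp_le by blast
    qed
  qed
  then show ?thesis using lim by blast
qed

lemma semi_inner_subspace:
  assumes "S \<subseteq> D" "(\<lambda>_. 0) \<in> S" "\<And>f g c d. f \<in> S \<Longrightarrow> g \<in> S \<Longrightarrow> (\<lambda>x. c * f x + d * g x) \<in> S"
  shows "semi_inner S B"
proof
  show "sesquilinear_on S B"
    using sesq assms(1) unfolding sesquilinear_on_def by blast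
qed (use assms pos in auto)

end

section \<open>Square integrable functions\<close>

lemma square_integrable_cmult:
  assumes "f \<in> square_integrable M" shows "(\<lambda>x. c * f x) \<in> square_integrable M"
  using assms by (auto simp: square_integrable_def norm_mult power_mult_distrib)

lemma square_integrable_add:
  assumes "f \<in> square_integrable M" "g \<in> square_integrable M"
  shows "(\<lambda>x. f x + g x) \<in> square_integrable M"
proof -
  have [measurable]: "f \<in> borel_measurable M" "g \<in> borel_measurable M"
    using assms by (auto simp: square_integrable_def)
  have "integrable M (\<lambda>x. (cmod (f x + g x))\<^sup>2)"
  proof (rule Bochner_Integration.integrable_bound)
    show "integrable M (\<lambda>x. 2 * (cmod (f x))\<^sup>2 + 2 * (cmod (g x))\<^sup>2)"
      using assms by (auto simp: square_integrable_def)
    show "AE x in M. norm ((cmod (f x + g x))\<^sup>2) \<le> norm (2 * (cmod (f x))\<^sup>2 + 2 * (cmod (g x))\<^sup>2)"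
    proof (rule AE_I2)
      fix x
      have "(cmod (f x + g x))\<^sup>2 \<le> (cmod (f x) + cmod (g x))\<^sup>2"
        by (intro power_mono norm_triangle_ineq) auto
      also have "\<dots> \<le> 2 * (cmod (f x))\<^sup>2 + 2 * (cmod (g x))\<^sup>2"
        using zero_le_power2[of "cmod (f x) - cmod (g x)"] by (simp add: power2_sum power2_diff)
      finally show "norm ((cmod (f x + g x))\<^sup>2) \<le> norm (2 * (cmod (f x))\<^sup>2 + 2 * (cmod (g x))\<^sup>2)"
        by simp
    qed
  qed measurable
  then show ?thesis by (auto simp: square_integrable_def)
qed

lemma square_integrable_lin:
  "f \<in> square_integrable M \<Longrightarrow> g \<in> square_integrable M \<Longrightarrow>
    (\<lambda>x. c * f x + d * g x) \<in> square_integrable M"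
  by (intro square_integrable_add square_integrable_cmult)

lemma borel_measurable_cnj [measurable]:
  "f \<in> borel_measurable M \<Longrightarrow> (\<lambda>x. cnj (f x)) \<in> borel_measurable M"
  by (rule measurable_compose[OF _ borel_measurable_continuous_onI[OF continuous_on_cnj[OF continuous_on_id]]])

lemma square_integrable_cnj:
  "f \<in> square_integrable M \<Longrightarrow> (\<lambda>x. cnj (f x)) \<in> square_integrable M"
  by (auto simp: square_integrable_def)

lemma square_integrable_mult:
  assumes "f \<in> square_integrable M" "g \<in> square_integrable M"
  shows "integrable M (\<lambda>x. f x * g x)"
proof (rule Bochner_Integration.integrable_bound)
  show "integrable M (\<lambda>x. (cmod (f x))\<^sup>2 + (cmod (g x))\<^sup>2)"
    using assms by (auto simp: square_integrable_def)
  show "AE x in M. norm (f x * g x) \<le> norm ((cmod (f x))\<^sup>2 + (cmod (g x))\<^sup>2)"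
  proof (rule AE_I2)
    fix x
    have "cmod (f x) * cmod (g x) \<le> (cmod (f x))\<^sup>2 + (cmod (g x))\<^sup>2"
      using zero_le_power2[of "cmod (f x) - cmod (g x)"] mult_nonneg_nonneg[OF norm_ge_zero norm_ge_zero, of "f x" "g x"]
      unfolding power2_diff by linarith
    then show "norm (f x * g x) \<le> norm ((cmod (f x))\<^sup>2 + (cmod (g x))\<^sup>2)"
      by (simp add: norm_mult)
  qed
qed (use assms in \<open>auto simp: square_integrable_def\<close>)

lemma square_integrable_mult_cnj:
  "f \<in> square_integrable M \<Longrightarrow> g \<in> square_integrable M \<Longrightarrow> integrable M (\<lambda>x. f x * cnj (g x))"
  by (intro square_integrable_mult square_integrable_cnj)

definition inner_on :: "real measure \<Rightarrow> (real \<Rightarrow> complex) \<Rightarrow> (real \<Rightarrow> complex) \<Rightarrow> complex" where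
  "inner_on M f g = (LINT x|M. f x * cnj (g x))"

lemma inner_on_self: "inner_on M f f = of_real (LINT x|M. (cmod (f x))\<^sup>2)"
  unfolding inner_on_def by (simp add: complex_norm_square[symmetric] del: of_real_power)

lemma semi_inner_square_integrable: "semi_inner (square_integrable M) (inner_on M)"
proof
  show "sesquilinear_on (square_integrable M) (inner_on M)"
    unfolding sesquilinear_on_def inner_on_def
    by (auto simp: distrib_left distrib_right mult.assoc square_integrable_mult_cnj
        mult.left_commute[of _ "cnj _"])
  fix f assume "f \<in> square_integrable M"
  then show "Im (inner_on M f f) = 0 \<and> 0 \<le> Re (inner_on M f f)"
    by (simp add: inner_on_self)
qed (use square_integrable_lin in \<open>auto simp: square_integrable_def\<close>)

lemma L2_inner_eq: "L2_inner = inner_on lborel"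
  by (intro ext) (simp add: L2_inner_def inner_on_def)

global_interpretation SI: semi_inner "square_integrable M" "inner_on M"
  rewrites "semi_inner.nrm (inner_on M) = (\<lambda>f. sqrt (LINT x|M. (cmod (f x))\<^sup>2))"
  for M
proof -
  show "semi_inner (square_integrable M) (inner_on M)" by (rule semi_inner_square_integrable)
  show "semi_inner.nrm (inner_on M) = (\<lambda>f. sqrt (LINT x|M. (cmod (f x))\<^sup>2))"
    by (intro ext) (simp add: semi_inner.nrm_def[OF semi_inner_square_integrable[of M]] inner_on_self)
qed

global_interpretation L2I: semi_inner L2 L2_inner
  rewrites "semi_inner.nrm L2_inner = L2_norm"
proof -
  show "semi_inner L2 L2_inner" by (simp add: L2_inner_eq semi_inner_square_integrable)
  show "semi_inner.nrm L2_inner = L2_norm"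
    unfolding L2_inner_eq SI.nrm_def by (intro ext) (simp add: L2_norm_def semi_inner.nrm_def[OF semi_inner_square_integrable] inner_on_self)
qed

section \<open>Completeness of square integrable functions\<close>

lemma nn_integral_cmod_square:
  "f \<in> square_integrable M \<Longrightarrow> (\<integral>\<^sup>+x. ennreal ((cmod (f x))\<^sup>2) \<partial>M) = ennreal (LINT x|M. (cmod (f x))\<^sup>2)"
  by (intro nn_integral_eq_integral) (auto simp: square_integrable_def)

text \<open>Riesz--Fischer. The rate \<open>4\<^sup>-\<^sup>k\<close> for the squared norms makes
  \<open>\<Sum>k. 2\<^sup>k |F (r (k+1)) - F (r k)|\<^sup>2\<close> integrable, hence the subsequence converges almost everywhere.\<close>

lemma square_integrable_complete:
  assumes "SI.cauchy M F"
  shows "\<exists>u\<in>square_integrable M. (\<lambda>n. sqrt (LINT x|M. (cmod (F n x - u x))\<^sup>2)) \<longlonglongrightarrow> 0"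
proof -
  let ?N = "\<lambda>f. sqrt (LINT x|M. (cmod (f x))\<^sup>2)"
  have F: "F n \<in> square_integrable M" for n using assms by (rule SI.cauchyD)
  have Fm [measurable]: "F n \<in> borel_measurable M" for n using F by (auto simp: square_integrable_def)
  have cau: "\<exists>N. \<forall>m\<ge>N. \<forall>n\<ge>N. ?N (\<lambda>x. F m x - F n x) < e" if "e > 0" for e
    using assms that unfolding SI.cauchy_def by blast
  have "\<exists>N. \<forall>k. \<forall>m\<ge>N k. \<forall>n\<ge>N k. ?N (\<lambda>x. F m x - F n x) < (1/2)^k"
    using cau[of "(1/2)^_"] by (intro choice) auto
  then obtain N where N: "\<And>k m n. m \<ge> N k \<Longrightarrow> n \<ge> N k \<Longrightarrow> ?N (\<lambda>x. F m x - F n x) < (1/2)^k"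
    by blast
  \<comment> \<open>Adding up gives \<open>r (Suc k) \<ge> N k\<close> as well as
    \<open>r k \<ge> N k\<close>, so consecutive terms are within 2^-k; the summand k makes r tend
    to infinity.\<close>
  define r where "r k = (\<Sum>i\<le>k. N i) + k" for k
  have r: "r k \<ge> N k" "r (Suc k) \<ge> N k" "r k \<ge> k" for k
  proof -
    have "N k \<le> sum N {..k}" by (intro member_le_sum) auto
    then show "r k \<ge> N k" "r (Suc k) \<ge> N k" "r k \<ge> k" unfolding r_def by auto
  qed
  define G where "G k x = F (r (Suc k)) x - F (r k) x" for k x
  have G: "G k \<in> square_integrable M" for k
    unfolding G_def using F SI.diff_mem by blast
  have Gm [measurable]: "G k \<in> borel_measurable M" for k using G by (auto simp: square_integrable_def)
  have Gk: "(LINT x|M. (cmod (G k x))\<^sup>2) \<le> (1/4)^k" for k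
  proof -
    have "?N (G k) < (1/2)^k" unfolding G_def using r[of k] by (intro N) auto
    then have "(?N (G k))\<^sup>2 \<le> ((1/2)^k)\<^sup>2" by (intro power_mono) auto
    then show ?thesis by (simp add: power2_eq_square power_mult_distrib[symmetric])
  qed
  have "(\<integral>\<^sup>+x. (\<Sum>k. ennreal (2^k * (cmod (G k x))\<^sup>2)) \<partial>M) = (\<Sum>k. \<integral>\<^sup>+x. ennreal (2^k * (cmod (G k x))\<^sup>2) \<partial>M)"
    by (intro nn_integral_suminf) measurable
  also have "\<dots> \<le> (\<Sum>k. ennreal ((1/2)^k))"
  proof (intro suminf_le summableI)
    fix k
    have "(\<integral>\<^sup>+x. ennreal (2^k * (cmod (G k x))\<^sup>2) \<partial>M) = ennreal (LINT x|M. 2^k * (cmod (G k x))\<^sup>2)"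
      using G[of k] by (intro nn_integral_eq_integral) (auto simp: square_integrable_def)
    also have "\<dots> \<le> ennreal (2^k * (1/4)^k)"
      using Gk[of k] by (intro ennreal_leI) simp
    also have "(2::real)^k * (1/4)^k = (1/2)^k" by (simp add: power_mult_distrib[symmetric])
    finally show "(\<integral>\<^sup>+x. ennreal (2^k * (cmod (G k x))\<^sup>2) \<partial>M) \<le> ennreal ((1/2)^k)" .
  qed
  also have "\<dots> < \<infinity>"
    by (subst suminf_ennreal2) (auto simp: summable_geometric)
  finally have "(\<integral>\<^sup>+x. (\<Sum>k. ennreal (2^k * (cmod (G k x))\<^sup>2)) \<partial>M) \<noteq> \<infinity>" by simp
  then have "AE x in M. (\<Sum>k. ennreal (2^k * (cmod (G k x))\<^sup>2)) \<noteq> \<infinity>"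
    by (intro nn_integral_PInf_AE) measurable
  then have conv: "AE x in M. convergent (\<lambda>k. F (r k) x)"
  proof eventually_elim
    fix x assume fin: "(\<Sum>k. ennreal (2^k * (cmod (G k x))\<^sup>2)) \<noteq> \<infinity>"
    define S where "S = enn2real (\<Sum>k. ennreal (2^k * (cmod (G k x))\<^sup>2))"
    have S: "(\<Sum>k. ennreal (2^k * (cmod (G k x))\<^sup>2)) = ennreal S" "S \<ge> 0"
      using fin by (auto simp: S_def less_top)
    have bound: "cmod (G k x) \<le> sqrt S * (sqrt (1/2))^k" for k
    proof -
      have "ennreal (2^k * (cmod (G k x))\<^sup>2) = (\<Sum>j\<in>{k}. ennreal (2^j * (cmod (G j x))\<^sup>2))" by simp
      also have "\<dots> \<le> ennreal S" unfolding S(1)[symmetric]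
        by (rule sum_le_suminf[OF summableI]) auto
      finally have "2^k * (cmod (G k x))\<^sup>2 \<le> S" using S(2) by (simp add: ennreal_le_iff)
      then have "(cmod (G k x))\<^sup>2 \<le> S * (1/2)^k" by (simp add: field_simps power_one_over)
      then have "sqrt ((cmod (G k x))\<^sup>2) \<le> sqrt (S * (1/2)^k)" by (rule real_sqrt_le_mono)
      then show ?thesis by (simp add: real_sqrt_mult real_sqrt_power)
    qed
    have "summable (\<lambda>k. G k x)"
    proof (rule summable_comparison_test')
      show "summable (\<lambda>k. sqrt S * (sqrt (1/2))^k)"
        by (intro summable_mult summable_geometric) (auto simp: real_sqrt_lt_1_iff)
      show "norm (G n x) \<le> sqrt S * (sqrt (1/2))^n" if "n \<ge> 0" for n using bound .
    qed
    then have "convergent (\<lambda>n. \<Sum>k<n. G k x)" by (rule summable_iff_convergent[THEN iffD1])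
    then have "convergent (\<lambda>n. F (r 0) x + (\<Sum>k<n. G k x))"
      by (intro convergent_add convergent_const)
    moreover have "F (r 0) x + (\<Sum>k<n. G k x) = F (r n) x" for n
      using sum_lessThan_telescope[of "\<lambda>k. F (r k) x" n] by (simp add: G_def)
    ultimately show "convergent (\<lambda>k. F (r k) x)" by simp
  qed
  define u where "u x = lim (\<lambda>k. F (r k) x)" for x
  have [measurable]: "u \<in> borel_measurable M" unfolding u_def by measurable
  have lim: "AE x in M. (\<lambda>k. F (r k) x) \<longlonglongrightarrow> u x"
    using conv by eventually_elim (simp add: u_def convergent_LIMSEQ_iff)
  \<comment> \<open>Fatou's lemma along the subsequence: a bound e for the distances from F n to all
    late F m passes to the limit u.\<close>
  have fatou: "?N (\<lambda>x. F n x - u x) \<le> e" "(\<lambda>x. F n x - u x) \<in> square_integrable M"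
    if e: "e > 0" and n: "\<And>m. m \<ge> K \<Longrightarrow> ?N (\<lambda>x. F n x - F m x) < e" for n K e
  proof -
    have "(\<integral>\<^sup>+x. ennreal ((cmod (F n x - u x))\<^sup>2) \<partial>M)
      = (\<integral>\<^sup>+x. liminf (\<lambda>k. ennreal ((cmod (F n x - F (r k) x))\<^sup>2)) \<partial>M)"
    proof (rule nn_integral_cong_AE)
      show "AE x in M. ennreal ((cmod (F n x - u x))\<^sup>2) = liminf (\<lambda>k. ennreal ((cmod (F n x - F (r k) x))\<^sup>2))"
        using lim
      proof eventually_elim
        fix x assume "(\<lambda>k. F (r k) x) \<longlonglongrightarrow> u x"
        then have "(\<lambda>k. ennreal ((cmod (F n x - F (r k) x))\<^sup>2)) \<longlonglongrightarrow> ennreal ((cmod (F n x - u x))\<^sup>2)"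
          by (intro tendsto_intros)
        then show "ennreal ((cmod (F n x - u x))\<^sup>2) = liminf (\<lambda>k. ennreal ((cmod (F n x - F (r k) x))\<^sup>2))"
          by (intro lim_imp_Liminf[symmetric]) auto
      qed
    qed
    also have "\<dots> \<le> liminf (\<lambda>k. \<integral>\<^sup>+x. ennreal ((cmod (F n x - F (r k) x))\<^sup>2) \<partial>M)"
      by (intro nn_integral_liminf) measurable
    also have "\<dots> \<le> ennreal (e\<^sup>2)"
    proof (rule order_trans[OF Liminf_le_Limsup Limsup_bounded])
      show "\<forall>\<^sub>F k in sequentially. (\<integral>\<^sup>+x. ennreal ((cmod (F n x - F (r k) x))\<^sup>2) \<partial>M) \<le> ennreal (e\<^sup>2)"
      proof (rule eventually_sequentiallyI[of K])
        fix k assume "k \<ge> K"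
        then have "?N (\<lambda>x. F n x - F (r k) x) < e" using r(3)[of k] by (intro n) auto
        then have "(?N (\<lambda>x. F n x - F (r k) x))\<^sup>2 \<le> e\<^sup>2" by (intro power_mono) auto
        then show "(\<integral>\<^sup>+x. ennreal ((cmod (F n x - F (r k) x))\<^sup>2) \<partial>M) \<le> ennreal (e\<^sup>2)"
          by (subst nn_integral_cmod_square) (use F SI.diff_mem in \<open>auto intro!: ennreal_leI\<close>)
      qed
    qed simp
    finally have le: "(\<integral>\<^sup>+x. ennreal ((cmod (F n x - u x))\<^sup>2) \<partial>M) \<le> ennreal (e\<^sup>2)" .
    then have "integrable M (\<lambda>x. (cmod (F n x - u x))\<^sup>2)"
      by (intro integrableI_bounded) (auto simp: le_less_trans)
    then show si: "(\<lambda>x. F n x - u x) \<in> square_integrable M"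
      by (simp add: square_integrable_def)
    have "(LINT x|M. (cmod (F n x - u x))\<^sup>2) \<le> e\<^sup>2"
      using le e unfolding nn_integral_cmod_square[OF si] by (simp add: ennreal_le_iff)
    then show "?N (\<lambda>x. F n x - u x) \<le> e"
      using e real_le_lsqrt by auto
  qed
  have "u \<in> square_integrable M"
  proof -
    obtain K where "\<forall>m\<ge>K. \<forall>n\<ge>K. ?N (\<lambda>x. F m x - F n x) < 1" using cau[of 1] by auto
    then have "(\<lambda>x. F K x - u x) \<in> square_integrable M" by (intro fatou(2)[of 1 K]) auto
    then show ?thesis using SI.diff_mem[OF F[of K]] by fastforce
  qed
  moreover have "(\<lambda>n. ?N (\<lambda>x. F n x - u x)) \<longlonglongrightarrow> 0"
  proof (rule LIMSEQ_I)
    fix e :: real assume "e > 0"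
    then obtain K where K: "\<forall>m\<ge>K. \<forall>n\<ge>K. ?N (\<lambda>x. F m x - F n x) < e/2" using cau[of "e/2"] by auto
    show "\<exists>no. \<forall>n\<ge>no. norm (?N (\<lambda>x. F n x - u x) - 0) < e"
    proof (intro exI[of _ K] allI impI)
      fix n assume "n \<ge> K"
      then have "?N (\<lambda>x. F n x - u x) \<le> e/2" using K \<open>e > 0\<close> by (intro fatou(1)[of _ K]) auto
      then show "norm (?N (\<lambda>x. F n x - u x) - 0) < e" using \<open>e > 0\<close> by simp
    qed
  qed
  ultimately show ?thesis by blast
qed

lemma L2_complete:
  assumes "L2I.cauchy F" shows "\<exists>u\<in>L2. (\<lambda>n. L2_norm (\<lambda>x. F n x - u x)) \<longlonglongrightarrow> 0"
  using square_integrable_complete[of lborel F] assms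
  unfolding L2I.cauchy_def SI.cauchy_def by (simp add: L2_norm_def)

section \<open>Semibounded forms\<close>

lemma L2_norm_cong_AE:
  assumes "u \<in> L2" "v \<in> L2" "AE x in lborel. u x = v x"
  shows "L2_norm u = L2_norm v"
proof -
  have [measurable]: "u \<in> borel_measurable borel" "v \<in> borel_measurable borel"
    using assms by (auto simp: square_integrable_def)
  have "(LINT x|lborel. (cmod (u x))\<^sup>2) = (LINT x|lborel. (cmod (v x))\<^sup>2)"
    by (rule integral_cong_AE) (use assms(3) in auto)
  then show ?thesis by (simp add: L2_norm_def)
qed

lemma L2_inner_cong_AE:
  assumes "u \<in> L2" "v \<in> L2" "w \<in> L2" "z \<in> L2" "AE x in lborel. u x = v x" "AE x in lborel. w x = z x"
  shows "L2_inner u w = L2_inner v z"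
proof -
  have [measurable]: "u \<in> borel_measurable borel" "v \<in> borel_measurable borel"
    "w \<in> borel_measurable borel" "z \<in> borel_measurable borel"
    using assms by (auto simp: square_integrable_def)
  show ?thesis unfolding L2_inner_def
    by (rule integral_cong_AE) (use assms(5,6) in auto)
qed

lemma L2_inner_self: "f \<in> L2 \<Longrightarrow> L2_inner f f = of_real ((L2_norm f)\<^sup>2)"
  by (simp add: L2_inner_eq inner_on_self L2_norm_def del: of_real_power)

text \<open>The shift c makes the norm of t + c dominate the L2 norm with constant 1, so that
  convergence in the form and in L2 is governed by a single norm.\<close>

locale form_data =
  fixes t :: L2_form and s :: "(real \<Rightarrow> complex) \<Rightarrow> (real \<Rightarrow> complex) \<Rightarrow> complex" and c :: real
  assumes quad: "quadratic_form t"
    and s_sesq: "sesquilinear_on (dom t) s"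
    and s_diag: "\<And>f. f \<in> dom t \<Longrightarrow> s f f = of_real (the (t f))"
    and bound: "\<And>f. f \<in> dom t \<Longrightarrow> (L2_norm f)\<^sup>2 \<le> the (t f) + c * (L2_norm f)\<^sup>2"
begin

definition B where "B u w = s u w + of_real c * L2_inner u w"

lemma dom_L2: "f \<in> dom t \<Longrightarrow> f \<in> L2"
  using quad unfolding quadratic_form_def by blast

lemma B_self: "f \<in> dom t \<Longrightarrow> B f f = of_real (the (t f) + c * (L2_norm f)\<^sup>2)"
  unfolding B_def by (simp add: s_diag L2_inner_self dom_L2)

sublocale T: semi_inner "dom t" B
proof
  show "sesquilinear_on (dom t) B"
    using s_sesq dom_L2 unfolding sesquilinear_on_def B_def
    by (simp add: L2I.lin_left L2I.lin_right algebra_simps)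
  fix f assume "f \<in> dom t"
  then show "Im (B f f) = 0 \<and> 0 \<le> Re (B f f)"
    using bound[of f] by (simp add: B_self order_trans[OF zero_le_power2])
qed (use quad in \<open>auto simp: quadratic_form_def\<close>)

lemma nrm_sq_eq: "f \<in> dom t \<Longrightarrow> (T.nrm f)\<^sup>2 = the (t f) + c * (L2_norm f)\<^sup>2"
  by (simp add: T.nrm_sq B_self)

lemma L2_norm_le_nrm: "f \<in> dom t \<Longrightarrow> L2_norm f \<le> T.nrm f"
  by (rule power2_le_imp_le) (use bound in \<open>auto simp: nrm_sq_eq\<close>)

lemma polarization_eq:
  assumes "u \<in> dom t" "w \<in> dom t" shows "polarization t u w = s u w"
proof -
  have ex: "of_real (the (t (\<lambda>x. u x + d * w x))) = s u u + cnj d * s u w + d * s w u + d * cnj d * s w w" for d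
  proof -
    have 1: "(\<lambda>x. 1 * u x + d * w x) \<in> dom t" using T.lin_mem[OF assms, of 1 d] .
    have l: "s (\<lambda>x. 1 * u x + d * w x) h = 1 * s u h + d * s w h"
      and r: "s h (\<lambda>x. 1 * u x + d * w x) = cnj 1 * s h u + cnj d * s h w" if "h \<in> dom t" for h
      using s_sesq assms that unfolding sesquilinear_on_def by blast+
    have "s (\<lambda>x. 1 * u x + d * w x) (\<lambda>x. 1 * u x + d * w x) = s u u + cnj d * s u w + d * s w u + d * cnj d * s w w"
      unfolding l[OF 1] r[OF assms(1)] r[OF assms(2)] by (simp add: algebra_simps)
    then show ?thesis using s_diag[OF 1] by simp
  qed
  have e: "of_real (the (t (\<lambda>x. u x + w x))) = s u u + s u w + s w u + s w w"
    "of_real (the (t (\<lambda>x. u x - w x))) = s u u - s u w - s w u + s w w"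
    "of_real (the (t (\<lambda>x. u x + \<i> * w x))) = s u u - \<i> * s u w + \<i> * s w u + s w w"
    "of_real (the (t (\<lambda>x. u x - \<i> * w x))) = s u u + \<i> * s u w - \<i> * s w u + s w w"
    using ex[of 1] ex[of "-1"] ex[of \<i>] ex[of "-\<i>"] by (simp_all add: algebra_simps)
  show ?thesis
    unfolding polarization_def e by (simp add: algebra_simps)
qed

lemma L2_cauchy: "T.cauchy F \<Longrightarrow> L2I.cauchy F"
  unfolding T.cauchy_def L2I.cauchy_def using dom_L2 L2_norm_le_nrm T.diff_mem
  by (meson le_less_trans)

lemma L2_convergent_cauchy:
  assumes F: "\<And>n. F n \<in> L2" and u: "u \<in> L2" and lim: "(\<lambda>n. L2_norm (\<lambda>x. F n x - u x)) \<longlonglongrightarrow> 0"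
  shows "L2I.cauchy F"
  unfolding L2I.cauchy_def
proof (intro conjI allI impI F)
  fix e :: real assume "e > 0"
  then have "\<forall>\<^sub>F n in sequentially. L2_norm (\<lambda>x. F n x - u x) < e/2"
    using lim by (intro order_tendstoD) auto
  then obtain N where N: "\<And>n. n \<ge> N \<Longrightarrow> L2_norm (\<lambda>x. F n x - u x) < e/2"
    unfolding eventually_sequentially by blast
  show "\<exists>N. \<forall>m\<ge>N. \<forall>n\<ge>N. L2_norm (\<lambda>x. F m x - F n x) < e"
  proof (intro exI[of _ N] allI impI)
    fix m n assume "N \<le> m" "N \<le> n"
    then show "L2_norm (\<lambda>x. F m x - F n x) < e"
      using L2I.triangle_diff[OF F u F, of m n] L2I.nrm_sym[OF u F, of n] N[of m] N[of n] by simp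
  qed
qed

text \<open>\<open>closed_form\<close> measures Cauchy sequences by the unshifted form along an
  L2-convergent sequence. The shift, c times a squared L2 norm, is then negligible in both
  directions.\<close>

lemma cauchy_iff:
  assumes "\<And>n. F n \<in> dom t" "L2I.cauchy F"
  shows "T.cauchy F \<longleftrightarrow> (\<forall>e>0. \<exists>N. \<forall>m\<ge>N. \<forall>n\<ge>N. \<bar>the (t (\<lambda>x. F m x - F n x))\<bar> < e)"
proof
  note D = T.diff_mem[OF assms(1,1)]
  assume T: "T.cauchy F"
  show "\<forall>e>0. \<exists>N. \<forall>m\<ge>N. \<forall>n\<ge>N. \<bar>the (t (\<lambda>x. F m x - F n x))\<bar> < e"
  proof (intro allI impI)
    fix e :: real assume e: "e > 0"
    define k where "k = sqrt (e / (1 + \<bar>c\<bar>))"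
    have k: "k > 0" "k\<^sup>2 * (1 + \<bar>c\<bar>) = e" using e by (auto simp: k_def)
    obtain N where N: "\<And>m n. m\<ge>N \<Longrightarrow> n\<ge>N \<Longrightarrow> T.nrm (\<lambda>x. F m x - F n x) < k"
      using T k(1) unfolding T.cauchy_def by blast
    show "\<exists>N. \<forall>m\<ge>N. \<forall>n\<ge>N. \<bar>the (t (\<lambda>x. F m x - F n x))\<bar> < e"
    proof (intro exI[of _ N] allI impI)
      fix m n assume mn: "N \<le> m" "N \<le> n"
      let ?d = "\<lambda>x. F m x - F n x"
      have L: "(L2_norm ?d)\<^sup>2 \<le> (T.nrm ?d)\<^sup>2"
        by (intro power_mono L2_norm_le_nrm L2I.nrm_ge0 dom_L2 D)
      have "\<bar>the (t ?d)\<bar> \<le> (T.nrm ?d)\<^sup>2 + \<bar>c\<bar> * (L2_norm ?d)\<^sup>2"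
        using nrm_sq_eq[OF D, of m n] abs_mult[of c "(L2_norm ?d)\<^sup>2"]
          zero_le_power2[of "T.nrm ?d"] abs_of_nonneg[OF zero_le_power2, of "L2_norm ?d"] by linarith
      also have "\<dots> \<le> (T.nrm ?d)\<^sup>2 + \<bar>c\<bar> * (T.nrm ?d)\<^sup>2"
        using L by (intro add_left_mono mult_left_mono) auto
      also have "\<dots> = (T.nrm ?d)\<^sup>2 * (1 + \<bar>c\<bar>)" by (simp add: algebra_simps)
      also have "\<dots> < k\<^sup>2 * (1 + \<bar>c\<bar>)"
        using N[OF mn] D by (intro mult_strict_right_mono power_strict_mono) auto
      finally show "\<bar>the (t ?d)\<bar> < e" using k(2) by simp
    qed
  qed
next
  note D = T.diff_mem[OF assms(1,1)]
  assume T: "\<forall>e>0. \<exists>N. \<forall>m\<ge>N. \<forall>n\<ge>N. \<bar>the (t (\<lambda>x. F m x - F n x))\<bar> < e"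
  show "T.cauchy F"
    unfolding T.cauchy_def
  proof (intro conjI allI impI assms(1))
    fix e :: real assume e: "e > 0"
    define k where "k = sqrt (e\<^sup>2 / 2 / (1 + \<bar>c\<bar>))"
    have "e\<^sup>2 / 2 / (1 + \<bar>c\<bar>) * (1 + \<bar>c\<bar>) = e\<^sup>2 / 2"
      by (rule nonzero_eq_divide_eq[THEN iffD1]) (auto intro: add_pos_nonneg)
    then have k: "k > 0" "k\<^sup>2 * (1 + \<bar>c\<bar>) = e\<^sup>2 / 2" using e unfolding k_def by auto
    obtain N1 where N1: "\<And>m n. m\<ge>N1 \<Longrightarrow> n\<ge>N1 \<Longrightarrow> \<bar>the (t (\<lambda>x. F m x - F n x))\<bar> < e\<^sup>2/2"
      using T e by (meson half_gt_zero zero_less_power)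
    obtain N2 where N2: "\<And>m n. m\<ge>N2 \<Longrightarrow> n\<ge>N2 \<Longrightarrow> L2_norm (\<lambda>x. F m x - F n x) < k"
      using assms(2) k(1) unfolding L2I.cauchy_def by blast
    show "\<exists>N. \<forall>m\<ge>N. \<forall>n\<ge>N. T.nrm (\<lambda>x. F m x - F n x) < e"
    proof (intro exI[of _ "max N1 N2"] allI impI)
      fix m n assume mn: "max N1 N2 \<le> m" "max N1 N2 \<le> n"
      let ?d = "\<lambda>x. F m x - F n x"
      have "(L2_norm ?d)\<^sup>2 \<le> k\<^sup>2"
        using N2[of m n] mn dom_L2[OF D, of m n] by (intro power_mono) (auto simp: less_imp_le)
      then have "c * (L2_norm ?d)\<^sup>2 \<le> (1 + \<bar>c\<bar>) * k\<^sup>2"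
        by (intro mult_mono) auto
      then have "(T.nrm ?d)\<^sup>2 < e\<^sup>2"
        using nrm_sq_eq[OF D, of m n] N1[of m n] mn k(2) by (simp add: algebra_simps)
      then show "T.nrm ?d < e" using e power2_less_imp_less less_imp_le by blast
    qed
  qed
qed

lemma nrm_tendsto_iff:
  assumes "\<And>n. F n \<in> dom t" "(\<lambda>n. L2_norm (F n)) \<longlonglongrightarrow> 0"
  shows "(\<lambda>n. T.nrm (F n)) \<longlonglongrightarrow> 0 \<longleftrightarrow> (\<lambda>n. the (t (F n))) \<longlonglongrightarrow> 0"
proof -
  have eq: "(T.nrm (F n))\<^sup>2 = the (t (F n)) + c * (L2_norm (F n))\<^sup>2" for n
    by (rule nrm_sq_eq[OF assms(1)])
  have c0: "(\<lambda>n. c * (L2_norm (F n))\<^sup>2) \<longlonglongrightarrow> 0"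
    using tendsto_mult_left[OF tendsto_power[OF assms(2), of 2], of c] by simp
  have "(\<lambda>n. T.nrm (F n)) \<longlonglongrightarrow> 0 \<longleftrightarrow> (\<lambda>n. (T.nrm (F n))\<^sup>2) \<longlonglongrightarrow> 0"
  proof
    assume "(\<lambda>n. (T.nrm (F n))\<^sup>2) \<longlonglongrightarrow> 0"
    then have "(\<lambda>n. sqrt ((T.nrm (F n))\<^sup>2)) \<longlonglongrightarrow> sqrt 0" by (rule tendsto_real_sqrt)
    then show "(\<lambda>n. T.nrm (F n)) \<longlonglongrightarrow> 0" using assms(1) by simp
  next
    assume "(\<lambda>n. T.nrm (F n)) \<longlonglongrightarrow> 0"
    from tendsto_power[OF this, of 2] show "(\<lambda>n. (T.nrm (F n))\<^sup>2) \<longlonglongrightarrow> 0" by simp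
  qed
  also have "\<dots> \<longleftrightarrow> (\<lambda>n. the (t (F n))) \<longlonglongrightarrow> 0"
    unfolding eq using tendsto_add[OF _ c0, of "\<lambda>n. the (t (F n))" 0] tendsto_diff[OF _ c0, of "\<lambda>n. the (t (F n)) + c * (L2_norm (F n))\<^sup>2" 0]
    by auto
  finally show ?thesis .
qed

section \<open>Limits and representation of functionals for closed forms\<close>

lemma closedD:
  assumes "closed_form t" "T.cauchy F"
  shows "\<exists>u\<in>dom t. (\<lambda>n. L2_norm (\<lambda>x. F n x - u x)) \<longlonglongrightarrow> 0 \<and> (\<lambda>n. T.nrm (\<lambda>x. F n x - u x)) \<longlonglongrightarrow> 0"
proof -
  note F = T.cauchyD[OF assms(2)]
  obtain u where u: "u \<in> L2" "(\<lambda>n. L2_norm (\<lambda>x. F n x - u x)) \<longlonglongrightarrow> 0"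
    using L2_complete[OF L2_cauchy[OF assms(2)]] by blast
  have "\<forall>e>0. \<exists>N. \<forall>m\<ge>N. \<forall>n\<ge>N. \<bar>the (t (\<lambda>x. F m x - F n x))\<bar> < e"
    using cauchy_iff[OF F L2_cauchy[OF assms(2)]] assms(2) by blast
  then have "u \<in> dom t \<and> (\<lambda>n. the (t (\<lambda>x. F n x - u x))) \<longlonglongrightarrow> 0"
    using assms(1) F u unfolding closed_form_def by blast
  moreover from this have "(\<lambda>n. T.nrm (\<lambda>x. F n x - u x)) \<longlonglongrightarrow> 0"
    using nrm_tendsto_iff[of "\<lambda>n x. F n x - u x"] u(2) F T.diff_mem by blast
  ultimately show ?thesis using u by blast
qed

text \<open>This is surjectivity of A + c for the operator A of a closed form. The functional given
  by v is bounded in the form norm because that norm dominates the L2 norm; its Riesz sequence is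
  Cauchy, and closedness supplies the limit.\<close>

lemma closed_riesz:
  assumes "closed_form t" "v \<in> L2"
  shows "\<exists>u\<in>dom t. \<forall>w\<in>dom t. s u w + of_real c * L2_inner u w = L2_inner v w"
proof -
  have "\<exists>F. T.cauchy F \<and> (\<forall>k\<in>dom t. (\<lambda>n. B (F n) k) \<longlonglongrightarrow> L2_inner v k)"
  proof (rule T.riesz_sequence)
    fix f g a b assume "f \<in> dom t" "g \<in> dom t"
    then show "L2_inner v (\<lambda>x. a * f x + b * g x) = cnj a * L2_inner v f + cnj b * L2_inner v g"
      using L2I.lin_right assms(2) dom_L2 by simp
  next
    fix f assume f: "f \<in> dom t"
    have "cmod (L2_inner v f) \<le> L2_norm v * L2_norm f"
      using L2I.Cauchy_Schwarz assms(2) f dom_L2 by blast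
    also have "\<dots> \<le> L2_norm v * T.nrm f"
      using L2_norm_le_nrm[OF f] assms(2) by (intro mult_left_mono) auto
    finally show "cmod (L2_inner v f) \<le> L2_norm v * T.nrm f" .
  qed
  then obtain F where F: "T.cauchy F" "\<And>k. k\<in>dom t \<Longrightarrow> (\<lambda>n. B (F n) k) \<longlonglongrightarrow> L2_inner v k" by blast
  obtain u where u: "u \<in> dom t" "(\<lambda>n. T.nrm (\<lambda>x. F n x - u x)) \<longlonglongrightarrow> 0"
    using closedD[OF assms(1) F(1)] by blast
  have "B u w = L2_inner v w" if w: "w \<in> dom t" for w
  proof (rule LIMSEQ_unique[OF _ F(2)[OF w]])
    have "(\<lambda>n. T.nrm (\<lambda>x. F n x - u x) * T.nrm w) \<longlonglongrightarrow> 0"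
      using tendsto_mult_left_zero[OF u(2)] .
    then have "(\<lambda>n. B (F n) w - B u w) \<longlonglongrightarrow> 0"
    proof (rule Lim_null_comparison[rotated])
      show "\<forall>\<^sub>F n in sequentially. norm (B (F n) w - B u w) \<le> T.nrm (\<lambda>x. F n x - u x) * T.nrm w"
        using T.Cauchy_Schwarz[OF T.diff_mem[OF T.cauchyD[OF F(1)] u(1)] w] T.cauchyD[OF F(1)] u(1) w
        by (simp add: T.diff_left)
    qed
    then show "(\<lambda>n. B (F n) w) \<longlonglongrightarrow> B u w" by (rule LIM_zero_cancel)
  qed
  then show ?thesis using u(1) unfolding B_def by blast
qed

lemma T_tendsto_nrm:
  assumes "\<And>n. F n \<in> dom t" "u \<in> dom t" "(\<lambda>n. T.nrm (\<lambda>x. F n x - u x)) \<longlonglongrightarrow> 0"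
  shows "(\<lambda>n. T.nrm (F n)) \<longlonglongrightarrow> T.nrm u"
proof -
  have "(\<lambda>n. T.nrm (F n) - T.nrm u) \<longlonglongrightarrow> 0"
    by (rule Lim_null_comparison[OF _ assms(3)]) (use T.nrm_rev_triangle[OF assms(1,2)] in simp)
  then show ?thesis by (rule LIM_zero_cancel)
qed

lemma tendsto_form:
  assumes "\<And>n. F n \<in> dom t" "u \<in> dom t" "(\<lambda>n. T.nrm (\<lambda>x. F n x - u x)) \<longlonglongrightarrow> 0"
  shows "(\<lambda>n. the (t (F n))) \<longlonglongrightarrow> the (t u)"
proof -
  have "(\<lambda>n. L2_norm (\<lambda>x. F n x - u x)) \<longlonglongrightarrow> 0"
  proof (rule Lim_null_comparison[OF _ assms(3)])
    show "\<forall>\<^sub>F n in sequentially. norm (L2_norm (\<lambda>x. F n x - u x)) \<le> T.nrm (\<lambda>x. F n x - u x)"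
      using assms T.diff_mem dom_L2 L2_norm_le_nrm by simp
  qed
  then have "(\<lambda>n. L2_norm (F n) - L2_norm u) \<longlonglongrightarrow> 0"
    by (rule Lim_null_comparison[rotated]) (use L2I.nrm_rev_triangle[OF dom_L2[OF assms(1)] dom_L2[OF assms(2)]] in simp)
  then have 1: "(\<lambda>n. L2_norm (F n)) \<longlonglongrightarrow> L2_norm u" by (rule LIM_zero_cancel)
  have "(\<lambda>n. (T.nrm (F n))\<^sup>2 - c * (L2_norm (F n))\<^sup>2) \<longlonglongrightarrow> (T.nrm u)\<^sup>2 - c * (L2_norm u)\<^sup>2"
    by (intro tendsto_intros T_tendsto_nrm[OF assms] 1)
  then show ?thesis by (simp add: nrm_sq_eq assms)
qed

end

lemma form_data_exists:
  assumes "quadratic_form t" "lower_semibounded t"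
  shows "\<exists>s c. form_data t s c"
proof -
  obtain s where s: "sesquilinear_on (dom t) s" "\<forall>f\<in>dom t. s f f = of_real (the (t f))"
    using assms(1) unfolding quadratic_form_def by blast
  obtain g where g: "\<forall>f \<in> dom t. the (t f) \<ge> g * (L2_norm f)\<^sup>2"
    using assms(2) unfolding lower_semibounded_def by blast
  \<comment> \<open>The shift 1 - g raises the lower bound g to 1.\<close>
  have "form_data t s (1 - g)"
    by standard (use assms(1) s g in \<open>auto simp: algebra_simps\<close>)
  then show ?thesis by blast
qed

section \<open>The closure of a form\<close>

text \<open>\<open>crit\<close> says that the map from the abstract completion of the form domain to
  L2 is injective. The completion can then be realised by L2 functions, which is how
  \<open>cdom\<close> arises.\<close>

locale closable_data = form_data +
  assumes crit: "\<And>F. T.cauchy F \<Longrightarrow> (\<lambda>n. L2_norm (F n)) \<longlonglongrightarrow> 0 \<Longrightarrow> (\<lambda>n. T.nrm (F n)) \<longlonglongrightarrow> 0"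
begin

definition apr where
  "apr u F \<longleftrightarrow> T.cauchy F \<and> u \<in> L2 \<and> (\<lambda>n. L2_norm (\<lambda>x. F n x - u x)) \<longlonglongrightarrow> 0"

definition cdom where "cdom = {u. \<exists>F. apr u F}"

definition app where "app u = (SOME F. apr u F)"

definition cB where "cB u w = lim (\<lambda>n. B (app u n) (app w n))"

lemma aprD: "apr u F \<Longrightarrow> T.cauchy F" "apr u F \<Longrightarrow> u \<in> L2"
  "apr u F \<Longrightarrow> (\<lambda>n. L2_norm (\<lambda>x. F n x - u x)) \<longlonglongrightarrow> 0" "apr u F \<Longrightarrow> F n \<in> dom t"
  "apr u F \<Longrightarrow> F n \<in> L2"
  using T.cauchyD dom_L2 by (auto simp: apr_def)

lemma apr_app: "u \<in> cdom \<Longrightarrow> apr u (app u)"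
  unfolding cdom_def app_def by (simp add: someI_ex)

lemma apr_lin:
  assumes "apr u F" "apr w G" shows "apr (\<lambda>x. a * u x + b * w x) (\<lambda>n x. a * F n x + b * G n x)"
proof -
  let ?U = "\<lambda>n x. F n x - u x" and ?W = "\<lambda>n x. G n x - w x"
  have D: "?U n \<in> L2" "?W n \<in> L2" for n
    using L2I.diff_mem aprD(2,5)[OF assms(1)] aprD(2,5)[OF assms(2)] by simp_all
  have "(\<lambda>n. cmod a * L2_norm (?U n) + cmod b * L2_norm (?W n)) \<longlonglongrightarrow> cmod a * 0 + cmod b * 0"
    by (intro tendsto_intros aprD(3) assms)
  then have "(\<lambda>n. L2_norm (\<lambda>x. a * F n x + b * G n x - (a * u x + b * w x))) \<longlonglongrightarrow> 0"
  proof (rule Lim_null_comparison[rotated, OF tendsto_eq_rhs])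
    have "L2_norm (\<lambda>x. a * F n x + b * G n x - (a * u x + b * w x)) \<le> cmod a * L2_norm (?U n) + cmod b * L2_norm (?W n)" for n
      using L2I.triangle[OF L2I.scale_mem[OF D(1)] L2I.scale_mem[OF D(2)], of a n b n]
        L2I.nrm_scale[OF D(1), of a n] L2I.nrm_scale[OF D(2), of b n] by (simp add: algebra_simps)
    moreover have "0 \<le> L2_norm (\<lambda>x. a * F n x + b * G n x - (a * u x + b * w x))" for n
      by (intro L2I.nrm_ge0 L2I.diff_mem L2I.lin_mem aprD(2,5)[OF assms(1)] aprD(2,5)[OF assms(2)])
    ultimately show "\<forall>\<^sub>F n in sequentially. norm (L2_norm (\<lambda>x. a * F n x + b * G n x - (a * u x + b * w x)))
      \<le> cmod a * L2_norm (?U n) + cmod b * L2_norm (?W n)" by simp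
  qed simp
  then show ?thesis
    unfolding apr_def using T.cauchy_lin[OF aprD(1)[OF assms(1)] aprD(1)[OF assms(2)]]
      L2I.lin_mem[OF aprD(2)[OF assms(1)] aprD(2)[OF assms(2)]] by simp
qed

lemma apr_unique:
  assumes "apr u F" "apr u G" shows "(\<lambda>n. T.nrm (\<lambda>x. F n x - G n x)) \<longlonglongrightarrow> 0"
proof -
  have "apr (\<lambda>x. 1 * u x + (-1) * u x) (\<lambda>n x. 1 * F n x + (-1) * G n x)"
    by (rule apr_lin) fact+
  then have "apr (\<lambda>x. 0) (\<lambda>n x. F n x - G n x)" by simp
  then show ?thesis using aprD(1,3) by (intro crit) fastforce+
qed

text \<open>By \<open>crit\<close>, two approximating sequences of one function differ by a null
  sequence in the form norm, so the limit does not depend on the choice made by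
  \<open>app\<close>.\<close>

lemma cB_lim:
  assumes u: "apr u F" and w: "apr w G" shows "(\<lambda>n. B (F n) (G n)) \<longlonglongrightarrow> cB u w"
proof -
  have uw: "u \<in> cdom" "w \<in> cdom" using assms by (auto simp: cdom_def)
  note au = apr_app[OF uw(1)] and aw = apr_app[OF uw(2)]
  have 1: "(\<lambda>n. B (app u n) (app w n)) \<longlonglongrightarrow> cB u w"
    unfolding cB_def using T.cauchy_pairing_convergent[OF aprD(1)[OF au] aprD(1)[OF aw]]
    by (simp add: convergent_LIMSEQ_iff)
  obtain K where K: "\<And>n. T.nrm (F n) \<le> K" using T.cauchy_bounded[OF aprD(1)[OF u]] by blast
  obtain K' where K': "\<And>n. T.nrm (app w n) \<le> K'" using T.cauchy_bounded[OF aprD(1)[OF aw]] by blast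
  have "(\<lambda>n. K * T.nrm (\<lambda>x. G n x - app w n x) + T.nrm (\<lambda>x. F n x - app u n x) * K') \<longlonglongrightarrow> K * 0 + 0 * K'"
    by (intro tendsto_intros apr_unique[OF w aw] apr_unique[OF u au])
  then have "(\<lambda>n. B (F n) (G n) - B (app u n) (app w n)) \<longlonglongrightarrow> 0"
  proof (rule Lim_null_comparison[rotated, OF tendsto_eq_rhs])
    have "norm (B (F n) (G n) - B (app u n) (app w n))
        \<le> K * T.nrm (\<lambda>x. G n x - app w n x) + T.nrm (\<lambda>x. F n x - app u n x) * K'" for n
    proof -
      note D = aprD(4)[OF u, of n] aprD(4)[OF w, of n] aprD(4)[OF au, of n] aprD(4)[OF aw, of n]
      have eq: "B (F n) (G n) - B (app u n) (app w n)
        = B (F n) (\<lambda>x. G n x - app w n x) + B (\<lambda>x. F n x - app u n x) (app w n)"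
        using D by (simp add: T.diff_left T.diff_right)
      have "norm (B (F n) (G n) - B (app u n) (app w n))
        \<le> T.nrm (F n) * T.nrm (\<lambda>x. G n x - app w n x) + T.nrm (\<lambda>x. F n x - app u n x) * T.nrm (app w n)"
        unfolding eq using D by (intro norm_triangle_le add_mono T.Cauchy_Schwarz T.diff_mem)
      also have "\<dots> \<le> K * T.nrm (\<lambda>x. G n x - app w n x) + T.nrm (\<lambda>x. F n x - app u n x) * K'"
        using D K K' by (intro add_mono mult_left_mono mult_right_mono T.nrm_ge0 T.diff_mem)
      finally show ?thesis .
    qed
    then show "\<forall>\<^sub>F n in sequentially. norm (B (F n) (G n) - B (app u n) (app w n))
        \<le> K * T.nrm (\<lambda>x. G n x - app w n x) + T.nrm (\<lambda>x. F n x - app u n x) * K'" by simp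
  qed simp
  from tendsto_add[OF this 1] show ?thesis by simp
qed

lemma apr_const: "f \<in> dom t \<Longrightarrow> apr f (\<lambda>_. f)"
  using T.cauchy_const dom_L2 by (simp add: apr_def L2_norm_def)

lemma dom_cdom: "dom t \<subseteq> cdom"
  using apr_const by (auto simp: cdom_def)

lemma cB_eq: "f \<in> dom t \<Longrightarrow> g \<in> dom t \<Longrightarrow> cB f g = B f g"
  using cB_lim[OF apr_const apr_const] by (simp add: LIMSEQ_const_iff)

lemma cdom_L2: "u \<in> cdom \<Longrightarrow> u \<in> L2"
  using apr_app aprD(2) by blast

lemma cB_sesq: "sesquilinear_on cdom cB"
  unfolding sesquilinear_on_def
proof (intro ballI allI conjI)
  fix f g h a b assume fgh: "f \<in> cdom" "g \<in> cdom" "h \<in> cdom"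
  note ap = fgh[THEN apr_app]
  note D = ap[THEN aprD(4)]
  have "(\<lambda>n. a * B (app f n) (app h n) + b * B (app g n) (app h n)) \<longlonglongrightarrow> a * cB f h + b * cB g h"
    by (intro tendsto_intros cB_lim ap)
  moreover have "(\<lambda>n. B (\<lambda>x. a * app f n x + b * app g n x) (app h n)) \<longlonglongrightarrow> cB (\<lambda>x. a * f x + b * g x) h"
    by (intro cB_lim apr_lin ap)
  ultimately show "cB (\<lambda>x. a * f x + b * g x) h = a * cB f h + b * cB g h"
    using D by (simp add: T.lin_left LIMSEQ_unique)
  have "(\<lambda>n. cnj a * B (app h n) (app f n) + cnj b * B (app h n) (app g n)) \<longlonglongrightarrow> cnj a * cB h f + cnj b * cB h g"
    by (intro tendsto_intros cB_lim ap)
  moreover have "(\<lambda>n. B (app h n) (\<lambda>x. a * app f n x + b * app g n x)) \<longlonglongrightarrow> cB h (\<lambda>x. a * f x + b * g x)"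
    by (intro cB_lim apr_lin ap)
  ultimately show "cB h (\<lambda>x. a * f x + b * g x) = cnj a * cB h f + cnj b * cB h g"
    using D by (simp add: T.lin_right LIMSEQ_unique)
qed

lemma cB_bound:
  assumes u: "u \<in> cdom" shows "Im (cB u u) = 0 \<and> (L2_norm u)\<^sup>2 \<le> Re (cB u u)"
proof -
  note ap = apr_app[OF u]
  have 1: "(\<lambda>n. B (app u n) (app u n)) \<longlonglongrightarrow> cB u u" by (intro cB_lim ap)
  have "(\<lambda>n. Im (B (app u n) (app u n))) \<longlonglongrightarrow> Im (cB u u)" by (intro tendsto_intros 1)
  then have I: "Im (cB u u) = 0" using T.pos[OF aprD(4)[OF ap]] by (simp add: LIMSEQ_const_iff)
  have "(\<lambda>n. L2_norm (app u n) - L2_norm u) \<longlonglongrightarrow> 0"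
    by (rule Lim_null_comparison[OF _ aprD(3)[OF ap]])
      (use L2I.nrm_rev_triangle[OF aprD(5)[OF ap] aprD(2)[OF ap]] in simp)
  then have "(\<lambda>n. (L2_norm (app u n))\<^sup>2) \<longlonglongrightarrow> (L2_norm u)\<^sup>2"
    by (rule tendsto_power[OF LIM_zero_cancel])
  moreover have "(\<lambda>n. Re (B (app u n) (app u n))) \<longlonglongrightarrow> Re (cB u u)" by (intro tendsto_intros 1)
  moreover have "(L2_norm (app u n))\<^sup>2 \<le> Re (B (app u n) (app u n))" for n
    using L2_norm_le_nrm[OF aprD(4)[OF ap, of n]] aprD(4,5)[OF ap, of n]
    by (simp add: T.nrm_sq[symmetric] power_mono)
  ultimately show ?thesis using I LIMSEQ_le by blast
qed

sublocale C: semi_inner cdom cB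
proof
  show "(\<lambda>_. 0) \<in> cdom" using dom_cdom T.zero_mem by blast
  show "(\<lambda>x. a * f x + b * g x) \<in> cdom" if "f \<in> cdom" "g \<in> cdom" for f g a b
    using apr_lin[OF apr_app[OF that(1)] apr_app[OF that(2)]] by (auto simp: cdom_def)
  show "sesquilinear_on cdom cB" by (rule cB_sesq)
  show "Im (cB f f) = 0 \<and> 0 \<le> Re (cB f f)" if "f \<in> cdom" for f
    using cB_bound[OF that] order_trans[OF zero_le_power2] by blast
qed

lemma nrm_cdom: "f \<in> dom t \<Longrightarrow> C.nrm f = T.nrm f"
  by (simp add: C.nrm_def T.nrm_def cB_eq)

lemma L2_norm_le_C: "u \<in> cdom \<Longrightarrow> L2_norm u \<le> C.nrm u"
  using cB_bound[of u] C.nrm_ge0[of u] by (rule_tac power2_le_imp_le) (auto simp: C.nrm_sq)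

text \<open>In the Cauchy estimate for F n - F m, n is fixed and m tends to infinity, which turns it
  into an estimate for F n - u. Thus the original domain is dense in the closure for the norm of the
  latter.\<close>

lemma apr_C:
  assumes "apr u F" shows "(\<lambda>n. C.nrm (\<lambda>x. F n x - u x)) \<longlonglongrightarrow> 0"
proof (rule LIMSEQ_I)
  fix e :: real assume e: "e > 0"
  obtain N where N: "\<And>m n. m\<ge>N \<Longrightarrow> n\<ge>N \<Longrightarrow> T.nrm (\<lambda>x. F m x - F n x) < e/2"
    using aprD(1)[OF assms] e unfolding T.cauchy_def by (meson half_gt_zero)
  have ucd: "u \<in> cdom" using assms by (auto simp: cdom_def)
  have Fcd: "F n \<in> cdom" for n using dom_cdom aprD(4)[OF assms] by blast
  show "\<exists>no. \<forall>n\<ge>no. norm (C.nrm (\<lambda>x. F n x - u x) - 0) < e"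
  proof (intro exI[of _ N] allI impI)
    fix n assume n: "n \<ge> N"
    have "apr (\<lambda>x. 1 * F n x + (-1) * u x) (\<lambda>m x. 1 * F n x + (-1) * F m x)"
      using apr_lin[OF apr_const[OF aprD(4)[OF assms, of n]] assms] .
    then have ap: "apr (\<lambda>x. F n x - u x) (\<lambda>m x. F n x - F m x)" by simp
    let ?d = "\<lambda>x. F n x - u x"
    have "(\<lambda>m. Re (B (\<lambda>x. F n x - F m x) (\<lambda>x. F n x - F m x))) \<longlonglongrightarrow> Re (cB ?d ?d)"
      by (intro tendsto_intros cB_lim ap)
    moreover have "Re (B (\<lambda>x. F n x - F m x) (\<lambda>x. F n x - F m x)) \<le> (e/2)\<^sup>2" if "m \<ge> N" for m
    proof -
      have D: "(\<lambda>x. F n x - F m x) \<in> dom t" using aprD(4)[OF assms] T.diff_mem by blast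
      show ?thesis unfolding T.nrm_sq[OF D, symmetric]
        using N[OF n that] D by (intro power_mono) auto
    qed
    ultimately have "Re (cB ?d ?d) \<le> (e/2)\<^sup>2"
      by (intro LIMSEQ_le_const2) auto
    then have "C.nrm ?d \<le> e/2"
      unfolding C.nrm_sq[OF C.diff_mem[OF Fcd ucd], symmetric] using e power2_le_imp_le by fastforce
    then show "norm (C.nrm ?d - 0) < e"
      using e C.nrm_ge0[OF C.diff_mem[OF Fcd ucd], of n] by simp
  qed
qed

definition closure_of_form where
  "closure_of_form u = (if u \<in> cdom then Some (Re (cB u u) - c * (L2_norm u)\<^sup>2) else None)"

lemma dom_closure: "dom closure_of_form = cdom"
  by (auto simp: closure_of_form_def dom_def)

lemma closure_quadratic: "quadratic_form closure_of_form"
  unfolding quadratic_form_def dom_closure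
proof (intro conjI ballI allI impI)
  show "cdom \<subseteq> L2" using cdom_L2 by blast
  show "(\<lambda>_. 0) \<in> cdom" by (rule C.zero_mem)
  show "(\<lambda>x. a * f x + b * g x) \<in> cdom" if "f \<in> cdom" "g \<in> cdom" for f g a b
    using that by (rule C.lin_mem)
  show "closure_of_form g = closure_of_form f" if f: "f \<in> cdom" and g: "g \<in> L2" and fg: "AE x in lborel. f x = g x" for f g
  proof -
    note ap = apr_app[OF f]
    have "L2_norm (\<lambda>x. app f n x - g x) = L2_norm (\<lambda>x. app f n x - f x)" for n
      using ap aprD g fg by (intro L2_norm_cong_AE L2I.diff_mem) auto
    then have ag: "apr g (app f)" using ap g unfolding apr_def by simp
    then have "g \<in> cdom" by (auto simp: cdom_def)
    moreover have "cB g g = cB f f"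
      using LIMSEQ_unique[OF cB_lim[OF ag ag] cB_lim[OF ap ap]] .
    moreover have "L2_norm g = L2_norm f"
      using L2_norm_cong_AE[OF cdom_L2[OF f] g fg] by simp
    ultimately show ?thesis using f by (simp add: closure_of_form_def)
  qed
  have "sesquilinear_on cdom (\<lambda>f g. cB f g - of_real c * L2_inner f g)"
    using cB_sesq cdom_L2 unfolding sesquilinear_on_def
    by (simp add: L2I.lin_left L2I.lin_right algebra_simps)
  moreover have "cB f f - of_real c * L2_inner f f = of_real (the (closure_of_form f))" if "f \<in> cdom" for f
    using that C.pos[OF that]
    by (simp add: closure_of_form_def L2_inner_self cdom_L2 complex_eq_iff del: of_real_power)
  ultimately show "\<exists>s. sesquilinear_on cdom s \<and> (\<forall>f\<in>cdom. s f f = of_real (the (closure_of_form f)))"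
    by blast
qed

lemma closure_form_data: "form_data closure_of_form (\<lambda>f g. cB f g - of_real c * L2_inner f g) c"
proof
  show "quadratic_form closure_of_form" by (rule closure_quadratic)
  show "sesquilinear_on (dom closure_of_form) (\<lambda>f g. cB f g - of_real c * L2_inner f g)"
    using cB_sesq cdom_L2 unfolding sesquilinear_on_def dom_closure
    by (simp add: L2I.lin_left L2I.lin_right algebra_simps)
  fix f assume "f \<in> dom closure_of_form"
  then have f: "f \<in> cdom" by (simp add: dom_closure)
  show "cB f f - of_real c * L2_inner f f = of_real (the (closure_of_form f))"
    using f C.pos[OF f]
    by (simp add: closure_of_form_def L2_inner_self cdom_L2 complex_eq_iff del: of_real_power)
  show "(L2_norm f)\<^sup>2 \<le> the (closure_of_form f) + c * (L2_norm f)\<^sup>2"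
    using cB_bound[OF f] f by (simp add: closure_of_form_def)
qed

lemma closure_nrm: "semi_inner.nrm (form_data.B (\<lambda>f g. cB f g - of_real c * L2_inner f g) c) = C.nrm"
proof -
  interpret CF: form_data closure_of_form "\<lambda>f g. cB f g - of_real c * L2_inner f g" c
    by (rule closure_form_data)
  show ?thesis unfolding CF.T.nrm_def C.nrm_def by (simp add: CF.B_def)
qed

lemma closure_extends: "t \<subseteq>\<^sub>m closure_of_form"
  unfolding map_le_def
proof
  fix f assume f: "f \<in> dom t"
  have "Re (cB f f) - c * (L2_norm f)\<^sup>2 = the (t f)" using f by (simp add: cB_eq B_self)
  then show "t f = closure_of_form f"
    using f dom_cdom by (auto simp: closure_of_form_def)
qed

text \<open>A Cauchy sequence in the closure is shadowed by a sequence G in the original domain with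
  errors 1/(n+1). G is Cauchy there and has the same L2 limit u, so u lies in \<open>cdom\<close> by
  construction.\<close>

lemma closure_closed: "closed_form closure_of_form"
  unfolding closed_form_def
proof (intro conjI allI impI closure_quadratic)
  interpret CF: form_data closure_of_form "\<lambda>f g. cB f g - of_real c * L2_inner f g" c
    by (rule closure_form_data)
  note nrm_eq = closure_nrm
  show "lower_semibounded closure_of_form"
    unfolding lower_semibounded_def using CF.bound
    by (intro exI[of _ "1 - c"]) (auto simp: algebra_simps)
  fix F u
  assume "(\<forall>n. F n \<in> dom closure_of_form) \<and> u \<in> L2 \<and> (\<lambda>n. L2_norm (\<lambda>x. F n x - u x)) \<longlonglongrightarrow> 0 \<and>
    (\<forall>e>0. \<exists>N. \<forall>m\<ge>N. \<forall>n\<ge>N. \<bar>the (closure_of_form (\<lambda>x. F m x - F n x))\<bar> < e)"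
  then have F: "\<And>n. F n \<in> cdom" and u: "u \<in> L2" and lim: "(\<lambda>n. L2_norm (\<lambda>x. F n x - u x)) \<longlonglongrightarrow> 0"
    and ca: "\<forall>e>0. \<exists>N. \<forall>m\<ge>N. \<forall>n\<ge>N. \<bar>the (closure_of_form (\<lambda>x. F m x - F n x))\<bar> < e"
    by (auto simp: dom_closure)
  have "L2I.cauchy F" using L2_convergent_cauchy[OF cdom_L2[OF F] u lim] .
  then have "CF.T.cauchy F"
    using CF.cauchy_iff[of F] F ca by (simp add: dom_closure)
  then have CC: "C.cauchy F"
    unfolding CF.T.cauchy_def unfolding C.cauchy_def nrm_eq dom_closure .
  have "\<exists>G. G \<in> dom t \<and> C.nrm (\<lambda>x. G x - F n x) < 1 / Suc n" for n
  proof -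
    have "\<forall>\<^sub>F k in sequentially. C.nrm (\<lambda>x. app (F n) k x - F n x) < 1 / Suc n"
      using apr_C[OF apr_app[OF F[of n]]] by (intro order_tendstoD) auto
    then show ?thesis using aprD(4)[OF apr_app[OF F[of n]]] unfolding eventually_sequentially by blast
  qed
  then obtain G where G: "\<And>n. G n \<in> dom t" "\<And>n. C.nrm (\<lambda>x. G n x - F n x) < 1 / Suc n" by metis
  have Gc: "G n \<in> cdom" for n using G dom_cdom by blast
  have G0: "(\<lambda>n. C.nrm (\<lambda>x. G n x - F n x)) \<longlonglongrightarrow> 0"
  proof (rule Lim_null_comparison)
    show "\<forall>\<^sub>F n in sequentially. norm (C.nrm (\<lambda>x. G n x - F n x)) \<le> 1 / Suc n"
      using G(2) Gc F C.diff_mem by (simp add: less_imp_le)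
    show "(\<lambda>n. 1 / real (Suc n)) \<longlonglongrightarrow> 0"
      using LIMSEQ_inverse_real_of_nat by (simp add: inverse_eq_divide)
  qed
  have apG: "apr u G"
    unfolding apr_def
  proof (intro conjI u)
    have "(\<lambda>n. C.nrm (\<lambda>x. G n x - F n x) + L2_norm (\<lambda>x. F n x - u x)) \<longlonglongrightarrow> 0"
      using tendsto_add[OF G0 lim] by simp
    then show "(\<lambda>n. L2_norm (\<lambda>x. G n x - u x)) \<longlonglongrightarrow> 0"
    proof (rule Lim_null_comparison[rotated])
      have "norm (L2_norm (\<lambda>x. G n x - u x)) \<le> C.nrm (\<lambda>x. G n x - F n x) + L2_norm (\<lambda>x. F n x - u x)" for n
        using L2I.triangle_diff[OF cdom_L2[OF Gc] cdom_L2[OF F] u, of n n]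
          L2_norm_le_C[OF C.diff_mem[OF Gc F], of n n] L2I.nrm_ge0[OF L2I.diff_mem[OF cdom_L2[OF Gc] u], of n] by simp
      then show "\<forall>\<^sub>F n in sequentially. norm (L2_norm (\<lambda>x. G n x - u x))
          \<le> C.nrm (\<lambda>x. G n x - F n x) + L2_norm (\<lambda>x. F n x - u x)" by simp
    qed
    show "T.cauchy G"
      unfolding T.cauchy_def
    proof (intro conjI allI impI G(1))
      fix e :: real assume e: "e > 0"
      obtain N1 where N1: "\<And>m n. m\<ge>N1 \<Longrightarrow> n\<ge>N1 \<Longrightarrow> C.nrm (\<lambda>x. F m x - F n x) < e/3"
        using CC e unfolding C.cauchy_def by (metis zero_less_divide_iff zero_less_numeral)
      have "\<forall>\<^sub>F n in sequentially. C.nrm (\<lambda>x. G n x - F n x) < e/3"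
        using G0 e by (intro order_tendstoD) auto
      then obtain N2 where N2: "\<And>n. n\<ge>N2 \<Longrightarrow> C.nrm (\<lambda>x. G n x - F n x) < e/3"
        unfolding eventually_sequentially by blast
      show "\<exists>N. \<forall>m\<ge>N. \<forall>n\<ge>N. T.nrm (\<lambda>x. G m x - G n x) < e"
      proof (intro exI[of _ "max N1 N2"] allI impI)
        fix m n assume mn: "max N1 N2 \<le> m" "max N1 N2 \<le> n"
        have "T.nrm (\<lambda>x. G m x - G n x) = C.nrm (\<lambda>x. G m x - G n x)"
          using G T.diff_mem by (simp add: nrm_cdom)
        also have "\<dots> \<le> C.nrm (\<lambda>x. G m x - F m x) + (C.nrm (\<lambda>x. F m x - F n x) + C.nrm (\<lambda>x. G n x - F n x))"
          using C.triangle_diff[OF Gc[of m] F[of m] Gc[of n]] C.triangle_diff[OF F[of m] F[of n] Gc[of n]]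
            C.nrm_sym[OF Gc[of n] F[of n]] by simp
        also have "\<dots> < e" using N1[of m n] N2[of m] N2[of n] mn by simp
        finally show "T.nrm (\<lambda>x. G m x - G n x) < e" .
      qed
    qed
  qed
  then show uc: "u \<in> dom closure_of_form" by (auto simp: dom_closure cdom_def)
  then have ucd: "u \<in> cdom" by (simp add: dom_closure)
  have "(\<lambda>n. C.nrm (\<lambda>x. G n x - F n x) + C.nrm (\<lambda>x. G n x - u x)) \<longlonglongrightarrow> 0"
    using tendsto_add[OF G0 apr_C[OF apG]] by simp
  then have "(\<lambda>n. C.nrm (\<lambda>x. F n x - u x)) \<longlonglongrightarrow> 0"
  proof (rule Lim_null_comparison[rotated])
    have "norm (C.nrm (\<lambda>x. F n x - u x)) \<le> C.nrm (\<lambda>x. G n x - F n x) + C.nrm (\<lambda>x. G n x - u x)" for n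
      using C.triangle_diff[OF F Gc ucd, of n n] C.nrm_sym[OF Gc F, of n n]
        C.nrm_ge0[OF C.diff_mem[OF F ucd], of n] by simp
    then show "\<forall>\<^sub>F n in sequentially. norm (C.nrm (\<lambda>x. F n x - u x)) \<le> C.nrm (\<lambda>x. G n x - F n x) + C.nrm (\<lambda>x. G n x - u x)"
      by simp
  qed
  then show "(\<lambda>n. the (closure_of_form (\<lambda>x. F n x - u x))) \<longlonglongrightarrow> 0"
    using CF.nrm_tendsto_iff[of "\<lambda>n x. F n x - u x"] lim C.diff_mem[OF F ucd]
    unfolding nrm_eq dom_closure by blast
qed

text \<open>A closed extension r contains u because it contains the approximating sequence, and both
  forms are continuous along that sequence. The lower bound of r may differ from that of t, so r
  gets form data of its own.\<close>

lemma closure_minimal: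
  assumes r: "closed_form r" and tr: "t \<subseteq>\<^sub>m r" shows "closure_of_form \<subseteq>\<^sub>m r"
  unfolding map_le_def dom_closure
proof
  fix u assume u: "u \<in> cdom"
  interpret CF: form_data closure_of_form "\<lambda>f g. cB f g - of_real c * L2_inner f g" c
    by (rule closure_form_data)
  obtain sr cr where "form_data r sr cr"
    using form_data_exists r unfolding closed_form_def by blast
  then interpret R: form_data r sr cr .
  let ?F = "app u"
  note ap = apr_app[OF u]
  have eq: "r f = t f" if "f \<in> dom t" for f using tr that unfolding map_le_def by simp
  have Fr: "?F n \<in> dom r" for n using aprD(4)[OF ap, of n] eq by (simp add: dom_def)
  have "\<forall>e>0. \<exists>N. \<forall>m\<ge>N. \<forall>n\<ge>N. \<bar>the (t (\<lambda>x. ?F m x - ?F n x))\<bar> < e"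
    using cauchy_iff[OF aprD(4)[OF ap] L2_cauchy[OF aprD(1)[OF ap]]] aprD(1)[OF ap] by blast
  then have Tca: "\<forall>e>0. \<exists>N. \<forall>m\<ge>N. \<forall>n\<ge>N. \<bar>the (r (\<lambda>x. ?F m x - ?F n x))\<bar> < e"
    using eq T.diff_mem[OF aprD(4)[OF ap] aprD(4)[OF ap]] by simp
  then have 1: "u \<in> dom r" "(\<lambda>n. the (r (\<lambda>x. ?F n x - u x))) \<longlonglongrightarrow> 0"
    using r Fr aprD(2,3)[OF ap] unfolding closed_form_def by blast+
  then have "(\<lambda>n. R.T.nrm (\<lambda>x. ?F n x - u x)) \<longlonglongrightarrow> 0"
    using R.nrm_tendsto_iff[of "\<lambda>n x. ?F n x - u x"] aprD(3)[OF ap] R.T.diff_mem[OF Fr 1(1)] by blast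
  then have "(\<lambda>n. the (r (?F n))) \<longlonglongrightarrow> the (r u)"
    by (intro R.tendsto_form Fr 1)
  moreover have "(\<lambda>n. the (closure_of_form (?F n))) \<longlonglongrightarrow> the (closure_of_form u)"
    using apr_C[OF ap] aprD(4)[OF ap] dom_cdom u
    by (intro CF.tendsto_form) (auto simp: dom_closure closure_nrm)
  moreover have "the (closure_of_form (?F n)) = the (r (?F n))" for n
    using closure_extends aprD(4)[OF ap, of n] eq by (simp add: map_le_def)
  ultimately have "the (r u) = the (closure_of_form u)" using LIMSEQ_unique by fastforce
  then show "closure_of_form u = r u"
    using 1(1) u by (auto simp: closure_of_form_def dom_def)
qed

lemma closable: "closable t"
  using closure_closed closure_extends unfolding closable_def by blast

lemma form_closure_eq: "form_closure t = closure_of_form"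
  unfolding form_closure_def
proof (rule the_equality)
  show "closed_form closure_of_form \<and> t \<subseteq>\<^sub>m closure_of_form \<and> (\<forall>r. closed_form r \<and> t \<subseteq>\<^sub>m r \<longrightarrow> closure_of_form \<subseteq>\<^sub>m r)"
    using closure_closed closure_extends closure_minimal by blast
  show "s = closure_of_form"
    if "closed_form s \<and> t \<subseteq>\<^sub>m s \<and> (\<forall>r. closed_form r \<and> t \<subseteq>\<^sub>m r \<longrightarrow> s \<subseteq>\<^sub>m r)" for s
    using that closure_closed closure_extends closure_minimal map_le_antisym by blast
qed

end

section \<open>Jordan and Hahn decompositions\<close>

lemma bounded_borel_Diff: "B \<in> bounded_borel \<Longrightarrow> A \<in> bounded_borel \<Longrightarrow> B - A \<in> bounded_borel"
  by (auto simp: bounded_borel_def intro: bounded_subset)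

lemma bounded_borel_Int: "B \<in> bounded_borel \<Longrightarrow> A \<in> sets borel \<Longrightarrow> B \<inter> A \<in> bounded_borel"
  by (auto simp: bounded_borel_def intro: bounded_subset)

lemma bounded_borel_ivl [simp]: "{a..<b} \<in> bounded_borel" "{a..b} \<in> bounded_borel" "{a<..<b} \<in> bounded_borel"
  "{a<..b} \<in> bounded_borel"
  by (auto simp: bounded_borel_def intro: bounded_subset[OF bounded_closed_interval[of a b]])

lemma loc_measure_Diff:
  assumes "loc_measure \<mu>" "B \<in> bounded_borel" "A \<in> bounded_borel" "A \<subseteq> B"
  shows "\<mu> (B - A) = \<mu> B - \<mu> A"
proof -
  have "\<mu> (A \<union> (B - A)) = \<mu> A + \<mu> (B - A)"
    using assms by (intro loc_measure_Un bounded_borel_Diff) auto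
  moreover have "A \<union> (B - A) = B" using assms by auto
  ultimately show ?thesis by simp
qed

lemma loc_measure_uminus: "loc_measure \<mu> \<Longrightarrow> loc_measure (\<lambda>B. - \<mu> B)"
  unfolding loc_measure_def by (auto intro: sums_minus)

text \<open>A set of unbounded variation would split off infinitely many disjoint pieces of
  measure at least 1, contradicting the convergence of the series of their measures.\<close>

lemma loc_measure_bounded:
  fixes \<mu> :: "real set \<Rightarrow> real"
  assumes \<mu>: "loc_measure \<mu>" and B: "B \<in> bounded_borel"
  shows "\<exists>C. \<forall>A\<in>bounded_borel. A \<subseteq> B \<longrightarrow> \<bar>\<mu> A\<bar> \<le> C"
proof (rule ccontr)
  define bad where "bad X \<longleftrightarrow> X \<in> bounded_borel \<and> (\<forall>C. \<exists>A\<in>bounded_borel. A \<subseteq> X \<and> \<bar>\<mu> A\<bar> > C)" for X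
  assume "\<not> ?thesis"
  then have "bad B" using B by (auto simp: bad_def not_le)
  have step: "\<exists>Y. bad Y \<and> Y \<subseteq> X \<and> \<bar>\<mu> (X - Y)\<bar> \<ge> 1" if X: "bad X" for X
  proof -
    \<comment> \<open>The excess over \<open>\<bar>\<mu> X\<bar> + 1\<close> makes both A and X - A
      of measure at least 1 in absolute value, so whichever of them stays bad, the other can be
      split off.\<close>
    obtain A where A: "A \<in> bounded_borel" "A \<subseteq> X" "\<bar>\<mu> A\<bar> > \<bar>\<mu> X\<bar> + 1"
      using X unfolding bad_def by blast
    have XA: "X - A \<in> bounded_borel" using A X bounded_borel_Diff unfolding bad_def by blast
    have d: "\<mu> (X - A) = \<mu> X - \<mu> A" using A X loc_measure_Diff[OF \<mu>] unfolding bad_def by blast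
    have "bad A \<or> bad (X - A)"
    proof (rule ccontr)
      assume "\<not> ?thesis"
      then obtain C1 C2 where C: "\<And>Z. Z \<in> bounded_borel \<Longrightarrow> Z \<subseteq> A \<Longrightarrow> \<bar>\<mu> Z\<bar> \<le> C1"
        "\<And>Z. Z \<in> bounded_borel \<Longrightarrow> Z \<subseteq> X - A \<Longrightarrow> \<bar>\<mu> Z\<bar> \<le> C2"
        using A(1) XA unfolding bad_def by (meson not_le)
      obtain Z where Z: "Z \<in> bounded_borel" "Z \<subseteq> X" "\<bar>\<mu> Z\<bar> > C1 + C2"
        using X unfolding bad_def by blast
      have ZA: "Z \<inter> A \<in> bounded_borel" "Z - A \<in> bounded_borel"
        using Z(1) A(1) bounded_borel_Int bounded_borel_Diff by (auto simp: bounded_borel_def)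
      have "\<mu> ((Z \<inter> A) \<union> (Z - A)) = \<mu> (Z \<inter> A) + \<mu> (Z - A)"
        by (intro loc_measure_Un \<mu> ZA) auto
      moreover have "(Z \<inter> A) \<union> (Z - A) = Z" by auto
      ultimately have "\<mu> Z = \<mu> (Z \<inter> A) + \<mu> (Z - A)" by simp
      then show False using C(1)[OF ZA(1)] C(2)[OF ZA(2)] Z(2,3) by fastforce
    qed
    then show ?thesis
    proof
      assume "bad A" then show ?thesis using A d by (intro exI[of _ A]) auto
    next
      assume "bad (X - A)"
      moreover have "X - (X - A) = A" using A by auto
      ultimately show ?thesis using A by (intro exI[of _ "X - A"]) auto
    qed
  qed
  obtain nx where nx: "\<And>X. bad X \<Longrightarrow> bad (nx X) \<and> nx X \<subseteq> X \<and> \<bar>\<mu> (X - nx X)\<bar> \<ge> 1"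
    using step by metis
  define Y where "Y n = (nx ^^ n) B" for n
  have bY: "bad (Y n)" for n by (induction n) (use \<open>bad B\<close> nx in \<open>auto simp: Y_def\<close>)
  have Y: "bad (Y n)" "Y (Suc n) \<subseteq> Y n" "\<bar>\<mu> (Y n - Y (Suc n))\<bar> \<ge> 1" "Y 0 = B" for n
    using nx[OF bY, of n] bY[of n] unfolding Y_def by simp_all
  let ?D = "\<lambda>n. Y n - Y (Suc n)"
  have dec: "Y n \<subseteq> Y m" if "m \<le> n" for m n
    using lift_Suc_antimono_le[of Y, OF Y(2) that] .
  have "disjoint_family ?D"
    unfolding disjoint_family_on_def
  proof (intro ballI impI)
    fix m n :: nat assume "m \<noteq> n"
    then show "?D m \<inter> ?D n = {}"
      using dec[of "Suc m" n] dec[of "Suc n" m] by (cases m n rule: linorder_cases) auto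
  qed
  moreover have "range ?D \<subseteq> bounded_borel"
    using Y(1) bounded_borel_Diff unfolding bad_def by blast
  moreover have "bounded (\<Union>i. ?D i)"
  proof (rule bounded_subset)
    show "bounded B" using B by (simp add: bounded_borel_def)
    show "(\<Union>i. ?D i) \<subseteq> B" using dec[of 0] unfolding Y(4) by blast
  qed
  ultimately have "(\<lambda>i. \<mu> (?D i)) sums \<mu> (\<Union>i. ?D i)"
    using \<mu> unfolding loc_measure_def by blast
  then have "(\<lambda>i. \<mu> (?D i)) \<longlonglongrightarrow> 0"
    using sums_summable summable_LIMSEQ_zero by blast
  then have "\<forall>\<^sub>F i in sequentially. \<bar>\<mu> (?D i)\<bar> < 1"
    by (intro order_tendstoD(2)[of _ 0] tendsto_rabs_zero) simp_all
  then obtain n where "\<bar>\<mu> (?D n)\<bar> < 1"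
    unfolding eventually_sequentially by blast
  then show False using Y(3)[of n] by linarith
qed

lemma space_pos_part [simp]: "space (pos_part \<mu>) = UNIV"
  using sets_eq_imp_space_eq[OF sets_pos_part[of \<mu>]] by simp

lemma space_neg_part [simp]: "space (neg_part \<mu>) = UNIV"
  by (simp add: neg_part_def)

lemma space_variation [simp]: "space (variation \<mu>) = UNIV"
  using sets_eq_imp_space_eq[OF sets_variation[of \<mu>]] by simp

lemma pos_part_finite:
  assumes "loc_measure \<mu>" "B \<in> bounded_borel" shows "emeasure (pos_part \<mu>) B < \<infinity>"
proof -
  obtain C where "\<forall>A\<in>bounded_borel. A \<subseteq> B \<longrightarrow> \<bar>\<mu> A\<bar> \<le> C"
    using loc_measure_bounded[OF assms] by blast
  then have "emeasure (pos_part \<mu>) B \<le> ennreal C"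
    using assms(2) unfolding emeasure_pos_part[OF assms(1), of B, OF assms(2)[unfolded bounded_borel_def, simplified, THEN conjunct1]]
    by (intro SUP_least ennreal_leI) (auto simp: abs_le_iff)
  then show ?thesis by (simp add: le_less_trans)
qed

lemma neg_part_finite: "loc_measure \<mu> \<Longrightarrow> B \<in> bounded_borel \<Longrightarrow> emeasure (neg_part \<mu>) B < \<infinity>"
  unfolding neg_part_def by (intro pos_part_finite loc_measure_uminus)

lemma pos_part_ge:
  assumes "loc_measure \<mu>" "B \<in> bounded_borel" shows "\<mu> B \<le> measure (pos_part \<mu>) B"
proof -
  have Bb: "B \<in> sets borel" using assms(2) by (simp add: bounded_borel_def)
  have "ennreal (\<mu> B) \<le> emeasure (pos_part \<mu>) B"
    unfolding emeasure_pos_part[OF assms(1) Bb] using assms(2) by (intro SUP_upper) auto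
  also have "\<dots> = ennreal (measure (pos_part \<mu>) B)"
    using pos_part_finite[OF assms] by (simp add: emeasure_eq_ennreal_measure less_top)
  finally show ?thesis by simp
qed

text \<open>For A inside B, \<open>\<mu> A\<close> is \<open>\<mu> B\<close> minus the measure of B
  - A, and the latter is at least minus the negative part of B. The supremum over A gives the bound;
  finiteness comes from \<open>loc_measure_bounded\<close>.\<close>

lemma pos_part_le:
  assumes \<mu>: "loc_measure \<mu>" and B: "B \<in> bounded_borel"
  shows "measure (pos_part \<mu>) B \<le> \<mu> B + measure (neg_part \<mu>) B"
proof -
  have Bb: "B \<in> sets borel" using B by (simp add: bounded_borel_def)
  have le: "\<mu> A \<le> \<mu> B + measure (neg_part \<mu>) B" if A: "A \<in> bounded_borel" "A \<subseteq> B" for A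
  proof -
    have "- \<mu> (B - A) \<le> measure (neg_part \<mu>) (B - A)"
      unfolding neg_part_def using pos_part_ge[OF loc_measure_uminus[OF \<mu>] bounded_borel_Diff[OF B A(1)]] .
    also have "\<dots> \<le> measure (neg_part \<mu>) B"
      using neg_part_finite[OF \<mu> B] Bb A by (intro measure_mono_fmeasurable fmeasurableI)
        (auto simp: bounded_borel_def)
    finally show ?thesis using loc_measure_Diff[OF \<mu> B A] by simp
  qed
  have "ennreal (measure (pos_part \<mu>) B) = emeasure (pos_part \<mu>) B"
    using pos_part_finite[OF assms] by (simp add: emeasure_eq_ennreal_measure less_top)
  also have "\<dots> \<le> ennreal (\<mu> B + measure (neg_part \<mu>) B)"
    unfolding emeasure_pos_part[OF \<mu> Bb] using le by (intro SUP_least ennreal_leI) auto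
  finally show ?thesis
    using le[of "{}"] loc_measure_empty[OF \<mu>] by (simp add: ennreal_le_iff)
qed

text \<open>One inequality is \<open>pos_part_le\<close>, the other is the same lemma for the
  negated measure, which interchanges the two parts.\<close>

lemma jordan:
  assumes \<mu>: "loc_measure \<mu>" and B: "B \<in> bounded_borel"
  shows "\<mu> B = measure (pos_part \<mu>) B - measure (neg_part \<mu>) B"
  using pos_part_le[OF assms] pos_part_le[OF loc_measure_uminus[OF \<mu>] B]
  by (simp add: neg_part_def)

section \<open>Locally finite measures and Hahn decomposition\<close>

definition locally_finite_measure :: "real measure \<Rightarrow> bool" where
  "locally_finite_measure M \<longleftrightarrow> sets M = sets borel \<and> (\<forall>B\<in>bounded_borel. emeasure M B < \<infinity>)"

lemma locally_finite_lborel: "locally_finite_measure lborel"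
  using emeasure_bounded_finite by (auto simp: locally_finite_measure_def bounded_borel_def)

lemma locally_finite_variation: "loc_measure \<mu> \<Longrightarrow> locally_finite_measure (variation \<mu>)"
  using pos_part_finite neg_part_finite
  by (auto simp: locally_finite_measure_def emeasure_variation bounded_borel_def)

lemma UN_ivl: "(\<Union>n::nat. {- real n..<real n}) = UNIV"
proof -
  have "\<exists>n::nat. x \<in> {- real n..<real n}" for x
  proof -
    obtain n :: nat where "\<bar>x\<bar> < real n" using reals_Archimedean2 by blast
    then show ?thesis by (intro exI[of _ n]) auto
  qed
  then show ?thesis by blast
qed

lemma sigma_finite_locally_finite:
  assumes "locally_finite_measure M" shows "sigma_finite_measure M"
proof
  show "\<exists>A. countable A \<and> A \<subseteq> sets M \<and> \<Union> A = space M \<and> (\<forall>a\<in>A. emeasure M a \<noteq> \<infinity>)"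
  proof (intro exI[of _ "range (\<lambda>n::nat. {- real n..<real n})"] conjI)
    have "space M = UNIV" using assms sets_eq_imp_space_eq[of M borel] by (simp add: locally_finite_measure_def)
    then show "\<Union> (range (\<lambda>n::nat. {- real n..<real n})) = space M" using UN_ivl by simp
    show "\<forall>a\<in>range (\<lambda>n::nat. {- real n..<real n}). emeasure M a \<noteq> \<infinity>"
      using assms unfolding locally_finite_measure_def by (auto simp: less_top[symmetric])
  qed (use assms in \<open>auto simp: locally_finite_measure_def\<close>)
qed

text \<open>On each window [-n, n) both parts are finite, so they can be compared by a Hahn set Y n.
  On subsets of Y n the measure \<mu> is nonnegative, hence its negative part, a supremum of values
  of -\<mu>, vanishes there. The union of all Y n works globally because countable unions of null
  sets are null.\<close>

lemma hahn:
  assumes \<mu>: "loc_measure \<mu>"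
  shows "\<exists>E\<in>sets borel. emeasure (pos_part \<mu>) (- E) = 0 \<and> emeasure (neg_part \<mu>) E = 0"
proof -
  let ?P = "pos_part \<mu>" and ?N = "neg_part \<mu>"
  let ?A = "\<lambda>n::nat. {- real n..<real n}"
  have "\<exists>Y\<in>sets ?P. Y \<subseteq> ?A n \<and> (\<forall>X\<in>sets ?P. X \<subseteq> Y \<longrightarrow> ?N X \<le> ?P X) \<and>
      (\<forall>X\<in>sets ?P. X \<subseteq> ?A n \<longrightarrow> X \<inter> Y = {} \<longrightarrow> ?P X \<le> ?N X)" for n
    using pos_part_finite[OF \<mu>, of "?A n"] neg_part_finite[OF \<mu>, of "?A n"]
    by (intro unsigned_Hahn_decomposition) auto
  then obtain Y where Y: "\<And>n. Y n \<in> sets borel" "\<And>n. Y n \<subseteq> ?A n"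
    "\<And>n X. X \<in> sets borel \<Longrightarrow> X \<subseteq> Y n \<Longrightarrow> ?N X \<le> ?P X"
    "\<And>n X. X \<in> sets borel \<Longrightarrow> X \<subseteq> ?A n \<Longrightarrow> X \<inter> Y n = {} \<Longrightarrow> ?P X \<le> ?N X"
    unfolding sets_pos_part by metis
  have le: "measure ?N X \<le> measure ?P X" if "?N X \<le> ?P X" "X \<in> bounded_borel" for X
    unfolding measure_def using that(1) pos_part_finite[OF \<mu> that(2)] by (intro enn2real_mono) auto
  have le': "measure ?P X \<le> measure ?N X" if "?P X \<le> ?N X" "X \<in> bounded_borel" for X
    unfolding measure_def using that(1) neg_part_finite[OF \<mu> that(2)] by (intro enn2real_mono) auto
  have neg0: "?N (Y n) = 0" for n
  proof -
    have "(SUP A \<in> {A \<in> bounded_borel. A \<subseteq> Y n}. ennreal (- \<mu> A)) \<le> 0"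
    proof (rule SUP_least)
      fix A assume "A \<in> {A \<in> bounded_borel. A \<subseteq> Y n}"
      then have A: "A \<in> bounded_borel" "A \<in> sets borel" "A \<subseteq> Y n" by (auto simp: bounded_borel_def)
      have "0 \<le> \<mu> A" using jordan[OF \<mu> A(1)] le[OF Y(3)[OF A(2,3)] A(1)] by simp
      then show "ennreal (- \<mu> A) \<le> 0" by (simp add: ennreal_neg)
    qed
    then show ?thesis
      unfolding neg_part_def emeasure_pos_part[OF loc_measure_uminus[OF \<mu>] Y(1)] by simp
  qed
  have pos0: "?P (?A n - Y n) = 0" for n
  proof -
    have AY: "?A n - Y n \<in> sets borel" using Y(1) by auto
    have "(SUP A \<in> {A \<in> bounded_borel. A \<subseteq> ?A n - Y n}. ennreal (\<mu> A)) \<le> 0"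
    proof (rule SUP_least)
      fix A assume "A \<in> {A \<in> bounded_borel. A \<subseteq> ?A n - Y n}"
      then have A: "A \<in> bounded_borel" "A \<in> sets borel" "A \<subseteq> ?A n" "A \<inter> Y n = {}" by (auto simp: bounded_borel_def)
      have "\<mu> A \<le> 0" using jordan[OF \<mu> A(1)] le'[OF Y(4)[OF A(2,3,4)] A(1)] by simp
      then show "ennreal (\<mu> A) \<le> 0" by (simp add: ennreal_neg)
    qed
    then show ?thesis unfolding emeasure_pos_part[OF \<mu> AY] by simp
  qed
  show ?thesis
  proof (intro bexI[of _ "\<Union>n. Y n"] conjI)
    have "(\<Union>n. Y n) \<in> null_sets ?N" using neg0 Y(1) by (intro null_sets_UN) (auto intro: null_setsI)
    then show "?N (\<Union>n. Y n) = 0" by auto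
    have "(\<Union>n. ?A n - Y n) \<in> null_sets ?P" using pos0 Y(1) by (intro null_sets_UN) (auto intro: null_setsI)
    moreover have "- (\<Union>n. Y n) \<subseteq> (\<Union>n. ?A n - Y n)" using UN_ivl by blast
    moreover have "- (\<Union>n. Y n) \<in> sets ?P" using Y(1) by auto
    ultimately have "- (\<Union>n. Y n) \<in> null_sets ?P" using null_sets_subset by blast
    then show "?P (- (\<Union>n. Y n)) = 0" by auto
  qed (use Y(1) in auto)
qed

lemma variation_bounded_null:
  assumes "loc_measure \<mu>" "B \<in> bounded_borel" "emeasure (variation \<mu>) B = 0" shows "\<mu> B = 0"
proof -
  have "emeasure (pos_part \<mu>) B = 0" "emeasure (neg_part \<mu>) B = 0"
    using assms emeasure_variation[of B \<mu>] by (auto simp: bounded_borel_def)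
  then show ?thesis using jordan[OF assms(1,2)] by (simp add: measure_def)
qed

definition hahn_sign :: "real set \<Rightarrow> real \<Rightarrow> real" where
  "hahn_sign E x = (if x \<in> E then 1 else - 1)"

lemma measurable_hahn_sign [measurable]: "E \<in> sets borel \<Longrightarrow> hahn_sign E \<in> borel_measurable borel"
  unfolding hahn_sign_def[abs_def] by (intro measurable_If_set) auto

text \<open>The two Jordan parts are the variation restricted to E and to its complement. All later
  analysis can thus be done with the positive measure |dP|, the sign being a bounded factor of the
  integrand.\<close>

lemma signed_integral_hahn:
  fixes g :: "real \<Rightarrow> 'a::{banach, second_countable_topology}"
  assumes E: "E \<in> sets borel" "emeasure (pos_part \<mu>) (- E) = 0" "emeasure (neg_part \<mu>) E = 0"
    and g: "integrable (variation \<mu>) g"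
  shows "signed_integral \<mu> g = (LINT x|variation \<mu>. hahn_sign E x *\<^sub>R g x)"
proof -
  let ?M = "variation \<mu>"
  have null: "emeasure (pos_part \<mu>) (B - E) = 0" "emeasure (neg_part \<mu>) (B \<inter> E) = 0" if "B \<in> sets borel" for B
    using E that emeasure_mono[of "B - E" "- E" "pos_part \<mu>"] emeasure_mono[of "B \<inter> E" "E" "neg_part \<mu>"] by auto
  have P: "pos_part \<mu> = density ?M (\<lambda>x. ennreal (indicator E x))"
  proof (rule measure_eqI)
    fix B assume "B \<in> sets (pos_part \<mu>)"
    then have B: "B \<in> sets borel" by simp
    have "emeasure (pos_part \<mu>) B = emeasure (pos_part \<mu>) (B \<inter> E) + emeasure (pos_part \<mu>) (B - E)"
      using B E by (subst plus_emeasure) (auto intro!: arg_cong[where f="emeasure _"])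
    also have "\<dots> = emeasure ?M (B \<inter> E)" using B E null[OF B] by (subst emeasure_variation) auto
    finally show "emeasure (pos_part \<mu>) B = emeasure (density ?M (\<lambda>x. ennreal (indicator E x))) B"
      using B E by (simp add: emeasure_density ennreal_indicator indicator_inter_arith[symmetric] Int_commute)
  qed simp
  have N: "neg_part \<mu> = density ?M (\<lambda>x. ennreal (indicator (- E) x))"
  proof (rule measure_eqI)
    fix B assume "B \<in> sets (neg_part \<mu>)"
    then have B: "B \<in> sets borel" by simp
    have "emeasure (neg_part \<mu>) B = emeasure (neg_part \<mu>) (B \<inter> E) + emeasure (neg_part \<mu>) (B - E)"
      using B E by (subst plus_emeasure) (auto intro!: arg_cong[where f="emeasure _"])
    also have "\<dots> = emeasure ?M (B - E)" using B E null[OF B] by (subst emeasure_variation) auto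
    also have "B - E = - E \<inter> B" by auto
    finally show "emeasure (neg_part \<mu>) B = emeasure (density ?M (\<lambda>x. ennreal (indicator (- E) x))) B"
      using B E by (simp add: emeasure_density ennreal_indicator indicator_inter_arith[symmetric])
  qed simp
  have [measurable]: "g \<in> borel_measurable borel" using borel_measurable_integrable[OF g] by simp
  note [measurable] = E(1)
  have "signed_integral \<mu> g = (LINT x|?M. indicator E x *\<^sub>R g x) - (LINT x|?M. indicator (- E) x *\<^sub>R g x)"
    unfolding signed_integral_def unfolding P N by (subst (1 2) integral_density) auto
  also have "\<dots> = (LINT x|?M. indicator E x *\<^sub>R g x - indicator (- E) x *\<^sub>R g x)"
    using E(1) by (intro Bochner_Integration.integral_diff[symmetric] integrable_mult_indicator g) auto
  also have "\<dots> = (LINT x|?M. hahn_sign E x *\<^sub>R g x)"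
    by (intro Bochner_Integration.integral_cong) (auto simp: hahn_sign_def indicator_def)
  finally show ?thesis .
qed

lemma locally_integrable_set:
  assumes "locally_integrable M g" "B \<in> bounded_borel" "sets M = sets borel"
  shows "set_integrable M B g"
proof -
  have "bounded B" "B \<in> sets borel" using assms by (auto simp: bounded_borel_def)
  then obtain a b where "B \<subseteq> {a..b}" using bounded_subset_cbox_symmetric[of B] unfolding cbox_interval by blast
  then show ?thesis using assms \<open>B \<in> sets borel\<close> unfolding locally_integrable_def
    by (metis set_integrable_subset)
qed

lemma loc_measure_integral:
  fixes g :: "real \<Rightarrow> 'a::{banach, second_countable_topology}"
  assumes M: "sets M = sets borel" and g: "locally_integrable M g"
  shows "loc_measure (\<lambda>B. LINT x:B|M. g x)"
  unfolding loc_measure_def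
proof (intro allI impI)
  fix A :: "nat \<Rightarrow> real set"
  assume "range A \<subseteq> bounded_borel \<and> disjoint_family A \<and> bounded (\<Union>i. A i)"
  then have A: "\<And>i. A i \<in> bounded_borel" "disjoint_family A" "bounded (\<Union>i. A i)" by auto
  have Ab: "A i \<in> sets borel" for i using A(1) by (simp add: bounded_borel_def)
  have U: "(\<Union>i. A i) \<in> bounded_borel" using A Ab by (simp add: bounded_borel_def)
  have int: "set_integrable M (\<Union>i. A i) g" by (rule locally_integrable_set[OF g U M])
  have "(\<lambda>n. LINT x:(\<Union>i<n. A i)|M. g x) \<longlonglongrightarrow> (LINT x:(\<Union>n. \<Union>i<n. A i)|M. g x)"
  proof (rule set_integral_cont_up)
    have eq: "(\<Union>n. \<Union>i<n. A i) = (\<Union>i. A i)" by blast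
    show "set_integrable M (\<Union>n. \<Union>i<n. A i) g" unfolding eq by (rule int)
    show "incseq (\<lambda>n. \<Union>i<n. A i)" by (intro incseq_SucI) (auto simp: lessThan_Suc)
  qed (use Ab M in auto)
  moreover have "(\<Union>n. \<Union>i<n. A i) = (\<Union>i. A i)" by blast
  moreover have "(LINT x:(\<Union>i<n. A i)|M. g x) = (\<Sum>i<n. LINT x:A i|M. g x)" for n
    using A(2) Ab M locally_integrable_set[OF g A(1) M]
    by (intro set_integral_finite_Union) (auto intro: disjoint_family_on_mono)
  ultimately show "(\<lambda>i. LINT x:A i|M. g x) sums (LINT x:(\<Union>i. A i)|M. g x)"
    by (simp add: sums_def)
qed

lemma loc_measure_cong:
  assumes "loc_measure \<mu>" "\<And>B. B \<in> bounded_borel \<Longrightarrow> \<mu> B = \<mu>' B" shows "loc_measure \<mu>'"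
  unfolding loc_measure_def
proof (intro allI impI)
  fix A :: "nat \<Rightarrow> real set"
  assume A: "range A \<subseteq> bounded_borel \<and> disjoint_family A \<and> bounded (\<Union>i. A i)"
  then have "(\<Union>i. A i) \<in> bounded_borel" by (auto simp: bounded_borel_def)
  moreover have "(\<lambda>i. \<mu> (A i)) sums \<mu> (\<Union>i. A i)"
    using A assms(1) unfolding loc_measure_def by blast
  moreover have "\<mu> (A i) = \<mu>' (A i)" for i using A assms(2) by blast
  ultimately show "(\<lambda>i. \<mu>' (A i)) sums \<mu>' (\<Union>i. A i)" using assms(2) by simp
qed

lemma loc_measure_lborel: "loc_measure (measure lborel)"
proof (rule loc_measure_cong)
  show "loc_measure (\<lambda>B. LINT x:B|lborel. (1::real))"
  proof (rule loc_measure_integral)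
    show "locally_integrable lborel (\<lambda>_. 1::real)"
      unfolding locally_integrable_def set_integrable_def by (auto simp: emeasure_lborel_Icc_eq)
  qed simp
  show "(LINT x:B|lborel. 1) = measure lborel B" if "B \<in> bounded_borel" for B
    using that by (simp add: set_lebesgue_integral_def bounded_borel_def)
qed

lemma loc_measure_dP: "loc_measure \<nu> \<Longrightarrow> loc_measure (dP \<nu>)"
  using loc_measure_lborel unfolding loc_measure_def dP_def by (auto intro: sums_add)

text \<open>A carrier N of \<nu> that is Lebesgue-null exists by singularity. Bounded sets off N are
  \<nu>-null, so dP is Lebesgue measure there and its negative part vanishes. The last conjunct lets
  every Lebesgue statement be read inside |dP|.\<close>

lemma dP_structure:
  assumes \<nu>: "loc_measure \<nu>" and sing: "lebesgue_singular \<nu>"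
  shows "\<exists>E N. E \<in> sets borel \<and> N \<in> sets borel \<and> emeasure lborel N = 0 \<and> - N \<subseteq> E \<and>
    emeasure (pos_part (dP \<nu>)) (- E) = 0 \<and> emeasure (neg_part (dP \<nu>)) E = 0 \<and>
    (\<forall>B\<in>sets borel. emeasure lborel B = emeasure (variation (dP \<nu>)) (B - N))"
proof -
  note P = loc_measure_dP[OF \<nu>]
  obtain N where N: "N \<in> null_sets lborel" "emeasure (variation \<nu>) (- N) = 0"
    using sing unfolding lebesgue_singular_def by blast
  have Nb: "N \<in> sets borel" using N(1) by auto
  obtain E where E: "E \<in> sets borel" "emeasure (pos_part (dP \<nu>)) (- E) = 0" "emeasure (neg_part (dP \<nu>)) E = 0"
    using hahn[OF P] by blast
  have dP: "dP \<nu> A = measure lborel A" if "A \<in> bounded_borel" "A \<subseteq> - N" for A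
  proof -
    have "emeasure (variation \<nu>) A \<le> emeasure (variation \<nu>) (- N)"
      using that Nb by (intro emeasure_mono) auto
    then show ?thesis using variation_bounded_null[OF \<nu> that(1)] N(2) by (simp add: dP_def)
  qed
  have neg0: "emeasure (neg_part (dP \<nu>)) (- N) = 0"
  proof -
    have "(SUP A \<in> {A \<in> bounded_borel. A \<subseteq> - N}. ennreal (- dP \<nu> A)) \<le> 0"
      by (intro SUP_least) (auto simp: dP ennreal_neg)
    then show ?thesis
      using emeasure_pos_part[OF loc_measure_uminus[OF P], of "- N"] Nb unfolding neg_part_def by simp
  qed
  have pos: "emeasure (pos_part (dP \<nu>)) B = emeasure lborel B" if B: "B \<in> sets borel" "B \<subseteq> - N" for B
  proof -
    have fin: "emeasure lborel A = ennreal (measure lborel A)" if "A \<in> bounded_borel" for A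
      using that emeasure_bounded_finite[of A] by (simp add: bounded_borel_def emeasure_eq_ennreal_measure less_top)
    have "(SUP A \<in> {A \<in> bounded_borel. A \<subseteq> B}. ennreal (dP \<nu> A)) = emeasure lborel B"
    proof (rule antisym)
      show "(SUP A \<in> {A \<in> bounded_borel. A \<subseteq> B}. ennreal (dP \<nu> A)) \<le> emeasure lborel B"
      proof (rule SUP_least)
        fix A assume "A \<in> {A \<in> bounded_borel. A \<subseteq> B}"
        then show "ennreal (dP \<nu> A) \<le> emeasure lborel B"
          using B by (auto simp: dP fin[symmetric] intro!: emeasure_mono)
      qed
      have "emeasure lborel B = (SUP n::nat. emeasure lborel (B \<inter> {- real n..<real n}))"
      proof -
        have "B = (\<Union>n::nat. B \<inter> {- real n..<real n})" using UN_ivl by blast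
        then show ?thesis using B(1)
          by (subst SUP_emeasure_incseq) (auto intro!: incseq_SucI)
      qed
      also have "\<dots> \<le> (SUP A \<in> {A \<in> bounded_borel. A \<subseteq> B}. ennreal (dP \<nu> A))"
      proof (rule SUP_least)
        fix n :: nat
        have A: "B \<inter> {- real n..<real n} \<in> bounded_borel"
          using B(1) bounded_borel_Int[of "{- real n..<real n}" B] by (simp add: Int_commute)
        have "emeasure lborel (B \<inter> {- real n..<real n}) = ennreal (dP \<nu> (B \<inter> {- real n..<real n}))"
          using B(2) A by (subst dP) (auto simp: fin)
        also have "\<dots> \<le> (SUP A \<in> {A \<in> bounded_borel. A \<subseteq> B}. ennreal (dP \<nu> A))"
          using A by (intro SUP_upper) auto
        finally show "emeasure lborel (B \<inter> {- real n..<real n}) \<le> (SUP A \<in> {A \<in> bounded_borel. A \<subseteq> B}. ennreal (dP \<nu> A))" .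
      qed
      finally show "emeasure lborel B \<le> (SUP A \<in> {A \<in> bounded_borel. A \<subseteq> B}. ennreal (dP \<nu> A))" .
    qed
    then show ?thesis using emeasure_pos_part[OF P B(1)] by simp
  qed
  show ?thesis
  \<comment> \<open>Since -N is null for the negative part, joining it to the Hahn set E gives
    another Hahn set; the sign is then +1 wherever Lebesgue measure lives.\<close>
  proof (rule exI[of _ "E \<union> - N"], rule exI[of _ N], intro conjI ballI)
    have "emeasure (pos_part (dP \<nu>)) (- (E \<union> - N)) \<le> emeasure (pos_part (dP \<nu>)) (- E)"
      using E Nb by (intro emeasure_mono) auto
    then show "emeasure (pos_part (dP \<nu>)) (- (E \<union> - N)) = 0" using E(2) by simp
    have "emeasure (neg_part (dP \<nu>)) (E \<union> - N) \<le> emeasure (neg_part (dP \<nu>)) E + emeasure (neg_part (dP \<nu>)) (- N)"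
      using E Nb by (intro emeasure_subadditive) auto
    then show "emeasure (neg_part (dP \<nu>)) (E \<union> - N) = 0" using E(3) neg0 by simp
    show "emeasure lborel B = emeasure (variation (dP \<nu>)) (B - N)" if B: "B \<in> sets borel" for B
    proof -
      have "emeasure (neg_part (dP \<nu>)) (B - N) \<le> emeasure (neg_part (dP \<nu>)) (- N)"
        using B Nb by (intro emeasure_mono) auto
      then have "emeasure (variation (dP \<nu>)) (B - N) = emeasure lborel (B - N)"
        using B Nb neg0 pos[of "B - N"] by (subst emeasure_variation) auto
      also have "\<dots> = emeasure lborel B"
        using N(1) B by (intro emeasure_Diff_null_set) auto
      finally show ?thesis by simp
    qed
  qed (use E Nb N in auto)
qed

section \<open>Functions of locally bounded variation\<close>

text \<open>Half-open intervals are an intersection-stable generator. The induction compares traces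
  on a fixed window [-n, n), because complements of bounded sets are unbounded and carry no
  meaningful value.\<close>

lemma loc_measure_unique:
  fixes \<mu> \<mu>' :: "real set \<Rightarrow> 'a::real_normed_vector"
  assumes m: "loc_measure \<mu>" "loc_measure \<mu>'"
    and eq: "\<And>a b. a \<le> b \<Longrightarrow> \<mu> {a..<b} = \<mu>' {a..<b}" and B: "B \<in> bounded_borel"
  shows "\<mu> B = \<mu>' B"
proof -
  obtain n :: nat where n: "B \<subseteq> {- real n..<real n}"
  proof -
    obtain r where r: "B \<subseteq> {-r..r}"
      using B bounded_subset_cbox_symmetric[of B] unfolding bounded_borel_def cbox_interval by blast
    obtain n :: nat where "r < real n" using reals_Archimedean2 by blast
    then have "{-r..r} \<subseteq> {- real n..<real n}" by auto
    with r show ?thesis using that by blast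
  qed
  let ?I = "{- real n..<real n}"
  let ?G = "range (\<lambda>(a::real, b). {a..<b})"
  have sub: "A \<inter> ?I \<in> bounded_borel" if "A \<in> sets borel" for A
    using bounded_borel_Int[of ?I A] that by (simp add: Int_commute)
  have borel: "sets borel = sigma_sets UNIV ?G"
    by (subst borel_eq_atLeastLessThan) (rule sets_measure_of, auto)
  have Iv: "{a..<b} \<inter> {c..<d} = {max a c..<min b d}" for a b c d :: real by auto
  have "Int_stable ?G" by (auto simp: Int_stable_def Iv)
  have closed: "?G \<subseteq> Pow UNIV" by auto
  have "B \<in> sigma_sets UNIV ?G" using B unfolding bounded_borel_def borel[symmetric] by simp
  with \<open>Int_stable ?G\<close> closed have "\<mu> (B \<inter> ?I) = \<mu>' (B \<inter> ?I)"
  proof (induction rule: sigma_sets_induct_disjoint)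
    case (basic A)
    then obtain a b where A: "A = {a..<b}" by auto
    have "A \<inter> ?I = {max a (- real n)..<max (max a (- real n)) (min b (real n))}" unfolding A by auto
    then show ?case using eq by simp
  next
    case empty
    then show ?case using loc_measure_empty[OF m(1)] loc_measure_empty[OF m(2)] by simp
  next
    case (compl A)
    then have A: "A \<in> sets borel" unfolding borel by simp
    have "(UNIV - A) \<inter> ?I = ?I - A \<inter> ?I" by auto
    then show ?case
      using loc_measure_Diff[OF m(1) _ sub[OF A], of ?I] loc_measure_Diff[OF m(2) _ sub[OF A], of ?I] compl eq[of "- real n" "real n"]
      by simp
  next
    case (union A)
    then have A: "A i \<in> sets borel" for i unfolding borel by auto
    have 1: "(\<Union>i. A i) \<inter> ?I = (\<Union>i. A i \<inter> ?I)" by auto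
    have pre: "range (\<lambda>i. A i \<inter> ?I) \<subseteq> bounded_borel \<and> disjoint_family (\<lambda>i. A i \<inter> ?I) \<and> bounded (\<Union>i. A i \<inter> ?I)"
    proof (intro conjI)
      show "range (\<lambda>i. A i \<inter> ?I) \<subseteq> bounded_borel" using sub[OF A] by blast
      show "disjoint_family (\<lambda>i. A i \<inter> ?I)" using union(1) by (auto simp: disjoint_family_on_def)
      show "bounded (\<Union>i. A i \<inter> ?I)"
        by (rule bounded_subset[OF bounded_closed_interval[of "- real n" "real n"]]) auto
    qed
    have "(\<lambda>i. \<mu> (A i \<inter> ?I)) sums \<mu> (\<Union>i. A i \<inter> ?I)" using m(1) pre unfolding loc_measure_def by blast
    moreover have "(\<lambda>i. \<mu>' (A i \<inter> ?I)) sums \<mu>' (\<Union>i. A i \<inter> ?I)" using m(2) pre unfolding loc_measure_def by blast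
    ultimately show ?case using union(3) unfolding 1 by (simp add: sums_unique2)
  qed
  then show ?thesis using n by (simp add: Int_absorb2)
qed

text \<open>The choice in \<open>stieltjes\<close> is harmless: any two candidates agree on
  half-open intervals, hence on all bounded Borel sets.\<close>

lemma stieltjes_eq:
  assumes "loc_measure m" "\<And>a b. a \<le> b \<Longrightarrow> m {a..<b} = f b - f a" "B \<in> bounded_borel"
  shows "stieltjes f B = m B"
proof -
  have "loc_measure (stieltjes f) \<and> (\<forall>a b. a \<le> b \<longrightarrow> stieltjes f {a..<b} = f b - f a)"
    unfolding stieltjes_def by (rule someI[of _ m]) (use assms in auto)
  then show ?thesis using assms(2) by (intro loc_measure_unique[OF _ assms(1) _ assms(3)]) simp_all
qed

lemma stieltjesI:
  assumes "loc_measure m" "\<And>a b. a \<le> b \<Longrightarrow> m {a..<b} = f b - f a"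
  shows "loc_measure (stieltjes f)" "a \<le> b \<Longrightarrow> stieltjes f {a..<b} = f b - f a"
proof -
  have "loc_measure (stieltjes f) \<and> (\<forall>a b. a \<le> b \<longrightarrow> stieltjes f {a..<b} = f b - f a)"
    unfolding stieltjes_def by (rule someI[of _ m]) (use assms in auto)
  then show "loc_measure (stieltjes f)" "a \<le> b \<Longrightarrow> stieltjes f {a..<b} = f b - f a" by auto
qed

section \<open>Total variation and monotone majorants\<close>

definition total_variation :: "(real \<Rightarrow> complex) \<Rightarrow> real \<Rightarrow> real \<Rightarrow> real" where
  "total_variation f a b = Sup {\<Sum>i<n. cmod (f (x (Suc i)) - f (x i)) | (x :: nat \<Rightarrow> real) n. mono x \<and> range x \<subseteq> {a..b}}"

lemma total_variation_upper:
  assumes "locally_bv f" "mono x" "range x \<subseteq> {a..b}"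
  shows "(\<Sum>i<n. cmod (f (x (Suc i)) - f (x i))) \<le> total_variation f a b"
proof -
  obtain C where "\<forall>(x :: nat \<Rightarrow> real) n. mono x \<and> range x \<subseteq> {a..b} \<longrightarrow> (\<Sum>i<n. cmod (f (x (Suc i)) - f (x i))) \<le> C"
    using assms(1) unfolding locally_bv_def by blast
  then have "bdd_above {\<Sum>i<n. cmod (f (x (Suc i)) - f (x i)) | (x :: nat \<Rightarrow> real) n. mono x \<and> range x \<subseteq> {a..b}}"
    by (intro bdd_aboveI[of _ C]) auto
  then show ?thesis unfolding total_variation_def using assms by (intro cSup_upper) auto
qed

lemma total_variation_least:
  assumes "a \<le> b" "\<And>(x :: nat \<Rightarrow> real) n. mono x \<Longrightarrow> range x \<subseteq> {a..b} \<Longrightarrow> (\<Sum>i<n. cmod (f (x (Suc i)) - f (x i))) \<le> C"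
  shows "total_variation f a b \<le> C"
  unfolding total_variation_def
proof (rule cSup_least)
  have "mono (\<lambda>_::nat. a) \<and> range (\<lambda>_::nat. a) \<subseteq> {a..b}" using assms(1) by (auto simp: mono_def)
  then show "{\<Sum>i<n. cmod (f (x (Suc i)) - f (x i)) | (x :: nat \<Rightarrow> real) n. mono x \<and> range x \<subseteq> {a..b}} \<noteq> {}"
    by blast
qed (use assms(2) in auto)

lemma total_variation_append:
  assumes f: "locally_bv f" and ab: "a \<le> b" "b \<le> c"
  shows "total_variation f a b + cmod (f c - f b) \<le> total_variation f a c"
proof -
  have "total_variation f a b \<le> total_variation f a c - cmod (f c - f b)"
  proof (rule total_variation_least[OF ab(1)])
    fix x :: "nat \<Rightarrow> real" and n assume x: "mono x" "range x \<subseteq> {a..b}"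
    have xb: "a \<le> x i" "x i \<le> b" for i using x(2) by (auto simp: subset_eq)
    \<comment> \<open>The partition is continued by b and then c. The increment from its last point
      to b is nonnegative and is dropped at the end.\<close>
    define y where "y i = (if i \<le> n then x i else if i = Suc n then b else c)" for i
    have "mono y"
      unfolding mono_iff_le_Suc
    proof
      fix i show "y i \<le> y (Suc i)"
        using monoD[OF x(1), of i "Suc i"] xb ab by (auto simp: y_def)
    qed
    moreover have "range y \<subseteq> {a..c}"
      using ab xb(1) order_trans[OF xb(2) ab(2)] by (auto simp: y_def)
    ultimately have "(\<Sum>i<Suc (Suc n). cmod (f (y (Suc i)) - f (y i))) \<le> total_variation f a c"
      by (rule total_variation_upper[OF f])
    moreover have "(\<Sum>i<n. cmod (f (y (Suc i)) - f (y i))) = (\<Sum>i<n. cmod (f (x (Suc i)) - f (x i)))"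
      by (intro sum.cong) (auto simp: y_def)
    moreover have "y (Suc (Suc n)) = c" "y (Suc n) = b" by (auto simp: y_def)
    ultimately have "(\<Sum>i<n. cmod (f (x (Suc i)) - f (x i))) + cmod (f b - f (y n)) + cmod (f c - f b)
        \<le> total_variation f a c" by simp
    moreover have "0 \<le> cmod (f b - f (y n))" by simp
    ultimately show "(\<Sum>i<n. cmod (f (x (Suc i)) - f (x i))) \<le> total_variation f a c - cmod (f c - f b)"
      by linarith
  qed
  then show ?thesis by simp
qed

lemma total_variation_prepend:
  assumes f: "locally_bv f" and ab: "a \<le> b" "b \<le> c"
  shows "cmod (f b - f a) + total_variation f b c \<le> total_variation f a c"
proof -
  have "total_variation f b c \<le> total_variation f a c - cmod (f b - f a)"
  proof (rule total_variation_least[OF ab(2)])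
    fix x :: "nat \<Rightarrow> real" and n assume x: "mono x" "range x \<subseteq> {b..c}"
    have xb: "b \<le> x i" "x i \<le> c" for i using x(2) by (auto simp: subset_eq)
    define y where "y = case_nat a (case_nat b x)"
    have "mono y"
      unfolding mono_iff_le_Suc
    proof
      fix i show "y i \<le> y (Suc i)"
        using monoD[OF x(1)] xb ab by (auto simp: y_def split: nat.split)
    qed
    moreover have "range y \<subseteq> {a..c}" using xb ab order_trans[OF ab(1) xb(1)] by (auto simp: y_def split: nat.split)
    ultimately have "(\<Sum>i<Suc (Suc n). cmod (f (y (Suc i)) - f (y i))) \<le> total_variation f a c"
      by (rule total_variation_upper[OF f])
    then have "cmod (f b - f a) + (cmod (f (x 0) - f b) + (\<Sum>i<n. cmod (f (x (Suc i)) - f (x i)))) \<le> total_variation f a c"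
      unfolding sum.lessThan_Suc_shift by (simp add: y_def)
    moreover have "0 \<le> cmod (f (x 0) - f b)" by simp
    ultimately show "(\<Sum>i<n. cmod (f (x (Suc i)) - f (x i))) \<le> total_variation f a c - cmod (f b - f a)"
      by linarith
  qed
  then show ?thesis by simp
qed

text \<open>The variation is counted from 0 with a sign, like an oriented integral; an increment
  across 0 is split there.\<close>

lemma bv_monotone_majorant:
  assumes f: "locally_bv f"
  shows "\<exists>G :: real \<Rightarrow> real. \<forall>a b. a \<le> b \<longrightarrow> cmod (f b - f a) \<le> G b - G a"
proof -
  have nn: "0 \<le> total_variation f a a" for a
    using total_variation_upper[OF f, of "\<lambda>_. a" a a 0] by (auto simp: mono_def)
  have ge: "cmod (f b - f a) \<le> total_variation f a b" if "a \<le> b" for a b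
    using total_variation_append[OF f, of a a b] nn[of a] that by simp
  define G where "G x = (if 0 \<le> x then total_variation f 0 x else - total_variation f x 0)" for x
  have "cmod (f b - f a) \<le> G b - G a" if "a \<le> b" for a b
  proof -
    consider "0 \<le> a" | "b < 0" | "a < 0" "0 \<le> b" using that by linarith
    then show ?thesis
    proof cases
      case 1 then show ?thesis using total_variation_append[OF f 1 that] that by (simp add: G_def)
    next
      case 2 then show ?thesis using total_variation_prepend[OF f that, of 0] that by (simp add: G_def)
    next
      case 3
      have "cmod (f b - f a) \<le> cmod (f b - f 0) + cmod (f 0 - f a)"
        using norm_triangle_ineq[of "f b - f 0" "f 0 - f a"] by simp
      then show ?thesis using 3 ge[of 0 b] ge[of a 0] by (simp add: G_def)
    qed
  qed
  then show ?thesis by blast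
qed

section \<open>Stieltjes measures of left-continuous functions\<close>

lemma mono_left_limit:
  fixes G :: "real \<Rightarrow> real" assumes "mono G"
  shows "(G \<longlongrightarrow> Sup (G ` {..<x})) (at_left x)"
proof -
  have bdd: "bdd_above (G ` {..<x})" by (rule bdd_aboveI2[of _ _ "G x"]) (simp add: monoD[OF assms])
  have ne: "G ` {..<x} \<noteq> {}" by simp
  show ?thesis
  proof (rule order_tendstoI)
    fix a assume "a < Sup (G ` {..<x})"
    then obtain y where y: "y < x" "a < G y" using less_cSup_iff[OF ne bdd] by auto
    show "\<forall>\<^sub>F z in at_left x. a < G z"
      using eventually_at_left_real[OF y(1)] by eventually_elim (use y in \<open>auto intro: less_le_trans[OF _ monoD[OF assms]]\<close>)
  next
    fix a assume a: "Sup (G ` {..<x}) < a"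
    have "G z < a" if "z < x" for z using cSup_upper[OF _ bdd, of "G z"] that a by auto
    then show "\<forall>\<^sub>F z in at_left x. G z < a" by (auto simp: eventually_at_filter)
  qed
qed

text \<open>The majorant from the total variation need not be left-continuous; its left limits form
  a monotone left-continuous function, to which a measure can be attached.\<close>

lemma mono_left_regularization:
  fixes G :: "real \<Rightarrow> real" assumes G: "mono G"
  defines "L \<equiv> \<lambda>x. Sup (G ` {..<x})"
  shows "mono L" "continuous (at_left x) L"
proof -
  have bdd: "bdd_above (G ` {..<x})" for x by (rule bdd_aboveI2[of _ _ "G x"]) (simp add: monoD[OF G])
  have ne: "G ` {..<x} \<noteq> {}" for x by simp
  show "mono L" unfolding L_def mono_def using bdd ne by (intro allI impI cSup_subset_mono) auto
  have up: "G y \<le> L z" if "y < z" for y z unfolding L_def using bdd that by (intro cSup_upper) auto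
  show "continuous (at_left x) L"
    unfolding continuous_within
  proof (rule order_tendstoI)
    fix a assume "a < L x"
    then obtain y where y: "y < x" "a < G y" unfolding L_def using less_cSup_iff[OF ne bdd] by auto
    show "\<forall>\<^sub>F z in at_left x. a < L z"
      using eventually_at_left_real[OF y(1)] by eventually_elim (use y up in \<open>auto intro: less_le_trans\<close>)
  next
    fix a assume "L x < a"
    then show "\<forall>\<^sub>F z in at_left x. L z < a"
      unfolding eventually_at_filter
      using le_less_trans[OF monoD[OF \<open>mono L\<close> less_imp_le]] by (auto intro!: always_eventually)
  qed
qed

lemma loc_measure_measure:
  assumes "locally_finite_measure M" shows "loc_measure (measure M)"
proof (rule loc_measure_cong)
  have sp: "sets M = sets borel" "space M = UNIV"
    using assms sets_eq_imp_space_eq[of M borel] by (auto simp: locally_finite_measure_def)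
  show "loc_measure (\<lambda>B. LINT x:B|M. (1::real))"
  proof (rule loc_measure_integral)
    show "locally_integrable M (\<lambda>_. 1::real)"
      using assms sp unfolding locally_integrable_def set_integrable_def by (auto simp: locally_finite_measure_def)
  qed (use sp in simp)
  show "(LINT x:B|M. 1) = measure M B" if "B \<in> bounded_borel" for B
    using that sp by (simp add: set_lebesgue_integral_def bounded_borel_def)
qed

text \<open>The library's \<^const>\<open>interval_measure\<close> needs right-continuity, so the line is reflected.\<close>

lemma monotone_stieltjes:
  fixes L :: "real \<Rightarrow> real"
  assumes "mono L" "\<And>x. continuous (at_left x) L"
  shows "\<exists>m. loc_measure m \<and> (\<forall>a b. a \<le> b \<longrightarrow> m {a..<b} = L b - L a)"
proof -
  define F where "F x = - L (- x)" for x
  have F: "F x \<le> F y" if "x \<le> y" for x y using monoD[OF assms(1)] that by (simp add: F_def)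
  have rc: "continuous (at_right a) F" for a
  proof -
    have "(L \<longlongrightarrow> L (- a)) (at_left (- a))" using assms(2) by (simp add: continuous_within)
    then have "(F \<longlongrightarrow> F a) (at_right a)"
      unfolding F_def at_right_minus[of a] filterlim_filtermap by (simp add: tendsto_minus)
    then show ?thesis by (simp add: continuous_within)
  qed
  define M where "M = distr (interval_measure F) borel uminus"
  have M: "emeasure M {a..<b} = ennreal (L b - L a)" if "a \<le> b" for a b
  proof -
    have "uminus -` {a..<b} = {- b<..- a}" by auto
    then have "emeasure M {a..<b} = emeasure (interval_measure F) {- b<..- a}"
      unfolding M_def by (subst emeasure_distr) auto
    also have "\<dots> = ennreal (F (- a) - F (- b))"
      using that F rc by (intro emeasure_interval_measure_Ioc) auto
    finally show ?thesis by (simp add: F_def)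
  qed
  have "locally_finite_measure M"
    unfolding locally_finite_measure_def
  proof (intro conjI ballI)
    show "sets M = sets borel" by (simp add: M_def)
    fix B :: "real set" assume B: "B \<in> bounded_borel"
    obtain r where r: "B \<subseteq> {-r..r}"
      using B bounded_subset_cbox_symmetric[of B] unfolding bounded_borel_def cbox_interval by blast
    have "emeasure M B \<le> emeasure M {-\<bar>r\<bar>..<\<bar>r\<bar>+1}" using r by (intro emeasure_mono) (auto simp: M_def)
    also have "\<dots> < \<infinity>" by (subst M) auto
    finally show "emeasure M B < \<infinity>" .
  qed
  moreover have "measure M {a..<b} = L b - L a" if "a \<le> b" for a b
    using M[OF that] monoD[OF assms(1) that] by (simp add: measure_def)
  ultimately show ?thesis using loc_measure_measure by blast
qed

text \<open>Both G and G - u are monotone. They may fail to be left-continuous, but their left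
  limits still differ by u because u is left-continuous, so the two regularisations yield the
  measure as a difference.\<close>

lemma real_stieltjes:
  fixes u G :: "real \<Rightarrow> real"
  assumes u: "\<And>x. continuous (at_left x) u" and G: "\<And>a b. a \<le> b \<Longrightarrow> \<bar>u b - u a\<bar> \<le> G b - G a"
  shows "\<exists>m. loc_measure m \<and> (\<forall>a b. a \<le> b \<longrightarrow> m {a..<b} = u b - u a)"
proof -
  let ?H = "\<lambda>x. G x - u x"
  have GH: "mono G" "mono ?H" using G by (auto simp: mono_def abs_le_iff) (smt (verit) G)+
  let ?LG = "\<lambda>x. Sup (G ` {..<x})" and ?LH = "\<lambda>x. Sup (?H ` {..<x})"
  have eq: "?LG x - ?LH x = u x" for x
  proof (rule tendsto_unique)
    show "((\<lambda>y. G y - ?H y) \<longlongrightarrow> ?LG x - ?LH x) (at_left x)"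
      by (intro tendsto_diff mono_left_limit GH)
    show "((\<lambda>y. G y - ?H y) \<longlongrightarrow> u x) (at_left x)"
      using u[of x] by (simp add: continuous_within)
  qed simp
  obtain m1 where m1: "loc_measure m1" "\<And>a b. a \<le> b \<Longrightarrow> m1 {a..<b} = ?LG b - ?LG a"
    using monotone_stieltjes[OF mono_left_regularization[OF GH(1)]] by blast
  obtain m2 where m2: "loc_measure m2" "\<And>a b. a \<le> b \<Longrightarrow> m2 {a..<b} = ?LH b - ?LH a"
    using monotone_stieltjes[OF mono_left_regularization[OF GH(2)]] by blast
  have "loc_measure (\<lambda>B. m1 B - m2 B)"
    using m1(1) m2(1) unfolding loc_measure_def by (auto intro: sums_diff)
  moreover have "m1 {a..<b} - m2 {a..<b} = u b - u a" if "a \<le> b" for a b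
    using m1(2)[OF that] m2(2)[OF that] eq[of a] eq[of b] by linarith
  ultimately show ?thesis by (intro exI[of _ "\<lambda>B. m1 B - m2 B"]) auto
qed

lemma stieltjes_exists:
  fixes f :: "real \<Rightarrow> complex"
  assumes c: "\<And>x. continuous (at_left x) f" and bv: "locally_bv f"
  shows "\<exists>m. loc_measure m \<and> (\<forall>a b. a \<le> b \<longrightarrow> m {a..<b} = f b - f a)"
proof -
  obtain G where G: "\<And>a b. a \<le> b \<Longrightarrow> cmod (f b - f a) \<le> G b - G a"
    using bv_monotone_majorant[OF bv] by blast
  have "\<exists>m. loc_measure m \<and> (\<forall>a b. a \<le> b \<longrightarrow> m {a..<b} = Re (f b) - Re (f a))"
  proof (rule real_stieltjes)
    show "\<bar>Re (f b) - Re (f a)\<bar> \<le> G b - G a" if "a \<le> b" for a b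
      using G[OF that] abs_Re_le_cmod[of "f b - f a"] by simp
  qed (use c in \<open>auto intro: continuous_intros\<close>)
  then obtain m1 where m1: "loc_measure m1" "\<And>a b. a \<le> b \<Longrightarrow> m1 {a..<b} = Re (f b) - Re (f a)" by blast
  have "\<exists>m. loc_measure m \<and> (\<forall>a b. a \<le> b \<longrightarrow> m {a..<b} = Im (f b) - Im (f a))"
  proof (rule real_stieltjes)
    show "\<bar>Im (f b) - Im (f a)\<bar> \<le> G b - G a" if "a \<le> b" for a b
      using G[OF that] abs_Im_le_cmod[of "f b - f a"] by simp
  qed (use c in \<open>auto intro: continuous_intros\<close>)
  then obtain m2 where m2: "loc_measure m2" "\<And>a b. a \<le> b \<Longrightarrow> m2 {a..<b} = Im (f b) - Im (f a)" by blast
  have "loc_measure (\<lambda>B. Complex (m1 B) (m2 B))"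
    using m1(1) m2(1) unfolding loc_measure_def by (auto simp: sums_complex_iff)
  then show ?thesis
    using m1(2) m2(2) by (intro exI[of _ "\<lambda>B. Complex (m1 B) (m2 B)"]) (auto simp: complex_eq_iff)
qed

section \<open>Radon-Nikodym densities of locally finite signed and complex measures\<close>

lemma loc_measure_RN_real:
  fixes l :: "real set \<Rightarrow> real"
  assumes M: "locally_finite_measure M" and l: "loc_measure l"
    and ac: "\<And>B. B \<in> bounded_borel \<Longrightarrow> emeasure M B = 0 \<Longrightarrow> l B = 0"
  shows "\<exists>g. locally_integrable M g \<and> (\<forall>B\<in>bounded_borel. l B = (LINT x:B|M. g x))"
proof -
  have sM: "sets M = sets borel" "space M = UNIV"
    using M sets_eq_imp_space_eq[of M borel] by (auto simp: locally_finite_measure_def)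
  interpret sigma_finite_measure M by (rule sigma_finite_locally_finite[OF M])
  have main: "\<exists>g. locally_integrable M g \<and> (\<forall>B\<in>bounded_borel. measure (pos_part k) B = (LINT x:B|M. g x))"
    if k: "loc_measure k" and kac: "\<And>B. B \<in> bounded_borel \<Longrightarrow> emeasure M B = 0 \<Longrightarrow> k B = 0"
    for k :: "real set \<Rightarrow> real"
  proof -
    let ?N = "pos_part k"
    have lf: "locally_finite_measure ?N"
      using pos_part_finite[OF k] by (simp add: locally_finite_measure_def)
    \<comment> \<open>The positive part of k on B is a supremum of values of k on bounded subsets of
      B, all of which are null when B is.\<close>
    have ac': "absolutely_continuous M ?N"
      unfolding absolutely_continuous_def
    proof
      fix B assume "B \<in> null_sets M"
      then have B: "B \<in> sets borel" "emeasure M B = 0" using sM by auto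
      have "(SUP A \<in> {A \<in> bounded_borel. A \<subseteq> B}. ennreal (k A)) \<le> 0"
      proof (rule SUP_least)
        fix A assume A: "A \<in> {A \<in> bounded_borel. A \<subseteq> B}"
        then have "emeasure M A \<le> emeasure M B" using B sM by (intro emeasure_mono) auto
        then show "ennreal (k A) \<le> 0" using A B kac by auto
      qed
      then show "B \<in> null_sets ?N" using B emeasure_pos_part[OF k B(1)] by auto
    qed
    define g where "g x = enn2real (RN_deriv M ?N x)" for x
    have int: "integrable M (\<lambda>x. g x * indicator B x)" "measure ?N B = (LINT x|M. g x * indicator B x)"
      if B: "B \<in> bounded_borel" for B
    proof -
      have Bb: "B \<in> sets borel" using B by (simp add: bounded_borel_def)
      have m: "(\<lambda>x. indicator B x :: real) \<in> borel_measurable M" using Bb sM by simp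
      note RN = RN_deriv_integrable[OF sigma_finite_locally_finite[OF lf] ac' _ m]
        RN_deriv_integral[OF sigma_finite_locally_finite[OF lf] ac' _ m]
      have "integrable ?N (\<lambda>x. indicator B x :: real)" using Bb pos_part_finite[OF k B] by simp
      then show "integrable M (\<lambda>x. g x * indicator B x)" using RN(1) sM by (simp add: g_def)
      show "measure ?N B = (LINT x|M. g x * indicator B x)" using RN(2) sM Bb by (simp add: g_def)
    qed
    have "locally_integrable M g"
      unfolding locally_integrable_def set_integrable_def using int(1)[of "{_.._}"] by (simp add: mult.commute)
    then show ?thesis
      using int(2) unfolding set_lebesgue_integral_def by (intro exI[of _ g]) (simp add: mult.commute)
  qed
  obtain g1 where g1: "locally_integrable M g1" "\<And>B. B \<in> bounded_borel \<Longrightarrow> measure (pos_part l) B = (LINT x:B|M. g1 x)"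
    using main[OF l ac] by blast
  obtain g2 where g2: "locally_integrable M g2" "\<And>B. B \<in> bounded_borel \<Longrightarrow> measure (neg_part l) B = (LINT x:B|M. g2 x)"
    using main[OF loc_measure_uminus[OF l]] ac unfolding neg_part_def by auto
  have "locally_integrable M (\<lambda>x. g1 x - g2 x)"
    using g1(1) g2(1) unfolding locally_integrable_def by (auto intro: set_integral_diff)
  moreover have "l B = (LINT x:B|M. g1 x - g2 x)" if B: "B \<in> bounded_borel" for B
    using jordan[OF l B] g1(2)[OF B] g2(2)[OF B]
      locally_integrable_set[OF g1(1) B sM(1)] locally_integrable_set[OF g2(1) B sM(1)]
    by (simp add: set_integral_diff(2))
  ultimately show ?thesis by (intro exI[of _ "\<lambda>x. g1 x - g2 x"]) auto
qed

lemma loc_measure_RN_complex: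
  fixes l :: "real set \<Rightarrow> complex"
  assumes M: "locally_finite_measure M" and l: "loc_measure l"
    and ac: "\<And>B. B \<in> bounded_borel \<Longrightarrow> emeasure M B = 0 \<Longrightarrow> l B = 0"
  shows "\<exists>g. locally_integrable M g \<and> (\<forall>B\<in>bounded_borel. l B = (LINT x:B|M. g x))"
proof -
  have sM: "sets M = sets borel" using M by (auto simp: locally_finite_measure_def)
  have "loc_measure (\<lambda>B. Re (l B))" "loc_measure (\<lambda>B. Im (l B))"
    using l unfolding loc_measure_def by (auto intro: sums_Re sums_Im)
  then obtain g1 g2 where g1: "locally_integrable M g1" "\<And>B. B \<in> bounded_borel \<Longrightarrow> Re (l B) = (LINT x:B|M. g1 x)"
    and g2: "locally_integrable M g2" "\<And>B. B \<in> bounded_borel \<Longrightarrow> Im (l B) = (LINT x:B|M. g2 x)"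
    using loc_measure_RN_real[OF M] ac by (metis zero_complex.sel)
  let ?g = "\<lambda>x. complex_of_real (g1 x) + \<i> * complex_of_real (g2 x)"
  have int: "set_integrable M B (\<lambda>x. complex_of_real (g1 x))" "set_integrable M B (\<lambda>x. \<i> * complex_of_real (g2 x))"
    if "B \<in> bounded_borel" for B
    using locally_integrable_set[OF g1(1) that sM] locally_integrable_set[OF g2(1) that sM]
    unfolding set_integrable_def by (simp_all add: scaleR_conv_of_real of_real_mult[symmetric]
        mult.left_commute[of _ \<i>] complex_of_real_integrable_eq del: of_real_mult)
  show ?thesis
  proof (intro exI[of _ ?g] conjI ballI)
    show "locally_integrable M ?g"
      unfolding locally_integrable_def using int[of "{_.._}"] by (auto intro: set_integral_add)
    show "l B = (LINT x:B|M. ?g x)" if B: "B \<in> bounded_borel" for B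
      using int[OF B] g1(2)[OF B] g2(2)[OF B]
      by (simp add: set_integral_add set_integral_complex_of_real complex_eq_iff)
  qed
qed

section \<open>Primitives\<close>

text \<open>Encodes df = g dM for a positive measure M. The half-open interval leaves out an atom at
  b, which matches left-continuous representatives.\<close>

definition is_prim :: "real measure \<Rightarrow> (real \<Rightarrow> 'a::{banach, second_countable_topology}) \<Rightarrow> (real \<Rightarrow> 'a) \<Rightarrow> bool" where
  "is_prim M f g \<longleftrightarrow> locally_integrable M g \<and> (\<forall>a b. a \<le> b \<longrightarrow> f b - f a = (LINT x:{a..<b}|M. g x))"

definition prim_of :: "real measure \<Rightarrow> (real \<Rightarrow> 'a::{banach, second_countable_topology}) \<Rightarrow> real \<Rightarrow> 'a" where
  "prim_of M g x = (LINT y:{0..<x}|M. g y) - (LINT y:{x..<0}|M. g y)"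

definition locally_bounded :: "(real \<Rightarrow> 'a::real_normed_vector) \<Rightarrow> bool" where
  "locally_bounded f \<longleftrightarrow> (\<forall>R. \<exists>C. \<forall>x\<in>{-R..R}. norm (f x) \<le> C)"

lemma locally_boundedD:
  assumes "locally_bounded f" shows "\<exists>C\<ge>0. \<forall>x\<in>{a..b}. norm (f x) \<le> C"
proof -
  obtain C where "\<forall>x\<in>{-(max \<bar>a\<bar> \<bar>b\<bar>)..max \<bar>a\<bar> \<bar>b\<bar>}. norm (f x) \<le> C"
    using assms unfolding locally_bounded_def by blast
  moreover have "x \<in> {-(max \<bar>a\<bar> \<bar>b\<bar>)..max \<bar>a\<bar> \<bar>b\<bar>}" if "x \<in> {a..b}" for x
    using that by (auto simp: abs_if max_def split: if_splits)
  ultimately have "\<forall>x\<in>{a..b}. norm (f x) \<le> max C 0" by (auto simp: le_max_iff_disj)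
  then show ?thesis by (intro exI[of _ "max C 0"]) simp
qed

text \<open>If the values differed, left continuity would keep f and h in disjoint open sets on an
  interval ending at x, which has positive Lebesgue measure. The hypothesis is local to (c, x) so
  that it fits supports and solutions known on a bounded interval.\<close>

lemma left_continuous_AE_eq_at:
  fixes f h :: "real \<Rightarrow> 'a::t2_space"
  assumes "continuous (at_left x) f" "continuous (at_left x) h"
    and "c < x" "AE y in lborel. c < y \<and> y < x \<longrightarrow> f y = h y"
  shows "f x = h x"
proof (rule ccontr)
  assume "f x \<noteq> h x"
  then obtain U V where UV: "open U" "open V" "f x \<in> U" "h x \<in> V" "U \<inter> V = {}"
    using hausdorff[of "f x" "h x"] by blast
  have "\<forall>\<^sub>F z in at_left x. f z \<in> U"
    by (rule topological_tendstoD[OF assms(1)[unfolded continuous_within] UV(1,3)])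
  moreover have "\<forall>\<^sub>F z in at_left x. h z \<in> V"
    by (rule topological_tendstoD[OF assms(2)[unfolded continuous_within] UV(2,4)])
  ultimately have "\<forall>\<^sub>F z in at_left x. f z \<noteq> h z"
    by eventually_elim (use UV(5) in auto)
  then obtain b where b: "b < x" "\<And>z. b < z \<Longrightarrow> z < x \<Longrightarrow> f z \<noteq> h z"
    using eventually_at_left[of "x - 1" x] by auto
  obtain N where N: "{y \<in> space lborel. \<not> (c < y \<and> y < x \<longrightarrow> f y = h y)} \<subseteq> N" "emeasure lborel N = 0" "N \<in> sets lborel"
    using AE_E[OF assms(4)] by blast
  have "emeasure lborel {max b c<..<x} \<le> emeasure lborel N"
    using b N by (intro emeasure_mono) auto
  then show False using N(2) b(1) assms(3) by simp
qed

lemma left_continuous_AE_eq: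
  fixes f h :: "real \<Rightarrow> 'a::t2_space"
  assumes "\<And>x. continuous (at_left x) f" "\<And>x. continuous (at_left x) h" "AE x in lborel. f x = h x"
  shows "f x = h x"
  using assms by (intro left_continuous_AE_eq_at[of x f h "x - 1"]) auto

locale lfm =
  fixes M :: "real measure"
  assumes lf: "locally_finite_measure M"
begin

lemma sets_M [simp, measurable_cong]: "sets M = sets borel"
  using lf by (simp add: locally_finite_measure_def)

lemma space_M [simp]: "space M = UNIV"
  using sets_eq_imp_space_eq[OF sets_M] by simp

sublocale sigma_finite_measure M
  by (rule sigma_finite_locally_finite[OF lf])

lemma emeasure_finite: "B \<in> bounded_borel \<Longrightarrow> emeasure M B < \<infinity>"
  using lf by (simp add: locally_finite_measure_def)

lemma loc_int: "locally_integrable M g \<Longrightarrow> B \<in> bounded_borel \<Longrightarrow> set_integrable M B g"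
  by (rule locally_integrable_set) auto

lemma loc_int_measurable:
  fixes g :: "real \<Rightarrow> 'a::{banach, second_countable_topology}"
  assumes "locally_integrable M g" shows "g \<in> borel_measurable borel"
proof (rule borel_measurable_LIMSEQ_metric)
  fix n :: nat
  have "integrable M (\<lambda>x. indicator {-real n..<real n} x *\<^sub>R g x)"
    using loc_int[OF assms, of "{-real n..<real n}"] by (simp add: set_integrable_def)
  from borel_measurable_integrable[OF this]
  show "(\<lambda>x. indicator {-real n..<real n} x *\<^sub>R g x) \<in> borel_measurable borel" by simp
next
  fix x :: real
  obtain N :: nat where N: "\<bar>x\<bar> < real N" using reals_Archimedean2 by blast
  have "\<forall>\<^sub>F n in sequentially. indicator {-real n..<real n} x *\<^sub>R g x = g x"
  proof (rule eventually_sequentiallyI[of N])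
    fix n assume "n \<ge> N"
    then have "- real n \<le> x" "x < real n" using N by linarith+
    then show "indicator {-real n..<real n} x *\<^sub>R g x = g x" by simp
  qed
  then show "(\<lambda>n. indicator {-real n..<real n} x *\<^sub>R g x) \<longlonglongrightarrow> g x"
    by (rule tendsto_eventually)
qed

lemma loc_int_mult_bounded:
  fixes g h :: "real \<Rightarrow> 'a::{banach, second_countable_topology, real_normed_algebra}"
  assumes g: "locally_integrable M g" and [measurable]: "h \<in> borel_measurable borel" and b: "locally_bounded h"
  shows "locally_integrable M (\<lambda>x. h x * g x)"
  unfolding locally_integrable_def
proof (intro allI)
  fix a b' :: real
  have [measurable]: "g \<in> borel_measurable borel" using loc_int_measurable[OF g] .
  obtain C where C: "C \<ge> 0" "\<forall>x\<in>{a..b'}. norm (h x) \<le> C" using locally_boundedD[OF b] by blast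
  show "set_integrable M {a..b'} (\<lambda>x. h x * g x)"
  proof (rule set_integrable_bound)
    show "set_integrable M {a..b'} (\<lambda>x. C *\<^sub>R g x)"
      using loc_int[OF g, of "{a..b'}"] by simp
    show "AE x in M. x \<in> {a..b'} \<longrightarrow> norm (h x * g x) \<le> norm (C *\<^sub>R g x)"
      using C by (auto intro!: order_trans[OF norm_mult_ineq] mult_right_mono)
  qed (simp add: set_borel_measurable_def)
qed

lemma loc_int_bounded:
  fixes h :: "real \<Rightarrow> 'a::{banach, second_countable_topology}"
  assumes [measurable]: "h \<in> borel_measurable borel" and b: "locally_bounded h"
  shows "locally_integrable M h"
  unfolding locally_integrable_def
proof (intro allI)
  fix a b' :: real
  obtain C where C: "C \<ge> 0" "\<forall>x\<in>{a..b'}. norm (h x) \<le> C" using locally_boundedD[OF b] by blast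
  show "set_integrable M {a..b'} h"
  proof (rule set_integrable_bound)
    show "set_integrable M {a..b'} (\<lambda>x. C)"
      using emeasure_finite[of "{a..b'}"] by (simp add: set_integrable_def)
    show "AE x in M. x \<in> {a..b'} \<longrightarrow> norm (h x) \<le> norm C"
      using C by auto
  qed (simp add: set_borel_measurable_def)
qed

lemma loc_int_add: "locally_integrable M f \<Longrightarrow> locally_integrable M g \<Longrightarrow> locally_integrable M (\<lambda>x. f x + g x)"
  and loc_int_diff: "locally_integrable M f \<Longrightarrow> locally_integrable M g \<Longrightarrow> locally_integrable M (\<lambda>x. f x - g x)"
  unfolding locally_integrable_def by (auto intro: set_integral_add set_integral_diff)

lemma loc_int_norm: "locally_integrable M g \<Longrightarrow> locally_integrable M (\<lambda>x. norm (g x))"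
  unfolding locally_integrable_def by (auto intro: set_integrable_norm)

lemma int_split:
  assumes "locally_integrable M g" "a \<le> b" "b \<le> c"
  shows "(LINT x:{a..<c}|M. g x) = (LINT x:{a..<b}|M. g x) + (LINT x:{b..<c}|M. g x)"
proof -
  have "{a..<c} = {a..<b} \<union> {b..<c}" using assms by auto
  then show ?thesis
    using assms(1) by (simp only:) (intro set_integral_Un loc_int, auto)
qed

lemma prim_of_0 [simp]: "prim_of M g 0 = 0"
  by (simp add: prim_of_def set_lebesgue_integral_def)

lemma is_prim_prim_of:
  assumes "locally_integrable M g" shows "is_prim M (prim_of M g) g"
  unfolding is_prim_def
proof (intro conjI allI impI assms)
  fix a b :: real assume ab: "a \<le> b"
  have e: "(LINT x:{c..<d}|M. g x) = 0" if "d \<le> c" for c d :: real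
    using that by (simp add: set_lebesgue_integral_def)
  have e0: "(LINT x:{}|M. g x) = 0" by (simp add: set_lebesgue_integral_def)
  consider "0 \<le> a" | "b \<le> 0" | "a \<le> 0" "0 \<le> b" by linarith
  then show "prim_of M g b - prim_of M g a = (LINT x:{a..<b}|M. g x)"
  proof cases
    case 1 then show ?thesis using int_split[OF assms 1 ab] ab by (simp add: prim_of_def e e0)
  next
    case 2 then show ?thesis using int_split[OF assms ab 2] ab by (simp add: prim_of_def e e0)
  next
    case 3 then show ?thesis using int_split[OF assms 3] by (simp add: prim_of_def e e0)
  qed
qed

lemma prim_int: "is_prim M f g \<Longrightarrow> locally_integrable M g"
  by (simp add: is_prim_def)

lemma prim_diff: "is_prim M f g \<Longrightarrow> a \<le> b \<Longrightarrow> f b - f a = (LINT x:{a..<b}|M. g x)"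
  by (simp add: is_prim_def)

lemma prim_lin:
  fixes f g :: "real \<Rightarrow> 'a::{banach, second_countable_topology, real_normed_field}"
  assumes "is_prim M f g" "is_prim M h k" shows "is_prim M (\<lambda>x. c * f x + d * h x) (\<lambda>x. c * g x + d * k x)"
  unfolding is_prim_def
proof (intro conjI allI impI)
  note i = prim_int[OF assms(1)] prim_int[OF assms(2)]
  show "locally_integrable M (\<lambda>x. c * g x + d * k x)"
    using i unfolding locally_integrable_def by (auto intro!: set_integral_add)
  fix a b :: real assume ab: "a \<le> b"
  show "c * f b + d * h b - (c * f a + d * h a) = (LINT x:{a..<b}|M. c * g x + d * k x)"
    using prim_diff[OF assms(1) ab] prim_diff[OF assms(2) ab] loc_int[OF i(1), of "{a..<b}"] loc_int[OF i(2), of "{a..<b}"]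
    by (simp add: set_integral_add algebra_simps flip: right_diff_distrib)
qed

lemma prim_cnj:
  assumes "is_prim M f g" shows "is_prim M (\<lambda>x. cnj (f x)) (\<lambda>x. cnj (g x))"
  unfolding is_prim_def
proof (intro conjI allI impI)
  show "locally_integrable M (\<lambda>x. cnj (g x))"
    using prim_int[OF assms] complex_integrable_cnj[of M "\<lambda>x. indicator _ x *\<^sub>R g x"]
    unfolding locally_integrable_def set_integrable_def by simp
  fix a b :: real assume ab: "a \<le> b"
  show "cnj (f b) - cnj (f a) = (LINT x:{a..<b}|M. cnj (g x))"
  proof -
    have "cnj (f b) - cnj (f a) = cnj (LINT x:{a..<b}|M. g x)"
      by (simp flip: prim_diff[OF assms ab])
    then show ?thesis by (simp add: set_lebesgue_integral_def flip: Bochner_Integration.integral_cnj)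
  qed
qed

lemma prim_const: "is_prim M (\<lambda>_. c) (\<lambda>_. 0)"
  by (simp add: is_prim_def locally_integrable_def set_integrable_def)

lemma prim_unique_upto_const:
  assumes "is_prim M f g" "is_prim M h g" shows "f x - f 0 = h x - h 0"
  using prim_diff[OF assms(1), of 0 x] prim_diff[OF assms(2), of 0 x]
    prim_diff[OF assms(1), of x 0] prim_diff[OF assms(2), of x 0]
  by (cases "0 \<le> x") (auto simp: algebra_simps)

lemma prim_measurable:
  assumes "is_prim M f g" shows "f \<in> borel_measurable borel"
proof -
  have [measurable]: "g \<in> borel_measurable borel" using loc_int_measurable prim_int assms by blast
  have "f x = f 0 + prim_of M g x" for x
  proof -
    have "f x - f 0 = prim_of M g x"
      using prim_unique_upto_const[OF assms is_prim_prim_of[OF prim_int[OF assms]], of x] by simp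
    then show ?thesis by (simp add: diff_eq_eq add.commute)
  qed
  then have eq: "f = (\<lambda>x. f 0 + prim_of M g x)" by (rule ext)
  have [measurable]: "g \<in> borel_measurable M"
    using loc_int_measurable[OF prim_int[OF assms]] by simp
  \<comment> \<open>Written this way the integrands are jointly measurable in (x, y), and
    measurability of parameter integrals applies.\<close>
  have "prim_of M g = (\<lambda>x. (LINT y|M. (if 0 \<le> y \<and> y < x then g y else 0))
      - (LINT y|M. (if x \<le> y \<and> y < 0 then g y else 0)))"
    unfolding prim_of_def[abs_def] set_lebesgue_integral_def
    by (intro ext arg_cong2[where f="(-)"] Bochner_Integration.integral_cong) (auto simp: indicator_def)
  also have "\<dots> \<in> borel_measurable borel" by measurable
  finally have "prim_of M g \<in> borel_measurable borel" .
  then have "(\<lambda>x. f 0 + prim_of M g x) \<in> borel_measurable borel" by measurable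
  then show ?thesis by (subst eq)
qed

lemma norm_int_le:
  assumes "locally_integrable M g" "B \<in> bounded_borel"
  shows "norm (LINT x:B|M. g x) \<le> (LINT x:B|M. norm (g x))"
  using set_integral_norm_bound[OF loc_int[OF assms]] .

lemma int_norm_mono:
  assumes "locally_integrable M g" "A \<subseteq> B" "A \<in> bounded_borel" "B \<in> bounded_borel"
  shows "(LINT x:A|M. norm (g x)) \<le> (LINT x:B|M. norm (g x))"
  unfolding set_lebesgue_integral_def
proof (rule integral_mono)
  note i = loc_int[OF loc_int_norm[OF assms(1)]]
  show "integrable M (\<lambda>x. indicator A x *\<^sub>R norm (g x))" "integrable M (\<lambda>x. indicator B x *\<^sub>R norm (g x))"
    using i[OF assms(3)] i[OF assms(4)] by (auto simp: set_integrable_def)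
qed (use assms(2) in \<open>auto simp: indicator_def\<close>)

lemma prim_locally_bounded:
  assumes "is_prim M f g" shows "locally_bounded f"
  unfolding locally_bounded_def
proof
  fix R
  show "\<exists>C. \<forall>x\<in>{-R..R}. norm (f x) \<le> C"
  proof (intro exI ballI)
    fix x assume x: "x \<in> {-R..R}"
    have "norm (f x) \<le> norm (f (-R)) + norm (f x - f (-R))"
      using norm_triangle_ineq[of "f (-R)" "f x - f (-R)"] by simp
    also have "norm (f x - f (-R)) \<le> (LINT x:{-R..<x}|M. norm (g x))"
      using x by (simp add: prim_diff[OF assms] norm_int_le[OF prim_int[OF assms]])
    also have "\<dots> \<le> (LINT x:{-R..R}|M. norm (g x))"
      using x by (intro int_norm_mono[OF prim_int[OF assms]]) auto
    finally show "norm (f x) \<le> norm (f (-R)) + (LINT x:{-R..R}|M. norm (g x))" by simp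
  qed
qed

text \<open>As s increases to x, the intervals [s, x) shrink to the empty set, x itself being
  excluded; by dominated convergence the increments of f tend to 0 even when M has an atom at
  x.\<close>

lemma prim_left_continuous:
  assumes "is_prim M f g" shows "continuous (at_left x) f"
  unfolding continuous_within
proof (rule tendsto_at_left_sequentially[of "x - 1"])
  fix S :: "nat \<Rightarrow> real" assume S: "\<And>n. S n < x" "\<And>n. x - 1 < S n" "incseq S" "S \<longlonglongrightarrow> x"
  have i: "set_integrable M {x-1..<x} g" by (intro loc_int prim_int[OF assms]) simp
  have [measurable]: "g \<in> borel_measurable borel" using loc_int_measurable prim_int assms by blast
  have "(\<lambda>n. LINT y|M. indicator {S n..<x} y *\<^sub>R g y) \<longlonglongrightarrow> (LINT y|M. 0)"
  proof (rule integral_dominated_convergence[where w="\<lambda>y. norm (indicator {x-1..<x} y *\<^sub>R g y)"])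
    show "integrable M (\<lambda>y. norm (indicator {x-1..<x} y *\<^sub>R g y))"
      using i unfolding set_integrable_def by (rule integrable_norm)
    show "AE y in M. (\<lambda>n. indicator {S n..<x} y *\<^sub>R g y) \<longlonglongrightarrow> 0"
    proof (rule AE_I2)
      fix y
      show "(\<lambda>n. indicator {S n..<x} y *\<^sub>R g y) \<longlonglongrightarrow> 0"
      proof (cases "y < x")
        case True
        have "\<forall>\<^sub>F n in sequentially. y < S n" using order_tendstoD(1)[OF S(4) True] .
        then have "\<forall>\<^sub>F n in sequentially. indicator {S n..<x} y *\<^sub>R g y = 0"
          by eventually_elim auto
        then show ?thesis by (rule tendsto_eventually)
      qed auto
    qed
    show "AE y in M. norm (indicator {S n..<x} y *\<^sub>R g y) \<le> norm (indicator {x-1..<x} y *\<^sub>R g y)" for n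
      using S(2)[of n] by (auto simp: indicator_def)
  qed auto
  then have "(\<lambda>n. f x - f (S n)) \<longlonglongrightarrow> 0"
    using S(1) prim_diff[OF assms less_imp_le] by (simp add: set_lebesgue_integral_def)
  from tendsto_diff[OF tendsto_const[of "f x"] this] show "(\<lambda>n. f (S n)) \<longlonglongrightarrow> f x" by simp
qed simp

lemma prim_bv:
  fixes f :: "real \<Rightarrow> complex"
  assumes "is_prim M f g" shows "locally_bv f"
  unfolding locally_bv_def
proof (intro allI)
  fix a b :: real
  note i = prim_int[OF assms] loc_int_norm[OF prim_int[OF assms]]
  show "\<exists>C. \<forall>(x :: nat \<Rightarrow> real) n. mono x \<and> range x \<subseteq> {a..b} \<longrightarrow> (\<Sum>i<n. cmod (f (x (Suc i)) - f (x i))) \<le> C"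
  proof (intro exI allI impI)
    fix x :: "nat \<Rightarrow> real" and n assume x: "mono x \<and> range x \<subseteq> {a..b}"
    have mx: "x i \<le> x j" if "i \<le> j" for i j using x that by (auto dest: monoD)
    have "(\<Sum>i<n. cmod (f (x (Suc i)) - f (x i))) \<le> (\<Sum>i<n. LINT y:{x i..<x (Suc i)}|M. cmod (g y))"
      using mx by (intro sum_mono) (simp add: prim_diff[OF assms] norm_int_le[OF i(1)])
    also have "\<dots> = (LINT y:{x 0..<x n}|M. cmod (g y))"
    proof (induction n)
      case 0 then show ?case by (simp add: set_lebesgue_integral_def)
    next
      case (Suc n)
      then show ?case using int_split[OF i(2) mx mx, of 0 n "Suc n"] by simp
    qed
    also have "\<dots> \<le> (LINT y:{a..b}|M. cmod (g y))"
      using x by (intro int_norm_mono[OF i(1)]) (auto simp: subset_eq intro: order_trans less_imp_le, meson less_imp_le order_trans rangeI)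
    finally show "(\<Sum>i<n. cmod (f (x (Suc i)) - f (x i))) \<le> (LINT y:{a..b}|M. cmod (g y))" .
  qed
qed

lemma int_unique_AE:
  fixes g h :: "real \<Rightarrow> 'a::{banach, second_countable_topology}"
  assumes g: "locally_integrable M g" and h: "locally_integrable M h"
    and eq: "\<And>a b. a \<le> b \<Longrightarrow> (LINT x:{a..<b}|M. g x) = (LINT x:{a..<b}|M. h x)"
  shows "AE x in M. g x = h x"
proof -
  have eqB: "(LINT x:B|M. g x) = (LINT x:B|M. h x)" if "B \<in> bounded_borel" for B
    using loc_measure_unique[OF loc_measure_integral[OF sets_M g] loc_measure_integral[OF sets_M h] eq that] .
  have "AE x in M. indicator {-real n..<real n} x *\<^sub>R g x = indicator {-real n..<real n} x *\<^sub>R h x" for n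
  proof (rule density_unique_banach)
    let ?I = "{-real n..<real n}"
    show "integrable M (\<lambda>x. indicator ?I x *\<^sub>R g x)" "integrable M (\<lambda>x. indicator ?I x *\<^sub>R h x)"
      using loc_int[OF g, of ?I] loc_int[OF h, of ?I] by (auto simp: set_integrable_def)
    fix A assume "A \<in> sets M"
    then have "A \<inter> ?I \<in> bounded_borel" using bounded_borel_Int[of ?I A] by (simp add: Int_commute)
    from eqB[OF this] show "(LINT x:A|M. indicator ?I x *\<^sub>R g x) = (LINT x:A|M. indicator ?I x *\<^sub>R h x)"
      unfolding set_lebesgue_integral_def by (simp add: indicator_inter_arith)
  qed
  then have "AE x in M. \<forall>n. indicator {-real n..<real n} x *\<^sub>R g x = indicator {-real n..<real n} x *\<^sub>R h x"
    by (subst AE_all_countable) auto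
  then show ?thesis
  proof eventually_elim
    fix x assume eqn: "\<forall>n. indicator {-real n..<real n} x *\<^sub>R g x = indicator {-real n..<real n} x *\<^sub>R h x"
    obtain n :: nat where "\<bar>x\<bar> < real n" using reals_Archimedean2 by blast
    then show "g x = h x" using eqn[rule_format, of n] by (simp add: abs_less_iff)
  qed
qed

lemma prim_unique_AE: "is_prim M f g \<Longrightarrow> is_prim M f h \<Longrightarrow> AE x in M. g x = h x"
  unfolding is_prim_def by (intro int_unique_AE) auto

lemma prim_cong_AE:
  assumes "is_prim M f g" "AE x in M. g x = h x" "h \<in> borel_measurable borel"
  shows "is_prim M f h"
proof -
  note [measurable] = assms(3) loc_int_measurable[OF prim_int[OF assms(1)]]
  have "set_integrable M B h \<and> (LINT x:B|M. h x) = (LINT x:B|M. g x)" if "B \<in> bounded_borel" for B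
  proof
    have [measurable]: "B \<in> sets borel" using that by (simp add: bounded_borel_def)
    have ae: "AE x in M. indicator B x *\<^sub>R g x = indicator B x *\<^sub>R h x" using assms(2) by auto
    show "set_integrable M B h"
      using loc_int[OF prim_int[OF assms(1)] that] ae unfolding set_integrable_def
      by (subst integrable_cong_AE[symmetric]) auto
    show "(LINT x:B|M. h x) = (LINT x:B|M. g x)"
      unfolding set_lebesgue_integral_def using ae by (intro integral_cong_AE) auto
  qed
  then show ?thesis using assms(1) unfolding is_prim_def locally_integrable_def by simp
qed

text \<open>Integration by parts, by Fubini on the square \<open>[a, b)\<^sup>2\<close> cut along its diagonal, which
  is a null set for \<open>M \<Otimes> lborel\<close>.\<close>

lemma prim_product:
  fixes F G :: "real \<Rightarrow> 'a::{banach, second_countable_topology, real_normed_field}"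
  assumes F: "is_prim M F g" and G: "is_prim lborel G k" and ab: "a \<le> b"
  shows "F b * G b - F a * G a = (LINT t:{a..<b}|lborel. F t * k t) + (LINT s:{a..<b}|M. g s * G s)"
proof -
  interpret L: lfm lborel by standard (rule locally_finite_lborel)
  interpret P: pair_sigma_finite M lborel ..
  let ?I = "{a..<b}"
  have [measurable]: "g \<in> borel_measurable borel" "k \<in> borel_measurable borel"
    "F \<in> borel_measurable borel" "G \<in> borel_measurable borel"
    using loc_int_measurable prim_int F L.loc_int_measurable L.prim_int G prim_measurable L.prim_measurable by blast+
  define g' where "g' s = indicator ?I s *\<^sub>R g s" for s
  define k' where "k' s = indicator ?I s *\<^sub>R k s" for s
  have ig: "integrable M g'" using loc_int[OF prim_int[OF F], of ?I] by (simp add: set_integrable_def g'_def[abs_def])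
  have ik: "integrable lborel k'" using L.loc_int[OF L.prim_int[OF G], of ?I] by (simp add: set_integrable_def k'_def[abs_def])
  have [measurable]: "g' \<in> borel_measurable borel" "k' \<in> borel_measurable borel"
    unfolding g'_def[abs_def] k'_def[abs_def] by measurable
  let ?h = "\<lambda>(s, t). g' s * k' t"
  have ih: "integrable (M \<Otimes>\<^sub>M lborel) ?h"
    by (rule P.Fubini_integrable) (use ig ik in \<open>auto simp: norm_mult\<close>)
  \<comment> \<open>The diagonal goes to \<open>H2\<close>: the slice s < t is exactly the interval
    behind \<open>F t - F a\<close>, and in the slice t \<le> s the extra point is null for Lebesgue
    measure, though it may be an atom of M.\<close>
  define H1 where "H1 s t = (if s < t then g' s * k' t else 0)" for s t
  define H2 where "H2 s t = (if t \<le> s then g' s * k' t else 0)" for s t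
  have i1: "integrable (M \<Otimes>\<^sub>M lborel) (case_prod H1)"
  proof (rule Bochner_Integration.integrable_bound[OF ih])
    show "case_prod H1 \<in> borel_measurable (M \<Otimes>\<^sub>M lborel)" unfolding H1_def[abs_def] by measurable
  qed (auto simp: H1_def)
  have i2: "integrable (M \<Otimes>\<^sub>M lborel) (case_prod H2)"
  proof (rule Bochner_Integration.integrable_bound[OF ih])
    show "case_prod H2 \<in> borel_measurable (M \<Otimes>\<^sub>M lborel)" unfolding H2_def[abs_def] by measurable
  qed (auto simp: H2_def)
  have Fd: "(LINT s|M. H1 s t) = k' t * (F t - F a)" for t
  proof (cases "t \<in> ?I")
    case True
    have "(LINT s|M. H1 s t) = (LINT s|M. (indicator {a..<t} s *\<^sub>R g s) * k' t)"
      using True by (intro Bochner_Integration.integral_cong) (auto simp: H1_def g'_def indicator_def)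
    also have "\<dots> = (F t - F a) * k' t"
      using True prim_diff[OF F, of a t] by (simp add: set_lebesgue_integral_def del: mult_scaleR_left)
    finally show ?thesis by simp
  next
    case False
    then have "k' t = 0" by (simp add: k'_def)
    then have "H1 s t = 0" for s by (simp add: H1_def)
    then show ?thesis using \<open>k' t = 0\<close> by simp
  qed
  have Gd: "(LINT t|lborel. H2 s t) = g' s * (G s - G a)" for s
  proof (cases "s \<in> ?I")
    case True
    have ae: "AE t in lborel. t \<noteq> s" using AE_lborel_singleton[of s] by simp
    have "(LINT t|lborel. H2 s t) = (LINT t|lborel. g' s * (indicator {a..<s} t *\<^sub>R k t))"
    proof (rule integral_cong_AE)
      show "AE t in lborel. H2 s t = g' s * (indicator {a..<s} t *\<^sub>R k t)"
        using ae by eventually_elim (use True in \<open>auto simp: H2_def k'_def indicator_def\<close>)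
    qed (auto simp: H2_def[abs_def])
    also have "\<dots> = g' s * (G s - G a)"
      using True L.prim_diff[OF G, of a s] by (simp add: set_lebesgue_integral_def del: mult_scaleR_right)
    finally show ?thesis .
  next
    case False
    then have "g' s = 0" by (simp add: g'_def)
    then have "H2 s t = 0" for t by (simp add: H2_def)
    then show ?thesis using \<open>g' s = 0\<close> by simp
  qed
  have f1: "(LINT t|lborel. LINT s|M. H1 s t) = (LINT p|(M \<Otimes>\<^sub>M lborel). case_prod H1 p)"
    using P.integral_snd[OF i1] by simp
  have f2: "(LINT s|M. LINT t|lborel. H2 s t) = (LINT p|(M \<Otimes>\<^sub>M lborel). case_prod H2 p)"
    using P.integral_fst'[OF i2] by simp
  have f3: "(LINT s|M. LINT t|lborel. g' s * k' t) = (LINT p|(M \<Otimes>\<^sub>M lborel). ?h p)"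
    using P.integral_fst'[OF ih] by simp
  have "(LINT p|(M \<Otimes>\<^sub>M lborel). ?h p) = (LINT p|(M \<Otimes>\<^sub>M lborel). case_prod H1 p + case_prod H2 p)"
    by (intro Bochner_Integration.integral_cong) (auto simp: H1_def H2_def)
  also have "\<dots> = (LINT t|lborel. k' t * (F t - F a)) + (LINT s|M. g' s * (G s - G a))"
    using i1 i2 by (simp add: f1[symmetric] f2[symmetric] Fd Gd)
  finally have main: "(LINT s|M. g' s) * (LINT t|lborel. k' t) =
      (LINT t|lborel. k' t * (F t - F a)) + (LINT s|M. g' s * (G s - G a))"
    unfolding f3[symmetric] by simp
  have I1: "(LINT s|M. g' s) = F b - F a" "(LINT t|lborel. k' t) = G b - G a"
    using prim_diff[OF F ab] L.prim_diff[OF G ab] by (auto simp: g'_def k'_def set_lebesgue_integral_def)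
  have int1: "integrable lborel (\<lambda>t. k' t * F t)"
    using L.loc_int[OF L.loc_int_mult_bounded[OF L.prim_int[OF G] _ prim_locally_bounded[OF F]], of ?I]
    by (simp add: set_integrable_def k'_def mult.commute)
  have int2: "integrable M (\<lambda>s. g' s * G s)"
    using loc_int[OF loc_int_mult_bounded[OF prim_int[OF F] _ L.prim_locally_bounded[OF G]], of ?I]
    by (simp add: set_integrable_def g'_def mult.commute)
  have e1: "(LINT t|lborel. k' t * (F t - F a)) = (LINT t|lborel. k' t * F t) - (G b - G a) * F a"
    using int1 ik by (simp add: right_diff_distrib I1(2)[symmetric])
  have e2: "(LINT s|M. g' s * (G s - G a)) = (LINT s|M. g' s * G s) - (F b - F a) * G a"
    using int2 ig by (simp add: right_diff_distrib I1(1)[symmetric])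
  have e3: "(LINT t|lborel. k' t * F t) = (LINT t:?I|lborel. F t * k t)"
    unfolding set_lebesgue_integral_def by (intro Bochner_Integration.integral_cong) (auto simp: k'_def)
  have e4: "(LINT s|M. g' s * G s) = (LINT s:?I|M. g s * G s)"
    unfolding set_lebesgue_integral_def by (intro Bochner_Integration.integral_cong) (auto simp: g'_def)
  show ?thesis
    using main unfolding e1 e2 e3 e4 I1 by (simp add: algebra_simps)
qed

end

interpretation lborel: lfm lborel
  by standard (rule locally_finite_lborel)

section \<open>Quasi-derivatives\<close>

text \<open>A Hahn set E turns df = g d\<mu> into \<open>is_prim\<close> for the positive measure
  |\<mu>| with density \<sigma> g, \<sigma> being the sign; the passage is reversible since \<sigma>
  squares to 1.\<close>

locale signed_rep =
  fixes \<mu> :: "real set \<Rightarrow> real" and E :: "real set"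
  assumes mu: "loc_measure \<mu>" and E: "E \<in> sets borel"
    and posE: "emeasure (pos_part \<mu>) (- E) = 0" and negE: "emeasure (neg_part \<mu>) E = 0"
begin

abbreviation "M \<equiv> variation \<mu>"
abbreviation "\<sigma> \<equiv> hahn_sign E"

sublocale lfm M
  by standard (rule locally_finite_variation[OF mu])

lemma sigma_sq [simp]: "\<sigma> x * \<sigma> x = 1" "\<sigma> x * (\<sigma> x * r) = r" "\<bar>\<sigma> x\<bar> = 1"
  by (auto simp: hahn_sign_def)

lemma sigma_scale [simp]: "\<sigma> x *\<^sub>R \<sigma> x *\<^sub>R (g x :: 'a::real_vector) = g x"
  by simp

lemma sigma_measurable [measurable]: "\<sigma> \<in> borel_measurable borel"
  using E by (rule measurable_hahn_sign)

lemma loc_int_sigma: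
  fixes g :: "real \<Rightarrow> 'a::{banach, second_countable_topology}"
  assumes "locally_integrable M g" shows "locally_integrable M (\<lambda>x. \<sigma> x *\<^sub>R g x)"
  unfolding locally_integrable_def
proof (intro allI)
  fix a b
  have [measurable]: "g \<in> borel_measurable borel" using loc_int_measurable[OF assms] .
  show "set_integrable M {a..b} (\<lambda>x. \<sigma> x *\<^sub>R g x)"
    by (rule set_integrable_bound[OF loc_int[OF assms, of "{a..b}"]])
      (auto simp: set_borel_measurable_def)
qed

lemma signed_integral_set:
  fixes g :: "real \<Rightarrow> 'a::{banach, second_countable_topology}"
  assumes "locally_integrable M g" "B \<in> bounded_borel"
  shows "signed_integral \<mu> (\<lambda>x. indicator B x *\<^sub>R g x) = (LINT x:B|M. \<sigma> x *\<^sub>R g x)"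
proof -
  have "integrable M (\<lambda>x. indicator B x *\<^sub>R g x)"
    using loc_int[OF assms] by (simp add: set_integrable_def)
  from signed_integral_hahn[OF E posE negE this] show ?thesis
    by (simp add: set_lebesgue_integral_def mult.commute)
qed

lemma prim_stieltjes:
  assumes "is_prim M f (\<lambda>x. \<sigma> x *\<^sub>R g x)" "B \<in> bounded_borel"
  shows "stieltjes f B = (LINT x:B|M. \<sigma> x *\<^sub>R g x)"
  using assms by (intro stieltjes_eq loc_measure_integral prim_int) (auto simp: prim_diff)

lemma prim_AC_loc:
  assumes p: "is_prim M f (\<lambda>x. \<sigma> x *\<^sub>R g x)" shows "f \<in> AC_loc \<mu>" "has_quasi_deriv \<mu> f g"
proof -
  have "locally_integrable M (\<lambda>x. \<sigma> x *\<^sub>R \<sigma> x *\<^sub>R g x)" by (rule loc_int_sigma[OF prim_int[OF p]])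
  then have g: "locally_integrable M g" by simp
  show "has_quasi_deriv \<mu> f g"
    unfolding has_quasi_deriv_def using g prim_stieltjes[OF p] signed_integral_set[OF g] by simp
  show "f \<in> AC_loc \<mu>"
    unfolding AC_loc_def
  proof (intro CollectI conjI ballI impI allI)
    show "continuous (at_left x) f" for x using prim_left_continuous[OF p] .
    show "locally_bv f" using prim_bv[OF p] .
    fix B assume B: "B \<in> bounded_borel" "emeasure M B = 0"
    then have "AE x in M. x \<notin> B" by (intro AE_not_in) (auto simp: bounded_borel_def intro!: null_setsI)
    then have "AE x in M. indicator B x *\<^sub>R (\<sigma> x *\<^sub>R g x) = 0" by auto
    then show "stieltjes f B = 0"
      unfolding prim_stieltjes[OF p B(1)] set_lebesgue_integral_def by (rule integral_eq_zero_AE)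
  qed
qed

lemma AC_loc_stieltjes:
  assumes "f \<in> AC_loc \<mu>" shows "loc_measure (stieltjes f)" "a \<le> b \<Longrightarrow> stieltjes f {a..<b} = f b - f a"
proof -
  obtain m where "loc_measure m" "\<And>a b. a \<le> b \<Longrightarrow> m {a..<b} = f b - f a"
    using stieltjes_exists assms unfolding AC_loc_def by blast
  then show "loc_measure (stieltjes f)" "a \<le> b \<Longrightarrow> stieltjes f {a..<b} = f b - f a"
    by (auto intro: stieltjesI)
qed

lemma has_quasi_deriv_prim:
  assumes f: "f \<in> AC_loc \<mu>" and h: "has_quasi_deriv \<mu> f g"
  shows "is_prim M f (\<lambda>x. \<sigma> x *\<^sub>R g x)"
  unfolding is_prim_def
proof (intro conjI allI impI)
  have g: "locally_integrable M g" using h by (simp add: has_quasi_deriv_def)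
  show "locally_integrable M (\<lambda>x. \<sigma> x *\<^sub>R g x)" by (rule loc_int_sigma[OF g])
  fix a b :: real assume "a \<le> b"
  then show "f b - f a = (LINT x:{a..<b}|M. \<sigma> x *\<^sub>R g x)"
    using h AC_loc_stieltjes(2)[OF f] signed_integral_set[OF g, of "{a..<b}"]
    by (simp add: has_quasi_deriv_def)
qed

lemma AC_loc_prim:
  assumes f: "f \<in> AC_loc \<mu>" shows "\<exists>g. is_prim M f (\<lambda>x. \<sigma> x *\<^sub>R g x)"
proof -
  have "\<exists>g. locally_integrable M g \<and> (\<forall>B\<in>bounded_borel. stieltjes f B = (LINT x:B|M. g x))"
    by (rule loc_measure_RN_complex[OF lf AC_loc_stieltjes(1)[OF f]]) (use f in \<open>auto simp: AC_loc_def\<close>)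
  then obtain g where g: "locally_integrable M g" "\<And>B. B\<in>bounded_borel \<Longrightarrow> stieltjes f B = (LINT x:B|M. g x)"
    by blast
  have "is_prim M f g"
    unfolding is_prim_def using g AC_loc_stieltjes(2)[OF f] by simp
  \<comment> \<open>Multiplication by \<sigma> converts the density for |\<mu>| into the one for
    \<mu>.\<close>
  then show ?thesis by (intro exI[of _ "\<lambda>x. \<sigma> x *\<^sub>R g x"]) simp
qed

lemma quasi_deriv_prim:
  assumes "f \<in> AC_loc \<mu>" shows "is_prim M f (\<lambda>x. \<sigma> x *\<^sub>R quasi_deriv \<mu> f x)"
proof -
  have "\<exists>g. has_quasi_deriv \<mu> f g" using AC_loc_prim[OF assms] prim_AC_loc(2) by blast
  then have "has_quasi_deriv \<mu> f (quasi_deriv \<mu> f)" unfolding quasi_deriv_def by (rule someI_ex)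
  then show ?thesis by (rule has_quasi_deriv_prim[OF assms])
qed

lemma prim_sigma_unique:
  fixes g h :: "real \<Rightarrow> complex"
  assumes "is_prim M f (\<lambda>x. \<sigma> x *\<^sub>R g x)" "is_prim M f (\<lambda>x. \<sigma> x *\<^sub>R h x)"
  shows "AE x in M. g x = h x"
  using prim_unique_AE[OF assms] by eventually_elim (simp add: hahn_sign_def split: if_splits)

end

text \<open>Lebesgue measure is dP for \<nu> = 0, so \<open>dP_structure\<close> determines its
  variation off a null set N; the part inside N is shown to vanish directly.\<close>

lemma variation_lborel: "variation (measure lborel) = lborel"
  and signed_rep_lborel: "signed_rep (measure lborel) UNIV"
proof -
  have neg0: "emeasure (neg_part (measure lborel)) B = 0" if B: "B \<in> sets borel" for B
  proof -
    have "(SUP A \<in> {A \<in> bounded_borel. A \<subseteq> B}. ennreal (- measure lborel A)) \<le> 0"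
      by (intro SUP_least) (auto simp: ennreal_neg)
    then show ?thesis
      unfolding neg_part_def emeasure_pos_part[OF loc_measure_uminus[OF loc_measure_lborel] B] by simp
  qed
  have "loc_measure (\<lambda>_. 0::real)" by (simp add: loc_measure_def)
  moreover have "lebesgue_singular (\<lambda>_. 0)"
  proof -
    have 0: "emeasure (pos_part (\<lambda>_. 0)) UNIV = 0"
      using emeasure_pos_part[OF \<open>loc_measure (\<lambda>_. 0::real)\<close>, of UNIV]
      by (auto intro!: antisym SUP_least)
    then have "emeasure (variation (\<lambda>_. 0)) UNIV = 0"
      by (subst emeasure_variation) (auto simp: neg_part_def)
    then show ?thesis unfolding lebesgue_singular_def by (intro bexI[of _ "{}"]) auto
  qed
  ultimately obtain E N where EN: "N \<in> sets borel" "emeasure lborel N = 0"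
    "\<And>B. B\<in>sets borel \<Longrightarrow> emeasure lborel B = emeasure (variation (dP (\<lambda>_. 0))) (B - N)"
    using dP_structure[of "\<lambda>_. 0"] by blast
  have dP0: "dP (\<lambda>_. 0) = measure lborel" by (simp add: dP_def fun_eq_iff)
  show "signed_rep (measure lborel) UNIV"
  proof
    show "emeasure (pos_part (measure lborel)) (- UNIV) = 0" by simp
  qed (use loc_measure_lborel neg0 in auto)
  show "variation (measure lborel) = lborel"
  proof (rule measure_eqI)
    fix B assume "B \<in> sets (variation (measure lborel))"
    then have B: "B \<in> sets borel" by simp
    have "emeasure (variation (measure lborel)) (B \<inter> N) = 0"
    proof -
      have "emeasure (pos_part (measure lborel)) (B \<inter> N) \<le> 0"
        unfolding emeasure_pos_part[OF loc_measure_lborel sets.Int[OF B EN(1)]]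
      proof (rule SUP_least)
        fix A assume A: "A \<in> {A \<in> bounded_borel. A \<subseteq> B \<inter> N}"
        then have "emeasure lborel A \<le> emeasure lborel N" using EN(1) by (intro emeasure_mono) auto
        then show "ennreal (measure lborel A) \<le> 0" using EN(2) by (simp add: measure_def)
      qed
      then show ?thesis using neg0[of "B \<inter> N"] B EN(1) by (subst emeasure_variation) auto
    qed
    moreover have "emeasure (variation (measure lborel)) B
        = emeasure (variation (measure lborel)) (B \<inter> N) + emeasure (variation (measure lborel)) (B - N)"
      using B EN(1) by (subst plus_emeasure) (auto intro!: arg_cong[where f="emeasure _"])
    ultimately show "emeasure (variation (measure lborel)) B = emeasure lborel B"
      using EN(3)[OF B] by (simp add: dP0)
  qed simp
qed

section \<open>The differential equation\<close>

context lfm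
begin

lemma prim_of_lin:
  fixes g h :: "real \<Rightarrow> 'a::{banach, second_countable_topology, real_normed_field}"
  assumes "locally_integrable M g" "locally_integrable M h"
  shows "prim_of M (\<lambda>x. c * g x + d * h x) x = c * prim_of M g x + d * prim_of M h x"
proof -
  have "(LINT y:B|M. c * g y + d * h y) = c * (LINT y:B|M. g y) + d * (LINT y:B|M. h y)"
    if "B \<in> bounded_borel" for B
    using loc_int[OF assms(1) that] loc_int[OF assms(2) that] by (simp add: set_integral_add)
  then show ?thesis by (simp add: prim_of_def algebra_simps)
qed

text \<open>The bound C is asked only between 0 and x, on the side of x. In the Picard iteration
  this allows C to depend on x through the monotone quantity |Q x|.\<close>

lemma prim_of_norm_le:
  assumes g: "locally_integrable M g" and x: "\<bar>x\<bar> \<le> R"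
    and b: "\<And>y. \<bar>y\<bar> \<le> \<bar>x\<bar> \<Longrightarrow> 0 \<le> x * y \<Longrightarrow> norm (g y) \<le> C"
  shows "norm (prim_of M g x) \<le> C * measure M {-R..R}"
proof -
  have C: "0 \<le> C" using order_trans[OF norm_ge_zero b[of 0]] by simp
  have le: "norm (LINT y:B|M. g y) \<le> C * measure M {-R..R}"
    if B: "B \<in> bounded_borel" "B \<subseteq> {-R..R}" and bB: "\<And>y. y \<in> B \<Longrightarrow> norm (g y) \<le> C" for B
  proof -
    have Bb: "B \<in> sets borel" using B(1) by (simp add: bounded_borel_def)
    have "norm (LINT y:B|M. g y) \<le> (LINT y:B|M. norm (g y))" by (rule norm_int_le[OF g B(1)])
    also have "\<dots> \<le> (LINT y:B|M. C)"
      unfolding set_lebesgue_integral_def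
    proof (rule integral_mono)
      show "integrable M (\<lambda>x. indicator B x *\<^sub>R norm (g x))"
        using loc_int[OF loc_int_norm[OF g] B(1)] by (simp add: set_integrable_def)
      show "integrable M (\<lambda>x. indicator B x *\<^sub>R C)" using emeasure_finite[OF B(1)] Bb by simp
    qed (use bB in \<open>auto simp: indicator_def\<close>)
    also have "\<dots> = C * measure M B" using Bb emeasure_finite[OF B(1)] by (simp add: set_lebesgue_integral_def)
    also have "\<dots> \<le> C * measure M {-R..R}"
      using C B Bb emeasure_finite[of "{-R..R}"] by (intro mult_left_mono measure_mono_fmeasurable fmeasurableI) auto
    finally show ?thesis .
  qed
  have e: "(LINT y:{c..<d}|M. g y) = 0" if "d \<le> c" for c d :: real
    using that by (simp add: set_lebesgue_integral_def)
  have e0: "(LINT y:{}|M. g y) = 0" by (simp add: set_lebesgue_integral_def)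
  show ?thesis
  proof (cases "0 \<le> x")
    case True
    have "norm (LINT y:{0..<x}|M. g y) \<le> C * measure M {-R..R}"
      using x True by (intro le b) (auto intro: mult_nonneg_nonneg)
    then show ?thesis using True by (simp add: prim_of_def e e0)
  next
    case False
    have "norm (LINT y:{x..<0}|M. g y) \<le> C * measure M {-R..R}"
      using x False by (intro le b) (auto intro: mult_nonpos_nonpos)
    then show ?thesis using False by (simp add: prim_of_def e e0)
  qed
qed

text \<open>Clipping the end points of an interval to [-R, R] does not change the increment of f.
  Hence g and its restriction to [-R, R) have the same integrals over all intervals and agree almost
  everywhere.\<close>

lemma prim_restrict:
  assumes p: "is_prim M f g" and R: "R \<ge> 0" "\<And>x. \<bar>x\<bar> \<ge> R \<Longrightarrow> f x = 0"
  shows "AE x in M. x \<notin> {-R..<R} \<longrightarrow> g x = 0"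
proof -
  let ?g = "\<lambda>x. indicator {-R..<R} x *\<^sub>R g x"
  have [measurable]: "g \<in> borel_measurable borel" using loc_int_measurable[OF prim_int[OF p]] .
  have li: "locally_integrable M ?g"
    unfolding locally_integrable_def
  proof (intro allI)
    fix a b
    show "set_integrable M {a..b} ?g"
      by (rule set_integrable_bound[OF loc_int[OF prim_int[OF p], of "{a..b}"]])
        (auto simp: indicator_def set_borel_measurable_def)
  qed
  have "(LINT x:{a..<b}|M. g x) = (LINT x:{a..<b}|M. ?g x)" if ab: "a \<le> b" for a b
  proof -
    let ?a = "max (-R) (min a R)" and ?b = "max (-R) (min b R)"
    \<comment> \<open>Clipping moves y only if |y| > R, and then f is 0 both at y and at the clipped
      point.\<close>
    have cl: "f (max (-R) (min y R)) = f y" for y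
      using R(1) R(2)[of y] R(2)[of R] R(2)[of "-R"] by (cases "\<bar>y\<bar> \<ge> R") (auto simp: max_def min_def abs_if split: if_splits)
    have "(LINT x:{a..<b}|M. ?g x) = (LINT x:{?a..<?b}|M. g x)"
      unfolding set_lebesgue_integral_def using R(1)
      by (intro Bochner_Integration.integral_cong) (auto simp: indicator_def)
    also have "\<dots> = f ?b - f ?a" using ab by (subst prim_diff[OF p]) (auto simp: max_def min_def)
    also have "\<dots> = (LINT x:{a..<b}|M. g x)" using cl prim_diff[OF p ab] by simp
    finally show ?thesis by simp
  qed
  then have "AE x in M. g x = ?g x" by (intro int_unique_AE prim_int[OF p] li)
  then show ?thesis by eventually_elim (auto simp: indicator_def split: if_splits)
qed

end

lemma prim_mult_lborel:
  fixes F G :: "real \<Rightarrow> 'a::{banach, second_countable_topology, real_normed_field}"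
  assumes F: "is_prim lborel F g" and G: "is_prim lborel G k"
  shows "is_prim lborel (\<lambda>x. F x * G x) (\<lambda>x. F x * k x + g x * G x)"
proof -
  have li: "locally_integrable lborel (\<lambda>x. F x * k x)" "locally_integrable lborel (\<lambda>x. g x * G x)"
    using lborel.loc_int_mult_bounded[OF lborel.prim_int[OF G] lborel.prim_measurable[OF F] lborel.prim_locally_bounded[OF F]]
      lborel.loc_int_mult_bounded[OF lborel.prim_int[OF F] lborel.prim_measurable[OF G] lborel.prim_locally_bounded[OF G]]
    by (auto simp: mult.commute)
  show ?thesis
    unfolding is_prim_def
  proof (intro conjI allI impI)
    show "locally_integrable lborel (\<lambda>x. F x * k x + g x * G x)" by (intro lborel.loc_int_add li)
    fix a b :: real assume "a \<le> b"
    then show "F b * G b - F a * G a = (LINT x:{a..<b}|lborel. F x * k x + g x * G x)"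
      using lborel.loc_int[OF li(1), of "{a..<b}"] lborel.loc_int[OF li(2), of "{a..<b}"]
      by (subst lborel.prim_product[OF F G]) (simp_all add: set_integral_add)
  qed
qed

lemma prim_power_lborel:
  fixes Q :: "real \<Rightarrow> real"
  assumes Q: "is_prim lborel Q a"
  shows "is_prim lborel (\<lambda>x. Q x ^ Suc n) (\<lambda>x. real (Suc n) * Q x ^ n * a x)"
proof (induction n)
  case (Suc n)
  show ?case
    using prim_mult_lborel[OF Suc.IH Q] by (simp add: algebra_simps)
qed (use Q in simp)

locale sturm_liouville = signed_rep "dP \<nu>" E for \<nu> :: "real set \<Rightarrow> real" and E :: "real set" +
  fixes N :: "real set" and q :: "real \<Rightarrow> real"
  assumes N: "N \<in> sets borel" and N_null: "emeasure lborel N = 0" and N_E: "- N \<subseteq> E"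
    and lebM: "\<And>B. B \<in> sets borel \<Longrightarrow> emeasure lborel B = emeasure M (B - N)"
    and q: "locally_integrable lborel q"
begin

definition qc :: "real \<Rightarrow> complex" where "qc x = of_real (q x)"

lemma qc: "locally_integrable lborel qc"
  using q unfolding locally_integrable_def set_integrable_def qc_def
  by (simp add: scaleR_conv_of_real of_real_mult[symmetric] complex_of_real_integrable_eq del: of_real_mult)

lemma qc_measurable [measurable]: "qc \<in> borel_measurable borel"
  by (rule lborel.loc_int_measurable[OF qc])

lemma lborel_density: "lborel = density M (\<lambda>x. ennreal (indicator (- N) x))"
proof (rule measure_eqI)
  fix B :: "real set" assume "B \<in> sets lborel"
  then have B: "B \<in> sets borel" by simp
  have "B - N = - N \<inter> B" by auto
  then show "emeasure lborel B = emeasure (density M (\<lambda>x. ennreal (indicator (- N) x))) B"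
    using B N by (simp add: emeasure_density lebM ennreal_indicator indicator_inter_arith[symmetric])
qed simp

lemma
  fixes h :: "real \<Rightarrow> 'a::{banach, second_countable_topology}"
  assumes [measurable]: "h \<in> borel_measurable borel"
  shows integrable_lborel_iff: "integrable lborel h \<longleftrightarrow> integrable M (\<lambda>x. indicator (- N) x *\<^sub>R h x)"
    and integral_lborel_eq: "(LINT x|lborel. h x) = (LINT x|M. indicator (- N) x *\<^sub>R h x)"
proof -
  note [measurable] = N
  show "integrable lborel h \<longleftrightarrow> integrable M (\<lambda>x. indicator (- N) x *\<^sub>R h x)"
    by (subst lborel_density, subst integrable_density) auto
  show "(LINT x|lborel. h x) = (LINT x|M. indicator (- N) x *\<^sub>R h x)"
    by (subst lborel_density, subst integral_density) auto
qed

lemma AE_M_lborel: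
  assumes "AE x in M. P x" shows "AE x in lborel. P x"
proof -
  obtain A where A: "{x \<in> space M. \<not> P x} \<subseteq> A" "emeasure M A = 0" "A \<in> sets M" using AE_E[OF assms] by blast
  have "emeasure lborel A \<le> 0"
    using A(2,3) lebM[of A] emeasure_mono[of "A - N" A M] by auto
  then show ?thesis using A by (intro AE_I[of _ _ A]) auto
qed

text \<open>Product rule across two measures: a Lebesgue primitive G is also a primitive for |dP|,
  with its density cut down to -N, where \<sigma> = 1. Variation of constants and cut-offs both
  depend on it.\<close>

lemma prim_mult:
  assumes F: "is_prim M F (\<lambda>x. \<sigma> x *\<^sub>R g x)" and G: "is_prim lborel G k"
  shows "is_prim M (\<lambda>x. F x * G x) (\<lambda>x. \<sigma> x *\<^sub>R (g x * G x + indicator (- N) x *\<^sub>R (F x * k x) :: complex))"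
proof -
  note [measurable] = N prim_measurable[OF F] lborel.prim_measurable[OF G] lborel.loc_int_measurable[OF lborel.prim_int[OF G]]
  have li1: "locally_integrable lborel (\<lambda>x. F x * k x)"
    using lborel.loc_int_mult_bounded[OF lborel.prim_int[OF G] _ prim_locally_bounded[OF F]] by simp
  have i1: "integrable M (\<lambda>x. indicator B x *\<^sub>R (indicator (- N) x *\<^sub>R (F x * k x)))"
    "(LINT x:B|lborel. F x * k x) = (LINT x:B|M. indicator (- N) x *\<^sub>R (F x * k x))"
    if "B \<in> bounded_borel" for B
  proof -
    have [measurable]: "B \<in> sets borel" using that by (simp add: bounded_borel_def)
    have comm: "indicator (- N) x *\<^sub>R indicator B x *\<^sub>R c = indicator B x *\<^sub>R indicator (- N) x *\<^sub>R c" for x and c :: complex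
      by (simp add: mult.commute)
    show "integrable M (\<lambda>x. indicator B x *\<^sub>R (indicator (- N) x *\<^sub>R (F x * k x)))"
      using lborel.loc_int[OF li1 that] unfolding set_integrable_def
      by (subst (asm) integrable_lborel_iff) (simp_all add: mult.commute)
    show "(LINT x:B|lborel. F x * k x) = (LINT x:B|M. indicator (- N) x *\<^sub>R (F x * k x))"
      unfolding set_lebesgue_integral_def by (subst integral_lborel_eq) (simp_all only: comm, measurable)
  qed
  have li1': "locally_integrable M (\<lambda>x. indicator (- N) x *\<^sub>R (F x * k x))"
    unfolding locally_integrable_def set_integrable_def using i1(1) by simp
  have li2: "locally_integrable M (\<lambda>x. \<sigma> x *\<^sub>R g x * G x)"
    using loc_int_mult_bounded[OF prim_int[OF F] _ lborel.prim_locally_bounded[OF G]] by (simp add: mult.commute)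
  have eq: "\<sigma> x *\<^sub>R (g x * G x + indicator (- N) x *\<^sub>R (F x * k x)) = \<sigma> x *\<^sub>R g x * G x + indicator (- N) x *\<^sub>R (F x * k x)" for x
    using N_E by (auto simp: hahn_sign_def indicator_def)
  show ?thesis
    unfolding is_prim_def eq
  proof (intro conjI allI impI)
    show "locally_integrable M (\<lambda>x. \<sigma> x *\<^sub>R g x * G x + indicator (- N) x *\<^sub>R (F x * k x))"
      by (intro loc_int_add li1' li2)
    fix a b :: real assume ab: "a \<le> b"
    show "F b * G b - F a * G a = (LINT x:{a..<b}|M. \<sigma> x *\<^sub>R g x * G x + indicator (- N) x *\<^sub>R (F x * k x))"
      unfolding prim_product[OF F G ab] i1(2)[OF bounded_borel_ivl(1)]
      using loc_int[OF li1', of "{a..<b}"] loc_int[OF li2, of "{a..<b}"] by (simp add: set_integral_add)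
  qed
qed

text \<open>The equation \<tau> f = v as a first-order system. Being both a dP-density of f and a
  Lebesgue primitive, f1 is the absolutely continuous representative of the
  quasi-derivative.\<close>

definition sol :: "(real \<Rightarrow> complex) \<Rightarrow> (real \<Rightarrow> complex) \<Rightarrow> (real \<Rightarrow> complex) \<Rightarrow> bool" where
  "sol f f1 v \<longleftrightarrow> is_prim M f (\<lambda>x. \<sigma> x *\<^sub>R f1 x) \<and> is_prim lborel f1 (\<lambda>x. qc x * f x - v x)"

lemma sol_lin:
  assumes "sol f f1 v" "sol h h1 w"
  shows "sol (\<lambda>x. a * f x + b * h x) (\<lambda>x. a * f1 x + b * h1 x) (\<lambda>x. a * v x + b * w x)"
  unfolding sol_def
proof
  have "is_prim M (\<lambda>x. a * f x + b * h x) (\<lambda>x. a * (\<sigma> x *\<^sub>R f1 x) + b * (\<sigma> x *\<^sub>R h1 x))"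
    using assms unfolding sol_def by (intro prim_lin) auto
  then show "is_prim M (\<lambda>x. a * f x + b * h x) (\<lambda>x. \<sigma> x *\<^sub>R (a * f1 x + b * h1 x))"
    by (simp add: scaleR_add_right)
  have "is_prim lborel (\<lambda>x. a * f1 x + b * h1 x) (\<lambda>x. a * (qc x * f x - v x) + b * (qc x * h x - w x))"
    using assms unfolding sol_def by (intro lborel.prim_lin) auto
  then show "is_prim lborel (\<lambda>x. a * f1 x + b * h1 x) (\<lambda>x. qc x * (a * f x + b * h x) - (a * v x + b * w x))"
    by (simp add: algebra_simps)
qed

lemma sol_cnj:
  assumes "sol f f1 v" shows "sol (\<lambda>x. cnj (f x)) (\<lambda>x. cnj (f1 x)) (\<lambda>x. cnj (v x))"
  using prim_cnj[of f] lborel.prim_cnj[of f1] assms unfolding sol_def by (fastforce simp: qc_def)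

lemma sol_source_int: "sol f f1 v \<Longrightarrow> locally_integrable lborel v"
proof -
  assume s: "sol f f1 v"
  have "locally_integrable lborel (\<lambda>x. f x * qc x)"
    using s by (intro lborel.loc_int_mult_bounded qc prim_measurable prim_locally_bounded) (auto simp: sol_def)
  moreover have "locally_integrable lborel (\<lambda>x. qc x * f x - v x)"
    using s lborel.prim_int by (auto simp: sol_def)
  ultimately have "locally_integrable lborel (\<lambda>x. f x * qc x - (qc x * f x - v x))"
    by (rule lborel.loc_int_diff)
  then show ?thesis by (simp add: mult.commute)
qed

lemma sol_regular:
  assumes "sol f f1 v"
  shows "f \<in> borel_measurable borel" "f1 \<in> borel_measurable borel" "v \<in> borel_measurable borel"
    "locally_bounded f" "locally_bounded f1"
  using assms prim_measurable lborel.prim_measurable prim_locally_bounded lborel.prim_locally_bounded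
    lborel.loc_int_measurable[OF sol_source_int[OF assms]] unfolding sol_def by auto

text \<open>Lagrange identity: when both products are integrated by parts, the terms f1 h1 against
  dP coincide and cancel. The bracket is bilinear; conjugates enter only through
  \<open>sol_cnj\<close> and \<open>test_cnj\<close>.\<close>

lemma green:
  assumes f: "sol f f1 v" and h: "sol h h1 r" and ab: "a \<le> b"
  shows "(f b * h1 b - h b * f1 b) - (f a * h1 a - h a * f1 a) = (LINT x:{a..<b}|lborel. h x * v x - f x * r x)"
proof -
  have p: "is_prim M f (\<lambda>x. \<sigma> x *\<^sub>R f1 x)" "is_prim lborel f1 (\<lambda>x. qc x * f x - v x)"
    "is_prim M h (\<lambda>x. \<sigma> x *\<^sub>R h1 x)" "is_prim lborel h1 (\<lambda>x. qc x * h x - r x)"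
    using f h by (auto simp: sol_def)
  have 1: "f b * h1 b - f a * h1 a = (LINT t:{a..<b}|lborel. f t * (qc t * h t - r t)) + (LINT s:{a..<b}|M. (\<sigma> s *\<^sub>R f1 s) * h1 s)"
    using p ab by (intro prim_product) auto
  have 2: "h b * f1 b - h a * f1 a = (LINT t:{a..<b}|lborel. h t * (qc t * f t - v t)) + (LINT s:{a..<b}|M. (\<sigma> s *\<^sub>R h1 s) * f1 s)"
    using p ab by (intro prim_product) auto
  have 3: "(LINT s:{a..<b}|M. (\<sigma> s *\<^sub>R f1 s) * h1 s) = (LINT s:{a..<b}|M. (\<sigma> s *\<^sub>R h1 s) * f1 s)"
    by (simp add: mult.commute)
  have i: "set_integrable lborel {a..<b} (\<lambda>t. f t * (qc t * h t - r t))" "set_integrable lborel {a..<b} (\<lambda>t. h t * (qc t * f t - v t))"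
    using lborel.loc_int_mult_bounded[OF lborel.prim_int[OF p(4)] sol_regular(1,4)[OF f]]
      lborel.loc_int_mult_bounded[OF lborel.prim_int[OF p(2)] sol_regular(1,4)[OF h]]
    by (auto intro: lborel.loc_int)
  have "(f b * h1 b - h b * f1 b) - (f a * h1 a - h a * f1 a) = (f b * h1 b - f a * h1 a) - (h b * f1 b - h a * f1 a)"
    by simp
  also have "\<dots> = (LINT t:{a..<b}|lborel. f t * (qc t * h t - r t)) - (LINT t:{a..<b}|lborel. h t * (qc t * f t - v t))"
    unfolding 1 2 3 by simp
  also have "\<dots> = (LINT t:{a..<b}|lborel. f t * (qc t * h t - r t) - h t * (qc t * f t - v t))"
    by (rule set_integral_diff(2)[OF i, symmetric])
  also have "\<dots> = (LINT x:{a..<b}|lborel. h x * v x - f x * r x)"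
    by (simp add: algebra_simps)
  finally show ?thesis .
qed

section \<open>Homogeneous solutions by Picard iteration for the quasi-derivative\<close>

definition picard :: "(real \<Rightarrow> complex) \<Rightarrow> real \<Rightarrow> complex" where
  "picard s = prim_of lborel (\<lambda>t. prim_of M (\<lambda>y. \<sigma> y *\<^sub>R s y) t * qc t)"

definition Q :: "real \<Rightarrow> real" where "Q = prim_of lborel (\<lambda>x. \<bar>q x\<bar>)"

lemma Q_prim: "is_prim lborel Q (\<lambda>x. \<bar>q x\<bar>)"
  unfolding Q_def using lborel.loc_int_norm[OF q] by (intro lborel.is_prim_prim_of) simp

lemma Q_mono: "x \<le> y \<Longrightarrow> Q x \<le> Q y"
proof -
  assume "x \<le> y"
  moreover have "0 \<le> (LINT t:{x..<y}|lborel. \<bar>q t\<bar>)"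
    unfolding set_lebesgue_integral_def by (intro Bochner_Integration.integral_nonneg) auto
  ultimately show ?thesis using lborel.prim_diff[OF Q_prim, of x y] by simp
qed

lemma Q_0 [simp]: "Q 0 = 0"
  by (simp add: Q_def)

lemma Q_abs_mono: "\<bar>y\<bar> \<le> \<bar>x\<bar> \<Longrightarrow> 0 \<le> x * y \<Longrightarrow> \<bar>Q y\<bar> \<le> \<bar>Q x\<bar>"
  using Q_mono[of 0 x] Q_mono[of 0 y] Q_mono[of x 0] Q_mono[of y 0] Q_mono[of x y] Q_mono[of y x]
  by (auto simp: zero_le_mult_iff abs_if split: if_splits)

definition admissible :: "(real \<Rightarrow> complex) \<Rightarrow> bool" where
  "admissible s \<longleftrightarrow> s \<in> borel_measurable borel \<and> locally_bounded s"

lemma admissible_inner: "admissible s \<Longrightarrow> locally_integrable M (\<lambda>y. \<sigma> y *\<^sub>R s y)"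
  by (intro loc_int_sigma loc_int_bounded) (auto simp: admissible_def)

lemma admissible_outer: "admissible s \<Longrightarrow> locally_integrable lborel (\<lambda>t. prim_of M (\<lambda>y. \<sigma> y *\<^sub>R s y) t * qc t)"
  using is_prim_prim_of[OF admissible_inner, of s]
  by (intro lborel.loc_int_mult_bounded qc prim_measurable prim_locally_bounded) auto

lemma picard_prim: "admissible s \<Longrightarrow> is_prim lborel (picard s) (\<lambda>t. prim_of M (\<lambda>y. \<sigma> y *\<^sub>R s y) t * qc t)"
  unfolding picard_def by (intro lborel.is_prim_prim_of admissible_outer)

lemma admissible_prim: "is_prim lborel f g \<Longrightarrow> admissible f"
  by (simp add: admissible_def lborel.prim_measurable lborel.prim_locally_bounded)

lemma picard_admissible: "admissible s \<Longrightarrow> admissible (picard s)"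
  using admissible_prim picard_prim by blast

text \<open>The inner integral runs against |dP|, which may have atoms, and is bounded crudely by
  the mass of [-R, R]. The gain 1/(n+1) comes from the outer integral against |q| dx: up to a sign,
  the power rule makes \<open>Q^(n+1) / (n+1)\<close> a primitive of the bound.\<close>

lemma picard_bound:
  assumes s: "admissible s" and b: "\<And>y. \<bar>y\<bar> \<le> R \<Longrightarrow> cmod (s y) \<le> C * \<bar>Q y\<bar> ^ n" and C: "0 \<le> C" and x: "\<bar>x\<bar> \<le> R"
  shows "cmod (picard s x) \<le> C * measure M {-R..R} * \<bar>Q x\<bar> ^ Suc n / Suc n"
proof -
  let ?m = "measure M {-R..R}"
  let ?F = "\<lambda>t. prim_of M (\<lambda>y. \<sigma> y *\<^sub>R s y) t * qc t"
  have F: "cmod (?F t) \<le> C * ?m * (\<bar>Q t\<bar> ^ n * \<bar>q t\<bar>)" if "\<bar>t\<bar> \<le> R" for t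
  proof -
    have "cmod (prim_of M (\<lambda>y. \<sigma> y *\<^sub>R s y) t) \<le> (C * \<bar>Q t\<bar> ^ n) * ?m"
    proof (rule prim_of_norm_le[OF admissible_inner[OF s] that])
      fix y assume y: "\<bar>y\<bar> \<le> \<bar>t\<bar>" "0 \<le> t * y"
      have "cmod (s y) \<le> C * \<bar>Q y\<bar> ^ n" using y that by (intro b) auto
      also have "\<dots> \<le> C * \<bar>Q t\<bar> ^ n" using C Q_abs_mono[OF y] by (intro mult_left_mono power_mono) auto
      finally show "norm (\<sigma> y *\<^sub>R s y) \<le> C * \<bar>Q t\<bar> ^ n" by simp
    qed
    then have "cmod (prim_of M (\<lambda>y. \<sigma> y *\<^sub>R s y) t) * \<bar>q t\<bar> \<le> (C * \<bar>Q t\<bar> ^ n) * ?m * \<bar>q t\<bar>"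
      by (intro mult_right_mono) auto
    then show ?thesis by (simp add: norm_mult qc_def mult_ac)
  qed
  note P = lborel.prim_int[OF prim_power_lborel[OF Q_prim, of n]]
  have Qp: "(LINT t:{a..<b}|lborel. Q t ^ n * \<bar>q t\<bar>) = (Q b ^ Suc n - Q a ^ Suc n) / Suc n" if "a \<le> b" for a b
  proof -
    have "Q b ^ Suc n - Q a ^ Suc n = (LINT t:{a..<b}|lborel. real (Suc n) * (Q t ^ n * \<bar>q t\<bar>))"
      using lborel.prim_diff[OF prim_power_lborel[OF Q_prim, of n] that] by (simp only: mult.assoc)
    also have "\<dots> = real (Suc n) * (LINT t:{a..<b}|lborel. Q t ^ n * \<bar>q t\<bar>)"
      by (rule set_integral_mult_right)
    finally show ?thesis by (simp add: field_simps)
  qed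
  have li: "locally_integrable lborel (\<lambda>t. Q t ^ n * \<bar>q t\<bar>)"
  proof -
    have "locally_integrable lborel (\<lambda>t. (1 / real (Suc n)) * (real (Suc n) * Q t ^ n * \<bar>q t\<bar>))"
      using P unfolding locally_integrable_def by (intro allI set_integrable_mult_right) auto
    then show ?thesis by (simp add: mult.assoc del: of_nat_Suc)
  qed
  \<comment> \<open>The sign e will be 1 to the right of 0 and (-1)^n to the left, where Q is
    nonpositive; it replaces the absolute value so that the power rule applies.\<close>
  have le: "cmod (LINT t:B|lborel. ?F t) \<le> C * ?m * (LINT t:B|lborel. e * (Q t ^ n * \<bar>q t\<bar>))"
    if B: "B \<in> bounded_borel" "B \<subseteq> {-R..R}" and e: "\<And>t. t \<in> B \<Longrightarrow> \<bar>Q t\<bar> ^ n = e * Q t ^ n" for B e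
  proof -
    have "cmod (LINT t:B|lborel. ?F t) \<le> (LINT t:B|lborel. cmod (?F t))"
      by (rule lborel.norm_int_le[OF admissible_outer[OF s] B(1)])
    also have "\<dots> \<le> (LINT t:B|lborel. C * ?m * (e * (Q t ^ n * \<bar>q t\<bar>)))"
    proof (rule set_integral_mono)
      show "set_integrable lborel B (\<lambda>t. cmod (?F t))"
        by (rule lborel.loc_int[OF lborel.loc_int_norm[OF admissible_outer[OF s]] B(1)])
      show "set_integrable lborel B (\<lambda>t. C * ?m * (e * (Q t ^ n * \<bar>q t\<bar>)))"
        using lborel.loc_int[OF li B(1)] by (intro set_integrable_mult_right) auto
      fix t assume t: "t \<in> B"
      then have "t \<in> {-R..R}" using B(2) by blast
      then have "cmod (?F t) \<le> C * ?m * (\<bar>Q t\<bar> ^ n * \<bar>q t\<bar>)" by (intro F) auto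
      then show "cmod (?F t) \<le> C * ?m * (e * (Q t ^ n * \<bar>q t\<bar>))" unfolding e[OF t] by (simp add: mult.assoc)
    qed
    finally show ?thesis by simp
  qed
  show ?thesis
  proof (cases "0 \<le> x")
    case True
    have "cmod (picard s x) = cmod (LINT t:{0..<x}|lborel. ?F t)"
      using True unfolding picard_def prim_of_def[of lborel] by (simp add: set_lebesgue_integral_def)
    also have "\<dots> \<le> C * ?m * (LINT t:{0..<x}|lborel. 1 * (Q t ^ n * \<bar>q t\<bar>))"
    proof (rule le)
      fix t assume "t \<in> {0..<x}"
      then have "0 \<le> Q t" using Q_mono[of 0 t] by simp
      then show "\<bar>Q t\<bar> ^ n = 1 * Q t ^ n" by simp
    qed (use True x in auto)
    also have "\<dots> = C * ?m * (\<bar>Q x\<bar> ^ Suc n / Suc n)"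
      using Qp[OF True] Q_mono[OF True] by simp
    finally show ?thesis by simp
  next
    case False
    have "cmod (picard s x) = cmod (LINT t:{x..<0}|lborel. ?F t)"
      using False unfolding picard_def prim_of_def[of lborel] by (simp add: set_lebesgue_integral_def)
    also have "\<dots> \<le> C * ?m * (LINT t:{x..<0}|lborel. (-1)^n * (Q t ^ n * \<bar>q t\<bar>))"
    proof (rule le)
      fix t assume "t \<in> {x..<0}"
      then have "\<bar>Q t\<bar> = (-1) * Q t" using Q_mono[of t 0] by simp
      then show "\<bar>Q t\<bar> ^ n = (-1)^n * Q t ^ n" by (metis power_mult_distrib)
    qed (use False x in auto)
    also have "(LINT t:{x..<0}|lborel. (-1)^n * (Q t ^ n * \<bar>q t\<bar>)) = (-1)^n * ((0 - Q x ^ Suc n) / Suc n)"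
      using Qp[of x 0] False by simp
    also have "\<dots> = \<bar>Q x\<bar> ^ Suc n / Suc n"
    proof -
      have "\<bar>Q x\<bar> = (-1) * Q x" using Q_mono[of x 0] False by simp
      then have "\<bar>Q x\<bar> ^ Suc n = (-1) ^ Suc n * Q x ^ Suc n" by (metis power_mult_distrib)
      then show ?thesis by simp
    qed
    finally show ?thesis by simp
  qed
qed

lemma picard_lin:
  assumes "admissible s" "admissible r"
  shows "picard (\<lambda>y. a * s y + b * r y) x = a * picard s x + b * picard r x"
proof -
  have 1: "prim_of M (\<lambda>y. \<sigma> y *\<^sub>R (a * s y + b * r y)) t
      = a * prim_of M (\<lambda>y. \<sigma> y *\<^sub>R s y) t + b * prim_of M (\<lambda>y. \<sigma> y *\<^sub>R r y) t" for t
    using prim_of_lin[OF admissible_inner[OF assms(1)] admissible_inner[OF assms(2)], of a b t]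
    by (simp add: scaleR_add_right)
  have "picard (\<lambda>y. a * s y + b * r y) x = prim_of lborel (\<lambda>t. a * (prim_of M (\<lambda>y. \<sigma> y *\<^sub>R s y) t * qc t)
      + b * (prim_of M (\<lambda>y. \<sigma> y *\<^sub>R r y) t * qc t)) x"
    unfolding picard_def 1 by (simp add: algebra_simps)
  also have "\<dots> = a * picard s x + b * picard r x"
    unfolding picard_def by (rule lborel.prim_of_lin[OF admissible_outer[OF assms(1)] admissible_outer[OF assms(2)]])
  finally show ?thesis .
qed

text \<open>The Neumann series of \<open>picard\<close> converges locally uniformly, its terms being bounded
  by those of an exponential series.\<close>

lemma picard_solve:
  assumes s0: "admissible s0"
  shows "\<exists>s. admissible s \<and> (\<forall>x. s x = s0 x + picard s x)"
proof -
  define S where "S n = (picard ^^ n) s0" for n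
  have S: "admissible (S n)" for n
    by (induction n) (use s0 picard_admissible in \<open>auto simp: S_def\<close>)
  have SS: "S (Suc n) = picard (S n)" for n by (simp add: S_def)
  have loc: "\<exists>a. summable a \<and> (\<forall>n x. \<bar>x\<bar> \<le> R \<longrightarrow> cmod (S n x) \<le> a n)" if R: "R \<ge> 0" for R
  proof -
    let ?m = "measure M {-R..R}"
    obtain K where K: "K \<ge> 0" "\<forall>x\<in>{-R..R}. cmod (s0 x) \<le> K"
      using s0 locally_boundedD unfolding admissible_def by blast
    have b: "cmod (S n x) \<le> (K * ?m ^ n / fact n) * \<bar>Q x\<bar> ^ n" if "\<bar>x\<bar> \<le> R" for n x
      using that
    proof (induction n arbitrary: x)
      case 0 then show ?case using K by (auto simp: S_def abs_le_iff)
    next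
      case (Suc n)
      have "cmod (picard (S n) x) \<le> (K * ?m ^ n / fact n) * ?m * \<bar>Q x\<bar> ^ Suc n / Suc n"
        using K Suc by (intro picard_bound S) auto
      then show ?case by (simp add: SS field_simps)
    qed
    define c where "c = ?m * (\<bar>Q R\<bar> + \<bar>Q (-R)\<bar>)"
    have "cmod (S n x) \<le> K * (inverse (fact n) * c ^ n)" if x: "\<bar>x\<bar> \<le> R" for n x
    proof -
      have "\<bar>Q x\<bar> \<le> \<bar>Q R\<bar> + \<bar>Q (-R)\<bar>"
        using x Q_mono[of x R] Q_mono[of "-R" x] by arith
      then have "(K * ?m ^ n / fact n) * \<bar>Q x\<bar> ^ n \<le> (K * ?m ^ n / fact n) * (\<bar>Q R\<bar> + \<bar>Q (-R)\<bar>) ^ n"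
        using K by (intro mult_left_mono power_mono) auto
      also have "\<dots> = K * (inverse (fact n) * c ^ n)" unfolding c_def power_mult_distrib by (simp add: divide_inverse mult_ac)
      finally show ?thesis using b[OF x, of n] by simp
    qed
    moreover have "summable (\<lambda>n. K * (inverse (fact n) * c ^ n))"
      by (intro summable_mult summable_exp)
    ultimately show ?thesis by blast
  qed
  define s where "s x = (\<Sum>n. S n x)" for x
  have sums: "(\<lambda>k. \<Sum>n<k. S n x) \<longlonglongrightarrow> s x" for x
  proof -
    obtain a where a: "summable a" "\<And>n. cmod (S n x) \<le> a n" using loc[of "\<bar>x\<bar>"] by auto
    have "summable (\<lambda>n. S n x)" by (rule summable_comparison_test'[OF a(1), of 0]) (use a(2) in auto)
    then show ?thesis unfolding s_def by (rule summable_LIMSEQ)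
  qed
  have part: "admissible (\<lambda>x. \<Sum>n<k. S n x)" "picard (\<lambda>x. \<Sum>n<k. S n x) y = (\<Sum>n<k. S (Suc n) y)" for k y
  proof (induction k)
    case 0
    { case 1 show ?case by (auto simp: admissible_def locally_bounded_def intro: exI[of _ 0]) }
    { case 2 show ?case by (simp add: picard_def prim_of_def set_lebesgue_integral_def) }
  next
    case (Suc k)
    { case 1
      have "locally_bounded (\<lambda>x. (\<Sum>n<k. S n x) + S k x)"
        unfolding locally_bounded_def
      proof
        fix R
        obtain C1 C2 where "\<forall>x\<in>{-R..R}. cmod (\<Sum>n<k. S n x) \<le> C1" "\<forall>x\<in>{-R..R}. cmod (S k x) \<le> C2"
          using Suc(1) S[of k] unfolding admissible_def locally_bounded_def by meson
        then show "\<exists>C. \<forall>x\<in>{-R..R}. cmod ((\<Sum>n<k. S n x) + S k x) \<le> C"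
          by (intro exI[of _ "C1 + C2"]) (auto intro!: norm_triangle_le add_mono)
      qed
      moreover have "(\<lambda>x. (\<Sum>n<k. S n x) + S k x) \<in> borel_measurable borel"
        using Suc(1) S[of k] unfolding admissible_def by (intro borel_measurable_add) auto
      ultimately show ?case by (simp add: admissible_def) }
    { case 2
      show ?case
        using picard_lin[OF Suc(1) S[of k], of 1 1 y] Suc(2) by (simp add: SS) }
  qed
  have unif: "\<exists>e. e \<longlonglongrightarrow> 0 \<and> (\<forall>k x. \<bar>x\<bar> \<le> R \<longrightarrow> cmod (s x - (\<Sum>n<k. S n x)) \<le> e k)" if R: "R \<ge> 0" for R
  proof -
    obtain a where a: "summable a" "\<And>n x. \<bar>x\<bar> \<le> R \<Longrightarrow> cmod (S n x) \<le> a n" using loc[OF R] by blast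
    have "(\<lambda>k. suminf a - (\<Sum>n<k. a n)) \<longlonglongrightarrow> 0"
      using tendsto_diff[OF tendsto_const summable_LIMSEQ[OF a(1)], of "suminf a"] by simp
    moreover have "cmod (s x - (\<Sum>n<k. S n x)) \<le> suminf a - (\<Sum>n<k. a n)" if x: "\<bar>x\<bar> \<le> R" for k x
    proof -
      have sm: "summable (\<lambda>n. S n x)" "summable (\<lambda>n. cmod (S n x))"
        by (rule summable_comparison_test'[OF a(1), of 0]; use a(2)[OF x] in simp)+
      have "s x - (\<Sum>n<k. S n x) = (\<Sum>n. S (n + k) x)"
        unfolding s_def using suminf_minus_initial_segment[OF sm(1), of k] by simp
      also have "cmod \<dots> \<le> (\<Sum>n. cmod (S (n + k) x))"
        by (rule summable_norm) (use summable_ignore_initial_segment[OF sm(2), of k] in simp)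
      also have "\<dots> \<le> (\<Sum>n. a (n + k))"
        by (intro suminf_le a(2) x summable_ignore_initial_segment sm(2) a(1))
      also have "\<dots> = suminf a - (\<Sum>n<k. a n)" using suminf_minus_initial_segment[OF a(1)] .
      finally show ?thesis .
    qed
    ultimately show ?thesis by blast
  qed
  have sa: "admissible s"
    unfolding admissible_def
  proof
    show "s \<in> borel_measurable borel"
      using part(1) by (intro borel_measurable_LIMSEQ_metric[OF _ sums]) (auto simp: admissible_def)
    show "locally_bounded s"
      unfolding locally_bounded_def
    proof
      fix R :: real
      obtain e where e: "\<And>k x. \<bar>x\<bar> \<le> \<bar>R\<bar> \<Longrightarrow> cmod (s x - (\<Sum>n<k. S n x)) \<le> e k"
        using unif[of "\<bar>R\<bar>"] by auto
      show "\<exists>C. \<forall>x\<in>{-R..R}. cmod (s x) \<le> C"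
        using e[of _ 0] by (intro exI[of _ "e 0"]) (auto simp: abs_le_iff)
    qed
  qed
  have "s x = s0 x + picard s x" for x
  proof -
    obtain e where e: "e \<longlonglongrightarrow> 0" "\<And>k y. \<bar>y\<bar> \<le> \<bar>x\<bar> \<Longrightarrow> cmod (s y - (\<Sum>n<k. S n y)) \<le> e k"
      using unif[of "\<bar>x\<bar>"] by auto
    let ?c = "measure M {-\<bar>x\<bar>..\<bar>x\<bar>} * \<bar>Q x\<bar>"
    have "cmod (picard s x - picard (\<lambda>y. \<Sum>n<k. S n y) x) \<le> e k * ?c" for k
    proof -
      have 0: "0 \<le> e k" using order_trans[OF norm_ge_zero e(2)[of 0 k]] by simp
      have ad: "admissible (\<lambda>y. s y - (\<Sum>n<k. S n y))"
      proof -
        have "locally_bounded (\<lambda>y. s y - (\<Sum>n<k. S n y))"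
          unfolding locally_bounded_def
        proof
          fix R
          obtain C1 C2 where "\<forall>x\<in>{-R..R}. cmod (\<Sum>n<k. S n x) \<le> C1" "\<forall>x\<in>{-R..R}. cmod (s x) \<le> C2"
            using part(1)[of k] sa unfolding admissible_def locally_bounded_def by meson
          then show "\<exists>C. \<forall>x\<in>{-R..R}. cmod (s x - (\<Sum>n<k. S n x)) \<le> C"
            by (intro exI[of _ "C2 + C1"]) (auto intro!: order_trans[OF norm_triangle_ineq4] add_mono)
        qed
        moreover have "(\<lambda>y. s y - (\<Sum>n<k. S n y)) \<in> borel_measurable borel"
          using part(1)[of k] sa unfolding admissible_def by (intro borel_measurable_diff) auto
        ultimately show ?thesis by (simp add: admissible_def)
      qed
      \<comment> \<open>The case n = 0 of \<open>picard_bound\<close> is continuity of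
        \<open>picard\<close> under locally uniform convergence.\<close>
      have "cmod (picard (\<lambda>y. s y - (\<Sum>n<k. S n y)) x) \<le> e k * measure M {-\<bar>x\<bar>..\<bar>x\<bar>} * \<bar>Q x\<bar> ^ Suc 0 / Suc 0"
        using e(2) 0 by (intro picard_bound ad) auto
      moreover have "picard (\<lambda>y. s y - (\<Sum>n<k. S n y)) x = picard s x - picard (\<lambda>y. \<Sum>n<k. S n y) x"
        using picard_lin[OF sa part(1)[of k], of 1 "-1" x] by simp
      ultimately show ?thesis by (simp add: mult.assoc)
    qed
    then have "(\<lambda>k. picard s x - picard (\<lambda>y. \<Sum>n<k. S n y) x) \<longlonglongrightarrow> 0"
      by (intro Lim_null_comparison[OF always_eventually tendsto_mult_left_zero[OF e(1), of ?c]] allI)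
    from tendsto_diff[OF tendsto_const[of "picard s x"] this]
    have 1: "(\<lambda>k. \<Sum>n<k. S (Suc n) x) \<longlonglongrightarrow> picard s x" by (simp add: part(2))
    have "(\<lambda>k. s0 x + (\<Sum>n<k. S (Suc n) x)) \<longlonglongrightarrow> s0 x + picard s x" by (intro tendsto_intros 1)
    moreover have "s0 x + (\<Sum>n<k. S (Suc n) x) = (\<Sum>n<Suc k. S n x)" for k
      unfolding sum.lessThan_Suc_shift by (simp add: S_def)
    ultimately have "(\<lambda>k. \<Sum>n<Suc k. S n x) \<longlonglongrightarrow> s0 x + picard s x"
      by (simp only:)
    then show ?thesis by (rule LIMSEQ_unique[OF LIMSEQ_Suc[OF sums[of x]]])
  qed
  then show ?thesis using sa by blast
qed

lemma homogeneous_solution: "\<exists>f f1. sol f f1 (\<lambda>_. 0) \<and> f 0 = c \<and> f1 0 = d"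
proof -
  \<comment> \<open>Inserting f = c + (integral of f1 dP) into f1' = q f and integrating from 0
    gives s = s0 + picard s for s = f1.\<close>
  define s0 where "s0 x = d * 1 + c * prim_of lborel qc x" for x
  have "is_prim lborel s0 (\<lambda>x. d * 0 + c * qc x)"
    unfolding s0_def by (intro lborel.prim_lin lborel.prim_const lborel.is_prim_prim_of qc)
  then have s0: "is_prim lborel s0 (\<lambda>x. c * qc x)" by simp
  obtain s where s: "admissible s" "\<And>x. s x = s0 x + picard s x"
    using picard_solve[OF admissible_prim[OF s0]] by blast
  define f where "f x = c + prim_of M (\<lambda>y. \<sigma> y *\<^sub>R s y) x" for x
  have "is_prim M (\<lambda>x. c * 1 + 1 * prim_of M (\<lambda>y. \<sigma> y *\<^sub>R s y) x) (\<lambda>x. c * 0 + 1 * (\<sigma> x *\<^sub>R s x))"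
    by (intro prim_lin prim_const is_prim_prim_of admissible_inner s)
  then have f: "is_prim M f (\<lambda>x. \<sigma> x *\<^sub>R s x)" by (simp add: f_def[abs_def])
  have "is_prim lborel (\<lambda>x. 1 * s0 x + 1 * picard s x) (\<lambda>x. 1 * (c * qc x) + 1 * (prim_of M (\<lambda>y. \<sigma> y *\<^sub>R s y) x * qc x))"
    by (intro lborel.prim_lin s0 picard_prim s)
  moreover have "s = (\<lambda>x. s0 x + picard s x)" using s(2) by auto
  ultimately have "is_prim lborel s (\<lambda>x. c * qc x + prim_of M (\<lambda>y. \<sigma> y *\<^sub>R s y) x * qc x)" by simp
  then have "is_prim lborel s (\<lambda>x. qc x * f x - 0)" by (simp add: f_def algebra_simps)
  then have "sol f s (\<lambda>_. 0)" using f by (simp add: sol_def)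
  moreover have "f 0 = c" by (simp add: f_def)
  moreover have "s 0 = d" using s(2)[of 0] by (simp add: s0_def picard_def)
  ultimately show ?thesis by blast
qed

end

section \<open>Weak solutions\<close>

lemma functional_multiple:
  fixes l l1 :: "(real \<Rightarrow> complex) \<Rightarrow> complex"
  assumes S: "\<And>f g c d. f \<in> S \<Longrightarrow> g \<in> S \<Longrightarrow> (\<lambda>x. c * f x + d * g x) \<in> S"
    and l: "\<And>f g c d. f \<in> S \<Longrightarrow> g \<in> S \<Longrightarrow> l (\<lambda>x. c * f x + d * g x) = c * l f + d * l g"
    and l1: "\<And>f g c d. f \<in> S \<Longrightarrow> g \<in> S \<Longrightarrow> l1 (\<lambda>x. c * f x + d * g x) = c * l1 f + d * l1 g"
    and ker: "\<And>f. f \<in> S \<Longrightarrow> l1 f = 0 \<Longrightarrow> l f = 0"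
  shows "\<exists>a. \<forall>f\<in>S. l f = a * l1 f"
proof (cases "\<forall>f\<in>S. l1 f = 0")
  case True then show ?thesis using ker by auto
next
  case False
  then obtain g where g: "g \<in> S" "l1 g \<noteq> 0" by blast
  have "l f = l g / l1 g * l1 f" if f: "f \<in> S" for f
  proof -
    let ?h = "\<lambda>x. 1 * f x + (- l1 f / l1 g) * g x"
    have "l1 ?h = 0" unfolding l1[OF f g(1)] using g(2) by simp
    then have "l ?h = 0" using S[OF f g(1)] ker by blast
    then show ?thesis unfolding l[OF f g(1)] using g(2) by (simp add: field_simps)
  qed
  then show ?thesis by blast
qed

text \<open>On the kernel of l2 the functional l is a multiple a of l1; then l - a l1 vanishes on
  that kernel and is a multiple of l2.\<close>

lemma functional_lin_comb:
  fixes l l1 l2 :: "(real \<Rightarrow> complex) \<Rightarrow> complex"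
  assumes S: "\<And>f g c d. f \<in> S \<Longrightarrow> g \<in> S \<Longrightarrow> (\<lambda>x. c * f x + d * g x) \<in> S"
    and l: "\<And>f g c d. f \<in> S \<Longrightarrow> g \<in> S \<Longrightarrow> l (\<lambda>x. c * f x + d * g x) = c * l f + d * l g"
    and l1: "\<And>f g c d. f \<in> S \<Longrightarrow> g \<in> S \<Longrightarrow> l1 (\<lambda>x. c * f x + d * g x) = c * l1 f + d * l1 g"
    and l2: "\<And>f g c d. f \<in> S \<Longrightarrow> g \<in> S \<Longrightarrow> l2 (\<lambda>x. c * f x + d * g x) = c * l2 f + d * l2 g"
    and ker: "\<And>f. f \<in> S \<Longrightarrow> l1 f = 0 \<Longrightarrow> l2 f = 0 \<Longrightarrow> l f = 0"
  shows "\<exists>a b. \<forall>f\<in>S. l f = a * l1 f + b * l2 f"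
proof -
  have "\<exists>a. \<forall>f\<in>{f\<in>S. l2 f = 0}. l f = a * l1 f"
    by (rule functional_multiple) (use S l l1 l2 ker in auto)
  then obtain a where a: "\<And>f. f \<in> S \<Longrightarrow> l2 f = 0 \<Longrightarrow> l f = a * l1 f" by blast
  have "\<exists>b. \<forall>f\<in>S. l f - a * l1 f = b * l2 f"
    by (rule functional_multiple) (use S l l1 l2 a in \<open>auto simp: algebra_simps\<close>)
  then show ?thesis by (metis add.commute diff_eq_eq)
qed

definition loc_L2 :: "(real \<Rightarrow> complex) \<Rightarrow> bool" where
  "loc_L2 u \<longleftrightarrow> u \<in> borel_measurable borel \<and> (\<forall>R. (\<lambda>x. indicator {-R..R} x *\<^sub>R u x) \<in> L2)"

definition L2_on :: "real \<Rightarrow> (real \<Rightarrow> complex) set" where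
  "L2_on R = {r \<in> L2. \<forall>x. \<bar>x\<bar> \<ge> R \<longrightarrow> r x = 0}"

lemma bounded_indicator_L2:
  assumes M: "locally_finite_measure M" and [measurable]: "u \<in> borel_measurable borel" and b: "locally_bounded u"
  shows "(\<lambda>x. indicator {-R..R} x *\<^sub>R u x) \<in> square_integrable M"
proof -
  interpret lfm M by standard (rule M)
  obtain C where C: "C \<ge> 0" "\<forall>x\<in>{-R..R}. cmod (u x) \<le> C" using locally_boundedD[OF b] by blast
  have "integrable M (\<lambda>x. (cmod (indicator {-R..R} x *\<^sub>R u x))\<^sup>2)"
  proof (rule Bochner_Integration.integrable_bound)
    show "integrable M (\<lambda>x. indicator {-R..R} x * C\<^sup>2)" using emeasure_finite[of "{-R..R}"] by simp
    show "AE x in M. norm ((cmod (indicator {-R..R} x *\<^sub>R u x))\<^sup>2) \<le> norm (indicator {-R..R} x * C\<^sup>2)"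
      using C by (auto simp: indicator_def intro!: power_mono)
  qed measurable
  then show ?thesis by (simp add: square_integrable_def)
qed

lemma loc_L2_bounded: "u \<in> borel_measurable borel \<Longrightarrow> locally_bounded u \<Longrightarrow> loc_L2 u"
  using bounded_indicator_L2[OF locally_finite_lborel] by (auto simp: loc_L2_def)

lemma loc_L2_lin:
  assumes "loc_L2 u" "loc_L2 v" shows "loc_L2 (\<lambda>x. c * u x + d * v x)"
  unfolding loc_L2_def
proof (intro conjI allI)
  show "(\<lambda>x. c * u x + d * v x) \<in> borel_measurable borel" using assms by (auto simp: loc_L2_def)
  fix R
  have "(\<lambda>x. c * (indicator {-R..R} x *\<^sub>R u x) + d * (indicator {-R..R} x *\<^sub>R v x)) \<in> L2"
    using assms by (intro square_integrable_lin) (auto simp: loc_L2_def)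
  then show "(\<lambda>x. indicator {-R..R} x *\<^sub>R (c * u x + d * v x)) \<in> L2"
    by (simp add: scaleR_add_right)
qed

lemma L2_loc_L2:
  assumes "u \<in> L2" shows "loc_L2 u"
  unfolding loc_L2_def
proof (intro conjI allI)
  show [measurable]: "u \<in> borel_measurable borel" using assms by (simp add: square_integrable_def)
  fix R
  have "integrable lborel (\<lambda>x. (cmod (indicator {-R..R} x *\<^sub>R u x))\<^sup>2)"
    by (rule Bochner_Integration.integrable_bound[of _ "\<lambda>x. (cmod (u x))\<^sup>2"])
      (use assms in \<open>auto simp: square_integrable_def indicator_def\<close>)
  then show "(\<lambda>x. indicator {-R..R} x *\<^sub>R u x) \<in> L2" by (simp add: square_integrable_def)
qed

lemma loc_L2_mult_integrable:
  assumes u: "loc_L2 u" and r: "r \<in> L2_on R" shows "integrable lborel (\<lambda>x. u x * r x)"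
proof -
  have "integrable lborel (\<lambda>x. (indicator {-R..R} x *\<^sub>R u x) * r x)"
    using u r by (intro square_integrable_mult) (auto simp: loc_L2_def L2_on_def)
  moreover have "(indicator {-R..R} x *\<^sub>R u x) * r x = u x * r x" for x
    using r by (cases "\<bar>x\<bar> \<ge> R") (auto simp: L2_on_def indicator_def)
  ultimately show ?thesis by simp
qed

lemma loc_L2_loc_int:
  assumes u: "loc_L2 u" shows "locally_integrable lborel u"
  unfolding locally_integrable_def
proof (intro allI)
  fix a b :: real
  define R where "R = max \<bar>a\<bar> \<bar>b\<bar> + 1"
  have ab: "{a..b} \<subseteq> {-R..R}" unfolding R_def by auto
  have eq: "(cmod (indicator {a..b} x *\<^sub>R (1::complex)))\<^sup>2 = indicator {a..b} x" for x
    by (simp add: indicator_def)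
  have "(\<lambda>x. indicator {a..b} x *\<^sub>R (1::complex)) \<in> L2"
    unfolding square_integrable_def mem_Collect_eq eq by (simp add: emeasure_lborel_Icc_eq)
  moreover have "indicator {a..b} x *\<^sub>R (1::complex) = 0" if "\<bar>x\<bar> \<ge> R" for x
    using that by (auto simp: indicator_def R_def abs_if max_def split: if_splits)
  ultimately have "(\<lambda>x. indicator {a..b} x *\<^sub>R (1::complex)) \<in> L2_on R"
    unfolding L2_on_def by blast
  from loc_L2_mult_integrable[OF u this] show "set_integrable lborel {a..b} u"
    by (simp add: set_integrable_def)
qed

lemma L2_on_zero_AE:
  assumes u: "loc_L2 u" and z: "\<And>r. r \<in> L2_on R \<Longrightarrow> (LINT x|lborel. u x * r x) = 0"
  shows "AE x in lborel. \<bar>x\<bar> < R \<longrightarrow> u x = 0"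
proof -
  have [measurable]: "u \<in> borel_measurable borel" using u by (simp add: loc_L2_def)
  \<comment> \<open>The conjugate of u itself is the test function; the open interval makes it
    vanish at |x| = R, as \<open>L2_on\<close> demands.\<close>
  define r where "r x = indicator {-R<..<R} x *\<^sub>R cnj (u x)" for x
  have i: "integrable lborel (\<lambda>x. (cmod (r x))\<^sup>2)"
  proof (rule Bochner_Integration.integrable_bound)
    show "integrable lborel (\<lambda>x. (cmod (indicator {-R..R} x *\<^sub>R u x))\<^sup>2)"
      using u by (simp add: loc_L2_def square_integrable_def)
  qed (auto simp: r_def[abs_def] indicator_def)
  then have "r \<in> L2_on R"
    by (auto simp: L2_on_def square_integrable_def r_def[abs_def] indicator_def)
  then have "(LINT x|lborel. u x * r x) = 0" by (rule z)
  moreover have "u x * r x = of_real ((cmod (r x))\<^sup>2)" for x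
    by (auto simp: r_def indicator_def complex_norm_square[symmetric] simp del: of_real_power)
  ultimately have "(LINT x|lborel. (cmod (r x))\<^sup>2) = 0" by (simp del: of_real_power)
  then have "AE x in lborel. (cmod (r x))\<^sup>2 = 0"
    using i by (subst (asm) integral_nonneg_eq_0_iff_AE) auto
  then show ?thesis
    by eventually_elim (auto simp: r_def indicator_def abs_less_iff split: if_splits)
qed

context sturm_liouville
begin

section \<open>Fundamental system and compactly supported solutions\<close>

lemma fundamental_system:
  "\<exists>p p1 r r1. sol p p1 (\<lambda>_. 0) \<and> sol r r1 (\<lambda>_. 0) \<and> (\<forall>x. p x * r1 x - r x * p1 x = 1)"
proof -
  obtain p p1 where p: "sol p p1 (\<lambda>_. 0)" "p 0 = 1" "p1 0 = 0" using homogeneous_solution by blast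
  obtain r r1 where r: "sol r r1 (\<lambda>_. 0)" "r 0 = 0" "r1 0 = 1" using homogeneous_solution by blast
  \<comment> \<open>Green's formula with two zero sources makes the Wronskian constant; the initial
    values give it the value 1 at 0.\<close>
  have "p b * r1 b - r b * p1 b = p a * r1 a - r a * p1 a" if "a \<le> b" for a b
    using green[OF p(1) r(1) that] by (simp add: set_lebesgue_integral_def)
  then have "p x * r1 x - r x * p1 x = p 0 * r1 0 - r 0 * p1 0" for x
    by (metis linear)
  then show ?thesis using p r by fastforce
qed

text \<open>A and C are primitives of p v and r v, so their derivatives contribute p r v - r p v = 0
  to that of f and, through the Wronskian, exactly -v to that of f1.\<close>

lemma variation_of_constants:
  assumes p: "sol p p1 (\<lambda>_. 0)" and r: "sol r r1 (\<lambda>_. 0)" and W: "\<And>x. p x * r1 x - r x * p1 x = 1"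
    and A: "is_prim lborel A (\<lambda>x. p x * v x)" and C: "is_prim lborel C (\<lambda>x. r x * v x)"
  shows "sol (\<lambda>x. p x * C x - r x * A x) (\<lambda>x. p1 x * C x - r1 x * A x) v"
  unfolding sol_def
proof
  have pp: "is_prim M p (\<lambda>x. \<sigma> x *\<^sub>R p1 x)" "is_prim lborel p1 (\<lambda>x. qc x * p x - 0)"
    and rr: "is_prim M r (\<lambda>x. \<sigma> x *\<^sub>R r1 x)" "is_prim lborel r1 (\<lambda>x. qc x * r x - 0)"
    using p r by (auto simp: sol_def)
  let ?i = "\<lambda>x. indicator (- N) x :: real"
  have "is_prim M (\<lambda>x. 1 * (p x * C x) + (-1) * (r x * A x))
    (\<lambda>x. 1 * (\<sigma> x *\<^sub>R (p1 x * C x + ?i x *\<^sub>R (p x * (r x * v x)))) + (-1) * (\<sigma> x *\<^sub>R (r1 x * A x + ?i x *\<^sub>R (r x * (p x * v x)))))"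
    by (intro prim_lin prim_mult pp rr A C)
  moreover have "1 * (\<sigma> x *\<^sub>R (p1 x * C x + ?i x *\<^sub>R (p x * (r x * v x)))) + (-1) * (\<sigma> x *\<^sub>R (r1 x * A x + ?i x *\<^sub>R (r x * (p x * v x))))
     = \<sigma> x *\<^sub>R (p1 x * C x - r1 x * A x)" for x
    by (simp add: algebra_simps)
  ultimately show "is_prim M (\<lambda>x. p x * C x - r x * A x) (\<lambda>x. \<sigma> x *\<^sub>R (p1 x * C x - r1 x * A x))"
    by simp
  have "is_prim lborel (\<lambda>x. 1 * (p1 x * C x) + (-1) * (r1 x * A x))
    (\<lambda>x. 1 * (p1 x * (r x * v x) + (qc x * p x - 0) * C x) + (-1) * (r1 x * (p x * v x) + (qc x * r x - 0) * A x))"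
    by (intro lborel.prim_lin prim_mult_lborel pp rr A C)
  moreover have "1 * (p1 x * (r x * v x) + (qc x * p x - 0) * C x) + (-1) * (r1 x * (p x * v x) + (qc x * r x - 0) * A x)
    = qc x * (p x * C x - r x * A x) - (p x * r1 x - r x * p1 x) * v x" for x
    by (simp add: algebra_simps)
  ultimately show "is_prim lborel (\<lambda>x. p1 x * C x - r1 x * A x) (\<lambda>x. qc x * (p x * C x - r x * A x) - v x)"
    unfolding W by simp
qed

text \<open>Up to null sets these are the elements of dom(H0), with an explicit radius for the
  supports of h and h1. They play the role of test functions.\<close>

definition test :: "real \<Rightarrow> (real \<Rightarrow> complex) \<Rightarrow> (real \<Rightarrow> complex) \<Rightarrow> (real \<Rightarrow> complex) \<Rightarrow> bool" where
  "test R h h1 r \<longleftrightarrow> sol h h1 r \<and> r \<in> L2 \<and> 0 \<le> R \<and> (\<forall>x. \<bar>x\<bar> \<ge> R \<longrightarrow> h x = 0 \<and> h1 x = 0)"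

lemma test_lin:
  assumes "test R f f1 v" "test R h h1 w"
  shows "test R (\<lambda>x. a * f x + b * h x) (\<lambda>x. a * f1 x + b * h1 x) (\<lambda>x. a * v x + b * w x)"
  using assms sol_lin square_integrable_lin unfolding test_def by simp

lemma test_cnj: "test R f f1 v \<Longrightarrow> test R (\<lambda>x. cnj (f x)) (\<lambda>x. cnj (f1 x)) (\<lambda>x. cnj (v x))"
  using sol_cnj square_integrable_cnj unfolding test_def by simp

lemma test_mono: "test R h h1 r \<Longrightarrow> R \<le> R' \<Longrightarrow> test R' h h1 r"
  unfolding test_def by auto

lemma test_source:
  assumes "test R h h1 r" shows "AE x in lborel. x \<notin> {-R..<R} \<longrightarrow> r x = 0"
proof -
  have "AE x in lborel. x \<notin> {-R..<R} \<longrightarrow> qc x * h x - r x = 0"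
    using assms by (intro lborel.prim_restrict[of h1]) (auto simp: test_def sol_def)
  then show ?thesis
    by eventually_elim (use assms in \<open>auto simp: test_def\<close>)
qed

lemma integral_restrict:
  fixes f :: "real \<Rightarrow> complex"
  assumes [measurable]: "f \<in> borel_measurable M'" "sets M' = sets borel"
    and "AE x in M'. x \<notin> {a..<b} \<longrightarrow> f x = 0"
  shows "(LINT x:{a..<b}|M'. f x) = (LINT x|M'. f x)"
  unfolding set_lebesgue_integral_def
proof (rule integral_cong_AE)
  have [measurable]: "{a..<b} \<in> sets M'" using assms(2) by simp
  show "(\<lambda>x. indicator {a..<b} x *\<^sub>R f x) \<in> borel_measurable M'" by measurable
  show "AE x in M'. indicator {a..<b} x *\<^sub>R f x = f x"
    using assms(3) by eventually_elim (auto simp: indicator_def)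
qed fact

lemma green_test:
  assumes f: "sol f f1 v" and h: "test R h h1 r"
  shows "(LINT x|lborel. f x * r x) = (LINT x|lborel. v x * h x)"
proof -
  have hs: "sol h h1 r" and R: "0 \<le> R" and z: "\<And>x. \<bar>x\<bar> \<ge> R \<Longrightarrow> h x = 0" "\<And>x. \<bar>x\<bar> \<ge> R \<Longrightarrow> h1 x = 0"
    using h by (auto simp: test_def)
  note [measurable] = sol_regular(1,2,3)[OF f] sol_regular(1,2,3)[OF hs]
  have i1: "set_integrable lborel {-R..<R} (\<lambda>x. h x * v x)"
    by (rule lborel.loc_int[OF lborel.loc_int_mult_bounded[OF sol_source_int[OF f] sol_regular(1,4)[OF hs]]]) simp
  have i2: "set_integrable lborel {-R..<R} (\<lambda>x. f x * r x)"
    by (rule lborel.loc_int[OF lborel.loc_int_mult_bounded[OF sol_source_int[OF hs] sol_regular(1,4)[OF f]]]) simp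
  have "0 = (LINT x:{-R..<R}|lborel. h x * v x - f x * r x)"
    using green[OF f hs, of "-R" R] R z by simp
  also have "\<dots> = (LINT x:{-R..<R}|lborel. h x * v x) - (LINT x:{-R..<R}|lborel. f x * r x)"
    by (rule set_integral_diff(2)[OF i1 i2])
  also have "(LINT x:{-R..<R}|lborel. h x * v x) = (LINT x|lborel. h x * v x)"
    by (rule integral_restrict) (use z in \<open>auto simp: not_le\<close>)
  also have "(LINT x:{-R..<R}|lborel. f x * r x) = (LINT x|lborel. f x * r x)"
  proof (rule integral_restrict)
    show "AE x in lborel. x \<notin> {-R..<R} \<longrightarrow> f x * r x = 0"
      using test_source[OF h] by eventually_elim simp
  qed auto
  finally show ?thesis by (simp add: mult.commute)
qed

text \<open>To the left of -R the primitives of p v and r v vanish by normalisation, to the right of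
  R because v is orthogonal to p and r. Variation of constants then gives a solution supported in
  [-R, R].\<close>

lemma test_exists:
  assumes p: "sol p p1 (\<lambda>_. 0)" and r: "sol r r1 (\<lambda>_. 0)" and W: "\<And>x. p x * r1 x - r x * p1 x = 1"
    and v: "v \<in> L2_on R" "0 \<le> R" and o: "(LINT x|lborel. p x * v x) = 0" "(LINT x|lborel. r x * v x) = 0"
  shows "\<exists>h h1. test R h h1 v"
proof -
  have v_loc: "locally_integrable lborel v"
    using v by (intro loc_L2_loc_int L2_loc_L2) (auto simp: L2_on_def)
  have *: "\<exists>A. is_prim lborel A (\<lambda>x. y x * v x) \<and> (\<forall>x. \<bar>x\<bar> \<ge> R \<longrightarrow> A x = 0)"
    if y: "sol y y1 (\<lambda>_. 0)" "(LINT x|lborel. y x * v x) = 0" for y y1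
  proof -
    have li: "locally_integrable lborel (\<lambda>x. y x * v x)"
      by (rule lborel.loc_int_mult_bounded[OF v_loc sol_regular(1,4)[OF y(1)]])
    note [measurable] = lborel.loc_int_measurable[OF li]
    let ?P = "prim_of lborel (\<lambda>x. y x * v x)"
    note P = lborel.is_prim_prim_of[OF li]
    have "is_prim lborel (\<lambda>x. 1 * ?P x + (- ?P (-R)) * 1) (\<lambda>x. 1 * (y x * v x) + (- ?P (-R)) * 0)"
      by (intro lborel.prim_lin P lborel.prim_const)
    then have a: "is_prim lborel (\<lambda>x. ?P x - ?P (-R)) (\<lambda>x. y x * v x)" by simp
    have b: "?P x - ?P (-R) = 0" if x: "\<bar>x\<bar> \<ge> R" for x
    proof -
      have z: "y t * v t = 0" if "\<bar>t\<bar> \<ge> R" for t using v that by (auto simp: L2_on_def)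
      consider "x \<le> -R" | "R \<le> x" using x by (auto simp: abs_if split: if_splits)
      then show ?thesis
      proof cases
        case 1
        have "?P (-R) - ?P x = (LINT t:{x..<-R}|lborel. y t * v t)" by (rule lborel.prim_diff[OF P 1])
        also have "\<dots> = (LINT t:{x..<-R}|lborel. 0)"
          using z by (intro set_lebesgue_integral_cong) (auto simp: abs_if)
        finally show ?thesis by simp
      next
        case 2
        then have "?P x - ?P (-R) = (LINT t:{-R..<x}|lborel. y t * v t)"
          using v(2) by (intro lborel.prim_diff[OF P]) simp
        also have "\<dots> = (LINT t|lborel. y t * v t)"
        proof (rule integral_restrict)
          have "y t * v t = 0" if "t \<notin> {-R..<x}" for t using 2 that v(2) by (intro z) auto
          then show "AE t in lborel. t \<notin> {-R..<x} \<longrightarrow> y t * v t = 0" by auto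
        qed auto
        finally show ?thesis using y(2) by simp
      qed
    qed
    show ?thesis by (rule exI[of _ "\<lambda>x. ?P x - ?P (-R)"], rule conjI, rule a, use b in blast)
  qed
  obtain A where A: "is_prim lborel A (\<lambda>x. p x * v x)" "\<And>x. \<bar>x\<bar> \<ge> R \<Longrightarrow> A x = 0" using *[OF p o(1)] by blast
  obtain C where C: "is_prim lborel C (\<lambda>x. r x * v x)" "\<And>x. \<bar>x\<bar> \<ge> R \<Longrightarrow> C x = 0" using *[OF r o(2)] by blast
  have "test R (\<lambda>x. p x * C x - r x * A x) (\<lambda>x. p1 x * C x - r1 x * A x) v"
    unfolding test_def using variation_of_constants[OF p r W A(1) C(1)] A(2) C(2) v by (auto simp: L2_on_def)
  then show ?thesis by blast
qed

text \<open>A source \<open>r\<close> with compact support admits a compactly supported solution iff it is orthogonal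
  to the fundamental system; hence \<open>u\<close> minus a particular solution is a combination of the latter.
  The set \<open>K\<close> of support radii is \<open>{R}\<close> for the local and \<open>{0..}\<close> for the global version.\<close>

lemma weak_solution:
  assumes u: "loc_L2 u" and v: "locally_integrable lborel v"
    and K: "K \<noteq> {}" "\<And>R. R \<in> K \<Longrightarrow> 0 \<le> R" "\<And>R R'. R \<in> K \<Longrightarrow> R' \<in> K \<Longrightarrow> max R R' \<in> K"
    and weak: "\<And>R h h1 r. R \<in> K \<Longrightarrow> test R h h1 r \<Longrightarrow> (LINT x|lborel. u x * r x) = (LINT x|lborel. v x * h x)"
  shows "\<exists>f f1. sol f f1 v \<and> (\<forall>R\<in>K. AE x in lborel. \<bar>x\<bar> < R \<longrightarrow> u x = f x)"
proof -
  obtain p p1 r r1 where pr: "sol p p1 (\<lambda>_. 0)" "sol r r1 (\<lambda>_. 0)" "\<And>x. p x * r1 x - r x * p1 x = 1"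
    using fundamental_system by blast
  have li: "locally_integrable lborel (\<lambda>x. y x * v x)" if "sol y y1 (\<lambda>_. 0)" for y y1
    by (rule lborel.loc_int_mult_bounded[OF v sol_regular(1,4)[OF that]])
  obtain w w1 where w: "sol w w1 v"
    using variation_of_constants[OF pr lborel.is_prim_prim_of[OF li[OF pr(1)]] lborel.is_prim_prim_of[OF li[OF pr(2)]]] by blast
  have lo: "loc_L2 y" if "sol y y1 s" for y y1 s using loc_L2_bounded sol_regular[OF that] by blast
  \<comment> \<open>S is a linear space because K is closed under maxima, so one argument covers the
    local and the global version.\<close>
  define S where "S = (\<Union>R\<in>K. L2_on R)"
  have uw: "loc_L2 (\<lambda>x. u x - w x)" using loc_L2_lin[OF u lo[OF w], of 1 "-1"] by simp
  have Slin: "(\<lambda>x. c * f x + d * g x) \<in> S" if fg: "f \<in> S" "g \<in> S" for f g c d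
  proof -
    obtain R R' where R: "R \<in> K" "f \<in> L2_on R" "R' \<in> K" "g \<in> L2_on R'" using fg by (auto simp: S_def)
    then have "(\<lambda>x. c * f x + d * g x) \<in> L2_on (max R R')"
      unfolding L2_on_def by (auto intro: square_integrable_lin)
    then show ?thesis using K(3) R by (auto simp: S_def)
  qed
  have int: "integrable lborel (\<lambda>x. y x * f x)" if "loc_L2 y" "f \<in> S" for y f
    using loc_L2_mult_integrable that by (auto simp: S_def)
  have lin: "(LINT x|lborel. y x * (c * f x + d * g x)) = c * (LINT x|lborel. y x * f x) + d * (LINT x|lborel. y x * g x)"
    if "loc_L2 y" "f \<in> S" "g \<in> S" for y f g c d
  proof -
    have "(LINT x|lborel. y x * (c * f x + d * g x)) = (LINT x|lborel. c * (y x * f x) + d * (y x * g x))"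
      by (simp add: algebra_simps)
    also have "\<dots> = c * (LINT x|lborel. y x * f x) + d * (LINT x|lborel. y x * g x)"
      using int[OF that(1,2)] int[OF that(1,3)] by simp
    finally show ?thesis .
  qed
  have "\<exists>a b. \<forall>f\<in>S. (LINT x|lborel. (u x - w x) * f x) = a * (LINT x|lborel. p x * f x) + b * (LINT x|lborel. r x * f x)"
  proof (rule functional_lin_comb)
    show "(\<lambda>x. c * f x + d * g x) \<in> S" if "f \<in> S" "g \<in> S" for f g c d using Slin that .
    fix f assume f: "f \<in> S" and o: "(LINT x|lborel. p x * f x) = 0" "(LINT x|lborel. r x * f x) = 0"
    obtain R where R: "R \<in> K" "f \<in> L2_on R" using f by (auto simp: S_def)
    obtain h h1 where h: "test R h h1 f" using test_exists[OF pr R(2) K(2)[OF R(1)] o] by blast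
    have "(LINT x|lborel. (u x - w x) * f x) = (LINT x|lborel. u x * f x) - (LINT x|lborel. w x * f x)"
      using int[OF u f] int[OF lo[OF w] f] by (simp add: left_diff_distrib)
    also have "\<dots> = 0" using weak[OF R(1) h] green_test[OF w h] by simp
    finally show "(LINT x|lborel. (u x - w x) * f x) = 0" .
  qed (rule lin[OF uw] lin[OF lo[OF pr(1)]] lin[OF lo[OF pr(2)]]; assumption)+
  then obtain a b where ab: "\<And>f. f \<in> S \<Longrightarrow> (LINT x|lborel. (u x - w x) * f x) = a * (LINT x|lborel. p x * f x) + b * (LINT x|lborel. r x * f x)"
    by blast
  let ?c = "\<lambda>x. a * p x + b * r x"
  have c: "sol ?c (\<lambda>x. a * p1 x + b * r1 x) (\<lambda>x. a * 0 + b * 0)" by (intro sol_lin pr)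
  have f: "sol (\<lambda>x. 1 * w x + 1 * ?c x) (\<lambda>x. 1 * w1 x + 1 * (a * p1 x + b * r1 x)) (\<lambda>x. 1 * v x + 1 * (a * 0 + b * 0))"
    by (intro sol_lin w pr)
  have "AE x in lborel. \<bar>x\<bar> < R \<longrightarrow> u x = 1 * w x + 1 * ?c x" if R: "R \<in> K" for R
  proof -
    have "AE x in lborel. \<bar>x\<bar> < R \<longrightarrow> (u x - w x) - ?c x = 0"
    proof (rule L2_on_zero_AE)
      show "loc_L2 (\<lambda>x. (u x - w x) - ?c x)" using loc_L2_lin[OF uw lo[OF c], of 1 "-1"] by (simp add: algebra_simps)
      fix s assume "s \<in> L2_on R"
      then have s: "s \<in> S" using R by (auto simp: S_def)
      have "(LINT x|lborel. ((u x - w x) - ?c x) * s x) = (LINT x|lborel. (u x - w x) * s x - (a * (p x * s x) + b * (r x * s x)))"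
        by (simp add: algebra_simps)
      also have "\<dots> = (LINT x|lborel. (u x - w x) * s x) - (a * (LINT x|lborel. p x * s x) + b * (LINT x|lborel. r x * s x))"
        using int[OF uw s] int[OF lo[OF pr(1)] s] int[OF lo[OF pr(2)] s] by simp
      also have "\<dots> = 0" using ab[OF s] by simp
      finally show "(LINT x|lborel. ((u x - w x) - ?c x) * s x) = 0" .
    qed
    then show ?thesis by eventually_elim (simp add: algebra_simps)
  qed
  then show ?thesis using f by (intro exI[of _ "\<lambda>x. 1 * w x + 1 * ?c x"] exI[of _ "\<lambda>x. 1 * w1 x + 1 * (a * p1 x + b * r1 x)"]) simp
qed

text \<open>In the integration by parts of f h1 only h1 has to be a Lebesgue primitive. So f may be
  any function with a dP-density, in particular an element of the form domain.\<close>

lemma form_test: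
  assumes f: "is_prim M f (\<lambda>x. \<sigma> x *\<^sub>R g x)" and h: "test R h h1 r"
  shows "(LINT x|M. \<sigma> x *\<^sub>R (g x * h1 x)) + (LINT x|lborel. qc x * (f x * h x)) = (LINT x|lborel. f x * r x)"
proof -
  have hs: "sol h h1 r" and R: "0 \<le> R" and z: "\<And>x. \<bar>x\<bar> \<ge> R \<Longrightarrow> h x = 0" "\<And>x. \<bar>x\<bar> \<ge> R \<Longrightarrow> h1 x = 0"
    using h by (auto simp: test_def)
  note [measurable] = prim_measurable[OF f] sol_regular(1,2,3)[OF hs] loc_int_measurable[OF prim_int[OF f]]
  have h1: "is_prim lborel h1 (\<lambda>x. qc x * h x - r x)" using hs by (simp add: sol_def)
  have "0 = (LINT t:{-R..<R}|lborel. f t * (qc t * h t - r t)) + (LINT s:{-R..<R}|M. (\<sigma> s *\<^sub>R g s) * h1 s)"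
    using prim_product[OF f h1, of "-R" R] R z by simp
  also have "(LINT s:{-R..<R}|M. (\<sigma> s *\<^sub>R g s) * h1 s) = (LINT s|M. (\<sigma> s *\<^sub>R g s) * h1 s)"
  proof (rule integral_restrict)
    show "(\<lambda>s. (\<sigma> s *\<^sub>R g s) * h1 s) \<in> borel_measurable M" by measurable
  qed (use z in \<open>auto simp: not_le\<close>)
  also have "(LINT t:{-R..<R}|lborel. f t * (qc t * h t - r t)) = (LINT t:{-R..<R}|lborel. qc t * (f t * h t)) - (LINT t:{-R..<R}|lborel. f t * r t)"
  proof -
    have "locally_integrable lborel (\<lambda>t. f t * (h t * qc t))"
      by (rule lborel.loc_int_mult_bounded[OF lborel.loc_int_mult_bounded[OF qc sol_regular(1,4)[OF hs]] prim_measurable[OF f] prim_locally_bounded[OF f]])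
    then have i1: "set_integrable lborel {-R..<R} (\<lambda>t. qc t * (f t * h t))"
      using lborel.loc_int[of _ "{-R..<R}"] by (simp add: mult_ac)
    have i2: "set_integrable lborel {-R..<R} (\<lambda>t. f t * r t)"
      by (rule lborel.loc_int[OF lborel.loc_int_mult_bounded[OF sol_source_int[OF hs] prim_measurable[OF f] prim_locally_bounded[OF f]]]) simp
    show ?thesis unfolding set_integral_diff(2)[OF i1 i2, symmetric] by (simp add: algebra_simps)
  qed
  also have "(LINT t:{-R..<R}|lborel. qc t * (f t * h t)) = (LINT t|lborel. qc t * (f t * h t))"
    by (rule integral_restrict) (use z in \<open>auto simp: not_le\<close>)
  also have "(LINT t:{-R..<R}|lborel. f t * r t) = (LINT t|lborel. f t * r t)"
  proof (rule integral_restrict)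
    show "AE x in lborel. x \<notin> {-R..<R} \<longrightarrow> f x * r x = 0"
      using test_source[OF h] by eventually_elim simp
  qed auto
  finally show ?thesis by (simp add: algebra_simps)
qed

end

section \<open>The maximal operator and the form in terms of primitives\<close>

lemma AC_lborel:
  assumes "f \<in> AC_loc (measure lborel)"
  shows "is_prim lborel f (quasi_deriv (measure lborel) f)"
proof -
  interpret LB: signed_rep "measure lborel" UNIV by (rule signed_rep_lborel)
  show ?thesis using LB.quasi_deriv_prim[OF assms] by (simp add: variation_lborel hahn_sign_def)
qed

lemma prim_AC_lborel:
  fixes f g :: "real \<Rightarrow> complex"
  assumes "is_prim lborel f g" shows "f \<in> AC_loc (measure lborel)"
proof -
  interpret LB: signed_rep "measure lborel" UNIV by (rule signed_rep_lborel)
  show ?thesis using LB.prim_AC_loc(1)[of f g] assms by (simp add: variation_lborel hahn_sign_def)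
qed

context sturm_liouville
begin

text \<open>Two candidates agree |dP|-almost everywhere, hence Lebesgue-almost everywhere, hence
  everywhere by left continuity.\<close>

lemma ac_quasi_deriv_eq:
  assumes "f \<in> AC_loc (dP \<nu>)" "g \<in> AC_loc (measure lborel)" "has_quasi_deriv (dP \<nu>) f g"
  shows "ac_quasi_deriv \<nu> f = g"
  unfolding ac_quasi_deriv_def
proof (rule the_equality)
  fix k assume k: "k \<in> AC_loc (measure lborel) \<and> has_quasi_deriv (dP \<nu>) f k"
  have "AE x in M. k x = g x"
    using k assms by (intro prim_sigma_unique[of f] has_quasi_deriv_prim) auto
  then have "AE x in lborel. k x = g x" by (rule AE_M_lborel)
  then have "k x = g x" for x
    using lborel.prim_left_continuous[OF AC_lborel] k assms(2) by (intro left_continuous_AE_eq) auto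
  then show "k = g" by auto
qed (use assms in auto)

text \<open>Removes the selected representatives from \<open>tau\<close>. A density may be altered
  on a null set, so the given v itself can be the source in \<open>sol\<close>.\<close>

lemma max_operator_iff:
  "(u, v) \<in> max_operator \<nu> q \<longleftrightarrow> u \<in> L2 \<and> v \<in> L2 \<and> (\<exists>f f1. sol f f1 v \<and> (AE x in lborel. u x = f x))"
proof
  assume "(u, v) \<in> max_operator \<nu> q"
  then obtain f where u: "u \<in> L2" and v: "v \<in> L2" and f: "f \<in> tau_dom \<nu>" "AE x in lborel. u x = f x"
    "AE x in lborel. v x = tau \<nu> q f x"
    unfolding max_operator_def by blast
  obtain g where g: "f \<in> AC_loc (dP \<nu>)" "g \<in> AC_loc (measure lborel)" "has_quasi_deriv (dP \<nu>) f g"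
    using f(1) unfolding tau_dom_def by blast
  note [measurable] = prim_measurable[OF has_quasi_deriv_prim[OF g(1,3)]]
  have [measurable]: "v \<in> borel_measurable borel" using v by (simp add: square_integrable_def)
  have "is_prim lborel g (\<lambda>x. qc x * f x - v x)"
  proof (rule lborel.prim_cong_AE[OF AC_lborel[OF g(2)]])
    show "AE x in lborel. quasi_deriv (measure lborel) g x = qc x * f x - v x"
      using f(3) by eventually_elim (simp add: tau_def ac_quasi_deriv_eq[OF g] qc_def)
  qed measurable
  then have "sol f g v" using has_quasi_deriv_prim[OF g(1,3)] by (simp add: sol_def)
  then show "u \<in> L2 \<and> v \<in> L2 \<and> (\<exists>f f1. sol f f1 v \<and> (AE x in lborel. u x = f x))"
    using u v f(2) by blast
next
  assume "u \<in> L2 \<and> v \<in> L2 \<and> (\<exists>f f1. sol f f1 v \<and> (AE x in lborel. u x = f x))"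
  then obtain f f1 where u: "u \<in> L2" "v \<in> L2" and f: "is_prim M f (\<lambda>x. \<sigma> x *\<^sub>R f1 x)"
    "is_prim lborel f1 (\<lambda>x. qc x * f x - v x)" "AE x in lborel. u x = f x"
    by (auto simp: sol_def)
  note g = prim_AC_loc(1)[OF f(1)] prim_AC_lborel[OF f(2)] prim_AC_loc(2)[OF f(1)]
  have "AE x in lborel. quasi_deriv (measure lborel) f1 x = qc x * f x - v x"
    by (rule lborel.prim_unique_AE[OF AC_lborel[OF g(2)] f(2)])
  then have "AE x in lborel. v x = tau \<nu> q f x"
    by eventually_elim (simp add: tau_def ac_quasi_deriv_eq[OF g] qc_def)
  moreover have "f \<in> tau_dom \<nu>" using g by (auto simp: tau_dom_def)
  ultimately show "(u, v) \<in> max_operator \<nu> q"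
    unfolding max_operator_def using u f(3) by blast
qed

section \<open>The form in terms of representatives, and part (i)\<close>

definition form_rep :: "(real \<Rightarrow> complex) \<Rightarrow> (real \<Rightarrow> complex) \<Rightarrow> (real \<Rightarrow> complex) \<Rightarrow> bool" where
  "form_rep u f g \<longleftrightarrow> u \<in> L2c \<and> is_prim M f (\<lambda>x. \<sigma> x *\<^sub>R g x) \<and> (AE x in lborel. u x = f x) \<and> g \<in> square_integrable M"

definition rep where "rep u = ac_rep (dP \<nu>) u"
definition rep1 where "rep1 u = quasi_deriv (dP \<nu>) (rep u)"

lemma ac_rep_eq:
  assumes "f \<in> AC_loc (dP \<nu>)" "AE x in lborel. u x = f x" shows "rep u = f"
  unfolding rep_def ac_rep_def
proof (rule the_equality)
  fix k assume k: "k \<in> AC_loc (dP \<nu>) \<and> (AE x in lborel. u x = k x)"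
  have "AE x in lborel. k x = f x" using conjunct2[OF k] assms(2) by eventually_elim simp
  then have "k x = f x" for x
    using k assms(1) unfolding AC_loc_def by (intro left_continuous_AE_eq) auto
  then show "k = f" by auto
qed (use assms in auto)

lemma prim_sigma_measurable:
  assumes "is_prim M f (\<lambda>x. \<sigma> x *\<^sub>R g x)" shows "g \<in> borel_measurable borel"
proof -
  note [measurable] = loc_int_measurable[OF prim_int[OF assms]]
  have "(\<lambda>x. \<sigma> x *\<^sub>R \<sigma> x *\<^sub>R g x) \<in> borel_measurable borel" by measurable
  then show ?thesis by simp
qed

lemma form_rep_unique:
  assumes "form_rep u f g" shows "rep u = f" "AE x in M. rep1 u x = g x" "form_rep u (rep u) (rep1 u)"
proof -
  have p: "is_prim M f (\<lambda>x. \<sigma> x *\<^sub>R g x)" "AE x in lborel. u x = f x" "g \<in> square_integrable M"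
    using assms by (auto simp: form_rep_def)
  note f = prim_AC_loc(1)[OF p(1)]
  show r: "rep u = f" by (rule ac_rep_eq[OF f p(2)])
  have p1: "is_prim M f (\<lambda>x. \<sigma> x *\<^sub>R rep1 u x)" unfolding rep1_def r by (rule quasi_deriv_prim[OF f])
  show ae: "AE x in M. rep1 u x = g x" by (rule prim_sigma_unique[OF p1 p(1)])
  note [measurable] = prim_sigma_measurable[OF p1] prim_sigma_measurable[OF p(1)]
  have "integrable M (\<lambda>x. (cmod (rep1 u x))\<^sup>2) \<longleftrightarrow> integrable M (\<lambda>x. (cmod (g x))\<^sup>2)"
    by (rule integrable_cong_AE) (use ae in auto)
  then have "rep1 u \<in> square_integrable M" using p(3) by (simp add: square_integrable_def)
  then show "form_rep u (rep u) (rep1 u)" using assms p1 by (simp add: form_rep_def r)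
qed

lemma dom_form0: "u \<in> dom (form0 \<nu> q) \<longleftrightarrow> form_rep u (rep u) (rep1 u)"
proof
  assume "u \<in> dom (form0 \<nu> q)"
  then have u: "u \<in> L2c" "\<exists>f \<in> AC_loc (dP \<nu>). AE x in lborel. u x = f x" "rep1 u \<in> square_integrable M"
    by (auto simp: form0_def rep1_def rep_def dom_def split: if_splits)
  then obtain f where f: "f \<in> AC_loc (dP \<nu>)" "AE x in lborel. u x = f x" by blast
  then show "form_rep u (rep u) (rep1 u)"
    using u quasi_deriv_prim[OF f(1)] ac_rep_eq[OF f] by (simp add: form_rep_def rep1_def)
next
  assume r: "form_rep u (rep u) (rep1 u)"
  then have "rep u \<in> AC_loc (dP \<nu>)" using prim_AC_loc(1) unfolding form_rep_def by blast
  then show "u \<in> dom (form0 \<nu> q)"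
    using r by (auto simp: form0_def rep1_def rep_def dom_def form_rep_def)
qed

lemma form_rep_dom: "form_rep u f g \<Longrightarrow> u \<in> dom (form0 \<nu> q)"
  using form_rep_unique(3) dom_form0 by blast

lemma form_rep_support:
  assumes "form_rep u f g" shows "\<exists>R\<ge>0. \<forall>x. \<bar>x\<bar> \<ge> R \<longrightarrow> f x = 0"
proof -
  have p: "is_prim M f (\<lambda>x. \<sigma> x *\<^sub>R g x)" "AE x in lborel. u x = f x" "u \<in> L2c"
    using assms by (auto simp: form_rep_def)
  obtain R where R: "AE x in lborel. \<bar>x\<bar> > R \<longrightarrow> u x = 0" using p(3) by (auto simp: L2c_def)
  \<comment> \<open>The margin 1 ensures that the whole interval (x - 1, x), from which left
    continuity reads off f x, lies where u vanishes almost everywhere.\<close>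
  have "f x = 0" if x: "\<bar>x\<bar> \<ge> \<bar>R\<bar> + 1" for x
  proof (rule left_continuous_AE_eq_at[of x f "\<lambda>_. 0" "x - 1"])
    show "continuous (at_left x) f" by (rule prim_left_continuous[OF p(1)])
    show "AE y in lborel. x - 1 < y \<and> y < x \<longrightarrow> f y = 0"
      using R p(2) by eventually_elim (use x in \<open>auto simp: abs_if split: if_splits\<close>)
  qed auto
  then show ?thesis by (intro exI[of _ "\<bar>R\<bar> + 1"]) auto
qed

lemma q_compact_integrable:
  assumes "is_prim M f g" "is_prim M h k" "\<And>x. \<bar>x\<bar> \<ge> R \<Longrightarrow> f x = 0"
  shows "integrable lborel (\<lambda>x. qc x * (f x * h x))"
proof -
  have "locally_integrable lborel (\<lambda>x. f x * (h x * qc x))"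
    by (rule lborel.loc_int_mult_bounded[OF lborel.loc_int_mult_bounded[OF qc prim_measurable[OF assms(2)] prim_locally_bounded[OF assms(2)]]
      prim_measurable[OF assms(1)] prim_locally_bounded[OF assms(1)]])
  then have "integrable lborel (\<lambda>x. indicator {-R..R} x *\<^sub>R (f x * (h x * qc x)))"
    using lborel.loc_int[of _ "{-R..R}"] by (simp add: set_integrable_def)
  moreover have "indicator {-R..R} x *\<^sub>R (f x * (h x * qc x)) = qc x * (f x * h x)" for x
    using assms(3)[of x] by (cases "\<bar>x\<bar> \<ge> R") (auto simp: not_le abs_less_iff mult_ac)
  ultimately show ?thesis by simp
qed

definition sform :: "(real \<Rightarrow> complex) \<Rightarrow> (real \<Rightarrow> complex) \<Rightarrow> complex" where
  "sform u w = (LINT x|M. \<sigma> x *\<^sub>R (rep1 u x * cnj (rep1 w x))) + (LINT x|lborel. qc x * (rep u x * cnj (rep w x)))"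

lemma sigma_integrable:
  assumes "g \<in> square_integrable M" "k \<in> square_integrable M"
  shows "integrable M (\<lambda>x. \<sigma> x *\<^sub>R (g x * cnj (k x)))"
proof (rule Bochner_Integration.integrable_bound[OF square_integrable_mult_cnj[OF assms]])
  have [measurable]: "g \<in> borel_measurable borel" "k \<in> borel_measurable borel"
    using assms by (auto simp: square_integrable_def)
  show "(\<lambda>x. \<sigma> x *\<^sub>R (g x * cnj (k x))) \<in> borel_measurable M" by measurable
qed simp

lemma sform_eq:
  assumes "form_rep u f g" "form_rep w h k"
  shows "sform u w = (LINT x|M. \<sigma> x *\<^sub>R (g x * cnj (k x))) + (LINT x|lborel. qc x * (f x * cnj (h x)))"
proof -
  note [measurable] = assms[unfolded form_rep_def, THEN conjunct2, THEN conjunct1, THEN prim_sigma_measurable]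
    form_rep_unique(3)[OF assms(1), unfolded form_rep_def, THEN conjunct2, THEN conjunct1, THEN prim_sigma_measurable]
    form_rep_unique(3)[OF assms(2), unfolded form_rep_def, THEN conjunct2, THEN conjunct1, THEN prim_sigma_measurable]
  have "(LINT x|M. \<sigma> x *\<^sub>R (rep1 u x * cnj (rep1 w x))) = (LINT x|M. \<sigma> x *\<^sub>R (g x * cnj (k x)))"
  proof (rule integral_cong_AE)
    show "AE x in M. \<sigma> x *\<^sub>R (rep1 u x * cnj (rep1 w x)) = \<sigma> x *\<^sub>R (g x * cnj (k x))"
      using form_rep_unique(2)[OF assms(1)] form_rep_unique(2)[OF assms(2)] by eventually_elim simp
  qed measurable
  then show ?thesis
    unfolding sform_def form_rep_unique(1)[OF assms(1)] form_rep_unique(1)[OF assms(2)] by simp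
qed

lemma form_rep_lin:
  assumes "form_rep u f g" "form_rep w h k"
  shows "form_rep (\<lambda>x. c * u x + d * w x) (\<lambda>x. c * f x + d * h x) (\<lambda>x. c * g x + d * k x)"
  unfolding form_rep_def
proof (intro conjI)
  obtain R R' where R: "AE x in lborel. \<bar>x\<bar> > R \<longrightarrow> u x = 0" "AE x in lborel. \<bar>x\<bar> > R' \<longrightarrow> w x = 0"
    using assms by (auto simp: form_rep_def L2c_def)
  have "AE x in lborel. \<bar>x\<bar> > max R R' \<longrightarrow> c * u x + d * w x = 0"
    using R by eventually_elim auto
  moreover have "(\<lambda>x. c * u x + d * w x) \<in> L2"
    using assms by (intro square_integrable_lin) (auto simp: form_rep_def L2c_def)
  ultimately show "(\<lambda>x. c * u x + d * w x) \<in> L2c" unfolding L2c_def by blast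
  have "is_prim M (\<lambda>x. c * f x + d * h x) (\<lambda>x. c * (\<sigma> x *\<^sub>R g x) + d * (\<sigma> x *\<^sub>R k x))"
    using assms by (intro prim_lin) (auto simp: form_rep_def)
  then show "is_prim M (\<lambda>x. c * f x + d * h x) (\<lambda>x. \<sigma> x *\<^sub>R (c * g x + d * k x))"
    by (simp add: scaleR_add_right)
  have "AE x in lborel. u x = f x" "AE x in lborel. w x = h x" using assms by (auto simp: form_rep_def)
  then show "AE x in lborel. c * u x + d * w x = c * f x + d * h x" by eventually_elim simp
  show "(\<lambda>x. c * g x + d * k x) \<in> square_integrable M"
    using assms by (intro square_integrable_lin) (auto simp: form_rep_def)
qed

lemma form_rep_zero: "form_rep (\<lambda>_. 0) (\<lambda>_. 0) (\<lambda>_. 0)"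
  using prim_const[of 0] by (auto simp: form_rep_def L2c_def square_integrable_def)

lemma form_rep_integrable:
  assumes "form_rep u f g" "form_rep w h k"
  shows "integrable M (\<lambda>x. \<sigma> x *\<^sub>R (g x * cnj (k x)))" "integrable lborel (\<lambda>x. qc x * (f x * cnj (h x)))"
proof -
  show "integrable M (\<lambda>x. \<sigma> x *\<^sub>R (g x * cnj (k x)))"
    using assms by (intro sigma_integrable) (auto simp: form_rep_def)
  obtain R where R: "\<And>x. \<bar>x\<bar> \<ge> R \<Longrightarrow> f x = 0" using form_rep_support[OF assms(1)] by blast
  have "is_prim M (\<lambda>x. cnj (h x)) (\<lambda>x. cnj (\<sigma> x *\<^sub>R k x))"
    using assms(2) by (intro prim_cnj) (simp add: form_rep_def)
  then show "integrable lborel (\<lambda>x. qc x * (f x * cnj (h x)))"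
    using assms(1) R by (intro q_compact_integrable) (auto simp: form_rep_def)
qed

lemma form0_eq:
  assumes "form_rep u f g" shows "sform u u = of_real (the (form0 \<nu> q u))"
proof -
  have u: "u \<in> dom (form0 \<nu> q)" by (rule form_rep_dom[OF assms])
  note r = form_rep_unique(3)[OF assms]
  have rr: "is_prim M (rep u) (\<lambda>x. \<sigma> x *\<^sub>R rep1 u x)" "AE x in lborel. u x = rep u x" "rep1 u \<in> square_integrable M" "u \<in> L2"
    using r by (auto simp: form_rep_def L2c_def)
  have i: "integrable M (\<lambda>x. (cmod (rep1 u x))\<^sup>2)" using rr(3) by (simp add: square_integrable_def)
  have q_real: "q x = Re (qc x)" for x by (simp add: qc_def)
  have [measurable]: "q \<in> borel_measurable borel" by (rule lborel.loc_int_measurable[OF q])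
  have [measurable]: "u \<in> borel_measurable borel" using rr(4) by (simp add: square_integrable_def)
  note [measurable] = prim_measurable[OF rr(1)]
  have 1: "(LINT x|lborel. q x * (cmod (u x))\<^sup>2) = (LINT x|lborel. q x * (cmod (rep u x))\<^sup>2)"
    by (rule integral_cong_AE) (use rr(2) in auto)
  have "the (form0 \<nu> q u) = signed_integral (dP \<nu>) (\<lambda>x. (cmod (rep1 u x))\<^sup>2) + (LINT x|lborel. q x * (cmod (rep u x))\<^sup>2)"
    using u unfolding 1[symmetric] by (auto simp: form0_def rep1_def rep_def dom_def split: if_splits)
  also have "signed_integral (dP \<nu>) (\<lambda>x. (cmod (rep1 u x))\<^sup>2) = (LINT x|M. \<sigma> x *\<^sub>R (cmod (rep1 u x))\<^sup>2)"
    by (rule signed_integral_hahn[OF E posE negE i])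
  finally have "complex_of_real (the (form0 \<nu> q u)) = of_real (LINT x|M. \<sigma> x *\<^sub>R (cmod (rep1 u x))\<^sup>2)
      + of_real (LINT x|lborel. q x * (cmod (rep u x))\<^sup>2)" by simp
  also have "\<dots> = (LINT x|M. complex_of_real (\<sigma> x *\<^sub>R (cmod (rep1 u x))\<^sup>2)) + (LINT x|lborel. complex_of_real (q x * (cmod (rep u x))\<^sup>2))"
    by (simp only: integral_complex_of_real)
  also have "\<dots> = sform u u"
    unfolding sform_def by (simp add: qc_def complex_norm_square[symmetric] scaleR_conv_of_real del: of_real_power)
  finally show ?thesis by simp
qed

lemma form0_quadratic: "quadratic_form (form0 \<nu> q)" "sesquilinear_on (dom (form0 \<nu> q)) sform"
proof -
  have lin: "(\<lambda>x. c * f x + d * g x) \<in> dom (form0 \<nu> q)" if "f \<in> dom (form0 \<nu> q)" "g \<in> dom (form0 \<nu> q)" for f g c d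
    using form_rep_dom[OF form_rep_lin] that dom_form0 by blast
  show sq: "sesquilinear_on (dom (form0 \<nu> q)) sform"
    unfolding sesquilinear_on_def
  proof (intro ballI allI conjI)
    fix f g h c d assume "f \<in> dom (form0 \<nu> q)" "g \<in> dom (form0 \<nu> q)" "h \<in> dom (form0 \<nu> q)"
    then have r: "form_rep f (rep f) (rep1 f)" "form_rep g (rep g) (rep1 g)" "form_rep h (rep h) (rep1 h)"
      using dom_form0 by auto
    note i = form_rep_integrable[OF r(1,3)] form_rep_integrable[OF r(2,3)]
      form_rep_integrable[OF r(3,1)] form_rep_integrable[OF r(3,2)]
    have "sform (\<lambda>x. c * f x + d * g x) h =
      (LINT x|M. c * (\<sigma> x *\<^sub>R (rep1 f x * cnj (rep1 h x))) + d * (\<sigma> x *\<^sub>R (rep1 g x * cnj (rep1 h x)))) +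
      (LINT x|lborel. c * (qc x * (rep f x * cnj (rep h x))) + d * (qc x * (rep g x * cnj (rep h x))))"
      unfolding sform_eq[OF form_rep_lin[OF r(1,2)] r(3)]
      by (intro arg_cong2[where f="(+)"] Bochner_Integration.integral_cong) (auto simp: algebra_simps)
    also have "\<dots> = c * sform f h + d * sform g h"
      unfolding sform_def using i by (simp add: distrib_left del: mult_scaleR_right)
    finally show "sform (\<lambda>x. c * f x + d * g x) h = c * sform f h + d * sform g h" .
    have "sform h (\<lambda>x. c * f x + d * g x) =
      (LINT x|M. cnj c * (\<sigma> x *\<^sub>R (rep1 h x * cnj (rep1 f x))) + cnj d * (\<sigma> x *\<^sub>R (rep1 h x * cnj (rep1 g x)))) +
      (LINT x|lborel. cnj c * (qc x * (rep h x * cnj (rep f x))) + cnj d * (qc x * (rep h x * cnj (rep g x))))"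
      unfolding sform_eq[OF r(3) form_rep_lin[OF r(1,2)]]
      by (intro arg_cong2[where f="(+)"] Bochner_Integration.integral_cong) (auto simp: algebra_simps)
    also have "\<dots> = cnj c * sform h f + cnj d * sform h g"
      unfolding sform_def using i by (simp add: distrib_left del: mult_scaleR_right)
    finally show "sform h (\<lambda>x. c * f x + d * g x) = cnj c * sform h f + cnj d * sform h g" .
  qed
  show "quadratic_form (form0 \<nu> q)"
    unfolding quadratic_form_def
  proof (intro conjI ballI allI impI)
    show "dom (form0 \<nu> q) \<subseteq> L2" using dom_form0 by (auto simp: form_rep_def L2c_def)
    show "(\<lambda>_. 0) \<in> dom (form0 \<nu> q)" by (rule form_rep_dom[OF form_rep_zero])
    show "(\<lambda>x. c * f x + d * g x) \<in> dom (form0 \<nu> q)" if "f \<in> dom (form0 \<nu> q)" "g \<in> dom (form0 \<nu> q)" for f g c d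
      by (rule lin[OF that])
    show "form0 \<nu> q g = form0 \<nu> q f" if f: "f \<in> dom (form0 \<nu> q)" and g: "g \<in> L2" and ae: "AE x in lborel. f x = g x" for f g
    proof -
      have r: "form_rep f (rep f) (rep1 f)" using f dom_form0 by blast
      then have f': "f \<in> L2c" "AE x in lborel. f x = rep f x" by (auto simp: form_rep_def)
      obtain R where R: "AE x in lborel. \<bar>x\<bar> > R \<longrightarrow> f x = 0" using f'(1) by (auto simp: L2c_def)
      have "AE x in lborel. \<bar>x\<bar> > R \<longrightarrow> g x = 0" using R ae by eventually_elim auto
      then have "g \<in> L2c" using g by (auto simp: L2c_def)
      moreover have "AE x in lborel. g x = rep f x" using f'(2) ae by eventually_elim simp
      ultimately have rg: "form_rep g (rep f) (rep1 f)" using r by (simp add: form_rep_def)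
      have "complex_of_real (the (form0 \<nu> q g)) = of_real (the (form0 \<nu> q f))"
        unfolding form0_eq[OF r, symmetric] form0_eq[OF rg, symmetric] sform_eq[OF rg rg] sform_eq[OF r r] ..
      then show ?thesis using f form_rep_dom[OF rg] by (auto simp: dom_def)
    qed
    show "\<exists>s. sesquilinear_on (dom (form0 \<nu> q)) s \<and> (\<forall>f\<in>dom (form0 \<nu> q). s f f = of_real (the (form0 \<nu> q f)))"
      using sq form0_eq dom_form0 by blast
  qed
qed

lemma test_form_rep:
  assumes h: "test R h h1 r" and u: "u \<in> L2" "AE x in lborel. u x = h x" shows "form_rep u h h1"
  unfolding form_rep_def
proof (intro conjI)
  have z: "\<And>x. \<bar>x\<bar> \<ge> R \<Longrightarrow> h x = 0" "\<And>x. \<bar>x\<bar> \<ge> R \<Longrightarrow> h1 x = 0" and s: "sol h h1 r" using h by (auto simp: test_def)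
  have "AE x in lborel. \<bar>x\<bar> > R \<longrightarrow> u x = 0" using u(2) by eventually_elim (use z in auto)
  then show "u \<in> L2c" using u(1) by (auto simp: L2c_def)
  show "is_prim M h (\<lambda>x. \<sigma> x *\<^sub>R h1 x)" using s by (simp add: sol_def)
  have "(\<lambda>x. indicator {-R..R} x *\<^sub>R h1 x) \<in> square_integrable M"
    by (rule bounded_indicator_L2[OF lf sol_regular(2,5)[OF s]])
  moreover have "indicator {-R..R} x *\<^sub>R h1 x = h1 x" for x using z(2)[of x] by (auto simp: indicator_def abs_if)
  ultimately show "h1 \<in> square_integrable M" by simp
qed (rule u)

lemma test_L2: "test R h h1 r \<Longrightarrow> h \<in> L2"
proof -
  assume h: "test R h h1 r"
  then have s: "sol h h1 r" and z: "\<And>x. \<bar>x\<bar> \<ge> R \<Longrightarrow> h x = 0" by (auto simp: test_def)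
  have "(\<lambda>x. indicator {-R..R} x *\<^sub>R h x) \<in> L2"
    by (rule bounded_indicator_L2[OF locally_finite_lborel sol_regular(1,4)[OF s]])
  moreover have "indicator {-R..R} x *\<^sub>R h x = h x" for x using z[of x] by (auto simp: indicator_def abs_if)
  ultimately show ?thesis by simp
qed

lemma test_max_operator: "test R h h1 r \<Longrightarrow> (h, r) \<in> max_operator \<nu> q"
  unfolding max_operator_iff using test_L2 by (auto simp: test_def)

text \<open>Both derivatives are moved onto h, so u enters only through its L2 class: for a test
  function h the functional u -> t0[u, h] is L2-bounded. Closability and the inclusion of the form
  operator in H come from this.\<close>

lemma sform_test:
  assumes u: "form_rep u f g" and h: "test R h h1 r"
  shows "sform u h = L2_inner u r"
proof -
  have f: "is_prim M f (\<lambda>x. \<sigma> x *\<^sub>R g x)" "AE x in lborel. u x = f x" "u \<in> L2" using u by (auto simp: form_rep_def L2c_def)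
  have "sform u h = (LINT x|lborel. f x * cnj (r x))"
    unfolding sform_eq[OF u test_form_rep[OF h test_L2[OF h]], simplified]
    using form_test[OF f(1) test_cnj[OF h]] by simp
  also have "\<dots> = L2_inner u r"
    unfolding L2_inner_def
  proof (rule integral_cong_AE)
    have [measurable]: "u \<in> borel_measurable borel" "r \<in> borel_measurable borel"
      using f(3) h by (auto simp: test_def square_integrable_def)
    note [measurable] = prim_measurable[OF f(1)]
    show "(\<lambda>x. f x * cnj (r x)) \<in> borel_measurable lborel" "(\<lambda>x. u x * cnj (r x)) \<in> borel_measurable lborel"
      by measurable
    show "AE x in lborel. f x * cnj (r x) = u x * cnj (r x)" using f(2) by eventually_elim simp
  qed
  finally show ?thesis .
qed

text \<open>The compact support of u passes to its left-continuous representative f and then to f1,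
  so f is a test function and u can be paired with it.\<close>

lemma operator0_form0:
  assumes "(u, v) \<in> max_operator0 \<nu> q"
  shows "u \<in> dom (form0 \<nu> q)" "L2_inner v u = of_real (the (form0 \<nu> q u))"
proof -
  have u: "u \<in> L2c" "u \<in> L2" "v \<in> L2" using assms by (auto simp: max_operator0_def max_operator_iff)
  obtain f f1 where f: "sol f f1 v" "AE x in lborel. u x = f x"
    using assms by (auto simp: max_operator0_def max_operator_iff)
  obtain R where R: "AE x in lborel. \<bar>x\<bar> > R \<longrightarrow> u x = 0" using u(1) by (auto simp: L2c_def)
  have z: "f x = 0" if x: "\<bar>x\<bar> \<ge> \<bar>R\<bar> + 1" for x
  proof (rule left_continuous_AE_eq_at[of x f "\<lambda>_. 0" "x - 1"])
    show "continuous (at_left x) f" using f(1) prim_left_continuous unfolding sol_def by blast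
    show "AE y in lborel. x - 1 < y \<and> y < x \<longrightarrow> f y = 0"
      using R f(2) by eventually_elim (use x in \<open>auto simp: abs_if split: if_splits\<close>)
  qed auto
  \<comment> \<open>Where f vanishes its density does so |dP|-almost everywhere, hence dx-almost
    everywhere. The further unit in |R| + 2 lets left continuity make f1 vanish at every
    point.\<close>
  have "AE x in M. x \<notin> {-(\<bar>R\<bar> + 1)..<\<bar>R\<bar> + 1} \<longrightarrow> \<sigma> x *\<^sub>R f1 x = 0"
    using f(1) z by (intro prim_restrict[of f]) (auto simp: sol_def)
  from AE_M_lborel[OF this] have ae: "AE x in lborel. x \<notin> {-(\<bar>R\<bar> + 1)..<\<bar>R\<bar> + 1} \<longrightarrow> f1 x = 0"
    by eventually_elim (auto simp: hahn_sign_def split: if_splits)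
  have z1: "f1 x = 0" if x: "\<bar>x\<bar> \<ge> \<bar>R\<bar> + 2" for x
  proof (rule left_continuous_AE_eq_at[of x f1 "\<lambda>_. 0" "x - 1"])
    show "continuous (at_left x) f1" using f(1) lborel.prim_left_continuous unfolding sol_def by blast
    show "AE y in lborel. x - 1 < y \<and> y < x \<longrightarrow> f1 y = 0"
      using ae by eventually_elim (use x in \<open>auto simp: abs_if split: if_splits\<close>)
  qed auto
  have t: "test (\<bar>R\<bar> + 2) f f1 v"
    unfolding test_def using f(1) u(3) z z1 by auto
  have r: "form_rep u f f1" by (rule test_form_rep[OF t u(2) f(2)])
  show "u \<in> dom (form0 \<nu> q)" by (rule form_rep_dom[OF r])
  have rf: "form_rep f f f1" by (rule test_form_rep[OF t test_L2[OF t]]) simp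
  \<comment> \<open>f is another representative of u, so it may stand in the second slot, where
    \<open>sform_test\<close> needs a test function.\<close>
  have "of_real (the (form0 \<nu> q u)) = sform u f"
    unfolding form0_eq[OF r, symmetric] sform_eq[OF r r] sform_eq[OF r rf] ..
  also have "\<dots> = L2_inner u v" by (rule sform_test[OF r t])
  finally have "L2_inner u v = of_real (the (form0 \<nu> q u))" by simp
  then show "L2_inner v u = of_real (the (form0 \<nu> q u))"
    using L2I.hermitian[OF u(2,3)] by simp
qed

end

section \<open>Density of the compactly supported solutions in the form domain\<close>

text \<open>Split B (F n) (F n) along F n = (F n - F N) + (F N - h) + h in the second slot. The
  first two terms are small by the Cauchy property and by density; in the third, B against the fixed
  h is an L2 inner product, which tends to 0 with F n. Each is at most K e, whence 3 K e.\<close>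

lemma (in form_data) closable_criterion:
  assumes rep: "\<And>h. h \<in> D0 \<Longrightarrow> h \<in> dom t \<and> (\<exists>w\<in>L2. \<forall>f\<in>dom t. B f h = L2_inner f w)"
    and dense: "\<And>f e. f \<in> dom t \<Longrightarrow> e > 0 \<Longrightarrow> \<exists>h\<in>D0. T.nrm (\<lambda>x. f x - h x) < e"
    and F: "T.cauchy F" "(\<lambda>n. L2_norm (F n)) \<longlonglongrightarrow> 0"
  shows "(\<lambda>n. T.nrm (F n)) \<longlonglongrightarrow> 0"
proof -
  note FD = T.cauchyD[OF F(1)]
  obtain K where K: "K > 0" "\<And>n. T.nrm (F n) \<le> K" using T.cauchy_bounded[OF F(1)] by blast
  have ev: "\<forall>\<^sub>F n in sequentially. (T.nrm (F n))\<^sup>2 < 3 * K * e" if e: "e > 0" for e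
  proof -
    obtain N where N: "\<And>n. n \<ge> N \<Longrightarrow> T.nrm (\<lambda>x. F n x - F N x) < e"
      using F(1) e unfolding T.cauchy_def by blast
    obtain h where h: "h \<in> D0" "T.nrm (\<lambda>x. F N x - h x) < e" using dense[OF FD[of N] e] by blast
    obtain w where w: "w \<in> L2" "\<And>f. f \<in> dom t \<Longrightarrow> B f h = L2_inner f w" using rep[OF h(1)] by blast
    have hd: "h \<in> dom t" using rep[OF h(1)] by blast
    have "(\<lambda>n. L2_norm (F n) * L2_norm w) \<longlonglongrightarrow> 0" using tendsto_mult_left_zero[OF F(2)] .
    then have "\<forall>\<^sub>F n in sequentially. L2_norm (F n) * L2_norm w < K * e"
      using K(1) e by (intro order_tendstoD(2)) auto
    then show ?thesis
      using eventually_ge_at_top[of N]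
    proof eventually_elim
      fix n assume lt: "L2_norm (F n) * L2_norm w < K * e" and n: "N \<le> n"
      have eq: "B (F n) (F n) = B (F n) (\<lambda>x. F n x - F N x) + B (F n) (\<lambda>x. F N x - h x) + B (F n) h"
        using FD hd by (simp add: T.diff_right)
      have 1: "cmod (B (F n) (\<lambda>x. F n x - F N x)) \<le> K * e"
        using T.Cauchy_Schwarz[OF FD[of n] T.diff_mem[OF FD[of n] FD[of N]]] K(2)[of n] N[OF n] K(1)
          mult_mono[of "T.nrm (F n)" K "T.nrm (\<lambda>x. F n x - F N x)" e] T.nrm_ge0[OF T.diff_mem[OF FD[of n] FD[of N]]]
        by linarith
      have 2: "cmod (B (F n) (\<lambda>x. F N x - h x)) \<le> K * e"
        using T.Cauchy_Schwarz[OF FD[of n] T.diff_mem[OF FD[of N] hd]] K(2)[of n] h(2) K(1)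
          mult_mono[of "T.nrm (F n)" K "T.nrm (\<lambda>x. F N x - h x)" e] T.nrm_ge0[OF T.diff_mem[OF FD[of N] hd]]
        by linarith
      have 3: "cmod (B (F n) h) < K * e"
        using L2I.Cauchy_Schwarz[OF dom_L2[OF FD[of n]] w(1)] lt by (simp add: w(2)[OF FD])
      have "(T.nrm (F n))\<^sup>2 \<le> cmod (B (F n) (F n))"
        by (simp add: T.nrm_sq[OF FD] complex_Re_le_cmod)
      also have "\<dots> \<le> cmod (B (F n) (\<lambda>x. F n x - F N x)) + cmod (B (F n) (\<lambda>x. F N x - h x)) + cmod (B (F n) h)"
        unfolding eq by (intro order_trans[OF norm_triangle_ineq] add_mono norm_triangle_ineq order_refl)
      finally show "(T.nrm (F n))\<^sup>2 < 3 * K * e" using 1 2 3 by linarith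
    qed
  qed
  show ?thesis
  proof (rule order_tendstoI)
    fix a :: real assume "a < 0"
    then show "\<forall>\<^sub>F n in sequentially. a < T.nrm (F n)"
      using less_le_trans[OF _ T.nrm_ge0[OF FD]] by (intro always_eventually) blast
  next
    fix a :: real assume a: "0 < a"
    have "\<forall>\<^sub>F n in sequentially. (T.nrm (F n))\<^sup>2 < 3 * K * (a\<^sup>2 / (3 * K))"
      using a K(1) by (intro ev) auto
    then show "\<forall>\<^sub>F n in sequentially. T.nrm (F n) < a"
    proof eventually_elim
      fix n assume "(T.nrm (F n))\<^sup>2 < 3 * K * (a\<^sup>2 / (3 * K))"
      then have "(T.nrm (F n))\<^sup>2 < a\<^sup>2" using K(1) by simp
      then show "T.nrm (F n) < a" using a power2_less_imp_less less_imp_le by blast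
    qed
  qed
qed

lemma (in lfm) square_integrable_indicator:
  assumes "B \<in> bounded_borel" shows "(\<lambda>x. indicator B x *\<^sub>R (1::complex)) \<in> square_integrable M"
proof -
  have eq: "(cmod (indicator B x *\<^sub>R (1::complex)))\<^sup>2 = indicator B x" for x by (simp add: indicator_def)
  have "B \<in> sets borel" using assms by (simp add: bounded_borel_def)
  then show ?thesis unfolding square_integrable_def mem_Collect_eq eq using emeasure_finite[OF assms] by simp
qed

lemma (in lfm) square_integrable_loc_int:
  assumes "g \<in> square_integrable M" shows "locally_integrable M g"
  unfolding locally_integrable_def set_integrable_def
  using square_integrable_mult[OF square_integrable_indicator assms, of "{_.._}"] by simp

context sturm_liouville
begin

lemma inner_on_tendsto:
  assumes F: "\<And>n. F n \<in> square_integrable M" and G: "G \<in> square_integrable M" and k: "k \<in> square_integrable M"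
    and lim: "(\<lambda>n. sqrt (LINT x|M. (cmod (F n x - G x))\<^sup>2)) \<longlonglongrightarrow> 0"
  shows "(\<lambda>n. inner_on M (F n) k) \<longlonglongrightarrow> inner_on M G k" "(\<lambda>n. inner_on M k (F n)) \<longlonglongrightarrow> inner_on M k G"
proof -
  let ?N = "\<lambda>f. sqrt (LINT x|M. (cmod (f x))\<^sup>2)"
  have "(\<lambda>n. ?N (\<lambda>x. F n x - G x) * ?N k) \<longlonglongrightarrow> 0" using tendsto_mult_left_zero[OF lim] .
  then have "(\<lambda>n. inner_on M (F n) k - inner_on M G k) \<longlonglongrightarrow> 0"
  proof (rule Lim_null_comparison[rotated])
    have "cmod (inner_on M (F n) k - inner_on M G k) \<le> ?N (\<lambda>x. F n x - G x) * ?N k" for n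
      using SI.Cauchy_Schwarz[OF SI.diff_mem[OF F G] k, of n] by (simp add: SI.diff_left[OF F G k])
    then show "\<forall>\<^sub>F n in sequentially. cmod (inner_on M (F n) k - inner_on M G k) \<le> ?N (\<lambda>x. F n x - G x) * ?N k" by simp
  qed
  then show 1: "(\<lambda>n. inner_on M (F n) k) \<longlonglongrightarrow> inner_on M G k" by (rule LIM_zero_cancel)
  have "(\<lambda>n. cnj (inner_on M (F n) k)) \<longlonglongrightarrow> cnj (inner_on M G k)" by (intro tendsto_intros 1)
  then show "(\<lambda>n. inner_on M k (F n)) \<longlonglongrightarrow> inner_on M k G"
    by (simp add: SI.hermitian[OF F k, symmetric] SI.hermitian[OF G k, symmetric])
qed

text \<open>If \<open>\<kappa>\<close> is orthogonal in \<open>L\<^sup>2(|dP|)\<close> to the quasi-derivatives of all compactly supported solutions,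
  then its primitive \<open>K\<close> is a weak solution of \<open>\<tau> K = q K\<close>, which forces \<open>(K\<^sup>[\<^sup>1\<^sup>])' = 0\<close>. The margin between
  \<open>R0\<close> and \<open>R\<close> excludes atoms of \<open>dP\<close> at the end points.\<close>

lemma orthogonal_to_tests:
  assumes k: "k \<in> square_integrable M" and R: "0 \<le> R0" "R0 < R"
    and o: "\<And>h h1 r. test R h h1 r \<Longrightarrow> inner_on M k h1 = 0"
  shows "\<exists>c. AE x in M. x \<in> {-R0..<R0} \<longrightarrow> k x = \<sigma> x *\<^sub>R c"
proof -
  define K where "K = prim_of M k"
  have li: "locally_integrable M k" by (rule square_integrable_loc_int[OF k])
  have K: "is_prim M K k" unfolding K_def by (rule is_prim_prim_of[OF li])
  have K': "is_prim M K (\<lambda>x. \<sigma> x *\<^sub>R (\<sigma> x *\<^sub>R k x))" using K by simp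
  note Kreg = prim_measurable[OF K] prim_locally_bounded[OF K]
  have weak: "(LINT x|lborel. K x * r x) = (LINT x|lborel. (K x * qc x) * h x)" if t: "test R h h1 r" for h h1 r
  proof -
    have "(LINT x|M. \<sigma> x *\<^sub>R ((\<sigma> x *\<^sub>R k x) * h1 x)) = (LINT x|M. k x * cnj (cnj (h1 x)))"
      by simp
    also have "\<dots> = 0" using o[OF test_cnj[OF t]] by (simp add: inner_on_def)
    finally show ?thesis using form_test[OF K' t] by (simp add: mult_ac)
  qed
  obtain f f1 where f: "sol f f1 (\<lambda>x. K x * qc x)" "\<And>S. S \<in> {R} \<Longrightarrow> AE x in lborel. \<bar>x\<bar> < S \<longrightarrow> K x = f x"
    using weak_solution[of K "\<lambda>x. K x * qc x" "{R}"] loc_L2_bounded[OF Kreg] lborel.loc_int_mult_bounded[OF qc Kreg]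
      weak R by auto
  have ae: "AE x in lborel. \<bar>x\<bar> < R \<longrightarrow> K x = f x" using f(2) by simp
  have Kf: "K x = f x" if x: "-R < x" "x < R" for x
  proof (rule left_continuous_AE_eq_at[of x K f "-R"])
    show "continuous (at_left x) K" by (rule prim_left_continuous[OF K])
    show "continuous (at_left x) f" using f(1) prim_left_continuous unfolding sol_def by blast
    show "AE y in lborel. -R < y \<and> y < x \<longrightarrow> K y = f y"
      using ae by eventually_elim (use x in auto)
  qed (use x in auto)
  have f1: "is_prim lborel f1 (\<lambda>x. qc x * f x - K x * qc x)" and fp: "is_prim M f (\<lambda>x. \<sigma> x *\<^sub>R f1 x)"
    using f(1) by (auto simp: sol_def)
  define c where "c = f1 0"
  \<comment> \<open>Where K = f the source K q cancels q f, so f1 has no increments.\<close>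
  have const: "f1 a = f1 b" if "-R < a" "a \<le> b" "b < R" for a b
  proof -
    have "f1 b - f1 a = (LINT x:{a..<b}|lborel. qc x * f x - K x * qc x)" by (rule lborel.prim_diff[OF f1 that(2)])
    also have "\<dots> = (LINT x:{a..<b}|lborel. 0)"
      using that Kf by (intro set_lebesgue_integral_cong) auto
    finally show ?thesis by simp
  qed
  have f1c: "f1 x = c" if "-R < x" "x < R" for x
    unfolding c_def using const[of x 0] const[of 0 x] that R by (cases "x \<le> 0") auto
  let ?I = "{-R0..<R0}"
  note [measurable] = loc_int_measurable[OF li]
  have int: "(LINT x:{a..<b}|M. indicator ?I x *\<^sub>R k x) = (LINT x:{a..<b}|M. indicator ?I x *\<^sub>R (\<sigma> x *\<^sub>R c))"
    if "a \<le> b" for a b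
  proof -
    let ?a = "max a (-R0)" and ?b = "min b R0"
    have restr: "(LINT x:{a..<b}|M. indicator ?I x *\<^sub>R g x) = (LINT x:{?a..<?b}|M. g x)" for g :: "real \<Rightarrow> complex"
      unfolding set_lebesgue_integral_def by (intro Bochner_Integration.integral_cong) (auto simp: indicator_def)
    show ?thesis
    proof (cases "?a \<le> ?b")
      case True
      have in': "-R < ?a" "?b < R" "-R < ?b" "?a < R" using R True by auto
      have "(LINT x:{?a..<?b}|M. k x) = K ?b - K ?a" by (rule prim_diff[OF K True, symmetric])
      also have "\<dots> = f ?b - f ?a" using Kf in' by (simp only:)
      also have "\<dots> = (LINT x:{?a..<?b}|M. \<sigma> x *\<^sub>R f1 x)" by (rule prim_diff[OF fp True])
      also have "\<dots> = (LINT x:{?a..<?b}|M. \<sigma> x *\<^sub>R c)"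
        using in' f1c by (intro set_lebesgue_integral_cong) auto
      finally show ?thesis unfolding restr .
    next
      case False
      then have e: "{?a..<?b} = {}" by (intro atLeastLessThan_empty) linarith
      show ?thesis unfolding restr e by (simp add: set_lebesgue_integral_def)
    qed
  qed
  have bound: "locally_integrable M (\<lambda>x. indicator ?I x *\<^sub>R g x)" if g: "locally_integrable M g" for g :: "real \<Rightarrow> complex"
    unfolding locally_integrable_def
  proof (intro allI)
    fix a b
    have [measurable]: "g \<in> borel_measurable borel" by (rule loc_int_measurable[OF g])
    show "set_integrable M {a..b} (\<lambda>x. indicator ?I x *\<^sub>R g x)"
      by (rule set_integrable_bound[OF loc_int[OF g, of "{a..b}"]])
        (auto simp: set_borel_measurable_def indicator_def)
  qed
  have "locally_integrable M (\<lambda>x. \<sigma> x *\<^sub>R c)"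
    by (intro loc_int_sigma loc_int_bounded) (auto simp: locally_bounded_def)
  then have "AE x in M. indicator ?I x *\<^sub>R k x = indicator ?I x *\<^sub>R (\<sigma> x *\<^sub>R c)"
    by (intro int_unique_AE bound li int)
  then have "AE x in M. x \<in> ?I \<longrightarrow> k x = \<sigma> x *\<^sub>R c" by eventually_elim (auto simp: indicator_def)
  then show ?thesis by blast
qed

text \<open>The Riesz sequence of g in the space of test quasi-derivatives converges to the
  projection G. The residual g - G is \<sigma> c on the support by
  \<open>orthogonal_to_tests\<close>, so its product with g is c times the conjugate of the total
  increment of f, which is 0; it is also orthogonal to G and therefore null.\<close>

lemma test_density:
  assumes u: "form_rep u f g" and R: "0 \<le> R0" "R0 < R" "\<And>x. \<bar>x\<bar> \<ge> R0 \<Longrightarrow> f x = 0"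
  shows "\<exists>H. (\<forall>n. \<exists>h r. test R h (H n) r) \<and> (\<lambda>n. LINT x|M. (cmod (g x - H n x))\<^sup>2) \<longlonglongrightarrow> 0"
proof -
  let ?N = "\<lambda>f. sqrt (LINT x|M. (cmod (f x))\<^sup>2)"
  define S where "S = {h1. \<exists>h r. test R h h1 r}"
  have g: "g \<in> square_integrable M" and fp: "is_prim M f (\<lambda>x. \<sigma> x *\<^sub>R g x)" using u by (auto simp: form_rep_def)
  have S_SI: "S \<subseteq> square_integrable M"
    using test_form_rep[OF _ test_L2] unfolding S_def form_rep_def by blast
  have S0: "(\<lambda>_. 0) \<in> S"
  proof -
    have "sol (\<lambda>_. 0) (\<lambda>_. 0) (\<lambda>_. 0)" using prim_const[of "0::complex"] lborel.prim_const[of "0::complex"] by (simp add: sol_def)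
    then have "test R (\<lambda>_. 0) (\<lambda>_. 0) (\<lambda>_. 0)" using R by (auto simp: test_def square_integrable_def)
    then show ?thesis by (auto simp: S_def)
  qed
  have Slin: "(\<lambda>x. c * f x + d * g x) \<in> S" if "f \<in> S" "g \<in> S" for f g c d
    using that test_lin unfolding S_def by blast
  interpret S: semi_inner S "inner_on M"
    by (rule SI.semi_inner_subspace[OF S_SI S0 Slin])
  have nrm: "S.nrm = ?N" by (intro ext) (simp add: S.nrm_def inner_on_self)
  have "\<exists>F. S.cauchy F \<and> (\<forall>k\<in>S. (\<lambda>n. inner_on M (F n) k) \<longlonglongrightarrow> inner_on M g k)"
  proof (rule S.riesz_sequence)
    show "inner_on M g (\<lambda>x. c * f x + d * h x) = cnj c * inner_on M g f + cnj d * inner_on M g h"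
      if "f \<in> S" "h \<in> S" for f h c d
      using SI.lin_right g S_SI that by blast
    show "cmod (inner_on M g h) \<le> ?N g * S.nrm h" if "h \<in> S" for h
      unfolding nrm using SI.Cauchy_Schwarz g S_SI that by blast
  qed
  then obtain F where F: "S.cauchy F" "\<And>k. k \<in> S \<Longrightarrow> (\<lambda>n. inner_on M (F n) k) \<longlonglongrightarrow> inner_on M g k" by blast
  have FS: "F n \<in> S" and FSI: "F n \<in> square_integrable M" for n using S.cauchyD[OF F(1)] S_SI by blast+
  have "SI.cauchy M F"
    using F(1) S_SI unfolding S.cauchy_def SI.cauchy_def nrm by blast
  then obtain G where G: "G \<in> square_integrable M" "(\<lambda>n. ?N (\<lambda>x. F n x - G x)) \<longlonglongrightarrow> 0"
    using square_integrable_complete by blast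
  let ?k = "\<lambda>x. g x - G x"
  have k: "?k \<in> square_integrable M" by (rule SI.diff_mem[OF g G(1)])
  have orth: "inner_on M ?k h1 = 0" if "h1 \<in> S" for h1
    using LIMSEQ_unique[OF F(2)[OF that] inner_on_tendsto(1)[OF FSI G(1) _ G(2)]] that S_SI
    by (simp add: SI.diff_left[OF g G(1)] subset_iff)
  obtain c where c: "AE x in M. x \<in> {-R0..<R0} \<longrightarrow> ?k x = \<sigma> x *\<^sub>R c"
    using orthogonal_to_tests[OF k R(1,2)] orth unfolding S_def by blast
  have g0: "AE x in M. x \<notin> {-R0..<R0} \<longrightarrow> g x = 0"
  proof -
    have "AE x in M. x \<notin> {-R0..<R0} \<longrightarrow> \<sigma> x *\<^sub>R g x = 0" by (rule prim_restrict[OF fp R(1)]) (rule R(3))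
    then show ?thesis by eventually_elim (auto simp: hahn_sign_def split: if_splits)
  qed
  note [measurable] = prim_sigma_measurable[OF fp]
  have [measurable]: "G \<in> borel_measurable borel" using G(1) by (auto simp: square_integrable_def)
  have "inner_on M ?k g = (LINT x|M. c * cnj (\<sigma> x *\<^sub>R g x))"
    unfolding inner_on_def
  proof (rule integral_cong_AE)
    show "AE x in M. ?k x * cnj (g x) = c * cnj (\<sigma> x *\<^sub>R g x)"
      using c g0 by eventually_elim (auto simp: mult_ac)
  qed measurable
  also have "\<dots> = c * cnj (LINT x|M. \<sigma> x *\<^sub>R g x)"
    by (simp only: integral_mult_right_zero Bochner_Integration.integral_cnj)
  also have "(LINT x|M. \<sigma> x *\<^sub>R g x) = (LINT x:{-R0..<R0}|M. \<sigma> x *\<^sub>R g x)"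
    using g0 by (intro integral_restrict[symmetric]) auto
  \<comment> \<open>The integral of g against dP is the increment of f across its support.\<close>
  also have "\<dots> = 0" using prim_diff[OF fp, of "-R0" R0] R by simp
  finally have kg: "inner_on M ?k g = 0" by simp
  have kG: "inner_on M ?k G = 0"
    using LIMSEQ_unique[OF inner_on_tendsto(2)[OF FSI G(1) k G(2)], of 0] orth[OF FS] by simp
  have "inner_on M ?k ?k = 0" using SI.diff_right[OF g G(1) k] kg kG by simp
  then have N0: "?N ?k = 0" using SI.nrm_sq[OF k] by simp
  have "(\<lambda>n. ?N (\<lambda>x. g x - F n x)) \<longlonglongrightarrow> 0"
  proof (rule Lim_null_comparison[OF _ G(2)])
    have "?N (\<lambda>x. g x - F n x) \<le> ?N (\<lambda>x. F n x - G x)" for n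
      using SI.triangle_diff[OF g G(1) FSI[of n]] SI.nrm_sym[OF G(1) FSI[of n]] N0 by simp
    then show "\<forall>\<^sub>F n in sequentially. norm (?N (\<lambda>x. g x - F n x)) \<le> ?N (\<lambda>x. F n x - G x)" by simp
  qed
  from tendsto_power[OF this, of 2] have "(\<lambda>n. LINT x|M. (cmod (g x - F n x))\<^sup>2) \<longlonglongrightarrow> 0" by simp
  then show ?thesis using FS unfolding S_def by blast
qed

text \<open>Cauchy-Schwarz bounds f uniformly by the L2(|dP|) norm of its quasi-derivative, since
  |dP| has finite mass on [-R, R]. C depends on R but not on the function, so approximation of
  quasi-derivatives within one interval becomes approximation in the form norm.\<close>

lemma form_upper_bound:
  assumes R: "0 \<le> R"
  shows "\<exists>C. \<forall>w f g. form_rep w f g \<longrightarrow> (\<forall>x. \<bar>x\<bar> \<ge> R \<longrightarrow> f x = 0) \<longrightarrow>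
    the (form0 \<nu> q w) + c * (L2_norm w)\<^sup>2 \<le> C * (LINT x|M. (cmod (g x))\<^sup>2)"
proof -
  define m where "m = measure M {-R..R}"
  define Q1 where "Q1 = (LINT x:{-R..R}|lborel. \<bar>q x\<bar>)"
  show ?thesis
  proof (intro exI allI impI)
    fix w f g assume w: "form_rep w f g" and z: "\<forall>x. \<bar>x\<bar> \<ge> R \<longrightarrow> f x = 0"
    define G where "G = (LINT x|M. (cmod (g x))\<^sup>2)"
    have g: "g \<in> square_integrable M" and fp: "is_prim M f (\<lambda>x. \<sigma> x *\<^sub>R g x)"
      and wf: "AE x in lborel. w x = f x" "w \<in> L2" using w by (auto simp: form_rep_def L2c_def)
    note [measurable] = prim_measurable[OF fp] prim_sigma_measurable[OF fp]
    have [measurable]: "w \<in> borel_measurable borel" using wf(2) by (simp add: square_integrable_def)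
    have G0: "0 \<le> G" unfolding G_def by (intro Bochner_Integration.integral_nonneg) auto
    have m0: "0 \<le> m" by (simp add: m_def)
    have fb: "(cmod (f x))\<^sup>2 \<le> m * G" for x
    proof (cases "\<bar>x\<bar> \<ge> R")
      case True then show ?thesis using z m0 G0 by simp
    next
      case False
      then have x: "-R \<le> x" "x \<le> R" by auto
      \<comment> \<open>\<open>?k\<close> represents evaluation at x: its inner product with g is f
        x, as f vanishes at -R.\<close>
      let ?k = "\<lambda>y. complex_of_real (indicator {-R..<x} y * \<sigma> y)"
      have ksq: "(cmod (?k y))\<^sup>2 = indicator {-R..<x} y" for y by (auto simp: indicator_def hahn_sign_def)
      have kSI: "?k \<in> square_integrable M"
        unfolding square_integrable_def mem_Collect_eq ksq using emeasure_finite[of "{-R..<x}"] by simp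
      have "f x = (LINT y:{-R..<x}|M. \<sigma> y *\<^sub>R g y)" using prim_diff[OF fp x(1)] z R by simp
      also have "\<dots> = inner_on M g ?k"
        unfolding inner_on_def set_lebesgue_integral_def by (simp add: scaleR_conv_of_real mult_ac)
      finally have "(cmod (f x))\<^sup>2 \<le> G * measure M {-R..<x}"
        using SI.Cauchy_Schwarz_sq[OF g kSI] ksq by (simp add: inner_on_self G_def del: of_real_mult)
      also have "\<dots> \<le> G * m"
        unfolding m_def using G0 x emeasure_finite[of "{-R..R}"]
        by (intro mult_left_mono measure_mono_fmeasurable fmeasurableI) auto
      finally show ?thesis by (simp add: mult.commute)
    qed
    have s1: "cmod (LINT x|M. \<sigma> x *\<^sub>R (g x * cnj (g x))) \<le> G"
    proof -
      have "cmod (LINT x|M. \<sigma> x *\<^sub>R (g x * cnj (g x))) \<le> (LINT x|M. cmod (\<sigma> x *\<^sub>R (g x * cnj (g x))))"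
        by (rule integral_norm_bound)
      also have "\<dots> = G" by (simp add: G_def norm_mult power2_eq_square)
      finally show ?thesis .
    qed
    have s2: "cmod (LINT x|lborel. qc x * (f x * cnj (f x))) \<le> Q1 * (m * G)"
    proof -
      have "cmod (LINT x|lborel. qc x * (f x * cnj (f x))) \<le> (LINT x|lborel. cmod (qc x * (f x * cnj (f x))))"
        by (rule integral_norm_bound)
      also have "\<dots> \<le> (LINT x|lborel. (indicator {-R..R} x *\<^sub>R \<bar>q x\<bar>) * (m * G))"
      proof (rule integral_mono)
        show "integrable lborel (\<lambda>x. cmod (qc x * (f x * cnj (f x))))"
          using form_rep_integrable(2)[OF w w] by (rule integrable_norm)
        show "integrable lborel (\<lambda>x. (indicator {-R..R} x *\<^sub>R \<bar>q x\<bar>) * (m * G))"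
          using lborel.loc_int[OF lborel.loc_int_norm[OF q], of "{-R..R}"] by (simp add: set_integrable_def)
        fix x
        have "cmod (qc x * (f x * cnj (f x))) = \<bar>q x\<bar> * (cmod (f x))\<^sup>2"
          by (simp add: norm_mult qc_def power2_eq_square)
        also have "\<dots> \<le> (indicator {-R..R} x *\<^sub>R \<bar>q x\<bar>) * (m * G)"
        proof (cases "\<bar>x\<bar> \<ge> R")
          case True then show ?thesis using z m0 G0 by simp
        next
          case False then show ?thesis using fb[of x] by (auto simp: indicator_def abs_if intro!: mult_left_mono split: if_splits)
        qed
        finally show "cmod (qc x * (f x * cnj (f x))) \<le> (indicator {-R..R} x *\<^sub>R \<bar>q x\<bar>) * (m * G)" .
      qed
      also have "\<dots> = Q1 * (m * G)" by (simp add: Q1_def set_lebesgue_integral_def)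
      finally show ?thesis .
    qed
    have s3: "(L2_norm w)\<^sup>2 \<le> 2 * R * (m * G)"
    proof -
      have "(L2_norm w)\<^sup>2 = (LINT x|lborel. (cmod (w x))\<^sup>2)" by (simp add: L2_norm_def)
      also have "\<dots> = (LINT x|lborel. (cmod (f x))\<^sup>2)" by (rule integral_cong_AE) (use wf(1) in auto)
      also have "\<dots> \<le> (LINT x|lborel. indicator {-R..R} x * (m * G))"
      proof (rule integral_mono')
        show "integrable lborel (\<lambda>x. indicator {-R..R} x * (m * G))"
          by (simp add: emeasure_lborel_Icc_eq)
        fix x show "(cmod (f x))\<^sup>2 \<le> indicator {-R..R} x * (m * G)"
          using fb[of x] z by (cases "\<bar>x\<bar> \<ge> R") (auto simp: indicator_def m0 G0)
      qed (use m0 G0 in auto)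
      also have "\<dots> = 2 * R * (m * G)" using R by simp
      finally show ?thesis .
    qed
    have "the (form0 \<nu> q w) = Re (sform w w)" unfolding form0_eq[OF w] by simp
    also have "\<dots> \<le> cmod (sform w w)" by (rule complex_Re_le_cmod)
    also have "\<dots> \<le> G + Q1 * (m * G)"
      unfolding sform_eq[OF w w] by (rule order_trans[OF norm_triangle_ineq add_mono[OF s1 s2]])
    finally have 1: "the (form0 \<nu> q w) \<le> G + Q1 * (m * G)" .
    have "c * (L2_norm w)\<^sup>2 \<le> \<bar>c\<bar> * (2 * R * (m * G))"
      using s3 by (intro mult_mono) auto
    then have "the (form0 \<nu> q w) + c * (L2_norm w)\<^sup>2 \<le> (1 + Q1 * m + \<bar>c\<bar> * (2 * R * m)) * G"
      using 1 by (simp add: algebra_simps)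
    then show "the (form0 \<nu> q w) + c * (L2_norm w)\<^sup>2 \<le> (1 + Q1 * m + \<bar>c\<bar> * (2 * R * m)) * (LINT x|M. (cmod (g x))\<^sup>2)"
      by (simp add: G_def)
  qed
qed

text \<open>Test functions meet both demands of \<open>closable_criterion\<close>:
  \<open>sform_test\<close> represents the shifted form by an L2 function, and
  \<open>test_density\<close> followed by \<open>form_upper_bound\<close> gives density.\<close>

lemma form0_closable_data:
  assumes "form_data (form0 \<nu> q) sform c" shows "closable_data (form0 \<nu> q) sform c"
proof -
  interpret FD: form_data "form0 \<nu> q" sform c by (rule assms)
  show ?thesis
  proof
    fix F assume F: "FD.T.cauchy F" "(\<lambda>n. L2_norm (F n)) \<longlonglongrightarrow> 0"
    show "(\<lambda>n. FD.T.nrm (F n)) \<longlonglongrightarrow> 0"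
    proof (rule FD.closable_criterion[OF _ _ F])
      fix h assume "h \<in> {h. \<exists>R h1 r. test R h h1 r}"
      then obtain R h1 r where h: "test R h h1 r" by blast
      have hd: "h \<in> dom (form0 \<nu> q)" by (rule form_rep_dom[OF test_form_rep[OF h test_L2[OF h]]]) simp
      have r: "r \<in> L2" using h by (simp add: test_def)
      have "FD.B f h = L2_inner f (\<lambda>x. 1 * r x + of_real c * h x)" if f: "f \<in> dom (form0 \<nu> q)" for f
      proof -
        have "form_rep f (rep f) (rep1 f)" using f dom_form0 by blast
        then show ?thesis
          using L2I.lin_right[OF r test_L2[OF h] FD.dom_L2[OF f], of 1 "of_real c"]
          by (simp add: FD.B_def sform_test[OF _ h])
      qed
      then show "h \<in> dom (form0 \<nu> q) \<and> (\<exists>w\<in>L2. \<forall>f\<in>dom (form0 \<nu> q). FD.B f h = L2_inner f w)"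
        using hd square_integrable_lin[OF r test_L2[OF h], of 1 "of_real c"] by blast
    next
      fix u :: "real \<Rightarrow> complex" and e :: real assume u: "u \<in> dom (form0 \<nu> q)" and e: "e > 0"
      define f where "f = rep u"
      define g where "g = rep1 u"
      have r: "form_rep u f g" using u dom_form0 unfolding f_def g_def by blast
      obtain R0 where R0: "0 \<le> R0" "\<And>x. \<bar>x\<bar> \<ge> R0 \<Longrightarrow> f x = 0" using form_rep_support[OF r] by blast
      \<comment> \<open>The radius R0 + 1 covers u and all its approximants, so one constant C
        serves the whole sequence.\<close>
      obtain C where C: "\<And>w f g. form_rep w f g \<Longrightarrow> (\<And>x. \<bar>x\<bar> \<ge> R0 + 1 \<Longrightarrow> f x = 0) \<Longrightarrow>
        the (form0 \<nu> q w) + c * (L2_norm w)\<^sup>2 \<le> C * (LINT x|M. (cmod (g x))\<^sup>2)"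
        using form_upper_bound[of "R0 + 1" c] R0(1) by auto
      obtain H where H: "\<And>n::nat. \<exists>h r. test (R0 + 1) h (H n) r" "(\<lambda>n. LINT x|M. (cmod (g x - H n x))\<^sup>2) \<longlonglongrightarrow> 0"
        using test_density[OF r R0(1) _ R0(2), of "R0 + 1"] by auto
      have "\<forall>\<^sub>F n in sequentially. C * (LINT x|M. (cmod (g x - H n x))\<^sup>2) < e\<^sup>2"
        using tendsto_mult_left[OF H(2), of C] e by (intro order_tendstoD(2)) auto
      then obtain n where n: "C * (LINT x|M. (cmod (g x - H n x))\<^sup>2) < e\<^sup>2"
        unfolding eventually_sequentially by blast
      obtain h s where h: "test (R0 + 1) h (H n) s" using H(1) by blast
      have rh: "form_rep h h (H n)" by (rule test_form_rep[OF h test_L2[OF h]]) simp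
      have rd: "form_rep (\<lambda>x. u x - h x) (\<lambda>x. f x - h x) (\<lambda>x. g x - H n x)"
        using form_rep_lin[OF r rh, of 1 "-1"] by simp
      have "(FD.T.nrm (\<lambda>x. u x - h x))\<^sup>2 = the (form0 \<nu> q (\<lambda>x. u x - h x)) + c * (L2_norm (\<lambda>x. u x - h x))\<^sup>2"
        by (rule FD.nrm_sq_eq[OF form_rep_dom[OF rd]])
      also have "\<dots> \<le> C * (LINT x|M. (cmod (g x - H n x))\<^sup>2)"
        by (rule C[OF rd]) (use R0(2) h in \<open>auto simp: test_def\<close>)
      also have "\<dots> < e\<^sup>2" by (rule n)
      finally have "FD.T.nrm (\<lambda>x. u x - h x) < e" using e power2_less_imp_less less_imp_le by blast
      then show "\<exists>h\<in>{h. \<exists>R h1 r. test R h h1 r}. FD.T.nrm (\<lambda>x. u x - h x) < e" using h by blast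
    qed
  qed
qed

end

section \<open>Uniqueness by cut-off and the main result\<close>

text \<open>\<phi> is the trapezoid with slopes 1/n and -1/n on n \<le> |x| \<le> 2 n. It is built
  from its slope \<psi> as a primitive, because the product rule asks for that form.\<close>

lemma cutoff_exists:
  fixes n :: real assumes n: "n > 0"
  shows "\<exists>\<phi> \<psi> :: real \<Rightarrow> real. is_prim lborel (\<lambda>x. complex_of_real (\<phi> x)) (\<lambda>x. complex_of_real (\<psi> x)) \<and>
    (\<forall>x. \<bar>x\<bar> \<le> n \<longrightarrow> \<phi> x = 1) \<and> (\<forall>x. \<bar>x\<bar> \<ge> 2 * n \<longrightarrow> \<phi> x = 0) \<and>
    (\<forall>x. \<bar>\<psi> x\<bar> \<le> 1 / n) \<and> (\<forall>x. \<bar>x\<bar> > 2 * n \<longrightarrow> \<psi> x = 0) \<and> \<psi> \<in> borel_measurable borel"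
proof -
  define \<psi> where "\<psi> x = (indicator {-(2*n)..<-n} x - indicator {n..<2*n} x) / n" for x :: real
  define \<phi> where "\<phi> x = 1 + prim_of lborel \<psi> x" for x
  have [measurable]: "\<psi> \<in> borel_measurable borel" unfolding \<psi>_def[abs_def] by measurable
  have b: "\<bar>\<psi> x\<bar> \<le> 1 / n" for x using n by (auto simp: \<psi>_def indicator_def)
  have "locally_bounded \<psi>" unfolding locally_bounded_def using b by auto
  then have li: "locally_integrable lborel \<psi>" by (intro lborel.loc_int_bounded) auto
  note P = lborel.is_prim_prim_of[OF li]
  have prim: "is_prim lborel \<phi> \<psi>"
    using P unfolding is_prim_def \<phi>_def by simp
  have "is_prim lborel (\<lambda>x. complex_of_real (\<phi> x)) (\<lambda>x. complex_of_real (\<psi> x))"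
    unfolding is_prim_def
  proof (intro conjI allI impI)
    show "locally_integrable lborel (\<lambda>x. complex_of_real (\<psi> x))"
      using \<open>locally_bounded \<psi>\<close> by (intro lborel.loc_int_bounded) (auto simp: locally_bounded_def)
    fix a b :: real assume "a \<le> b"
    then show "complex_of_real (\<phi> b) - complex_of_real (\<phi> a) = (LINT x:{a..<b}|lborel. complex_of_real (\<psi> x))"
      using lborel.prim_diff[OF prim] by (simp add: set_integral_complex_of_real flip: of_real_diff)
  qed
  moreover have int: "(LINT x:A|lborel. \<psi> x) = (measure lborel (A \<inter> {-(2*n)..<-n}) - measure lborel (A \<inter> {n..<2*n})) / n"
    if A: "A \<in> bounded_borel" for A
  proof -
    have Ab: "A \<in> sets borel" using A by (simp add: bounded_borel_def)
    have fin: "emeasure lborel (A \<inter> {c..<d}) < \<infinity>" for c d :: real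
      using lborel.emeasure_finite[OF bounded_borel_Int[OF A, of "{c..<d}"]] by simp
    have "(LINT x:A|lborel. \<psi> x) = (LINT x|lborel. (indicator (A \<inter> {-(2*n)..<-n}) x - indicator (A \<inter> {n..<2*n}) x) / n)"
      unfolding set_lebesgue_integral_def \<psi>_def
      by (intro Bochner_Integration.integral_cong) (auto simp: indicator_def)
    also have "\<dots> = (LINT x|lborel. indicator (A \<inter> {-(2*n)..<-n}) x - indicator (A \<inter> {n..<2*n}) x) / n"
      by simp
    also have "(LINT x|lborel. indicator (A \<inter> {-(2*n)..<-n}) x - indicator (A \<inter> {n..<2*n}) x) =
      measure lborel (A \<inter> {-(2*n)..<-n}) - measure lborel (A \<inter> {n..<2*n})"
      using fin[of "-(2*n)" "-n"] fin[of n "2*n"] Ab by (subst Bochner_Integration.integral_diff) auto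
    finally show ?thesis .
  qed
  have I: "{0..<x} \<inter> {-(2*n)..<-n} = {}" "{x..<0} \<inter> {n..<2*n} = {}" for x using n by auto
  moreover have "\<phi> x = 1" if x: "\<bar>x\<bar> \<le> n" for x
  proof -
    have e: "{0..<x} \<inter> {n..<2*n} = {}" "{x..<0} \<inter> {-(2*n)..<-n} = {}" using x by auto
    show ?thesis unfolding \<phi>_def prim_of_def int[OF bounded_borel_ivl(1)] I e by simp
  qed
  moreover have "\<phi> x = 0" if x: "\<bar>x\<bar> \<ge> 2 * n" for x
  proof (cases "0 \<le> x")
    case True
    then have "{0..<x} \<inter> {n..<2*n} = {n..<2*n}" "{x..<0} = {}" using x n by auto
    then show ?thesis using n by (simp add: \<phi>_def prim_of_def int I)
  next
    case False
    then have "{x..<0} \<inter> {-(2*n)..<-n} = {-(2*n)..<-n}" "{0..<x} = {}" using x n by auto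
    then show ?thesis using n by (simp add: \<phi>_def prim_of_def int I)
  qed
  moreover have "\<psi> x = 0" if "\<bar>x\<bar> > 2 * n" for x using that by (auto simp: \<psi>_def indicator_def)
  ultimately show ?thesis using b by (intro exI[of _ \<phi>] exI[of _ \<psi>]) auto
qed

context sturm_liouville
begin

text \<open>With \<open>y = \<phi> f\<close>, integrating \<open>d(\<phi>\<^sup>2 f\<^sup>* f\<^sup>[\<^sup>1\<^sup>])\<close> leaves only the term \<open>\<phi>'\<^sup>2 |f|\<^sup>2\<close> of the form.\<close>

lemma cutoff_form:
  assumes f: "sol f f1 (\<lambda>x. - of_real c * f x)" and u: "u \<in> L2" "AE x in lborel. u x = f x" and n: "n > 0"
  shows "\<exists>y\<in>dom (form0 \<nu> q). the (form0 \<nu> q y) + c * (L2_norm y)\<^sup>2 \<le> (L2_norm u)\<^sup>2 / n\<^sup>2 \<and>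
    (LINT x|lborel. indicator {-n..n} x * (cmod (u x))\<^sup>2) \<le> (L2_norm y)\<^sup>2"
proof -
  obtain \<phi> \<psi> :: "real \<Rightarrow> real" where
    phi: "is_prim lborel (\<lambda>x. complex_of_real (\<phi> x)) (\<lambda>x. complex_of_real (\<psi> x))"
    and phi1: "\<And>x. \<bar>x\<bar> \<le> n \<Longrightarrow> \<phi> x = 1" and phi0: "\<And>x. \<bar>x\<bar> \<ge> 2 * n \<Longrightarrow> \<phi> x = 0"
    and psi: "\<And>x. \<bar>\<psi> x\<bar> \<le> 1 / n" "\<And>x. \<bar>x\<bar> > 2 * n \<Longrightarrow> \<psi> x = 0" and [measurable]: "\<psi> \<in> borel_measurable borel"
    using cutoff_exists[OF n] by blast
  let ?R = "2 * n"
  let ?\<phi> = "\<lambda>x. complex_of_real (\<phi> x)" and ?\<psi> = "\<lambda>x. complex_of_real (\<psi> x)" and ?i = "\<lambda>x. indicator (- N) x :: real"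
  have fp: "is_prim M f (\<lambda>x. \<sigma> x *\<^sub>R f1 x)" and f1p: "is_prim lborel f1 (\<lambda>x. qc x * f x - (- of_real c * f x))"
    using f by (auto simp: sol_def)
  note reg = sol_regular[OF f]
  note [measurable] = reg(1,2) lborel.prim_measurable[OF phi] N
  have phi_b: "locally_bounded ?\<phi>" by (rule lborel.prim_locally_bounded[OF phi])
  define y where "y x = f x * ?\<phi> x" for x
  \<comment> \<open>G is the quasi-derivative of \<phi> f; likewise Z below is that of the conjugate
    of f times \<phi>^2.\<close>
  define G where "G x = f1 x * ?\<phi> x + ?i x *\<^sub>R (f x * ?\<psi> x)" for x
  have yp: "is_prim M y (\<lambda>x. \<sigma> x *\<^sub>R G x)"
    unfolding y_def[abs_def] G_def[abs_def] by (rule prim_mult[OF fp phi])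
  have yz: "y x = 0" if "\<bar>x\<bar> \<ge> ?R" for x using phi0[OF that] by (simp add: y_def)
  have Gz: "G x = 0" if "\<bar>x\<bar> > ?R" for x using phi0[of x] psi(2)[OF that] that by (simp add: G_def)
  have [measurable]: "G \<in> borel_measurable borel" unfolding G_def[abs_def] by measurable
  have [measurable]: "y \<in> borel_measurable borel" by (rule prim_measurable[OF yp])
  have Gb: "locally_bounded G"
    unfolding locally_bounded_def
  proof
    fix S
    obtain C1 C2 C3 where C: "\<forall>x\<in>{-S..S}. cmod (f1 x) \<le> C1" "\<forall>x\<in>{-S..S}. cmod (?\<phi> x) \<le> C2" "\<forall>x\<in>{-S..S}. cmod (f x) \<le> C3"
      using reg(4,5) phi_b unfolding locally_bounded_def by meson
    have "cmod (G x) \<le> C1 * C2 + C3 * (1 / n)" if x: "x \<in> {-S..S}" for x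
    proof -
      have "cmod (f1 x * ?\<phi> x) \<le> C1 * C2"
        unfolding norm_mult using C x norm_ge_zero order_trans by (intro mult_mono) blast+
      moreover have "cmod (?i x *\<^sub>R (f x * ?\<psi> x)) \<le> cmod (f x) * \<bar>\<psi> x\<bar>"
        by (auto simp: indicator_def norm_mult)
      moreover have "cmod (f x) * \<bar>\<psi> x\<bar> \<le> C3 * (1 / n)"
        using C(3) x psi(1)[of x] order_trans[OF norm_ge_zero, of "f x" C3] by (intro mult_mono) auto
      ultimately show ?thesis unfolding G_def by (intro order_trans[OF norm_triangle_ineq]) linarith
    qed
    then show "\<exists>C. \<forall>x\<in>{-S..S}. cmod (G x) \<le> C" by blast
  qed
  have "(\<lambda>x. indicator {-?R..?R} x *\<^sub>R G x) \<in> square_integrable M"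
    by (rule bounded_indicator_L2[OF lf _ Gb]) measurable
  moreover have "indicator {-?R..?R} x *\<^sub>R G x = G x" for x using Gz[of x] by (auto simp: indicator_def abs_if)
  ultimately have GSI: "G \<in> square_integrable M" by simp
  have "(\<lambda>x. indicator {-?R..?R} x *\<^sub>R y x) \<in> L2"
    by (rule bounded_indicator_L2[OF locally_finite_lborel _ prim_locally_bounded[OF yp]]) measurable
  moreover have "indicator {-?R..?R} x *\<^sub>R y x = y x" for x using yz[of x] by (auto simp: indicator_def abs_if)
  ultimately have yL2: "y \<in> L2" by simp
  have yL2c: "y \<in> L2c" unfolding L2c_def using yL2 yz by (auto intro!: exI[of _ ?R])
  have yr: "form_rep y y G" using yL2c yp GSI by (simp add: form_rep_def)
  have pp: "is_prim lborel (\<lambda>x. ?\<phi> x * ?\<phi> x) (\<lambda>x. ?\<phi> x * ?\<psi> x + ?\<psi> x * ?\<phi> x)"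
    by (rule prim_mult_lborel[OF phi phi])
  have fc: "is_prim M (\<lambda>x. cnj (f x)) (\<lambda>x. \<sigma> x *\<^sub>R cnj (f1 x))"
    using prim_cnj[OF fp] by simp
  define Z where "Z x = cnj (f1 x) * (?\<phi> x * ?\<phi> x) + ?i x *\<^sub>R (cnj (f x) * (?\<phi> x * ?\<psi> x + ?\<psi> x * ?\<phi> x))" for x
  have Zp: "is_prim M (\<lambda>x. cnj (f x) * (?\<phi> x * ?\<phi> x)) (\<lambda>x. \<sigma> x *\<^sub>R Z x)"
    unfolding Z_def[abs_def] by (rule prim_mult[OF fc pp])
  have [measurable]: "Z \<in> borel_measurable borel" unfolding Z_def[abs_def] by measurable
  have Zz: "Z x = 0" if "\<bar>x\<bar> \<ge> ?R" for x using phi0[OF that] by (simp add: Z_def)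
  have off: "\<bar>x\<bar> \<ge> ?R" if "x \<notin> {-?R..<?R}" for x using that n by auto
  \<comment> \<open>The boundary terms of this integration by parts vanish because \<phi> does at
    both ends; the resulting zero is subtracted from the form below.\<close>
  have prod: "0 = (LINT t:{-?R..<?R}|lborel. (cnj (f t) * (?\<phi> t * ?\<phi> t)) * (qc t * f t - (- of_real c * f t)))
      + (LINT s:{-?R..<?R}|M. (\<sigma> s *\<^sub>R Z s) * f1 s)"
    using prim_product[OF Zp f1p, of "-?R" ?R] n phi0[of ?R] phi0[of "-?R"] by simp
  have li1: "locally_integrable lborel (\<lambda>t. (cnj (f t) * (?\<phi> t * ?\<phi> t)) * (qc t * f t - (- of_real c * f t)))"
    by (rule lborel.loc_int_mult_bounded[OF lborel.prim_int[OF f1p] prim_measurable[OF Zp] prim_locally_bounded[OF Zp]])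
  have li2: "locally_integrable M (\<lambda>s. (\<sigma> s *\<^sub>R Z s) * f1 s)"
    using loc_int_mult_bounded[OF prim_int[OF Zp] _ reg(5)] by (simp add: mult.commute)
  have whole: "integrable M' h \<and> (LINT t:{-?R..<?R}|M'. h t) = (LINT t|M'. h t)"
    if li: "locally_integrable M' h" and M': "sets M' = sets borel" and [measurable]: "h \<in> borel_measurable borel"
      and z: "\<And>x. \<bar>x\<bar> \<ge> ?R \<Longrightarrow> h x = 0" for M' and h :: "real \<Rightarrow> complex"
  proof
    have "integrable M' (\<lambda>x. indicator {-?R..<?R} x *\<^sub>R h x)"
      using locally_integrable_set[OF li _ M', of "{-?R..<?R}"] by (simp add: set_integrable_def)
    moreover have "indicator {-?R..<?R} x *\<^sub>R h x = h x" for x using z off by (auto simp: indicator_def)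
    ultimately show "integrable M' h" by simp
    have "h \<in> borel_measurable M'" using M' by (simp cong: measurable_cong_sets)
    then show "(LINT t:{-?R..<?R}|M'. h t) = (LINT t|M'. h t)"
      using z off M' by (intro integral_restrict) auto
  qed
  let ?h1 = "\<lambda>t. (cnj (f t) * (?\<phi> t * ?\<phi> t)) * (qc t * f t - (- of_real c * f t))"
  let ?h2 = "\<lambda>s. (\<sigma> s *\<^sub>R Z s) * f1 s"
  have w1: "integrable lborel ?h1" "(LINT t:{-?R..<?R}|lborel. ?h1 t) = (LINT t|lborel. ?h1 t)"
    using whole[OF li1] phi0 by auto
  have w2: "integrable M ?h2" "(LINT t:{-?R..<?R}|M. ?h2 t) = (LINT t|M. ?h2 t)"
    using whole[OF li2] Zz by auto
  have zero: "(LINT t|lborel. ?h1 t) + (LINT t|M. ?h2 t) = 0" using prod unfolding w1 w2 by simp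
  let ?g1 = "\<lambda>x. qc x * (y x * cnj (y x))" and ?g2 = "\<lambda>x. \<sigma> x *\<^sub>R (G x * cnj (G x))"
  note gi = form_rep_integrable[OF yr yr]
  have p1: "?g1 x - ?h1 x = - of_real (c * (cmod (y x))\<^sup>2)" for x
  proof -
    have "?g1 x - ?h1 x = - (of_real c * (y x * cnj (y x)))" by (simp add: y_def algebra_simps)
    then show ?thesis by (simp add: complex_norm_square[symmetric] del: of_real_power)
  qed
  \<comment> \<open>The mixed terms 2 \<phi> \<psi> Re (f1 cnj f) of |G|^2 and of Z f1 cancel in the
    real part; the imaginary part of Z f1 may remain, so only real parts are compared.\<close>
  have p2: "Re (?g2 x - ?h2 x) = ?i x *\<^sub>R ((\<psi> x)\<^sup>2 * (cmod (f x))\<^sup>2)" for x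
  proof -
    have s: "\<sigma> x * ?i x = ?i x" using N_E by (auto simp: hahn_sign_def indicator_def)
    have ii: "?i x * ?i x = ?i x" by (auto simp: indicator_def)
    have "Re (G x * cnj (G x) - Z x * f1 x) = ?i x * ((\<psi> x)\<^sup>2 * (cmod (f x))\<^sup>2)"
      unfolding G_def Z_def cmod_power2 by (auto simp: indicator_def algebra_simps power2_eq_square)
    then have "\<sigma> x * Re (G x * cnj (G x) - Z x * f1 x) = ?i x * ((\<psi> x)\<^sup>2 * (cmod (f x))\<^sup>2)"
      using s by (metis mult.assoc)
    moreover have "?g2 x - ?h2 x = \<sigma> x *\<^sub>R (G x * cnj (G x) - Z x * f1 x)"
      by (simp add: scaleR_diff_right)
    ultimately show ?thesis by simp
  qed
  have Psi: "integrable lborel (\<lambda>x. (\<psi> x)\<^sup>2 * (cmod (f x))\<^sup>2) \<and> (LINT x|lborel. (\<psi> x)\<^sup>2 * (cmod (f x))\<^sup>2) \<le> (L2_norm u)\<^sup>2 / n\<^sup>2"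
  proof
    have [measurable]: "u \<in> borel_measurable borel" using u(1) by (simp add: square_integrable_def)
    have iu: "integrable lborel (\<lambda>x. (cmod (u x))\<^sup>2 / n\<^sup>2)" using u(1) by (simp add: square_integrable_def)
    have le: "AE x in lborel. (\<psi> x)\<^sup>2 * (cmod (f x))\<^sup>2 \<le> (cmod (u x))\<^sup>2 / n\<^sup>2"
      using u(2)
    proof eventually_elim
      fix x assume "u x = f x"
      have "(\<psi> x)\<^sup>2 \<le> (1 / n)\<^sup>2" using psi(1)[of x] n by (intro abs_le_square_iff[THEN iffD1]) simp
      then have "(\<psi> x)\<^sup>2 * (cmod (f x))\<^sup>2 \<le> (1 / n)\<^sup>2 * (cmod (f x))\<^sup>2" by (intro mult_right_mono) auto
      then show "(\<psi> x)\<^sup>2 * (cmod (f x))\<^sup>2 \<le> (cmod (u x))\<^sup>2 / n\<^sup>2" using \<open>u x = f x\<close> by (simp add: power_divide)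
    qed
    show i: "integrable lborel (\<lambda>x. (\<psi> x)\<^sup>2 * (cmod (f x))\<^sup>2)"
      by (rule Bochner_Integration.integrable_bound[OF iu]) (use le in auto)
    have "(LINT x|lborel. (\<psi> x)\<^sup>2 * (cmod (f x))\<^sup>2) \<le> (LINT x|lborel. (cmod (u x))\<^sup>2 / n\<^sup>2)"
      by (rule integral_mono_AE[OF i iu le])
    then show "(LINT x|lborel. (\<psi> x)\<^sup>2 * (cmod (f x))\<^sup>2) \<le> (L2_norm u)\<^sup>2 / n\<^sup>2" by (simp add: L2_norm_def)
  qed
  have "sform y y = (LINT x|M. ?g2 x) + (LINT x|lborel. ?g1 x) - ((LINT t|lborel. ?h1 t) + (LINT t|M. ?h2 t))"
    unfolding zero sform_eq[OF yr yr] by simp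
  also have "\<dots> = (LINT x|M. ?g2 x - ?h2 x) + (LINT x|lborel. ?g1 x - ?h1 x)"
    unfolding Bochner_Integration.integral_diff[OF gi(1) w2(1)] Bochner_Integration.integral_diff[OF gi(2) w1(1)] by simp
  finally have "Re (sform y y) = (LINT x|M. Re (?g2 x - ?h2 x)) + Re (LINT x|lborel. ?g1 x - ?h1 x)"
    using integral_Re[OF Bochner_Integration.integrable_diff[OF gi(1) w2(1)]] by simp
  \<comment> \<open>The indicator of -N converts the integral against |dP| into a Lebesgue integral,
    which the L2 norm of u controls.\<close>
  also have "(LINT x|M. Re (?g2 x - ?h2 x)) = (LINT x|lborel. (\<psi> x)\<^sup>2 * (cmod (f x))\<^sup>2)"
    unfolding p2 by (rule integral_lborel_eq[symmetric]) measurable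
  also have "Re (LINT x|lborel. ?g1 x - ?h1 x) = - c * (L2_norm y)\<^sup>2"
    unfolding p1 by (simp add: L2_norm_def del: of_real_mult of_real_power)
  finally have "the (form0 \<nu> q y) = (LINT x|lborel. (\<psi> x)\<^sup>2 * (cmod (f x))\<^sup>2) - c * (L2_norm y)\<^sup>2"
    unfolding form0_eq[OF yr] by simp
  then have 1: "the (form0 \<nu> q y) + c * (L2_norm y)\<^sup>2 \<le> (L2_norm u)\<^sup>2 / n\<^sup>2" using Psi by simp
  have "(LINT x|lborel. indicator {-n..n} x * (cmod (u x))\<^sup>2) \<le> (LINT x|lborel. (cmod (y x))\<^sup>2)"
  proof (rule integral_mono_AE)
    have [measurable]: "u \<in> borel_measurable borel" using u(1) by (simp add: square_integrable_def)
    have "integrable lborel (\<lambda>x. indicator {-n..n} x *\<^sub>R (cmod (u x))\<^sup>2)"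
      using u(1) by (intro integrable_mult_indicator) (auto simp: square_integrable_def)
    then show "integrable lborel (\<lambda>x. indicator {-n..n} x * (cmod (u x))\<^sup>2)" by simp
    show "integrable lborel (\<lambda>x. (cmod (y x))\<^sup>2)" using yL2 by (simp add: square_integrable_def)
    show "AE x in lborel. indicator {-n..n} x * (cmod (u x))\<^sup>2 \<le> (cmod (y x))\<^sup>2"
      using u(2) by eventually_elim (auto simp: indicator_def y_def phi1 abs_le_iff)
  qed
  then have 2: "(LINT x|lborel. indicator {-n..n} x * (cmod (u x))\<^sup>2) \<le> (L2_norm y)\<^sup>2" by (simp add: L2_norm_def)
  show ?thesis using 1 2 form_rep_dom[OF yr] by blast
qed

text \<open>The shifted form at the cut-off function dominates its squared L2 norm, hence the mass
  of u in [-n, n]. By \<open>cutoff_form\<close> that form value is at most the squared norm of u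
  divided by n^2, which tends to 0.\<close>

lemma semibounded_kernel_trivial:
  assumes fd: "form_data (form0 \<nu> q) sform c" and u: "(u, \<lambda>x. - of_real c * u x) \<in> max_operator \<nu> q"
  shows "AE x in lborel. u x = 0"
proof -
  interpret FD: form_data "form0 \<nu> q" sform c by (rule fd)
  obtain f f1 where uL2: "u \<in> L2" and f: "sol f f1 (\<lambda>x. - of_real c * u x)" and uf: "AE x in lborel. u x = f x"
    using u unfolding max_operator_iff by blast
  have [measurable]: "u \<in> borel_measurable borel" using uL2 by (simp add: square_integrable_def)
  note [measurable] = sol_regular(1)[OF f]
  \<comment> \<open>The source is rewritten from u to f so that the equation involves one
    representative only.\<close>
  have f': "sol f f1 (\<lambda>x. - of_real c * f x)"
    unfolding sol_def
  proof
    show "is_prim M f (\<lambda>x. \<sigma> x *\<^sub>R f1 x)" using f by (simp add: sol_def)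
    show "is_prim lborel f1 (\<lambda>x. qc x * f x - - of_real c * f x)"
    proof (rule lborel.prim_cong_AE)
      show "is_prim lborel f1 (\<lambda>x. qc x * f x - - of_real c * u x)" using f by (simp add: sol_def)
      show "AE x in lborel. qc x * f x - - of_real c * u x = qc x * f x - - of_real c * f x"
        using uf by eventually_elim simp
    qed measurable
  qed
  have le: "(LINT x|lborel. indicator {-m..m} x * (cmod (u x))\<^sup>2) \<le> (L2_norm u)\<^sup>2 / n\<^sup>2" if mn: "m \<le> n" "0 < n" for m n
  proof -
    obtain y where y: "y \<in> dom (form0 \<nu> q)" "the (form0 \<nu> q y) + c * (L2_norm y)\<^sup>2 \<le> (L2_norm u)\<^sup>2 / n\<^sup>2"
      "(LINT x|lborel. indicator {-n..n} x * (cmod (u x))\<^sup>2) \<le> (L2_norm y)\<^sup>2"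
      using cutoff_form[OF f' uL2 uf mn(2)] by blast
    have ii: "integrable lborel (\<lambda>x. indicator {-m..m} x * (cmod (u x))\<^sup>2)" for m
    proof -
      have "integrable lborel (\<lambda>x. indicator {-m..m} x *\<^sub>R (cmod (u x))\<^sup>2)"
        using uL2 by (intro integrable_mult_indicator) (auto simp: square_integrable_def)
      then show ?thesis by simp
    qed
    have "(LINT x|lborel. indicator {-m..m} x * (cmod (u x))\<^sup>2) \<le> (LINT x|lborel. indicator {-n..n} x * (cmod (u x))\<^sup>2)"
      by (rule integral_mono[OF ii ii]) (use mn in \<open>auto simp: indicator_def\<close>)
    then show ?thesis using y FD.bound[OF y(1)] by linarith
  qed
  have z: "AE x in lborel. \<bar>x\<bar> \<le> real m \<longrightarrow> u x = 0" for m :: nat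
  proof -
    let ?I = "LINT x|lborel. indicator {-real m..real m} x * (cmod (u x))\<^sup>2"
    have "(\<lambda>n. (L2_norm u)\<^sup>2 / (real (Suc n))\<^sup>2) \<longlonglongrightarrow> (L2_norm u)\<^sup>2 * 0\<^sup>2"
      unfolding divide_inverse power_inverse[symmetric] by (intro tendsto_intros LIMSEQ_inverse_real_of_nat)
    then have "?I \<le> (L2_norm u)\<^sup>2 * 0\<^sup>2"
      by (rule LIMSEQ_le_const) (auto intro!: exI[of _ m] le)
    moreover have "0 \<le> ?I" by (intro Bochner_Integration.integral_nonneg) auto
    ultimately have I0: "?I = 0" by simp
    have "integrable lborel (\<lambda>x. indicator {-real m..real m} x *\<^sub>R (cmod (u x))\<^sup>2)"
      using uL2 by (intro integrable_mult_indicator) (auto simp: square_integrable_def)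
    then have "AE x in lborel. indicator {-real m..real m} x * (cmod (u x))\<^sup>2 = 0"
      using I0 by (subst (asm) integral_nonneg_eq_0_iff_AE) auto
    then show ?thesis by eventually_elim (auto simp: indicator_def abs_le_iff)
  qed
  then have "AE x in lborel. \<forall>m::nat. \<bar>x\<bar> \<le> real m \<longrightarrow> u x = 0" by (subst AE_all_countable) auto
  then show ?thesis by eventually_elim (use real_arch_simple in blast)
qed

text \<open>This is \<open>weak_solution\<close> for all radii at once: H contains the adjoint of
  its compactly supported part.\<close>

lemma max_operatorI:
  assumes u: "u \<in> L2" and v: "v \<in> L2" and w: "\<And>R h h1 r. test R h h1 r \<Longrightarrow> L2_inner u r = L2_inner v h"
  shows "(u, v) \<in> max_operator \<nu> q"
proof -
  have "\<exists>f f1. sol f f1 v \<and> (\<forall>R\<in>{0..}. AE x in lborel. \<bar>x\<bar> < R \<longrightarrow> u x = f x)"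
  proof (rule weak_solution)
    show "(LINT x|lborel. u x * r x) = (LINT x|lborel. v x * h x)" if "test R h h1 r" for R h h1 r
      using w[OF test_cnj[OF that]] by (simp add: L2_inner_def)
  qed (use u v L2_loc_L2 loc_L2_loc_int in auto)
  then obtain f f1 where f: "sol f f1 v" "\<And>R. 0 \<le> R \<Longrightarrow> AE x in lborel. \<bar>x\<bar> < R \<longrightarrow> u x = f x" by auto
  have "AE x in lborel. \<forall>n::nat. \<bar>x\<bar> < real n \<longrightarrow> u x = f x"
    using f(2) by (subst AE_all_countable) auto
  then have "AE x in lborel. u x = f x" by eventually_elim (use reals_Archimedean2 in blast)
  then show ?thesis using u v f(1) unfolding max_operator_iff by blast
qed

lemma max_operator_diff:
  assumes "(u, v) \<in> max_operator \<nu> q" "(w, z) \<in> max_operator \<nu> q"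
  shows "(\<lambda>x. u x - w x, \<lambda>x. v x - z x) \<in> max_operator \<nu> q"
proof -
  obtain f f1 where f: "sol f f1 v" "AE x in lborel. u x = f x" using assms(1) unfolding max_operator_iff by blast
  obtain h h1 where h: "sol h h1 z" "AE x in lborel. w x = h x" using assms(2) unfolding max_operator_iff by blast
  have s: "sol (\<lambda>x. 1 * f x + (-1) * h x) (\<lambda>x. 1 * f1 x + (-1) * h1 x) (\<lambda>x. 1 * v x + (-1) * z x)"
    by (rule sol_lin[OF f(1) h(1)])
  have "AE x in lborel. u x - w x = f x - h x" using f(2) h(2) by eventually_elim simp
  then show ?thesis
    using s assms L2I.diff_mem unfolding max_operator_iff by auto
qed

text \<open>Let G be the projection of u onto the closure of the test functions. Since u - G is
  orthogonal to them, (0, u - G) belongs to H by \<open>max_operatorI\<close>. But a solution that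
  is 0 has zero quasi-derivative and zero source, whence u = G.\<close>

lemma max_operator_densely_defined: "densely_defined (max_operator \<nu> q)"
  unfolding densely_defined_def
proof (intro ballI allI impI)
  fix u :: "real \<Rightarrow> complex" and e :: real assume u: "u \<in> L2" and e: "e > 0"
  define S where "S = {h. \<exists>R h1 r. test R h h1 r}"
  have S_L2: "S \<subseteq> L2" using test_L2 by (auto simp: S_def)
  have "sol (\<lambda>_. 0) (\<lambda>_. 0) (\<lambda>_. 0)" using prim_const[of "0::complex"] lborel.prim_const[of "0::complex"] by (simp add: sol_def)
  then have "test 0 (\<lambda>_. 0) (\<lambda>_. 0) (\<lambda>_. 0)" by (auto simp: test_def square_integrable_def)
  then have S0: "(\<lambda>_. 0) \<in> S" unfolding S_def by blast
  have Slin: "(\<lambda>x. c * f x + d * g x) \<in> S" if fg: "f \<in> S" "g \<in> S" for f g c d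
  proof -
    obtain R f1 r R' g1 r' where t: "test R f f1 r" "test R' g g1 r'" using fg by (auto simp: S_def)
    have "test (max R R') f f1 r" "test (max R R') g g1 r'"
      using t by (auto intro: test_mono)
    from test_lin[OF this] show ?thesis unfolding S_def by blast
  qed
  interpret S: semi_inner S L2_inner
    by (rule L2I.semi_inner_subspace[OF S_L2 S0 Slin])
  have nrm: "S.nrm = L2_norm" using S.nrm_def[abs_def] L2_norm_def[abs_def] by (simp add: L2_inner_eq inner_on_self)
  have "\<exists>F. S.cauchy F \<and> (\<forall>k\<in>S. (\<lambda>n. L2_inner (F n) k) \<longlonglongrightarrow> L2_inner u k)"
  proof (rule S.riesz_sequence)
    show "L2_inner u (\<lambda>x. c * f x + d * h x) = cnj c * L2_inner u f + cnj d * L2_inner u h"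
      if "f \<in> S" "h \<in> S" for f h c d
      using L2I.lin_right u S_L2 that by blast
    show "cmod (L2_inner u h) \<le> L2_norm u * S.nrm h" if "h \<in> S" for h
      unfolding nrm using L2I.Cauchy_Schwarz u S_L2 that by blast
  qed
  then obtain F where F: "S.cauchy F" "\<And>k. k \<in> S \<Longrightarrow> (\<lambda>n. L2_inner (F n) k) \<longlonglongrightarrow> L2_inner u k" by blast
  have FS: "F n \<in> S" and FL: "F n \<in> L2" for n using S.cauchyD[OF F(1)] S_L2 by blast+
  have "L2I.cauchy F" using F(1) S_L2 unfolding S.cauchy_def L2I.cauchy_def nrm by blast
  then obtain G where G: "G \<in> L2" "(\<lambda>n. L2_norm (\<lambda>x. F n x - G x)) \<longlonglongrightarrow> 0"
    using L2_complete by blast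
  have orth: "L2_inner (\<lambda>x. u x - G x) h = 0" if h: "h \<in> S" for h
  proof -
    have hL: "h \<in> L2" using h S_L2 by blast
    have "(\<lambda>n. L2_norm (\<lambda>x. F n x - G x) * L2_norm h) \<longlonglongrightarrow> 0" using tendsto_mult_left_zero[OF G(2)] .
    then have "(\<lambda>n. L2_inner (F n) h - L2_inner G h) \<longlonglongrightarrow> 0"
    proof (rule Lim_null_comparison[rotated])
      show "\<forall>\<^sub>F n in sequentially. cmod (L2_inner (F n) h - L2_inner G h) \<le> L2_norm (\<lambda>x. F n x - G x) * L2_norm h"
        using L2I.Cauchy_Schwarz[OF L2I.diff_mem[OF FL G(1)] hL] by (simp add: L2I.diff_left[OF FL G(1) hL])
    qed
    then have "(\<lambda>n. L2_inner (F n) h) \<longlonglongrightarrow> L2_inner G h" by (rule LIM_zero_cancel)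
    then have "L2_inner u h = L2_inner G h" by (rule LIMSEQ_unique[OF F(2)[OF h]])
    then show ?thesis by (simp add: L2I.diff_left[OF u G(1) hL])
  qed
  have zL: "(\<lambda>_. 0) \<in> L2" by (simp add: square_integrable_def)
  have "(\<lambda>_. 0, \<lambda>x. u x - G x) \<in> max_operator \<nu> q"
  proof (rule max_operatorI[OF zL L2I.diff_mem[OF u G(1)]])
    show "L2_inner (\<lambda>_. 0) r = L2_inner (\<lambda>x. u x - G x) h" if "test R h h1 r" for R h h1 r
      using orth[of h] that unfolding S_def by (auto simp: L2_inner_def)
  qed
  then obtain f f1 where f: "sol f f1 (\<lambda>x. u x - G x)" "AE x in lborel. 0 = f x" unfolding max_operator_iff by auto
  have fz: "f x = 0" for x
    using f left_continuous_AE_eq[of f "\<lambda>_. 0" x] prim_left_continuous[of f] unfolding sol_def by auto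
  then have f0: "f = (\<lambda>_. 0)" by auto
  have "is_prim M (\<lambda>_. 0) (\<lambda>x. \<sigma> x *\<^sub>R f1 x)" using f(1) unfolding f0 by (simp add: sol_def)
  moreover have "is_prim M (\<lambda>_. 0::complex) (\<lambda>x. \<sigma> x *\<^sub>R 0)" using prim_const[of "0::complex"] by simp
  ultimately have "AE x in M. f1 x = 0" by (rule prim_sigma_unique)
  then have "AE x in lborel. f1 x = 0" by (rule AE_M_lborel)
  then have f1z: "f1 x = 0" for x
    using f left_continuous_AE_eq[of f1 "\<lambda>_. 0" x] lborel.prim_left_continuous[of f1] unfolding sol_def by auto
  then have f10: "f1 = (\<lambda>_. 0)" by auto
  have "is_prim lborel (\<lambda>_. 0) (\<lambda>x. - (u x - G x))"
    using f(1) unfolding f0 f10 by (simp add: sol_def)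
  from lborel.prim_unique_AE[OF this lborel.prim_const[of 0]]
  have uG: "AE x in lborel. u x = G x" by eventually_elim simp
  have "(\<lambda>n. L2_norm (\<lambda>x. F n x - G x)) \<longlonglongrightarrow> 0" by (rule G(2))
  then have "\<forall>\<^sub>F n in sequentially. L2_norm (\<lambda>x. F n x - G x) < e" using e by (intro order_tendstoD(2)) auto
  then obtain n where n: "L2_norm (\<lambda>x. F n x - G x) < e" unfolding eventually_sequentially by blast
  have "L2_norm (\<lambda>x. u x - F n x) = L2_norm (\<lambda>x. F n x - u x)" by (rule L2I.nrm_sym[OF u FL])
  also have "\<dots> = L2_norm (\<lambda>x. F n x - G x)"
    by (rule L2_norm_cong_AE[OF L2I.diff_mem[OF FL u] L2I.diff_mem[OF FL G(1)]]) (use uG in auto)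
  finally have "L2_norm (\<lambda>x. u x - F n x) < e" using n by simp
  moreover have "F n \<in> Domain (max_operator \<nu> q)"
    using FS[of n] test_max_operator unfolding S_def by blast
  ultimately show "\<exists>f\<in>Domain (max_operator \<nu> q). L2_norm (\<lambda>x. u x - f x) < e" by blast
qed

section \<open>Part (ii): the operator of the closure and self-adjointness\<close>

lemma semibounded_form_operator:
  assumes "lower_semibounded (form0 \<nu> q)"
  shows "closable (form0 \<nu> q)" "form_operator (form_closure (form0 \<nu> q)) = max_operator \<nu> q"
    "self_adjoint (max_operator \<nu> q)"
proof -
  let ?t = "form0 \<nu> q"
  obtain g where g: "\<forall>f \<in> dom ?t. the (?t f) \<ge> g * (L2_norm f)\<^sup>2"
    using assms unfolding lower_semibounded_def by blast
  define c where "c = 1 - g"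
  have fd: "form_data ?t sform c"
  proof
    show "sform f f = of_real (the (?t f))" if "f \<in> dom ?t" for f
      using form0_eq that dom_form0 by blast
    show "(L2_norm f)\<^sup>2 \<le> the (?t f) + c * (L2_norm f)\<^sup>2" if "f \<in> dom ?t" for f
      using g that by (simp add: c_def algebra_simps)
  qed (rule form0_quadratic)+
  interpret CD: closable_data ?t sform c by (rule form0_closable_data[OF fd])
  interpret CF: form_data CD.closure_of_form "\<lambda>f g. CD.cB f g - of_real c * L2_inner f g" c
    by (rule CD.closure_form_data)
  let ?s = "CD.closure_of_form"
  let ?A = "form_operator ?s"
  show "closable ?t" by (rule CD.closable)
  have pol: "polarization ?s u w = CD.cB u w - of_real c * L2_inner u w" if "u \<in> dom ?s" "w \<in> dom ?s" for u w
    using CF.polarization_eq[OF that] .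
  \<comment> \<open>Against a test function h the shifted form is an L2 inner product, and this
    passes to the closure along an approximating sequence; so \<open>max_operatorI\<close>
    applies.\<close>
  have sub: "?A \<subseteq> max_operator \<nu> q"
  proof
    fix p assume "p \<in> ?A"
    then obtain u v where p: "p = (u, v)" and u: "u \<in> dom ?s" and v: "v \<in> L2"
      and uv: "\<And>w. w \<in> dom ?s \<Longrightarrow> polarization ?s u w = L2_inner v w" unfolding form_operator_def by blast
    have uL: "u \<in> L2" by (rule CF.dom_L2[OF u])
    have "(u, v) \<in> max_operator \<nu> q"
    proof (rule max_operatorI[OF uL v])
      fix R h h1 r assume h: "test R h h1 r"
      have hL: "h \<in> L2" and rL: "r \<in> L2" using test_L2[OF h] h by (auto simp: test_def)
      have hd: "h \<in> dom ?t" by (rule form_rep_dom[OF test_form_rep[OF h hL]]) simp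
      then have hs: "h \<in> dom ?s" using CD.dom_cdom CD.dom_closure by blast
      have ucd: "u \<in> CD.cdom" using u by (simp add: CD.dom_closure)
      note ap = CD.apr_app[OF ucd]
      have lim1: "(\<lambda>n. CD.B (CD.app u n) h) \<longlonglongrightarrow> CD.cB u h" by (rule CD.cB_lim[OF ap CD.apr_const[OF hd]])
      let ?k = "\<lambda>x. 1 * r x + of_real c * h x"
      have kL: "?k \<in> L2" by (rule square_integrable_lin[OF rL hL])
      have Bk: "CD.B f h = L2_inner f ?k" if "f \<in> dom ?t" for f
      proof -
        have "form_rep f (rep f) (rep1 f)" using that dom_form0 by blast
        then show ?thesis using L2I.lin_right[OF rL hL CD.dom_L2[OF that], of 1 "of_real c"]
          by (simp add: CD.B_def sform_test[OF _ h])
      qed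
      have "(\<lambda>n. L2_norm (\<lambda>x. CD.app u n x - u x) * L2_norm ?k) \<longlonglongrightarrow> 0"
        using tendsto_mult_left_zero[OF CD.aprD(3)[OF ap]] .
      then have "(\<lambda>n. L2_inner (CD.app u n) ?k - L2_inner u ?k) \<longlonglongrightarrow> 0"
      proof (rule Lim_null_comparison[rotated])
        show "\<forall>\<^sub>F n in sequentially. cmod (L2_inner (CD.app u n) ?k - L2_inner u ?k) \<le> L2_norm (\<lambda>x. CD.app u n x - u x) * L2_norm ?k"
          using L2I.Cauchy_Schwarz[OF L2I.diff_mem[OF CD.aprD(5)[OF ap] uL] kL]
          by (simp only: L2I.diff_left[OF CD.aprD(5)[OF ap] uL kL] eventually_True)
      qed
      then have "(\<lambda>n. CD.B (CD.app u n) h) \<longlonglongrightarrow> L2_inner u ?k"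
        unfolding Bk[OF CD.aprD(4)[OF ap]] by (rule LIM_zero_cancel)
      then have "CD.cB u h = L2_inner u ?k" by (rule LIMSEQ_unique[OF lim1])
      also have "\<dots> = L2_inner u r + of_real c * L2_inner u h"
        using L2I.lin_right[OF rL hL uL, of 1 "of_real c"] by simp
      finally show "L2_inner u r = L2_inner v h" using uv[OF hs] pol[OF u hs] by simp
    qed
    then show "p \<in> max_operator \<nu> q" by (simp add: p)
  qed
  have sup: "max_operator \<nu> q \<subseteq> ?A"
  proof
    fix p assume "p \<in> max_operator \<nu> q"
    then obtain u v where p: "p = (u, v)" and uv: "(u, v) \<in> max_operator \<nu> q" by (cases p) auto
    have uL: "u \<in> L2" and v: "v \<in> L2" using uv by (auto simp: max_operator_iff)
    let ?v = "\<lambda>x. 1 * v x + of_real c * u x"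
    have vL: "?v \<in> L2" by (rule square_integrable_lin[OF v uL])
    \<comment> \<open>u' solves (A + c) u' = (H + c) u. As A is contained in H, the difference u -
      u' lies in the kernel of H + c, which is trivial.\<close>
    obtain u' where u': "u' \<in> dom ?s"
      and sol': "\<And>w. w \<in> dom ?s \<Longrightarrow> CD.cB u' w - of_real c * L2_inner u' w + of_real c * L2_inner u' w = L2_inner ?v w"
      using CF.closed_riesz[OF CD.closure_closed vL] by blast
    have u'L: "u' \<in> L2" by (rule CF.dom_L2[OF u'])
    let ?w = "\<lambda>x. 1 * ?v x + (- of_real c) * u' x"
    have wL: "?w \<in> L2" by (rule square_integrable_lin[OF vL u'L])
    have "(u', ?w) \<in> ?A"
      unfolding form_operator_def
    proof (intro CollectI case_prodI conjI ballI u' wL)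
      fix w assume w: "w \<in> dom ?s"
      show "polarization ?s u' w = L2_inner ?w w"
        unfolding pol[OF u' w] L2I.lin_left[OF vL u'L CF.dom_L2[OF w]] using sol'[OF w] by simp
    qed
    then have "(u', ?w) \<in> max_operator \<nu> q" using sub by blast
    from max_operator_diff[OF uv this] have "(\<lambda>x. u x - u' x, \<lambda>x. - of_real c * (u x - u' x)) \<in> max_operator \<nu> q"
      by (simp add: algebra_simps)
    then have "AE x in lborel. u x - u' x = 0" by (rule semibounded_kernel_trivial[OF fd])
    then have ae: "AE x in lborel. u' x = u x" by eventually_elim simp
    have inv: "?s b = ?s a" if "a \<in> dom ?s" "b \<in> L2" "AE x in lborel. a x = b x" for a b
      using CD.closure_quadratic that unfolding quadratic_form_def by blast
    have us: "u \<in> dom ?s" using inv[OF u' uL ae] u' by (auto simp: dom_def)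
    have "(u, v) \<in> ?A"
      unfolding form_operator_def
    proof (intro CollectI case_prodI conjI ballI us v)
      fix w assume w: "w \<in> dom ?s"
      have wL': "w \<in> L2" by (rule CF.dom_L2[OF w])
      \<comment> \<open>u and u' agree only almost everywhere, so the four terms of the polarization
        are carried over one by one.\<close>
      have ps: "?s (\<lambda>x. 1 * u x + a * w x) = ?s (\<lambda>x. 1 * u' x + a * w x)" for a
        by (rule inv[OF CF.T.lin_mem[OF u' w] square_integrable_lin[OF uL wL']])
          (use ae in eventually_elim, simp)
      have "polarization ?s u w = polarization ?s u' w"
        unfolding polarization_def using ps[of 1] ps[of "-1"] ps[of \<i>] ps[of "-\<i>"] by simp
      also have "\<dots> = L2_inner ?v w - of_real c * L2_inner u' w"
        unfolding pol[OF u' w] using sol'[OF w] by simp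
      also have "\<dots> = L2_inner v w"
        using L2I.lin_left[OF v uL wL', of 1 "of_real c"] L2_inner_cong_AE[OF u'L uL wL' wL' ae] by simp
      finally show "polarization ?s u w = L2_inner v w" .
    qed
    then show "p \<in> ?A" by (simp add: p)
  qed
  have eq: "?A = max_operator \<nu> q" using sub sup by blast
  show "form_operator (form_closure ?t) = max_operator \<nu> q"
    unfolding CD.form_closure_eq by (rule eq)
  show "self_adjoint (max_operator \<nu> q)"
    unfolding self_adjoint_def
  proof (intro conjI max_operator_densely_defined equalityI subsetI)
    fix p assume "p \<in> L2_adjoint (max_operator \<nu> q)"
    then obtain u v where p: "p = (u, v)" and uv: "u \<in> L2" "v \<in> L2"
      "\<And>f g. (f, g) \<in> max_operator \<nu> q \<Longrightarrow> L2_inner g u = L2_inner f v"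
      unfolding L2_adjoint_def by blast
    have "(u, v) \<in> max_operator \<nu> q"
    proof (rule max_operatorI[OF uv(1,2)])
      fix R h h1 r assume h: "test R h h1 r"
      have "r \<in> L2" using h by (simp add: test_def)
      then show "L2_inner u r = L2_inner v h"
        using uv(3)[OF test_max_operator[OF h]] L2I.hermitian[of r u] L2I.hermitian[OF test_L2[OF h] uv(2)] uv(1) by simp
    qed
    then show "p \<in> max_operator \<nu> q" by (simp add: p)
  next
    \<comment> \<open>H is now the operator of a hermitian form, which makes it symmetric; the
      inclusion of the adjoint in H above needed only test functions.\<close>
    fix p assume "p \<in> max_operator \<nu> q"
    then obtain u v where p: "p = (u, v)" and uv: "(u, v) \<in> ?A" unfolding eq by (cases p) auto
    then have u: "u \<in> dom ?s" "v \<in> L2" "\<And>w. w \<in> dom ?s \<Longrightarrow> polarization ?s u w = L2_inner v w"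
      unfolding form_operator_def by auto
    have uL: "u \<in> L2" by (rule CF.dom_L2[OF u(1)])
    have "L2_inner g' u = L2_inner f v" if "(f, g') \<in> max_operator \<nu> q" for f g'
    proof -
      have f: "f \<in> dom ?s" "\<And>w. w \<in> dom ?s \<Longrightarrow> polarization ?s f w = L2_inner g' w"
        using that unfolding eq[symmetric] form_operator_def by auto
      have fL: "f \<in> L2" by (rule CF.dom_L2[OF f(1)])
      have "L2_inner g' u = CD.cB f u - of_real c * L2_inner f u" using f(2)[OF u(1)] pol[OF f(1) u(1)] by simp
      also have "\<dots> = cnj (CD.cB u f - of_real c * L2_inner u f)"
        using CD.C.hermitian[of u f] L2I.hermitian[OF uL fL] f(1) u(1) by (simp add: CD.dom_closure)
      also have "\<dots> = cnj (L2_inner v f)" using u(3)[OF f(1)] pol[OF u(1) f(1)] by simp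
      also have "\<dots> = L2_inner f v" using L2I.hermitian[OF u(2) fL] by simp
      finally show ?thesis .
    qed
    then show "p \<in> L2_adjoint (max_operator \<nu> q)"
      unfolding L2_adjoint_def p using uL u(2) by blast
  qed
qed

end

theorem lemma4p3:
  fixes q :: "real \<Rightarrow> real" and \<nu> :: "real set \<Rightarrow> real"
  assumes "locally_integrable lborel q"
    and "loc_measure \<nu>"
    and "lebesgue_singular \<nu>"
  shows "(\<forall>(f, h) \<in> max_operator0 \<nu> q.
            f \<in> dom (form0 \<nu> q) \<and> L2_inner h f = of_real (the (form0 \<nu> q f)))
       \<and> ((bounded (measure_support \<nu>)
           \<or> measure_support \<nu> \<in> null_sets lborel
           \<or> (\<exists>\<epsilon>>0. \<exists>(xp :: nat \<Rightarrow> real) (xm :: nat \<Rightarrow> real).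
                filterlim xp at_top sequentially \<and> filterlim xm at_bot sequentially \<and>
                (\<forall>j. {xp j<..<xp j + \<epsilon>} \<inter> measure_support \<nu> = {} \<and>
                     {xm j<..<xm j + \<epsilon>} \<inter> measure_support \<nu> = {})))
          \<longrightarrow> lower_semibounded (form0 \<nu> q)
          \<longrightarrow> closable (form0 \<nu> q)
              \<and> form_operator (form_closure (form0 \<nu> q)) = max_operator \<nu> q
              \<and> self_adjoint (max_operator \<nu> q))"
proof -
  obtain E N where EN: "E \<in> sets borel" "N \<in> sets borel" "emeasure lborel N = 0" "- N \<subseteq> E"
    "emeasure (pos_part (dP \<nu>)) (- E) = 0" "emeasure (neg_part (dP \<nu>)) E = 0"
    "\<And>B. B \<in> sets borel \<Longrightarrow> emeasure lborel B = emeasure (variation (dP \<nu>)) (B - N)"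
    using dP_structure[OF assms(2,3)] by blast
  interpret sturm_liouville \<nu> E N q
    by standard (use EN assms(1) loc_measure_dP[OF assms(2)] in auto)
  show ?thesis
    using operator0_form0 semibounded_form_operator by blast
qed

end
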